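(* Suppose $u_T\in L^\infty(\Omega)$ and $m_0\in L^2(\Omega)$, $m_0\ge0$. Let $\epsilon=\exp\!\left(-\frac{1}{\sigma^2}(\|u_T\|_\infty+\|f\|_\infty T)\right)$ and define recursively $\psi^0=0$, $\phi^{n+\frac12}=\Phi(\psi^n)$, $\psi^{n+1}=\Psi(\phi^{n+\frac12})$ for $n\in\mathbb{N}$. Then: (i) $(\phi^{n+\frac12})_n$ is a (pointwise a.e.) nonincreasing sequence in $\mathcal{P}_\epsilon$; (ii) $(\psi^n)_n$ is a nondecreasing sequence in $\mathcal{P}_0$, bounded from above by $\Psi(\epsilon)$ (where $\epsilon$ denotes the constant function); (iii) $(\phi^{n+\frac12},\psi^n)_n$ converges almost everywhere in $(0,T)\times\Omega$ and in $L^2(0,T;L^2(\Omega))$ to a couple $(\phi,\psi)$; (iv) $(\phi,\psi)\in\mathcal{P}_\epsilon\times\mathcal{P}_0$ is a weak solution of the system $(\mathcal S)$, i.e. $\phi(T,\cdot)=\exp(u_T/\sigma^2)$, $\psi(0,\cdot)=m_0/\phi(0,\cdot)$, and for a.e. $t$ and all $v\in H^1(\Omega)$: $\langle\partial_t\phi(t),v\rangle-\frac{\sigma^2}{2}\int_\Omega\nabla\phi\cdot\nabla v=-\frac{1}{\sigma^2}\int_\Omega f(x,\phi\psi)\phi v$ and $\langle\partial_t\psi(t),v\rangle+\frac{\sigma^2}{2}\int_\Omega\nabla\psi\cdot\nabla v=\frac{1}{\sigma^2}\int_\Omega f(x,\phi\psi)\psi v$.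
   Context: $d\ge1$, $\Omega=(0,1)^d$, $T>0$, $\sigma>0$. Standing assumptions on $f:\Omega\times\mathbb{R}\to\mathbb{R}$: $f$ is measurable, for each $x$ the map $\xi\mapsto f(x,\xi)$ is continuous and nonincreasing, $f$ is bounded with $\|f\|_\infty=\sup|f|<\infty$, and $f\le0$. $\mathcal{P}$ denotes the set of $g\in L^2(0,T;H^1(\Omega))$ with $\partial_t g\in L^2(0,T;H^{-1}(\Omega))$, and $\mathcal{P}_\epsilon=\{g\in\mathcal{P}: g\ge\epsilon\text{ a.e.}\}$. $\Phi:\mathcal{P}_0\to\mathcal{P}_\epsilon$ maps $\psi$ to the unique weak solution $\phi\in\mathcal{P}$ of $\partial_t\phi+\frac{\sigma^2}{2}\Delta\phi=-\frac{1}{\sigma^2}f(x,\phi\psi)\phi$ with homogeneous Neumann condition and $\phi(T,\cdot)=\exp(u_T/\sigma^2)$ (weak form: for a.e. $t$, all $v\in H^1(\Omega)$, $\langle\partial_t\phi(t),v\rangle-\frac{\sigma^2}{2}\int\nabla\phi\cdot\nabla v=-\frac{1}{\sigma^2}\int f(x,\phi\psi)\phi v$). $\Psi:\mathcal{P}_\epsilon\to\mathcal{P}_0$ maps $\phi$ to the unique weak solution $\psi\in\mathcal{P}$ of $\partial_t\psi-\frac{\sigma^2}{2}\Delta\psi=\frac{1}{\sigma^2}f(x,\phi\psi)\psi$ with homogeneous Neumann condition and $\psi(0,\cdot)=m_0/\phi(0,\cdot)$ (weak form: $\langle\partial_t\psi(t),v\rangle+\frac{\sigma^2}{2}\int\nabla\psi\cdot\nabla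 v=\frac{1}{\sigma^2}\int f(x,\phi\psi)\psi v$). These maps are well defined. *)

theory Defs
  imports "HOL-Analysis.Analysis"
begin

definition Om :: "'a::euclidean_space set" where
  "Om = box 0 One"

definition Qc :: "real \<Rightarrow> (real \<times> 'a::euclidean_space) set" where
  "Qc T = {0<..<T} \<times> Om"

definition L2 :: "'b measure \<Rightarrow> ('b \<Rightarrow> real) \<Rightarrow> bool" where
  "L2 M u \<longleftrightarrow> u \<in> borel_measurable M \<and> integrable M (\<lambda>x. (u x)^2)"

definition test_fun :: "'a::euclidean_space set \<Rightarrow> ('a \<Rightarrow> real) \<Rightarrow> ('a \<Rightarrow> 'a) \<Rightarrow> bool" where
  "test_fun U \<phi> D\<phi> \<longleftrightarrow>
     (\<forall>x. (\<phi> has_derivative (\<lambda>h. D\<phi> x \<bullet> h)) (at x)) \<and> continuous_on UNIV D\<phi> \<and>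
     compact (closure {x. \<phi> x \<noteq> 0}) \<and> closure {x. \<phi> x \<noteq> 0} \<subseteq> U"

definition weak_grad :: "('a::euclidean_space \<Rightarrow> real) \<Rightarrow> ('a \<Rightarrow> 'a) \<Rightarrow> bool" where
  "weak_grad u G \<longleftrightarrow>
     (\<forall>\<phi> D\<phi>. test_fun Om \<phi> D\<phi> \<longrightarrow>
        (\<forall>b\<in>Basis. (\<integral>x. u x * (D\<phi> x \<bullet> b) \<partial>lebesgue_on Om)
                   = - (\<integral>x. (G x \<bullet> b) * \<phi> x \<partial>lebesgue_on Om)))"

definition L2grad :: "('a::euclidean_space \<Rightarrow> 'a) \<Rightarrow> bool" where
  "L2grad G \<longleftrightarrow> (\<forall>b\<in>Basis. L2 (lebesgue_on Om) (\<lambda>x. G x \<bullet> b))"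

definition H1 :: "('a::euclidean_space \<Rightarrow> real) \<Rightarrow> bool" where
  "H1 u \<longleftrightarrow> L2 (lebesgue_on Om) u \<and> (\<exists>G. L2grad G \<and> weak_grad u G)"

text \<open>The (a.e. unique) weak gradient of an H^1 function.\<close>
definition grad :: "('a::euclidean_space \<Rightarrow> real) \<Rightarrow> 'a \<Rightarrow> 'a" where
  "grad u = (SOME G. L2grad G \<and> weak_grad u G)"

definition H1norm :: "('a::euclidean_space \<Rightarrow> real) \<Rightarrow> real" where
  "H1norm u = sqrt ((\<integral>x. (u x)^2 \<partial>lebesgue_on Om) + (\<integral>x. (norm (grad u x))^2 \<partial>lebesgue_on Om))"

definition L2H1 :: "real \<Rightarrow> (real \<Rightarrow> 'a::euclidean_space \<Rightarrow> real) \<Rightarrow> (real \<Rightarrow> 'a \<Rightarrow> 'a) \<Rightarrow> bool" where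
  "L2H1 T g Dg \<longleftrightarrow>
     L2 (lebesgue_on (Qc T)) (\<lambda>p. g (fst p) (snd p)) \<and>
     (\<forall>b\<in>Basis. L2 (lebesgue_on (Qc T)) (\<lambda>p. Dg (fst p) (snd p) \<bullet> b)) \<and>
     (AE t in lebesgue_on {0<..<T}. weak_grad (g t) (Dg t))"

text \<open>w is the time derivative of g, taken in L^2(0,T;H^{-1}(Omega)), where H^{-1}(Omega)
  is the dual of H^1(Omega); w t v stands for the duality pairing.\<close>
definition dual_dt :: "real \<Rightarrow> (real \<Rightarrow> 'a::euclidean_space \<Rightarrow> real) \<Rightarrow> (real \<Rightarrow> ('a \<Rightarrow> real) \<Rightarrow> real) \<Rightarrow> bool" where
  "dual_dt T g w \<longleftrightarrow>
     (\<exists>C. L2 (lebesgue_on {0<..<T}) C \<and>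
        (AE t in lebesgue_on {0<..<T}.
           (\<forall>v1 v2 a b. H1 v1 \<longrightarrow> H1 v2 \<longrightarrow>
               w t (\<lambda>x. a * v1 x + b * v2 x) = a * w t v1 + b * w t v2) \<and>
           (\<forall>v. H1 v \<longrightarrow> \<bar>w t v\<bar> \<le> C t * H1norm v))) \<and>
     (\<forall>v. H1 v \<longrightarrow> (\<lambda>t. w t v) \<in> borel_measurable (lebesgue_on {0<..<T})) \<and>
     (\<forall>v \<eta> D\<eta>. H1 v \<longrightarrow> test_fun {0<..<T} \<eta> D\<eta> \<longrightarrow>
        (\<integral>t. (\<integral>x. g t x * v x \<partial>lebesgue_on Om) * D\<eta> t \<partial>lebesgue_on {0<..<T})
          = - (\<integral>t. w t v * \<eta> t \<partial>lebesgue_on {0<..<T}))"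

definition inP :: "real \<Rightarrow> (real \<Rightarrow> 'a::euclidean_space \<Rightarrow> real) \<Rightarrow> bool" where
  "inP T g \<longleftrightarrow> (\<exists>Dg w. L2H1 T g Dg \<and> dual_dt T g w)"

definition inPe :: "real \<Rightarrow> real \<Rightarrow> (real \<Rightarrow> 'a::euclidean_space \<Rightarrow> real) \<Rightarrow> bool" where
  "inPe T \<epsilon> g \<longleftrightarrow> inP T g \<and> (AE p in lebesgue_on (Qc T). g (fst p) (snd p) \<ge> \<epsilon>)"

text \<open>Time trace: the (continuous in time, L^2-valued) representative of g takes the value
  h at time t0, i.e. g(t) \<rightarrow> h in L^2(Omega) as t \<rightarrow> t0 (essentially in t).\<close>
definition has_trace :: "real \<Rightarrow> (real \<Rightarrow> 'a::euclidean_space \<Rightarrow> real) \<Rightarrow> real \<Rightarrow> ('a \<Rightarrow> real) \<Rightarrow> bool" where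
  "has_trace T g t0 h \<longleftrightarrow> L2 (lebesgue_on Om) h \<and>
     (\<forall>e>0. \<exists>\<delta>>0. AE t in lebesgue_on {0<..<T}.
        \<bar>t - t0\<bar> < \<delta> \<longrightarrow> (\<integral>x. (g t x - h x)^2 \<partial>lebesgue_on Om) < e)"

definition Phi_sol :: "real \<Rightarrow> real \<Rightarrow> ('a::euclidean_space \<Rightarrow> real \<Rightarrow> real) \<Rightarrow> ('a \<Rightarrow> real)
      \<Rightarrow> (real \<Rightarrow> 'a \<Rightarrow> real) \<Rightarrow> (real \<Rightarrow> 'a \<Rightarrow> real) \<Rightarrow> bool" where
  "Phi_sol T \<sigma> f uT \<psi> \<phi> \<longleftrightarrow>
     (\<exists>D\<phi> w. L2H1 T \<phi> D\<phi> \<and> dual_dt T \<phi> w \<and>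
        has_trace T \<phi> T (\<lambda>x. exp (uT x / \<sigma>^2)) \<and>
        (AE t in lebesgue_on {0<..<T}. \<forall>v. H1 v \<longrightarrow>
           w t v - \<sigma>^2 / 2 * (\<integral>x. D\<phi> t x \<bullet> grad v x \<partial>lebesgue_on Om)
             = - (1 / \<sigma>^2) * (\<integral>x. f x (\<phi> t x * \<psi> t x) * \<phi> t x * v x \<partial>lebesgue_on Om)))"

definition Psi_sol :: "real \<Rightarrow> real \<Rightarrow> ('a::euclidean_space \<Rightarrow> real \<Rightarrow> real) \<Rightarrow> ('a \<Rightarrow> real)
      \<Rightarrow> (real \<Rightarrow> 'a \<Rightarrow> real) \<Rightarrow> (real \<Rightarrow> 'a \<Rightarrow> real) \<Rightarrow> bool" where
  "Psi_sol T \<sigma> f m0 \<phi> \<psi> \<longleftrightarrow>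
     (\<exists>D\<psi> w. L2H1 T \<psi> D\<psi> \<and> dual_dt T \<psi> w \<and>
        (\<exists>h. has_trace T \<phi> 0 h \<and> has_trace T \<psi> 0 (\<lambda>x. m0 x / h x)) \<and>
        (AE t in lebesgue_on {0<..<T}. \<forall>v. H1 v \<longrightarrow>
           w t v + \<sigma>^2 / 2 * (\<integral>x. D\<psi> t x \<bullet> grad v x \<partial>lebesgue_on Om)
             = (1 / \<sigma>^2) * (\<integral>x. f x (\<phi> t x * \<psi> t x) * \<psi> t x * v x \<partial>lebesgue_on Om)))"

definition Linf_norm :: "('a::euclidean_space \<Rightarrow> real) \<Rightarrow> real" where
  "Linf_norm u = Inf {M. AE x in lebesgue_on Om. \<bar>u x\<bar> \<le> M}"

definition f_sup :: "('a::euclidean_space \<Rightarrow> real \<Rightarrow> real) \<Rightarrow> real" where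
  "f_sup f = (SUP p \<in> (Om \<times> UNIV). \<bar>f (fst p) (snd p)\<bar>)"

end

theory Submission
  imports Defs
begin

text \<open>Reversing time in the first equation turns both equations into the same problem
  \<open>u\<^sub>t - (\<sigma>\<^sup>2/2) \<Delta>u = f(x, uk) u / \<sigma>\<^sup>2\<close> with a given nonnegative factor \<open>k\<close>. Since \<open>f \<le> 0\<close> is
  nonincreasing, the right hand side decreases in \<open>k\<close> and, for nonnegative \<open>u\<close>, in \<open>u\<close>, so testing the difference of
  two solutions with a smoothed positive part shows that \<open>u\<close> decreases in \<open>k\<close> and increases in its data. Hence the
  iteration is monotone by induction; the subsolution \<open>exp(-(\<parallel>u\<^sub>T\<parallel> + \<parallel>f\<parallel>(T - t))/\<sigma>\<^sup>2)\<close> gives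
  \<open>\<phi> \<ge> \<epsilon>\<close>, and comparison with \<open>\<Psi>(\<epsilon>)\<close> bounds \<open>\<psi>\<^sup>n\<close> from above. The right hand sides then converge in
  \<open>L\<^sup>2\<close> by dominated convergence, and the energy estimate for differences makes both sequences Cauchy in
  \<open>L\<^sup>2(0,T;H\<^sup>1)\<close> and uniformly Cauchy in time with values in \<open>L\<^sup>2\<close>, so that the equations and the traces pass to the limit
  strongly.

  The energy identity is obtained by mollifying in time only: the mollified solution satisfies its equation at
  every time and against every \<open>v \<in> H\<^sup>1\<close> simultaneously, so that it may be tested with a function of itself.\<close>

subsection \<open>Square-integrable functions\<close>

text \<open>The original notions live on \<open>lebesgue_on Om\<close>, which neither translations
  nor Borel product arguments respect. All analysis is therefore done with Borel representatives
  extended by zero to the whole space and integrated over \<open>lborel\<close>; only at the two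
  ends are weak solutions translated (\<open>weq_of_weak\<close>, \<open>weak_of_weq\<close>). The
  extension need not be weakly differentiable across the boundary, but test functions keep their
  support in \<open>Om\<close>, so the jump is never seen. The dual space disappears as well:
  \<open>weq\<close> tests with products of a space and a time function, which is all that
  mollification in time requires.

  The delicate coupling is the initial datum \<open>m0 / \<phi>(0)\<close>. It needs order relations
  and the bound \<open>\<epsilon>\<close> for the trace of \<open>\<phi>\<close> at time 0, an
  instant that almost-everywhere statements on the cylinder do not reach, and convergence of these
  traces. This is the purpose of the uniform convergence in time: it lets the limits in
  \<open>n\<close> and in time be interchanged. The lower bound on the traces makes
  \<open>m0 / \<epsilon>\<close> a dominating function for the quotients.\<close>

lemma L2_meas: "L2 M u \<Longrightarrow> u \<in> borel_measurable M"
  by (simp add: L2_def)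

lemma L2_sq: "L2 M u \<Longrightarrow> integrable M (\<lambda>x. (u x)^2)"
  by (simp add: L2_def)

lemma L2_bound:
  assumes "L2 M v" "u \<in> borel_measurable M" "AE x in M. \<bar>u x\<bar> \<le> \<bar>v x\<bar>"
  shows "L2 M u"
  unfolding L2_def
proof
  show "integrable M (\<lambda>x. (u x)^2)"
    by (rule Bochner_Integration.integrable_bound[OF L2_sq[OF assms(1)]])
       (use assms in \<open>auto simp: abs_le_square_iff\<close>)
qed (use assms in simp)

lemma L2_mult:
  assumes "L2 M u" "L2 M v" shows "integrable M (\<lambda>x. u x * v x)"
proof (rule Bochner_Integration.integrable_bound)
  show "integrable M (\<lambda>x. (u x)^2 + (v x)^2)"
    using assms by (simp add: L2_def)
  show "AE x in M. norm (u x * v x) \<le> norm ((u x)^2 + (v x)^2)"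
  proof (rule AE_I2)
    fix x
    have "0 \<le> (\<bar>u x\<bar> - \<bar>v x\<bar>)^2" by simp
    then have "2 * (\<bar>u x\<bar> * \<bar>v x\<bar>) \<le> (u x)^2 + (v x)^2"
      by (simp add: power2_diff)
    moreover have "0 \<le> \<bar>u x\<bar> * \<bar>v x\<bar>" by simp
    ultimately have "\<bar>u x\<bar> * \<bar>v x\<bar> \<le> (u x)^2 + (v x)^2" by linarith
    then show "norm (u x * v x) \<le> norm ((u x)^2 + (v x)^2)"
      by (simp add: abs_mult)
  qed
qed (use assms in \<open>auto simp: L2_def\<close>)

lemma L2_cmult: "L2 M u \<Longrightarrow> L2 M (\<lambda>x. c * u x)"
  by (auto simp: L2_def power_mult_distrib)

lemma L2_minus: "L2 M u \<Longrightarrow> L2 M (\<lambda>x. - u x)"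
  by (auto simp: L2_def)

lemma L2_zero [simp]: "L2 M (\<lambda>x. 0)"
  by (simp add: L2_def)

lemma L2_add:
  assumes "L2 M u" "L2 M v" shows "L2 M (\<lambda>x. u x + v x)"
proof -
  have "integrable M (\<lambda>x. (u x)^2 + (v x)^2 + 2 * (u x * v x))"
    using L2_mult[OF assms] assms by (auto simp: L2_def)
  then show ?thesis using assms by (auto simp: L2_def power2_sum mult.assoc)
qed

lemma L2_diff:
  assumes "L2 M u" "L2 M v" shows "L2 M (\<lambda>x. u x - v x)"
  using L2_add[OF assms(1) L2_minus[OF assms(2)]] by simp

lemma L2_sum: "(\<And>i. i \<in> I \<Longrightarrow> L2 M (u i)) \<Longrightarrow> L2 M (\<lambda>x. \<Sum>i\<in>I. u i x)"
  by (induction I rule: infinite_finite_induct) (auto intro: L2_add)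

lemma L2_mult_bdd:
  assumes "L2 M u" "v \<in> borel_measurable M" "\<And>x. \<bar>v x\<bar> \<le> C"
  shows "L2 M (\<lambda>x. v x * u x)"
proof (rule L2_bound[OF L2_cmult[OF assms(1), of C]])
  show "AE x in M. \<bar>v x * u x\<bar> \<le> \<bar>C * u x\<bar>"
  proof (rule AE_I2)
    fix x
    have "\<bar>v x\<bar> \<le> \<bar>C\<bar>" using assms(3)[of x] by linarith
    then show "\<bar>v x * u x\<bar> \<le> \<bar>C * u x\<bar>" by (simp add: abs_mult mult_right_mono)
  qed
qed (use assms in \<open>auto simp: L2_def\<close>)

lemma L2_AE_zero:
  assumes "L2 M u" "(\<integral>x. (u x)^2 \<partial>M) \<le> 0"
  shows "AE x in M. u x = 0"
proof -
  have "(\<integral>x. (u x)^2 \<partial>M) = 0" using assms(2) by (intro antisym) auto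
  then show ?thesis using integral_nonneg_eq_0_iff_AE[OF L2_sq[OF assms(1)]] by simp
qed

text \<open>\<open>A + 2 * l * B + l^2 * C\<close> is the integral of a square, hence nonnegative
  for every \<open>l\<close>; \<open>l = - B / C\<close> is its minimiser. In the degenerate case
  \<open>C = 0\<close> it is affine in \<open>l\<close>, and a nonzero \<open>B\<close> would allow
  the value -1.\<close>

lemma L2_Cauchy_Schwarz:
  assumes u: "L2 M u" and v: "L2 M v"
  shows "\<bar>\<integral>x. u x * v x \<partial>M\<bar> \<le> sqrt (\<integral>x. (u x)^2 \<partial>M) * sqrt (\<integral>x. (v x)^2 \<partial>M)"
proof -
  define A B C where "A = (\<integral>x. (u x)^2 \<partial>M)" and "B = (\<integral>x. u x * v x \<partial>M)"
    and "C = (\<integral>x. (v x)^2 \<partial>M)"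
  have q: "0 \<le> A + 2 * l * B + l^2 * C" for l
  proof -
    have "0 \<le> (\<integral>x. (u x + l * v x)^2 \<partial>M)" by simp
    also have "\<dots> = (\<integral>x. (u x)^2 + 2 * l * (u x * v x) + l^2 * (v x)^2 \<partial>M)"
      by (rule Bochner_Integration.integral_cong) (auto simp: power2_eq_square algebra_simps)
    also have "\<dots> = A + 2 * l * B + l^2 * C"
      using L2_mult[OF u v] L2_sq[OF u] L2_sq[OF v] by (simp add: A_def B_def C_def)
    finally show ?thesis .
  qed
  have C0: "0 \<le> C" by (simp add: C_def)
  have "B^2 \<le> A * C"
  proof (cases "C = 0")
    case True
    have "B = 0"
    proof (rule ccontr)
      assume "B \<noteq> 0"
      then show False using q[of "- (A + 1) / (2 * B)"] True by (simp add: field_simps)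
    qed
    then show ?thesis using True by simp
  next
    case False
    then have "C > 0" using C0 by simp
    have "0 \<le> A + 2 * (- B / C) * B + (- B / C)^2 * C" by (rule q)
    also have "\<dots> = A - B^2 / C" using False by (simp add: field_simps power2_eq_square)
    finally show ?thesis using \<open>C > 0\<close> by (simp add: field_simps)
  qed
  then have "sqrt (B^2) \<le> sqrt (A * C)" by (rule real_sqrt_le_mono)
  then show ?thesis by (simp add: A_def B_def C_def real_sqrt_mult)
qed

lemma L2_triangle:
  assumes "L2 M u" "L2 M v"
  shows "(\<integral>x. (u x + v x)^2 \<partial>M) \<le> 2 * (\<integral>x. (u x)^2 \<partial>M) + 2 * (\<integral>x. (v x)^2 \<partial>M)"
proof -
  have "(\<integral>x. (u x + v x)^2 \<partial>M) \<le> (\<integral>x. 2 * (u x)^2 + 2 * (v x)^2 \<partial>M)"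
  proof (rule integral_mono)
    fix x
    have "0 \<le> (u x - v x)^2" by simp
    then show "(u x + v x)^2 \<le> 2 * (u x)^2 + 2 * (v x)^2"
      by (simp add: power2_diff power2_sum)
  qed (use L2_sq[OF L2_add[OF assms]] L2_sq[OF assms(1)] L2_sq[OF assms(2)] in auto)
  then show ?thesis using L2_sq[OF assms(1)] L2_sq[OF assms(2)] by simp
qed

lemma L2_triangle_diff:
  assumes "L2 M u" "L2 M v" "L2 M w"
  shows "(\<integral>x. (u x - w x)^2 \<partial>M) \<le> 2 * (\<integral>x. (u x - v x)^2 \<partial>M) + 2 * (\<integral>x. (v x - w x)^2 \<partial>M)"
  using L2_triangle[OF L2_diff[OF assms(1,2)] L2_diff[OF assms(2,3)]] by simp

lemma L2_sq_mono:
  assumes "L2 M v" "u \<in> borel_measurable M" "AE x in M. \<bar>u x\<bar> \<le> \<bar>v x\<bar>"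
  shows "(\<integral>x. (u x)^2 \<partial>M) \<le> (\<integral>x. (v x)^2 \<partial>M)"
  by (rule integral_mono_AE[OF L2_sq[OF L2_bound[OF assms]] L2_sq[OF assms(1)]])
     (use assms(3) in \<open>auto simp: abs_le_square_iff\<close>)

text \<open>Membership of all terms and of the limit is built in: where the squared difference is
  not integrable, its integral defaults to 0 and convergence would say nothing.\<close>

definition L2_lim :: "'b measure \<Rightarrow> (nat \<Rightarrow> 'b \<Rightarrow> real) \<Rightarrow> ('b \<Rightarrow> real) \<Rightarrow> bool" where
  "L2_lim M X u \<longleftrightarrow> (\<forall>n. L2 M (X n)) \<and> L2 M u \<and> (\<lambda>n. \<integral>x. (X n x - u x)^2 \<partial>M) \<longlonglongrightarrow> 0"

lemma L2_lim_const: "L2 M u \<Longrightarrow> L2_lim M (\<lambda>n. u) u"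
  by (simp add: L2_lim_def)

lemma L2_lim_subseq:
  assumes "L2_lim M X u" "strict_mono r" shows "L2_lim M (\<lambda>n. X (r n)) u"
  using assms LIMSEQ_subseq_LIMSEQ[OF _ assms(2), of "\<lambda>n. \<integral>x. (X n x - u x)^2 \<partial>M"]
  by (auto simp: L2_lim_def o_def)

text \<open>The product difference is split into one term with both errors and two with a single
  error; Cauchy-Schwarz bounds each. The limits of weak forms below rest on this.\<close>

lemma L2_lim_inner:
  assumes X: "L2_lim M X u" and Y: "L2_lim M Y v"
  shows "(\<lambda>n. \<integral>x. X n x * Y n x \<partial>M) \<longlonglongrightarrow> (\<integral>x. u x * v x \<partial>M)"
proof -
  have L: "L2 M (X n)" "L2 M u" "L2 M (Y n)" "L2 M v" for n
    using X Y by (auto simp: L2_lim_def)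
  define a b where "a = (\<lambda>n. sqrt (\<integral>x. (X n x - u x)^2 \<partial>M))"
    and "b = (\<lambda>n. sqrt (\<integral>x. (Y n x - v x)^2 \<partial>M))"
  have lim: "a \<longlonglongrightarrow> 0" "b \<longlonglongrightarrow> 0"
    using X Y tendsto_real_sqrt by (force simp: L2_lim_def a_def b_def)+
  define c d where "c = sqrt (\<integral>x. (u x)^2 \<partial>M)" and "d = sqrt (\<integral>x. (v x)^2 \<partial>M)"
  have "norm ((\<integral>x. X n x * Y n x \<partial>M) - (\<integral>x. u x * v x \<partial>M)) \<le> a n * b n + a n * d + c * b n" for n
  proof -
    have D: "L2 M (\<lambda>x. X n x - u x)" "L2 M (\<lambda>x. Y n x - v x)" using L L2_diff by blast+
    have "(\<integral>x. X n x * Y n x \<partial>M) = (\<integral>x. u x * v x + ((X n x - u x) * (Y n x - v x)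
        + (X n x - u x) * v x + u x * (Y n x - v x)) \<partial>M)"
      by (rule Bochner_Integration.integral_cong) (auto simp: algebra_simps)
    also have "\<dots> = (\<integral>x. u x * v x \<partial>M) + ((\<integral>x. (X n x - u x) * (Y n x - v x) \<partial>M)
        + (\<integral>x. (X n x - u x) * v x \<partial>M) + (\<integral>x. u x * (Y n x - v x) \<partial>M))"
      using L2_mult[OF D] L2_mult[OF D(1) L(4)] L2_mult[OF L(2) D(2)] L2_mult[OF L(2) L(4)]
      by (simp only: Bochner_Integration.integral_add Bochner_Integration.integrable_add)
    finally show ?thesis
      using L2_Cauchy_Schwarz[OF D] L2_Cauchy_Schwarz[OF D(1) L(4)] L2_Cauchy_Schwarz[OF L(2) D(2)]
      by (simp add: a_def b_def c_def d_def)
  qed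
  then have "\<forall>n. norm ((\<integral>x. X n x * Y n x \<partial>M) - (\<integral>x. u x * v x \<partial>M)) \<le> a n * b n + a n * d + c * b n"
    by blast
  moreover have "(\<lambda>n. a n * b n + a n * d + c * b n) \<longlonglongrightarrow> 0"
    using lim by (auto intro!: tendsto_eq_intros)
  ultimately have "(\<lambda>n. (\<integral>x. X n x * Y n x \<partial>M) - (\<integral>x. u x * v x \<partial>M)) \<longlonglongrightarrow> 0"
    by (rule Lim_null_comparison[OF always_eventually])
  then show ?thesis by (simp add: LIM_zero_iff)
qed

lemma L2_lim_sq: "L2_lim M X u \<Longrightarrow> (\<lambda>n. \<integral>x. (X n x)^2 \<partial>M) \<longlonglongrightarrow> (\<integral>x. (u x)^2 \<partial>M)"
  using L2_lim_inner[of M X u X u] by (simp add: power2_eq_square)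

text \<open>Transfers convergence to Lipschitz functions of the terms and to restrictions to a set,
  without passing to a subsequence.\<close>

lemma L2_lim_bound:
  assumes X: "L2_lim M X u" and "\<And>n. Y n \<in> borel_measurable M" "L2 M w"
    and b: "\<And>n. AE x in M. \<bar>Y n x - w x\<bar> \<le> C * \<bar>X n x - u x\<bar>"
  shows "L2_lim M Y w"
proof -
  have L: "L2 M (X n)" "L2 M u" for n using X by (auto simp: L2_lim_def)
  have D: "L2 M (\<lambda>x. C * (X n x - u x))" for n by (intro L2_cmult L2_diff L)
  have b': "AE x in M. \<bar>Y n x - w x\<bar> \<le> \<bar>C * (X n x - u x)\<bar>" for n
    using b[of n]
  proof eventually_elim
    case (elim x)
    have "C * \<bar>X n x - u x\<bar> \<le> \<bar>C\<bar> * \<bar>X n x - u x\<bar>" by (intro mult_right_mono) auto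
    then show ?case using elim by (simp add: abs_mult)
  qed
  have m: "(\<lambda>x. Y n x - w x) \<in> borel_measurable M" for n
    using assms(2)[of n] assms(3) by (auto simp: L2_def)
  have LY: "L2 M (\<lambda>x. Y n x - w x)" for n by (rule L2_bound[OF D m b'])
  have "L2 M (Y n)" for n using L2_add[OF LY assms(3)] by simp
  moreover have "(\<lambda>n. \<integral>x. (Y n x - w x)^2 \<partial>M) \<longlonglongrightarrow> 0"
  proof (rule Lim_null_comparison[OF always_eventually])
    show "\<forall>n. norm (\<integral>x. (Y n x - w x)^2 \<partial>M) \<le> C^2 * (\<integral>x. (X n x - u x)^2 \<partial>M)"
      using L2_sq_mono[OF D m b'] by (simp add: power_mult_distrib)
    show "(\<lambda>n. C^2 * (\<integral>x. (X n x - u x)^2 \<partial>M)) \<longlonglongrightarrow> 0"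
      using X by (auto simp: L2_lim_def intro!: tendsto_mult_right_zero)
  qed
  ultimately show ?thesis using assms(3) by (simp add: L2_lim_def)
qed

lemma L2_lim_AE_subseq:
  assumes "L2_lim M X u"
  obtains r where "strict_mono r" "AE x in M. (\<lambda>n. X (r n) x) \<longlonglongrightarrow> u x"
proof -
  have L: "L2 M (\<lambda>x. X n x - u x)" for n using assms by (auto simp: L2_lim_def intro: L2_diff)
  obtain r where r: "strict_mono r" "AE x in M. (\<lambda>n. (X (r n) x - u x)^2) \<longlonglongrightarrow> 0"
    using tendsto_L1_AE_subseq[of M "\<lambda>n x. (X n x - u x)^2"] L2_sq[OF L] assms
    by (auto simp: L2_lim_def)
  have "AE x in M. (\<lambda>n. X (r n) x) \<longlonglongrightarrow> u x"
    using r(2)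
  proof eventually_elim
    case (elim x)
    then have "(\<lambda>n. sqrt ((X (r n) x - u x)^2)) \<longlonglongrightarrow> 0" using tendsto_real_sqrt[of "\<lambda>n. (X (r n) x - u x)^2" 0] by simp
    then show ?case by (simp add: tendsto_rabs_zero_iff LIM_zero_iff)
  qed
  then show ?thesis using r(1) that by blast
qed

text \<open>The limit inherits the bound \<open>z\<close>, so the squared error is dominated by
  \<open>4 * z^2\<close>. This turns almost everywhere convergence of the monotone iterates into
  strong convergence.\<close>

lemma L2_lim_dominated:
  assumes z: "L2 M z" and X: "\<And>n. X n \<in> borel_measurable M" and u: "u \<in> borel_measurable M"
    and lim: "AE x in M. (\<lambda>n. X n x) \<longlonglongrightarrow> u x" and b: "\<And>n. AE x in M. \<bar>X n x\<bar> \<le> z x"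
  shows "L2_lim M X u"
proof -
  have b': "AE x in M. \<forall>n. \<bar>X n x\<bar> \<le> z x" using b by (simp add: AE_all_countable)
  have bu: "AE x in M. \<bar>u x\<bar> \<le> z x"
    using b' lim by eventually_elim (rule LIMSEQ_le_const2[OF tendsto_rabs], auto)
  have "L2 M (X n)" for n using b[of n] by (intro L2_bound[OF z X]) auto
  moreover have "L2 M u" using bu by (intro L2_bound[OF z u]) auto
  moreover have "(\<lambda>n. \<integral>x. (X n x - u x)^2 \<partial>M) \<longlonglongrightarrow> (\<integral>x. 0 \<partial>M)"
  proof (rule integral_dominated_convergence[where w="\<lambda>x. 4 * (z x)^2"])
    show "AE x in M. (\<lambda>n. (X n x - u x)^2) \<longlonglongrightarrow> 0"
      using lim by eventually_elim (auto intro!: tendsto_eq_intros)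
    show "AE x in M. norm ((X n x - u x)^2) \<le> 4 * (z x)^2" for n
      using b[of n] bu
    proof eventually_elim
      case (elim x)
      then have "\<bar>X n x - u x\<bar>^2 \<le> (2 * z x)^2" by (intro power_mono) auto
      then show ?case by (simp add: power_mult_distrib)
    qed
  qed (use X u L2_sq[OF z] in auto)
  ultimately show ?thesis by (simp add: L2_lim_def)
qed

text \<open>Serves \<open>L2_complete\<close>, where it is applied to differences with a fixed term
  and so bounds the distance of that term from the limit.\<close>

lemma L2_Fatou:
  assumes X: "\<And>n. L2 M (X n)" and u: "u \<in> borel_measurable M"
    and lim: "AE x in M. (\<lambda>n. X n x) \<longlonglongrightarrow> u x"
    and C: "\<And>n. (\<integral>x. (X n x)^2 \<partial>M) \<le> C"
  shows "L2 M u" "(\<integral>x. (u x)^2 \<partial>M) \<le> C"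
proof -
  have C0: "0 \<le> C" using C[of 0] by (rule order_trans[rotated]) simp
  have m: "X n \<in> borel_measurable M" for n using X by (simp add: L2_def)
  have "(\<integral>\<^sup>+x. ennreal ((u x)^2) \<partial>M) = (\<integral>\<^sup>+x. liminf (\<lambda>n. ennreal ((X n x)^2)) \<partial>M)"
  proof (rule nn_integral_cong_AE)
    show "AE x in M. ennreal ((u x)^2) = liminf (\<lambda>n. ennreal ((X n x)^2))"
      using lim
    proof eventually_elim
      case (elim x)
      have "(\<lambda>n. ennreal ((X n x)^2)) \<longlonglongrightarrow> ennreal ((u x)^2)"
        using elim by (intro tendsto_ennrealI tendsto_intros)
      then show ?case by (metis lim_imp_Liminf trivial_limit_sequentially)
    qed
  qed
  also have "\<dots> \<le> liminf (\<lambda>n. \<integral>\<^sup>+x. ennreal ((X n x)^2) \<partial>M)"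
    by (rule nn_integral_liminf) (use m in measurable)
  also have "\<dots> \<le> ennreal C"
  proof -
    have "(\<integral>\<^sup>+x. ennreal ((X n x)^2) \<partial>M) \<le> ennreal C" for n
      using C[of n] L2_sq[OF X[of n]] C0 by (subst nn_integral_eq_integral) (auto intro: ennreal_leI)
    then show ?thesis by (intro Liminf_le always_eventually) auto
  qed
  finally have *: "(\<integral>\<^sup>+x. ennreal ((u x)^2) \<partial>M) \<le> ennreal C" .
  have "integrable M (\<lambda>x. (u x)^2)"
    by (rule integrableI_bounded) (use u * in \<open>auto simp: le_less_trans\<close>)
  then show "L2 M u" using u by (simp add: L2_def)
  show "(\<integral>x. (u x)^2 \<partial>M) \<le> C"
    using * nn_integral_eq_integral[OF \<open>integrable M (\<lambda>x. (u x)^2)\<close>] C0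
    by (simp add: ennreal_le_iff)
qed

text \<open>Riesz-Fischer: along a subsequence with squared increments at most
  \<open>(1/4)^k\<close> the sum of \<open>2^k * (d k x)^2\<close> has finite integral, and the
  elementary bound \<open>\<bar>d\<bar> \<le> (1/2)^k + 2^k * d^2\<close> then makes the increments
  summable almost everywhere.\<close>

lemma L2_complete:
  fixes X :: "nat \<Rightarrow> 'b \<Rightarrow> real"
  assumes X: "\<And>n. L2 M (X n)"
    and C: "\<And>e. e > 0 \<Longrightarrow> \<exists>N. \<forall>m\<ge>N. \<forall>n\<ge>N. (\<integral>x. (X m x - X n x)^2 \<partial>M) < e"
  obtains u where "L2_lim M X u"
proof -
  have m[measurable]: "X n \<in> borel_measurable M" for n using X by (simp add: L2_def)
  have "\<exists>N. \<forall>m\<ge>N. \<forall>n\<ge>N. (\<integral>x. (X m x - X n x)^2 \<partial>M) < (1/4)^k" for k :: nat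
    by (rule C) simp
  then obtain N where N: "\<And>k m n. m \<ge> N k \<Longrightarrow> n \<ge> N k \<Longrightarrow> (\<integral>x. (X m x - X n x)^2 \<partial>M) < (1/4)^k"
    by metis
  \<comment> \<open>The \<open>Suc\<close> makes \<open>r\<close> strictly increasing, the other
    entry keeps \<open>r k\<close> beyond the threshold \<open>N k\<close>.\<close>
  define r where "r = rec_nat (N 0) (\<lambda>k p. max (Suc p) (N (Suc k)))"
  have r0: "r 0 = N 0" and rS: "r (Suc k) = max (Suc (r k)) (N (Suc k))" for k
    by (auto simp: r_def)
  have rN: "r k \<ge> N k" for k by (cases k) (auto simp: r0 rS)
  have sm: "strict_mono r" unfolding strict_mono_Suc_iff rS by (simp add: less_max_iff_disj)
  define d where "d k x = X (r (Suc k)) x - X (r k) x" for k x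
  have Ld: "L2 M (d k)" for k unfolding d_def by (intro L2_diff X)
  have md[measurable]: "d k \<in> borel_measurable M" for k using Ld by (simp add: L2_def)
  have dk: "(\<integral>x. (d k x)^2 \<partial>M) \<le> (1/4)^k" for k
  proof -
    have "r k \<le> r (Suc k)" using rS[of k] by simp
    then have "N k \<le> r (Suc k)" using rN[of k] by (rule order_trans[rotated])
    then show ?thesis unfolding d_def using N[of k "r (Suc k)" "r k"] rN[of k] by (intro less_imp_le) auto
  qed
  have "(\<integral>\<^sup>+x. (\<Sum>k. ennreal (2^k * (d k x)^2)) \<partial>M) = (\<Sum>k. \<integral>\<^sup>+x. ennreal (2^k * (d k x)^2) \<partial>M)"
    by (rule nn_integral_suminf) measurable
  also have "\<dots> \<le> (\<Sum>k. ennreal ((1/2)^k))"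
  proof (rule suminf_le)
    fix k :: nat
    have "(\<integral>\<^sup>+x. ennreal (2^k * (d k x)^2) \<partial>M) = ennreal (\<integral>x. 2^k * (d k x)^2 \<partial>M)"
      by (rule nn_integral_eq_integral) (use L2_sq[OF Ld] in auto)
    also have "\<dots> \<le> ennreal ((1/2)^k)"
    proof (rule ennreal_leI)
      have "2^k * (\<integral>x. (d k x)^2 \<partial>M) \<le> 2^k * (1/4)^k" using dk[of k] by (intro mult_left_mono) auto
      also have "\<dots> = (1/2 :: real)^k" by (simp flip: power_mult_distrib)
      finally show "(\<integral>x. 2^k * (d k x)^2 \<partial>M) \<le> (1/2)^k" by simp
    qed
    finally show "(\<integral>\<^sup>+x. ennreal (2^k * (d k x)^2) \<partial>M) \<le> ennreal ((1/2)^k)" .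
  qed auto
  also have "\<dots> = ennreal (\<Sum>k. (1/2)^k)" by (rule suminf_ennreal2) (auto simp: summable_geometric)
  finally have fin: "(\<integral>\<^sup>+x. (\<Sum>k. ennreal (2^k * (d k x)^2)) \<partial>M) \<noteq> \<infinity>"
    by (metis ennreal_less_top infinity_ennreal_def leD)
  have "AE x in M. (\<Sum>k. ennreal (2^k * (d k x)^2)) \<noteq> \<infinity>"
    by (rule nn_integral_PInf_AE[OF _ fin]) measurable
  then have conv: "AE x in M. convergent (\<lambda>k. X (r k) x)"
  proof eventually_elim
    case (elim x)
    have s1: "summable (\<lambda>k. 2^k * (d k x)^2)"
      by (rule summable_suminf_not_top) (use elim in auto)
    have "summable (\<lambda>k. (1/2)^k + 2^k * (d k x)^2)"
      by (intro summable_add s1 summable_geometric) simp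
    then have "summable (\<lambda>k. d k x)"
    proof (rule summable_comparison_test[rotated], intro exI allI impI)
      fix k :: nat
      have "0 \<le> (1/2)^k * (1 - 2^k * \<bar>d k x\<bar>)^2" by simp
      also have "\<dots> = (1/2)^k - 2 * \<bar>d k x\<bar> * ((1/2)^k * 2^k) + ((1/2)^k * 2^k) * (2^k * (d k x)^2)"
        by (simp add: power2_eq_square algebra_simps abs_mult_self_eq)
      also have "(1/2::real)^k * 2^k = 1" by (simp flip: power_mult_distrib)
      finally show "norm (d k x) \<le> (1/2)^k + 2^k * (d k x)^2" by simp
    qed
    then have "convergent (\<lambda>n. \<Sum>k<n. d k x)" by (simp add: summable_iff_convergent)
    moreover have "(\<Sum>k<n. d k x) = X (r n) x - X (r 0) x" for n
      unfolding d_def by (rule sum_lessThan_telescope)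
    ultimately have "convergent (\<lambda>n. (X (r n) x - X (r 0) x) + X (r 0) x)"
      by (intro convergent_add convergent_const) simp
    then show ?case by simp
  qed
  define u where "u x = lim (\<lambda>k. X (r k) x)" for x
  have mu: "u \<in> borel_measurable M" unfolding u_def by measurable
  have lim: "AE x in M. (\<lambda>k. X (r k) x) \<longlonglongrightarrow> u x"
    using conv by eventually_elim (simp add: u_def convergent_LIMSEQ_iff)
  \<comment> \<open>Fatou along the subsequence; the shift by \<open>k\<close> discards the terms
    before the threshold.\<close>
  have F: "L2 M (\<lambda>x. u x - X n x) \<and> (\<integral>x. (u x - X n x)^2 \<partial>M) \<le> e"
    if e: "e > 0" and n: "\<And>m. m \<ge> k \<Longrightarrow> (\<integral>x. (X m x - X n x)^2 \<partial>M) < e" for n e k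
  proof -
    have mk: "r (j + k) \<ge> k" for j using strict_mono_imp_increasing[OF sm, of "j + k"] by simp
    have l: "AE x in M. (\<lambda>j. X (r (j + k)) x - X n x) \<longlonglongrightarrow> u x - X n x"
      using lim by eventually_elim (intro tendsto_intros LIMSEQ_ignore_initial_segment)
    have b: "(\<integral>x. (X (r (j + k)) x - X n x)^2 \<partial>M) \<le> e" for j using n[OF mk] by (rule less_imp_le)
    show ?thesis
      using L2_Fatou[of M "\<lambda>j x. X (r (j + k)) x - X n x", OF L2_diff[OF X X] _ l b] mu by auto
  qed
  have Lu: "L2 M u"
  proof -
    obtain k where "\<forall>m\<ge>k. \<forall>n\<ge>k. (\<integral>x. (X m x - X n x)^2 \<partial>M) < 1" using C[of 1] by auto
    then have "L2 M (\<lambda>x. u x - X k x)" using F[of 1 k k] by auto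
    from L2_add[OF this X[of k]] show ?thesis by simp
  qed
  have "(\<lambda>n. \<integral>x. (X n x - u x)^2 \<partial>M) \<longlonglongrightarrow> 0"
  proof (rule LIMSEQ_I)
    fix e :: real assume e: "e > 0"
    then obtain k where k: "\<forall>m\<ge>k. \<forall>n\<ge>k. (\<integral>x. (X m x - X n x)^2 \<partial>M) < e / 2"
      using C[of "e/2"] by auto
    have "(\<integral>x. (X n x - u x)^2 \<partial>M) < e" if "n \<ge> k" for n
    proof -
      have "(\<integral>x. (u x - X n x)^2 \<partial>M) \<le> e / 2" using F[of "e/2" k n] k that e by auto
      then show ?thesis using e by (simp add: power2_commute)
    qed
    then show "\<exists>no. \<forall>n\<ge>no. norm ((\<integral>x. (X n x - u x)^2 \<partial>M) - 0) < e" by auto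
  qed
  then show ?thesis using that X Lu by (auto simp: L2_lim_def)
qed

subsection \<open>Translations and mollification\<close>

lemma lborel_translate:
  fixes f :: "'a::euclidean_space \<Rightarrow> real"
  assumes [measurable]: "f \<in> borel_measurable borel"
  shows integral_translate: "(\<integral>x. f (x + h) \<partial>lborel) = (\<integral>x. f x \<partial>lborel)"
    and integrable_translate: "integrable lborel (\<lambda>x. f (x + h)) \<longleftrightarrow> integrable lborel f"
proof -
  have d: "lborel = distr lborel borel ((+) h)" by (rule lborel_distr_plus[symmetric])
  have "(\<integral>x. f x \<partial>lborel) = (\<integral>x. f (h + x) \<partial>lborel)"
    by (subst d, subst integral_distr) auto
  then show "(\<integral>x. f (x + h) \<partial>lborel) = (\<integral>x. f x \<partial>lborel)" by (simp add: add.commute)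
  have "integrable lborel f \<longleftrightarrow> integrable lborel (\<lambda>x. f (h + x))"
    by (subst d, subst integrable_distr_eq) auto
  then show "integrable lborel (\<lambda>x. f (x + h)) \<longleftrightarrow> integrable lborel f" by (simp add: add.commute)
qed

lemma L2_translate:
  assumes "L2 lborel (f :: 'a::euclidean_space \<Rightarrow> real)"
  shows "L2 lborel (\<lambda>x. f (x + h))" "(\<integral>x. (f (x + h))^2 \<partial>lborel) = (\<integral>x. (f x)^2 \<partial>lborel)"
proof -
  have [measurable]: "f \<in> borel_measurable borel" using assms by (simp add: L2_def)
  show "L2 lborel (\<lambda>x. f (x + h))"
    using assms integrable_translate[of "\<lambda>x. (f x)^2" h] by (auto simp: L2_def)
  show "(\<integral>x. (f (x + h))^2 \<partial>lborel) = (\<integral>x. (f x)^2 \<partial>lborel)"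
    by (rule integral_translate[of "\<lambda>x. (f x)^2" h]) measurable
qed

text \<open>The loss \<open>I x - I (x + h)\<close> tends to 0 pointwise, because a point of an open
  set stays in it under small shifts, and it is dominated by the indicator. The gain at boundary
  points has no such pointwise control, but gain and loss have equal integrals by translation
  invariance.\<close>

lemma L1_translate_open:
  fixes U :: "'a::euclidean_space set"
  assumes U: "open U" "emeasure lborel U < \<infinity>" and h: "h \<longlonglongrightarrow> 0"
  shows "(\<lambda>n. \<integral>x. \<bar>indicator U (x + h n) - indicator U x\<bar> \<partial>lborel) \<longlonglongrightarrow> (0::real)"
proof -
  let ?I = "indicator U :: 'a \<Rightarrow> real"
  have [measurable]: "U \<in> sets borel" using U(1) by auto
  have iU: "integrable lborel ?I" using U(2) by simp
  have iUh: "integrable lborel (\<lambda>x. ?I (x + h n))" for n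
    using iU by (subst integrable_translate) auto
  have "(\<lambda>n. \<integral>x. max 0 (?I x - ?I (x + h n)) \<partial>lborel) \<longlonglongrightarrow> (\<integral>x. 0 \<partial>(lborel :: 'a measure))"
  proof (rule integral_dominated_convergence[where w="?I"])
    show "AE x in lborel. (\<lambda>n. max 0 (?I x - ?I (x + h n))) \<longlonglongrightarrow> 0"
    proof (rule AE_I2)
      fix x :: 'a
      show "(\<lambda>n. max 0 (?I x - ?I (x + h n))) \<longlonglongrightarrow> 0"
      proof (cases "x \<in> U")
        case True
        have "(\<lambda>n. x + h n) \<longlonglongrightarrow> x + 0" by (intro tendsto_intros h)
        then have "\<forall>\<^sub>F n in sequentially. x + h n \<in> U"
          using topological_tendstoD[OF _ U(1)] True by force
        then have "\<forall>\<^sub>F n in sequentially. max 0 (?I x - ?I (x + h n)) = 0"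
          by eventually_elim (simp add: True)
        then show ?thesis by (rule tendsto_eventually)
      next
        case False
        then have "max 0 (?I x - ?I (x + h n)) = 0" for n by (simp split: split_indicator)
        then show ?thesis by simp
      qed
    qed
    show "AE x in lborel. norm (max 0 (?I x - ?I (x + h n))) \<le> ?I x" for n
      by (rule AE_I2) (auto split: split_indicator)
  qed (use iU in auto)
  moreover have "(\<integral>x. \<bar>?I (x + h n) - ?I x\<bar> \<partial>lborel) = 2 * (\<integral>x. max 0 (?I x - ?I (x + h n)) \<partial>lborel)" for n
  proof -
    have "(\<integral>x. \<bar>?I (x + h n) - ?I x\<bar> \<partial>lborel)
      = (\<integral>x. 2 * max 0 (?I x - ?I (x + h n)) + (?I (x + h n) - ?I x) \<partial>lborel)"
      by (rule Bochner_Integration.integral_cong) (auto split: split_indicator)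
    also have "\<dots> = 2 * (\<integral>x. max 0 (?I x - ?I (x + h n)) \<partial>lborel)
        + ((\<integral>x. ?I (x + h n) \<partial>lborel) - (\<integral>x. ?I x \<partial>lborel))"
    proof (subst Bochner_Integration.integral_add)
      show "integrable lborel (\<lambda>x. 2 * max 0 (?I x - ?I (x + h n)))"
        using iU iUh[of n] by (intro integrable_mult_right integrable_max) auto
    qed (use iU iUh[of n] in auto)
    also have "(\<integral>x. ?I (x + h n) \<partial>lborel) = (\<integral>x. ?I x \<partial>lborel)" by (rule integral_translate) auto
    finally show ?thesis by simp
  qed
  ultimately show ?thesis
    by (simp add: tendsto_mult_right_zero)
qed

text \<open>Induction over integrable functions: outer regularity reduces indicators of Borel sets
  to open sets, sums follow from the triangle inequality, and in the limit case the shifted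
  approximation error equals the unshifted one.\<close>

lemma L1_translate:
  fixes f :: "'a::euclidean_space \<Rightarrow> real"
  assumes f: "integrable lborel f" and h: "h \<longlonglongrightarrow> 0"
  shows "(\<lambda>n. \<integral>x. \<bar>f (x + h n) - f x\<bar> \<partial>lborel) \<longlonglongrightarrow> 0"
  using f
proof (induction rule: integrable_induct)
  case (base A c)
  have A[measurable]: "A \<in> sets borel" using base by simp
  let ?I = "indicator A :: 'a \<Rightarrow> real"
  have iA: "integrable lborel ?I" using base by simp
  have iAh: "integrable lborel (\<lambda>x. ?I (x + h n))" for n
    using iA by (subst integrable_translate) auto
  have "(\<lambda>n. \<integral>x. \<bar>?I (x + h n) - ?I x\<bar> \<partial>lborel) \<longlonglongrightarrow> 0"
  proof (rule LIMSEQ_I)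
    fix e :: real assume e: "e > 0"
    \<comment> \<open>The excess \<open>U - A\<close> enters twice, once shifted, which leaves
      \<open>e/2\<close> for the open set.\<close>
    obtain U where U: "open U" "A \<subseteq> U" "emeasure lborel (U - A) < ennreal (e/4)"
      using outer_regular_lborel[OF A, of "e/4"] e by auto
    have [measurable]: "U \<in> sets borel" using U(1) by auto
    have "emeasure lborel U \<le> emeasure lborel A + emeasure lborel (U - A)"
      using emeasure_subadditive[of A lborel "U - A"] U(2) by (simp add: Un_absorb1)
    then have finU: "emeasure lborel U < \<infinity>" using base U(3)
      by (metis ennreal_add_less_top infinity_ennreal_def le_less_trans less_top order_less_trans)
    let ?W = "indicator (U - A) :: 'a \<Rightarrow> real" and ?J = "indicator U :: 'a \<Rightarrow> real"
    have fW: "emeasure lborel (U - A) < \<infinity>" using U(3) by (simp add: less_top order_less_trans)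
    have iW: "integrable lborel ?W" using fW by (subst integrable_indicator_iff) auto
    have iWh: "integrable lborel (\<lambda>x. ?W (x + h n))" for n
      using iW by (subst integrable_translate) auto
    have iJ: "integrable lborel ?J" using finU by simp
    have iJh: "integrable lborel (\<lambda>x. ?J (x + h n))" for n
      using iJ by (subst integrable_translate) auto
    have mW: "(\<integral>x. ?W x \<partial>lborel) < e / 4"
    proof -
      have "ennreal (measure lborel (U - A)) < ennreal (e/4)"
        using U(3) fW by (simp add: emeasure_eq_ennreal_measure less_top)
      then show ?thesis using e by (simp add: ennreal_less_iff)
    qed
    have bnd: "(\<integral>x. \<bar>?I (x + h n) - ?I x\<bar> \<partial>lborel)
        \<le> (\<integral>x. \<bar>?J (x + h n) - ?J x\<bar> \<partial>lborel) + 2 * (\<integral>x. ?W x \<partial>lborel)" for n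
    proof -
      have "(\<integral>x. \<bar>?I (x + h n) - ?I x\<bar> \<partial>lborel)
          \<le> (\<integral>x. \<bar>?J (x + h n) - ?J x\<bar> + ?W (x + h n) + ?W x \<partial>lborel)"
        by (rule integral_mono)
           (use iA iAh iW iWh iJ iJh U(2) in \<open>auto split: split_indicator\<close>)
      also have "\<dots> = (\<integral>x. \<bar>?J (x + h n) - ?J x\<bar> \<partial>lborel) + (\<integral>x. ?W (x + h n) \<partial>lborel) + (\<integral>x. ?W x \<partial>lborel)"
        using iW iWh iJ iJh by (simp only: Bochner_Integration.integral_add Bochner_Integration.integrable_add
            Bochner_Integration.integrable_diff integrable_abs)
      also have "(\<integral>x. ?W (x + h n) \<partial>lborel) = (\<integral>x. ?W x \<partial>lborel)" by (rule integral_translate) auto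
      finally show ?thesis by simp
    qed
    obtain N where N: "\<forall>n\<ge>N. norm ((\<integral>x. \<bar>?J (x + h n) - ?J x\<bar> \<partial>lborel) - 0) < e / 2"
      using LIMSEQ_D[OF L1_translate_open[OF U(1) finU h], of "e/2"] e by auto
    have "norm ((\<integral>x. \<bar>?I (x + h n) - ?I x\<bar> \<partial>lborel) - 0) < e" if "n \<ge> N" for n
      using N[rule_format, OF that] bnd[of n] mW by simp
    then show "\<exists>N. \<forall>n\<ge>N. norm ((\<integral>x. \<bar>?I (x + h n) - ?I x\<bar> \<partial>lborel) - 0) < e" by blast
  qed
  then have "(\<lambda>n. (\<integral>x. \<bar>?I (x + h n) - ?I x\<bar> \<partial>lborel) * \<bar>c\<bar>) \<longlonglongrightarrow> 0"
    by (rule tendsto_mult_left_zero)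
  moreover have "(\<integral>x. \<bar>?I (x + h n) *\<^sub>R c - ?I x *\<^sub>R c\<bar> \<partial>lborel) = (\<integral>x. \<bar>?I (x + h n) - ?I x\<bar> \<partial>lborel) * \<bar>c\<bar>" for n
    by (simp add: abs_mult flip: left_diff_distrib)
  ultimately show ?case by simp
next
  case (add f g)
  have m[measurable]: "f \<in> borel_measurable borel" "g \<in> borel_measurable borel"
    using add(1,2)[THEN borel_measurable_integrable] by simp_all
  have i: "integrable lborel (\<lambda>x. f (x + h n))" "integrable lborel (\<lambda>x. g (x + h n))" for n
    using add m by (simp_all add: integrable_translate)
  show ?case
  proof (rule Lim_null_comparison[OF always_eventually])
    show "\<forall>n. norm (\<integral>x. \<bar>f (x + h n) + g (x + h n) - (f x + g x)\<bar> \<partial>lborel)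
      \<le> (\<integral>x. \<bar>f (x + h n) - f x\<bar> \<partial>lborel) + (\<integral>x. \<bar>g (x + h n) - g x\<bar> \<partial>lborel)"
    proof
      fix n
      have "(\<integral>x. \<bar>f (x + h n) + g (x + h n) - (f x + g x)\<bar> \<partial>lborel)
        \<le> (\<integral>x. \<bar>f (x + h n) - f x\<bar> + \<bar>g (x + h n) - g x\<bar> \<partial>lborel)"
        by (rule integral_mono) (use add i in auto)
      then show "norm (\<integral>x. \<bar>f (x + h n) + g (x + h n) - (f x + g x)\<bar> \<partial>lborel)
        \<le> (\<integral>x. \<bar>f (x + h n) - f x\<bar> \<partial>lborel) + (\<integral>x. \<bar>g (x + h n) - g x\<bar> \<partial>lborel)"
        using add i by simp
    qed
  qed (use add in \<open>auto intro: tendsto_add_zero\<close>)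
next
  case (lim f s)
  have m[measurable]: "f \<in> borel_measurable borel" "s i \<in> borel_measurable borel" for i
    using lim(1,4) by (auto dest: borel_measurable_integrable)
  \<comment> \<open>The approximants satisfy
    \<open>\<bar>s i x\<bar> \<le> 2 * \<bar>f x\<bar>\<close>, whence the factor 3 in the
    dominating function.\<close>
  have conv: "(\<lambda>i. \<integral>x. \<bar>s i x - f x\<bar> \<partial>lborel) \<longlonglongrightarrow> (\<integral>x. 0 \<partial>(lborel :: 'a measure))"
  proof (rule integral_dominated_convergence[where w="\<lambda>x. 3 * \<bar>f x\<bar>"])
    show "AE x in lborel. (\<lambda>i. \<bar>s i x - f x\<bar>) \<longlonglongrightarrow> 0"
    proof (rule AE_I2)
      fix x :: 'a
      have "(\<lambda>i. s i x) \<longlonglongrightarrow> f x" using lim(2)[of x] by simp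
      then show "(\<lambda>i. \<bar>s i x - f x\<bar>) \<longlonglongrightarrow> 0" by (simp add: LIM_zero tendsto_rabs_zero)
    qed
    show "AE x in lborel. norm \<bar>s i x - f x\<bar> \<le> 3 * \<bar>f x\<bar>" for i
      by (rule AE_I2) (use lim(3)[of _ i] in \<open>force simp: abs_if split: if_splits\<close>)
  qed (use lim in auto)
  have i: "integrable lborel (\<lambda>x. f (x + h n))" "integrable lborel (\<lambda>x. s i (x + h n))" for n i
    using lim(1,4) m by (simp_all add: integrable_translate)
  show ?case
  proof (rule LIMSEQ_I)
    fix e :: real assume e: "e > 0"
    obtain k where k: "(\<integral>x. \<bar>s k x - f x\<bar> \<partial>lborel) < e / 4"
      using LIMSEQ_D[OF conv, of "e/4"] e by auto
    obtain N where N: "\<forall>n\<ge>N. norm ((\<integral>x. \<bar>s k (x + h n) - s k x\<bar> \<partial>lborel) - 0) < e / 4"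
      using LIMSEQ_D[OF lim(5)[of k], of "e/4"] e by auto
    have "norm ((\<integral>x. \<bar>f (x + h n) - f x\<bar> \<partial>lborel) - 0) < e" if "n \<ge> N" for n
    proof -
      have "(\<integral>x. \<bar>f (x + h n) - f x\<bar> \<partial>lborel)
        \<le> (\<integral>x. \<bar>s k (x + h n) - f (x + h n)\<bar> + \<bar>s k (x + h n) - s k x\<bar> + \<bar>s k x - f x\<bar> \<partial>lborel)"
        by (rule integral_mono) (use lim(1,4) i in auto)
      also have "\<dots> = (\<integral>x. \<bar>s k (x + h n) - f (x + h n)\<bar> \<partial>lborel)
          + (\<integral>x. \<bar>s k (x + h n) - s k x\<bar> \<partial>lborel) + (\<integral>x. \<bar>s k x - f x\<bar> \<partial>lborel)"
        using lim(1,4) i by simp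
      also have "(\<integral>x. \<bar>s k (x + h n) - f (x + h n)\<bar> \<partial>lborel) = (\<integral>x. \<bar>s k x - f x\<bar> \<partial>lborel)"
        by (rule integral_translate[of "\<lambda>x. \<bar>s k x - f x\<bar>"]) measurable
      finally show ?thesis using k N[rule_format, OF that] e by simp
    qed
    then show "\<exists>N. \<forall>n\<ge>N. norm ((\<integral>x. \<bar>f (x + h n) - f x\<bar> \<partial>lborel) - 0) < e" by blast
  qed
qed

text \<open>Reduces continuity of translation in \<open>L2\<close> to \<open>L1\<close>: nonnegative
  numbers satisfy \<open>(p - q)^2 \<le> \<bar>p^2 - q^2\<bar>\<close>, and splitting into positive
  and negative part keeps the signs that squaring would lose.\<close>

lemma sq_diff_pos_parts:
  fixes a b :: real
  shows "(a - b)^2 \<le> 2 * \<bar>(max 0 a)^2 - (max 0 b)^2\<bar> + 2 * \<bar>(max 0 (-a))^2 - (max 0 (-b))^2\<bar>"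
proof -
  have nn: "(p - q)^2 \<le> \<bar>p^2 - q^2\<bar>" if "0 \<le> p" "0 \<le> q" for p q :: real
  proof -
    have "(p - q)^2 = \<bar>p - q\<bar> * \<bar>p - q\<bar>" by (simp add: power2_eq_square)
    also have "\<dots> \<le> \<bar>p - q\<bar> * \<bar>p + q\<bar>" using that by (intro mult_left_mono) auto
    also have "\<dots> = \<bar>p^2 - q^2\<bar>" by (simp add: power2_eq_square algebra_simps flip: abs_mult)
    finally show ?thesis .
  qed
  define p q p' q' where "p = max 0 a" "q = max 0 b" "p' = max 0 (-a)" "q' = max 0 (-b)"
  have e: "a - b = (p - q) - (p' - q')" by (auto simp: p_q_p'_q'_def)
  have "0 \<le> ((p - q) + (p' - q'))^2" by simp
  then have "(a - b)^2 \<le> 2 * (p - q)^2 + 2 * (p' - q')^2"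
    unfolding e power2_diff[of "p - q"] power2_sum[of "p - q"] by simp
  also have "\<dots> \<le> 2 * \<bar>p^2 - q^2\<bar> + 2 * \<bar>p'^2 - q'^2\<bar>"
    by (intro add_mono mult_left_mono nn) (auto simp: p_q_p'_q'_def)
  finally show ?thesis by (simp add: p_q_p'_q'_def)
qed

lemma L2_translate_tendsto:
  fixes f :: "'a::euclidean_space \<Rightarrow> real"
  assumes f: "L2 lborel f" and h: "h \<longlonglongrightarrow> 0"
  shows "(\<lambda>n. \<integral>x. (f (x + h n) - f x)^2 \<partial>lborel) \<longlonglongrightarrow> 0"
proof -
  have m[measurable]: "f \<in> borel_measurable borel" using f by (simp add: L2_def)
  define p q where "p x = (max 0 (f x))^2" and "q x = (max 0 (- f x))^2" for x
  have pm[measurable]: "p \<in> borel_measurable borel" "q \<in> borel_measurable borel"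
    unfolding p_def q_def by measurable
  have ip: "integrable lborel p"
    by (rule Bochner_Integration.integrable_bound[OF L2_sq[OF f]]) (auto simp: p_def max_def)
  have iq: "integrable lborel q"
    by (rule Bochner_Integration.integrable_bound[OF L2_sq[OF f]]) (auto simp: q_def max_def)
  have ih: "integrable lborel (\<lambda>x. p (x + h n))" "integrable lborel (\<lambda>x. q (x + h n))" for n
    using ip iq by (simp_all add: integrable_translate)
  have b: "(\<integral>x. (f (x + h n) - f x)^2 \<partial>lborel)
      \<le> 2 * (\<integral>x. \<bar>p (x + h n) - p x\<bar> \<partial>lborel) + 2 * (\<integral>x. \<bar>q (x + h n) - q x\<bar> \<partial>lborel)" for n
  proof -
    have "(\<integral>x. (f (x + h n) - f x)^2 \<partial>lborel)
        \<le> (\<integral>x. 2 * \<bar>p (x + h n) - p x\<bar> + 2 * \<bar>q (x + h n) - q x\<bar> \<partial>lborel)"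
    proof (rule integral_mono)
      show "integrable lborel (\<lambda>x. (f (x + h n) - f x)^2)"
        by (intro L2_sq L2_diff L2_translate f)
      show "(f (x + h n) - f x)^2 \<le> 2 * \<bar>p (x + h n) - p x\<bar> + 2 * \<bar>q (x + h n) - q x\<bar>" for x
        unfolding p_def q_def by (rule sq_diff_pos_parts)
    qed (use ip iq ih in auto)
    then show ?thesis using ip iq ih by simp
  qed
  have "(\<lambda>n. 2 * (\<integral>x. \<bar>p (x + h n) - p x\<bar> \<partial>lborel) + 2 * (\<integral>x. \<bar>q (x + h n) - q x\<bar> \<partial>lborel)) \<longlonglongrightarrow> 0"
    using L1_translate[OF ip h] L1_translate[OF iq h] by (auto intro!: tendsto_eq_intros)
  then show ?thesis
    by (rule Lim_null_comparison[OF always_eventually, rotated]) (use b in auto)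
qed

text \<open>Sequences suffice: a violating shift for each \<open>d = 1/(n+1)\<close> would
  contradict \<open>L2_translate_tendsto\<close>.\<close>

lemma L2_translate_small:
  fixes f :: "'a::euclidean_space \<Rightarrow> real"
  assumes f: "L2 lborel f" and e: "e > 0"
  obtains d where "d > 0" "\<And>h. norm h < d \<Longrightarrow> (\<integral>x. (f (x + h) - f x)^2 \<partial>lborel) \<le> e"
proof (rule ccontr)
  assume "\<not> thesis"
  then have "\<And>d. d > 0 \<Longrightarrow> \<exists>h. norm h < d \<and> e < (\<integral>x. (f (x + h) - f x)^2 \<partial>lborel)"
    using that by (meson not_le)
  then have "\<forall>n. \<exists>h. norm h < 1 / Suc n \<and> e < (\<integral>x. (f (x + h) - f x)^2 \<partial>lborel)"
    by simp
  then obtain h where h: "\<And>n. norm (h n) < 1 / Suc n" "\<And>n. e < (\<integral>x. (f (x + h n) - f x)^2 \<partial>lborel)"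
    by metis
  have "h \<longlonglongrightarrow> 0"
  proof (rule Lim_null_comparison[OF always_eventually])
    show "\<forall>n. norm (h n) \<le> inverse (real (Suc n))" using h(1) by (auto simp: divide_inverse intro: less_imp_le)
  qed (rule LIMSEQ_inverse_real_of_nat)
  from L2_translate_tendsto[OF f this] have "0 \<ge> e"
    by (rule LIMSEQ_le_const) (use h(2) in \<open>auto intro: less_imp_le\<close>)
  then show False using e by simp
qed

text \<open>Jensen's inequality for the probability density \<open>\<rho>\<close>, followed by
  Tonelli. The map \<open>j\<close> admits shifts by all of space as well as by time alone.\<close>

lemma mollify_close:
  fixes F :: "'b::euclidean_space \<Rightarrow> real" and \<rho> :: "'c::euclidean_space \<Rightarrow> real" and j :: "'c \<Rightarrow> 'b"
  assumes F: "L2 lborel F"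
    and \<rho>: "\<And>r. 0 \<le> \<rho> r" "integrable lborel \<rho>" "(\<integral>r. \<rho> r \<partial>lborel) = 1"
    and j[measurable]: "j \<in> borel_measurable borel"
    and e: "\<And>r. \<rho> r \<noteq> 0 \<Longrightarrow> (\<integral>x. (F (x + j r) - F x)^2 \<partial>lborel) \<le> e"
  defines "U \<equiv> \<lambda>x. \<integral>r. \<rho> r * F (x + j r) \<partial>lborel"
  shows "AE x in lborel. integrable lborel (\<lambda>r. \<rho> r * F (x + j r))"
    and "L2 lborel U" and "(\<integral>x. (U x - F x)^2 \<partial>lborel) \<le> e"
proof -
  have m[measurable]: "F \<in> borel_measurable borel" "\<rho> \<in> borel_measurable borel"
    using F \<rho>(2) by (auto simp: L2_def dest: borel_measurable_integrable)
  have e0: "0 \<le> e"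
  proof -
    have "\<exists>r. \<rho> r \<noteq> 0"
    proof (rule ccontr)
      assume "\<nexists>r. \<rho> r \<noteq> 0"
      then have "\<rho> = (\<lambda>r. 0)" by auto
      then show False using \<rho>(3) by simp
    qed
    then obtain r where "\<rho> r \<noteq> 0" by blast
    from e[OF this] show ?thesis by (rule order_trans[rotated]) simp
  qed
  have nn1: "(\<integral>\<^sup>+r. ennreal (\<rho> r) \<partial>lborel) = 1"
    using nn_integral_eq_integral[OF \<rho>(2)] \<rho>(1,3) by simp
  have LD: "L2 lborel (\<lambda>x. F (x + j r) - F x)" for r by (intro L2_diff L2_translate F)
  have K: "(\<integral>\<^sup>+x. (\<integral>\<^sup>+r. ennreal (\<rho> r * (F (x + j r) - F x)^2) \<partial>lborel) \<partial>lborel) \<le> ennreal e"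
  proof -
    have "(\<integral>\<^sup>+x. (\<integral>\<^sup>+r. ennreal (\<rho> r * (F (x + j r) - F x)^2) \<partial>lborel) \<partial>lborel)
       = (\<integral>\<^sup>+r. (\<integral>\<^sup>+x. ennreal (\<rho> r * (F (x + j r) - F x)^2) \<partial>lborel) \<partial>lborel)"
      by (rule lborel_pair.Fubini'[symmetric]) measurable
    also have "\<dots> \<le> (\<integral>\<^sup>+r. ennreal (\<rho> r) * ennreal e \<partial>lborel)"
    proof (rule nn_integral_mono)
      fix r :: 'c
      have "(\<integral>\<^sup>+x. ennreal (\<rho> r * (F (x + j r) - F x)^2) \<partial>lborel)
         = ennreal (\<rho> r * (\<integral>x. (F (x + j r) - F x)^2 \<partial>lborel))"
        using nn_integral_eq_integral[of lborel "\<lambda>x. \<rho> r * (F (x + j r) - F x)^2"]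
          L2_sq[OF LD[of r]] \<rho>(1)[of r] by simp
      also have "\<dots> \<le> ennreal (\<rho> r * e)"
        using e[of r] \<rho>(1)[of r] by (intro ennreal_leI) (cases "\<rho> r = 0", auto intro: mult_left_mono)
      finally show "(\<integral>\<^sup>+x. ennreal (\<rho> r * (F (x + j r) - F x)^2) \<partial>lborel) \<le> ennreal (\<rho> r) * ennreal e"
        using \<rho>(1)[of r] e0 by (simp add: ennreal_mult)
    qed
    also have "\<dots> = ennreal e" using nn1 by (subst nn_integral_multc) auto
    finally show ?thesis .
  qed
  have "AE x in lborel. (\<integral>\<^sup>+r. ennreal (\<rho> r * (F (x + j r) - F x)^2) \<partial>lborel) \<noteq> \<infinity>"
    by (rule nn_integral_PInf_AE) (use K in \<open>auto simp: top_unique\<close>)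
  then have i2: "AE x in lborel. integrable lborel (\<lambda>r. \<rho> r * (F (x + j r) - F x)^2)"
  proof eventually_elim
    case (elim x)
    show ?case by (rule integrableI_bounded) (use elim \<rho>(1) in \<open>auto simp: less_top abs_mult\<close>)
  qed
  have pt: "integrable lborel (\<lambda>r. \<rho> r * F (x + j r)) \<and>
      (U x - F x)^2 \<le> (\<integral>r. \<rho> r * (F (x + j r) - F x)^2 \<partial>lborel)"
    if i: "integrable lborel (\<lambda>r. \<rho> r * (F (x + j r) - F x)^2)" for x
  proof -
    \<comment> \<open>The weight is split as \<open>sqrt (\<rho> r) * sqrt (\<rho> r)\<close>, so
      that Cauchy-Schwarz meets one factor of unit norm.\<close>
    have A: "L2 lborel (\<lambda>r. sqrt (\<rho> r))"
      using \<rho> by (simp add: L2_def)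
    have B: "L2 lborel (\<lambda>r. sqrt (\<rho> r) * (F (x + j r) - F x))"
      using i \<rho>(1) by (simp add: L2_def power_mult_distrib)
    have eq: "sqrt (\<rho> r) * (sqrt (\<rho> r) * (F (x + j r) - F x)) = \<rho> r * (F (x + j r) - F x)" for r
      using \<rho>(1)[of r] by (simp flip: mult.assoc)
    have iD: "integrable lborel (\<lambda>r. \<rho> r * (F (x + j r) - F x))"
      using L2_mult[OF A B] by (simp add: eq)
    have iF: "integrable lborel (\<lambda>r. \<rho> r * F x)" using \<rho>(2) by simp
    have i1: "integrable lborel (\<lambda>r. \<rho> r * F (x + j r))"
      using Bochner_Integration.integrable_add[OF iD iF] by (simp add: algebra_simps)
    have "U x - F x = (\<integral>r. \<rho> r * F (x + j r) - \<rho> r * F x \<partial>lborel)"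
      using i1 iF \<rho>(3) by (simp add: U_def)
    also have "\<dots> = (\<integral>r. sqrt (\<rho> r) * (sqrt (\<rho> r) * (F (x + j r) - F x)) \<partial>lborel)"
      by (simp only: eq) (simp add: right_diff_distrib)
    finally have "\<bar>U x - F x\<bar> \<le> sqrt (\<integral>r. \<rho> r * (F (x + j r) - F x)^2 \<partial>lborel)"
      using L2_Cauchy_Schwarz[OF A B] \<rho> by (simp add: power_mult_distrib)
    then have "\<bar>U x - F x\<bar>^2 \<le> (sqrt (\<integral>r. \<rho> r * (F (x + j r) - F x)^2 \<partial>lborel))^2"
      by (intro power_mono) auto
    then show ?thesis using i1 \<rho>(1) by simp
  qed
  show "AE x in lborel. integrable lborel (\<lambda>r. \<rho> r * F (x + j r))"
    using i2 by eventually_elim (use pt in blast)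
  have mU[measurable]: "U \<in> borel_measurable borel"
    unfolding U_def by measurable
  have K2: "(\<integral>\<^sup>+x. ennreal ((U x - F x)^2) \<partial>lborel) \<le> ennreal e"
  proof (rule order_trans[OF nn_integral_mono_AE K])
    show "AE x in lborel. ennreal ((U x - F x)^2) \<le> (\<integral>\<^sup>+r. ennreal (\<rho> r * (F (x + j r) - F x)^2) \<partial>lborel)"
      using i2
    proof eventually_elim
      case (elim x)
      then show ?case using pt[OF elim] \<rho>(1)
        by (subst nn_integral_eq_integral[OF elim]) (auto intro: ennreal_leI)
    qed
  qed
  have iU: "integrable lborel (\<lambda>x. (U x - F x)^2)"
    by (rule integrableI_bounded) (use K2 in \<open>auto simp: le_less_trans\<close>)
  then have "L2 lborel (\<lambda>x. U x - F x)" by (simp add: L2_def)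
  from L2_add[OF this F] show "L2 lborel U" by simp
  show "(\<integral>x. (U x - F x)^2 \<partial>lborel) \<le> e"
    using K2 nn_integral_eq_integral[OF iU] e0 by (simp add: ennreal_le_iff)
qed

lemma mollify_lim:
  fixes F :: "'b::euclidean_space \<Rightarrow> real" and \<rho> :: "nat \<Rightarrow> 'c::euclidean_space \<Rightarrow> real" and j :: "'c \<Rightarrow> 'b"
  assumes F: "L2 lborel F"
    and \<rho>: "\<And>n r. 0 \<le> \<rho> n r" "\<And>n. integrable lborel (\<rho> n)" "\<And>n. (\<integral>r. \<rho> n r \<partial>lborel) = 1"
    and supp: "\<And>n r. \<rho> n r \<noteq> 0 \<Longrightarrow> norm r \<le> \<delta> n" "\<delta> \<longlonglongrightarrow> 0"
    and j[measurable]: "j \<in> borel_measurable borel" and jn: "\<And>r. norm (j r) \<le> norm r"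
  shows "L2_lim lborel (\<lambda>n x. \<integral>r. \<rho> n r * F (x + j r) \<partial>lborel) F"
  unfolding L2_lim_def
proof (intro conjI allI)
  \<comment> \<open>The crude bound by four times the squared norm of \<open>F\<close> holds for
    every shift, so it gives membership for each \<open>n\<close>, however wide the kernel still
    is.\<close>
  show "L2 lborel (\<lambda>x. \<integral>r. \<rho> n r * F (x + j r) \<partial>lborel)" for n
  proof (rule mollify_close(2)[OF F \<rho> j])
    fix r
    show "(\<integral>x. (F (x + j r) - F x)^2 \<partial>lborel) \<le> 4 * (\<integral>x. (F x)^2 \<partial>lborel)"
      using L2_triangle[OF L2_translate(1)[OF F] L2_minus[OF F], of "j r"] L2_translate(2)[OF F, of "j r"]
      by simp
  qed
  show "(\<lambda>n. \<integral>x. ((\<integral>r. \<rho> n r * F (x + j r) \<partial>lborel) - F x)^2 \<partial>lborel) \<longlonglongrightarrow> 0"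
  proof (rule LIMSEQ_I)
    fix e :: real assume e: "e > 0"
    then obtain d where d: "d > 0" "\<And>h. norm h < d \<Longrightarrow> (\<integral>x. (F (x + h) - F x)^2 \<partial>lborel) \<le> e / 2"
      using L2_translate_small[OF F, of "e/2"] by auto
    obtain N where N: "\<forall>n\<ge>N. norm (\<delta> n - 0) < d" using LIMSEQ_D[OF supp(2) d(1)] by auto
    have "(\<integral>x. ((\<integral>r. \<rho> n r * F (x + j r) \<partial>lborel) - F x)^2 \<partial>lborel) \<le> e / 2" if "n \<ge> N" for n
    proof (rule mollify_close(3)[OF F \<rho> j])
      fix r assume "\<rho> n r \<noteq> 0"
      from supp(1)[OF this] N[rule_format, OF that] jn[of r] have "norm (j r) < d" by simp
      then show "(\<integral>x. (F (x + j r) - F x)^2 \<partial>lborel) \<le> e / 2" by (rule d(2))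
    qed
    then show "\<exists>N. \<forall>n\<ge>N. norm ((\<integral>x. ((\<integral>r. \<rho> n r * F (x + j r) \<partial>lborel) - F x)^2 \<partial>lborel) - 0) < e"
      using e by (intro exI[of _ N]) (force intro: le_less_trans)
  qed
qed (rule F)

subsection \<open>A radial kernel of class C1\<close>

lemma has_derivative_pos_part_sq: "((\<lambda>s. (max 0 s)^2) has_real_derivative 2 * max 0 s) (at s)" for s :: real
proof -
  consider "s > 0" | "s < 0" | "s = 0" by linarith
  then show ?thesis
  proof cases
    case 1
    have "((\<lambda>s. s^2) has_real_derivative 2 * max 0 s) (at s)"
      using 1 by (auto intro!: derivative_eq_intros)
    then show ?thesis
      by (rule has_field_derivative_transform_within_open[where S="{0<..}"]) (use 1 in auto)
  next
    case 2
    have "((\<lambda>s. 0) has_real_derivative 2 * max 0 s) (at s)" using 2 by auto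
    then show ?thesis
      by (rule has_field_derivative_transform_within_open[where S="{..<0}"]) (use 2 in auto)
  next
    case 3
    have "((\<lambda>h::real. ((max 0 h)^2) / h) \<longlongrightarrow> 0) (at 0)"
    proof (rule Lim_null_comparison[OF always_eventually])
      show "\<forall>h::real. norm ((max 0 h)^2 / h) \<le> \<bar>h\<bar>"
        by (auto simp: max_def power2_eq_square)
    qed (auto intro!: tendsto_eq_intros)
    then show ?thesis using 3 by (simp add: DERIV_def)
  qed
qed

text \<open>One continuous derivative is enough for \<open>test_fun\<close>, so a squared positive
  part replaces the usual exponential bump. Being available in every Euclidean space, it serves both
  in space and in time.\<close>

definition bump :: "real \<Rightarrow> 'a::euclidean_space \<Rightarrow> real" where
  "bump \<delta> x = (max 0 (\<delta>^2 - x \<bullet> x))^2"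

definition kern :: "real \<Rightarrow> 'a::euclidean_space \<Rightarrow> real" where
  "kern \<delta> x = bump \<delta> x / (\<integral>y. bump \<delta> y \<partial>(lborel :: 'a measure))"

definition kernD :: "real \<Rightarrow> 'a::euclidean_space \<Rightarrow> 'a" where
  "kernD \<delta> x = (- 4 * max 0 (\<delta>^2 - x \<bullet> x) / (\<integral>y. bump \<delta> y \<partial>(lborel :: 'a measure))) *\<^sub>R x"

lemma bump_eq_0_iff: "\<delta> > 0 \<Longrightarrow> bump \<delta> x = 0 \<longleftrightarrow> \<delta> \<le> norm x"
  unfolding bump_def by (auto simp: max_def dot_square_norm abs_le_square_iff[symmetric] split: if_splits)

lemma bump_le: "bump \<delta> x \<le> (\<delta>^2)^2"
  unfolding bump_def by (intro power_mono) auto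

lemma continuous_bump: "continuous_on UNIV (bump \<delta>)"
  unfolding bump_def by (intro continuous_intros)

lemma bump_integrable:
  assumes "\<delta> > 0" shows "integrable lborel (bump \<delta> :: 'a::euclidean_space \<Rightarrow> real)"
proof (rule Bochner_Integration.integrable_bound)
  show "integrable lborel (\<lambda>x. (\<delta>^2)^2 * indicator (cball 0 \<delta> :: 'a set) x :: real)"
    using emeasure_bounded_finite[of "cball 0 \<delta> :: 'a set"] by (intro integrable_mult_right) simp
  show "AE x in lborel. norm (bump \<delta> x) \<le> norm ((\<delta>^2)^2 * indicator (cball 0 \<delta> :: 'a set) x :: real)"
  proof (rule AE_I2)
    fix x :: 'a
    show "norm (bump \<delta> x) \<le> norm ((\<delta>^2)^2 * indicator (cball 0 \<delta> :: 'a set) x :: real)"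
      using bump_le[of \<delta> x] bump_eq_0_iff[OF assms, of x]
      by (cases "x \<in> cball 0 \<delta>") (auto simp: bump_def)
  qed
qed (use borel_measurable_continuous_onI[OF continuous_bump] in simp)

lemma bump_integral_pos:
  assumes "\<delta> > 0" shows "(\<integral>x. bump \<delta> x \<partial>(lborel :: 'a::euclidean_space measure)) > 0"
proof (rule ccontr)
  assume "\<not> ?thesis"
  moreover have nn: "0 \<le> bump \<delta> x" for x :: 'a by (simp add: bump_def)
  ultimately have "(\<integral>x. bump \<delta> x \<partial>(lborel :: 'a measure)) = 0"
    by (metis antisym_conv2 Bochner_Integration.integral_nonneg)
  then have "AE x in (lborel :: 'a measure). bump \<delta> x = 0"
    using integral_nonneg_eq_0_iff_AE[OF bump_integrable[OF assms]] nn by blast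
  then have "AE x in (lborel :: 'a measure). x \<notin> ball 0 \<delta>"
    by eventually_elim (simp add: bump_eq_0_iff[OF assms])
  then have "emeasure lborel (ball 0 \<delta> :: 'a set) = 0"
    by (subst (asm) AE_iff_measurable[of "ball 0 \<delta>"]) auto
  then show False using content_ball_pos[OF assms, of "0::'a"] by (simp add: measure_def)
qed

lemma kern_nonneg: "0 \<le> kern \<delta> x"
  unfolding kern_def by (intro divide_nonneg_nonneg Bochner_Integration.integral_nonneg) (auto simp: bump_def)

lemma kern_integrable: "\<delta> > 0 \<Longrightarrow> integrable lborel (kern \<delta> :: 'a::euclidean_space \<Rightarrow> real)"
  unfolding kern_def[abs_def] by (intro integrable_divide bump_integrable)

lemma kern_integral: "\<delta> > 0 \<Longrightarrow> (\<integral>x. kern \<delta> x \<partial>(lborel :: 'a::euclidean_space measure)) = 1"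
  unfolding kern_def[abs_def] using bump_integral_pos[of \<delta>, where 'a='a] by simp

lemma kern_eq_0_iff: "\<delta> > 0 \<Longrightarrow> kern \<delta> x = 0 \<longleftrightarrow> \<delta> \<le> norm (x::'a::euclidean_space)"
  unfolding kern_def using bump_integral_pos[of \<delta>, where 'a='a] bump_eq_0_iff[of \<delta> x] by auto

lemma kern_neq_0: "\<delta> > 0 \<Longrightarrow> kern \<delta> x \<noteq> 0 \<Longrightarrow> norm (x::'a::euclidean_space) \<le> \<delta>"
  by (simp add: kern_eq_0_iff)

lemma continuous_kern: "continuous_on UNIV (kern \<delta> :: 'a::euclidean_space \<Rightarrow> real)"
  unfolding kern_def[abs_def] divide_inverse by (intro continuous_intros continuous_bump)

lemma continuous_kernD: "continuous_on UNIV (kernD \<delta> :: 'a::euclidean_space \<Rightarrow> 'a)"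
  unfolding kernD_def[abs_def] divide_inverse by (intro continuous_intros)

lemma kern_measurable [measurable]: "kern \<delta> \<in> borel_measurable borel"
  by (rule borel_measurable_continuous_onI[OF continuous_kern])

lemma kernD_measurable [measurable]: "kernD \<delta> \<in> borel_measurable borel"
  by (rule borel_measurable_continuous_onI[OF continuous_kernD])

lemma kernD_eq_0: "\<delta> > 0 \<Longrightarrow> \<delta> \<le> norm x \<Longrightarrow> kernD \<delta> x = 0"
  unfolding kernD_def by (auto simp: max_def dot_square_norm abs_le_square_iff[symmetric])

lemma kern_has_derivative:
  "(kern \<delta> has_derivative (\<lambda>h. kernD \<delta> x \<bullet> h)) (at (x::'a::euclidean_space))"
proof -
  let ?Z = "\<integral>y. bump \<delta> y \<partial>(lborel :: 'a measure)"
  have 1: "((\<lambda>x. \<delta>^2 - x \<bullet> x) has_derivative (\<lambda>h. - 2 * (x \<bullet> h))) (at x)"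
    by (auto intro!: derivative_eq_intros simp: inner_commute)
  have "((\<lambda>x. (max 0 (\<delta>^2 - x \<bullet> x))^2) has_derivative
      (\<lambda>h. (- 2 * (x \<bullet> h)) * (2 * max 0 (\<delta>^2 - x \<bullet> x)))) (at x)"
    using has_derivative_compose[OF 1, of "\<lambda>s. (max 0 s)^2" "(*) (2 * max 0 (\<delta>^2 - x \<bullet> x))"]
      has_derivative_pos_part_sq[of "\<delta>^2 - x \<bullet> x"]
    by (simp add: has_field_derivative_def mult.commute)
  then have "(kern \<delta> has_derivative
      (\<lambda>h. inverse ?Z * ((- 2 * (x \<bullet> h)) * (2 * max 0 (\<delta>^2 - x \<bullet> x))))) (at x)"
    unfolding kern_def[abs_def] bump_def[symmetric] divide_inverse
    by (subst mult.commute) (rule has_derivative_mult_right)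
  then show ?thesis
    by (rule has_derivative_eq_rhs) (auto simp: kernD_def divide_inverse fun_eq_iff)
qed

lemma continuous_compact_support_bounded:
  fixes f :: "'a::euclidean_space \<Rightarrow> 'b::real_normed_vector"
  assumes "continuous_on UNIV f" "compact K" "\<And>x. x \<notin> K \<Longrightarrow> f x = 0"
  obtains M where "M > 0" "\<And>x. norm (f x) \<le> M"
proof -
  have "bounded (f ` K)"
    by (intro compact_imp_bounded compact_continuous_image continuous_on_subset[OF assms(1)] assms(2)) auto
  then obtain M where "M > 0" "\<And>x. x \<in> K \<Longrightarrow> norm (f x) \<le> M"
    by (auto simp: bounded_pos)
  then show ?thesis using that[of M] assms(3) by (metis less_imp_le norm_zero)
qed

lemma kern_bounded:
  assumes "\<delta> > 0" obtains M where "M > 0" "\<And>x::'a::euclidean_space. \<bar>kern \<delta> x\<bar> \<le> M"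
    "\<And>x::'a. norm (kernD \<delta> x) \<le> M"
proof -
  obtain M1 where "M1 > 0" "\<And>x::'a. norm (kern \<delta> x) \<le> M1"
    by (rule continuous_compact_support_bounded[OF continuous_kern[of \<delta>] compact_cball[of 0 \<delta>]])
       (auto simp: kern_eq_0_iff[OF assms])
  moreover obtain M2 where "M2 > 0" "\<And>x::'a. norm (kernD \<delta> x) \<le> M2"
    by (rule continuous_compact_support_bounded[OF continuous_kernD[of \<delta>] compact_cball[of 0 \<delta>]])
       (auto intro!: kernD_eq_0[OF assms])
  ultimately show ?thesis using that[of "max M1 M2"]
    by (auto simp: le_max_iff_disj)
qed

text \<open>The kernel is positive exactly on the open ball, so its support is the closed
  ball.\<close>

lemma test_fun_kern:
  assumes d: "\<delta> > 0" and U: "cball x \<delta> \<subseteq> U"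
  shows "test_fun U (\<lambda>y. kern \<delta> (y - x)) (\<lambda>y. kernD \<delta> (y - (x::'a::euclidean_space)))"
proof -
  have eq: "closure {y. kern \<delta> (y - x) \<noteq> 0} = cball x \<delta>"
  proof -
    have "{y. kern \<delta> (y - x) \<noteq> 0} = ball x \<delta>"
      by (auto simp: kern_eq_0_iff[OF d] dist_norm norm_minus_commute[of x])
    then show ?thesis using d by simp
  qed
  have "((\<lambda>y. kern \<delta> (y - x)) has_derivative (\<lambda>h. kernD \<delta> (y - x) \<bullet> h)) (at y)" for y
  proof -
    have "((\<lambda>y. y - x) has_derivative (\<lambda>h. h)) (at y)"
      by (auto intro!: derivative_eq_intros)
    from has_derivative_compose[OF this kern_has_derivative] show ?thesis .
  qed
  moreover have "continuous_on UNIV (\<lambda>y. kernD \<delta> (y - x))"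
    by (rule continuous_on_compose2[OF continuous_kernD]) (auto intro!: continuous_intros)
  ultimately show ?thesis using U unfolding test_fun_def eq by auto
qed

text \<open>After this substitution only the kernel depends on \<open>x\<close>: derivatives fall on
  it, and the shifted kernel can play the test function.\<close>

lemma kern_convolution:
  fixes F :: "'a::euclidean_space \<Rightarrow> real"
  assumes [measurable]: "F \<in> borel_measurable borel"
  shows "(\<integral>r. kern \<delta> r * F (x + r) \<partial>lborel) = (\<integral>z. F z * kern \<delta> (z - x) \<partial>lborel)"
  using integral_translate[of "\<lambda>z. F z * kern \<delta> (z - x)" x] by (simp add: add.commute mult.commute)

lemma mollify_kern:
  fixes F :: "'b::euclidean_space \<Rightarrow> real" and j :: "'c::euclidean_space \<Rightarrow> 'b"
  assumes F: "L2 lborel F" and \<delta>: "\<And>n. \<delta> n > 0" "\<delta> \<longlonglongrightarrow> 0"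
    and j: "j \<in> borel_measurable borel" "\<And>r. norm (j r) \<le> norm r"
  shows "L2_lim lborel (\<lambda>n x. \<integral>r. kern (\<delta> n) r * F (x + j r) \<partial>lborel) F"
proof (rule mollify_lim[where \<delta>=\<delta>])
  show "integrable lborel (kern (\<delta> n) :: 'c \<Rightarrow> real)" for n by (rule kern_integrable[OF \<delta>(1)])
  show "(\<integral>r. kern (\<delta> n) r \<partial>(lborel :: 'c measure)) = 1" for n by (rule kern_integral[OF \<delta>(1)])
  show "norm r \<le> \<delta> n" if "kern (\<delta> n) r \<noteq> 0" for n and r :: 'c by (rule kern_neq_0[OF \<delta>(1) that])
qed (rule F kern_nonneg \<delta>(2) j)+

subsection \<open>Differentiation under the integral sign and integration by parts\<close>

lemma abs_diff_le_of_deriv_bounded: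
  fixes g :: "real \<Rightarrow> real"
  assumes "\<And>s. (g has_real_derivative g' s) (at s)" "\<And>s. \<bar>g' s\<bar> \<le> C"
  shows "\<bar>g s - g t\<bar> \<le> C * \<bar>s - t\<bar>"
  using field_differentiable_bound[of UNIV g g' C s t] assms by simp

text \<open>The mean value inequality bounds all difference quotients of the kernel by
  \<open>C\<close>, which supplies the dominating function
  \<open>\<bar>u z\<bar> * C\<close>.\<close>

lemma has_derivative_under_integral:
  fixes \<kappa> \<kappa>' :: "real \<Rightarrow> 'b \<Rightarrow> real"
  assumes u: "integrable M u"
    and d: "\<And>s z. ((\<lambda>s. \<kappa> s z) has_real_derivative \<kappa>' s z) (at s)"
    and b: "\<And>s z. \<bar>\<kappa> s z\<bar> \<le> C" "\<And>s z. \<bar>\<kappa>' s z\<bar> \<le> C"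
    and m: "\<And>s. \<kappa> s \<in> borel_measurable M" "\<And>s. \<kappa>' s \<in> borel_measurable M"
  shows "((\<lambda>s. \<integral>z. u z * \<kappa> s z \<partial>M) has_real_derivative (\<integral>z. u z * \<kappa>' s z \<partial>M)) (at s)"
  unfolding DERIV_def tendsto_at_iff_sequentially
proof (intro allI impI)
  fix X :: "nat \<Rightarrow> real" assume X0: "\<forall>i. X i \<in> UNIV - {0}" and X: "X \<longlonglongrightarrow> 0"
  have [measurable]: "u \<in> borel_measurable M" using u by (rule borel_measurable_integrable)
  note m[measurable]
  have i: "integrable M (\<lambda>z. u z * \<kappa> s z)" for s
    by (rule Bochner_Integration.integrable_bound[of _ "\<lambda>z. u z * C"])
       (use u order_trans[OF b(1)[of s] abs_ge_self] in \<open>auto simp: abs_mult intro!: mult_left_mono\<close>)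
  have "(\<lambda>n. \<integral>z. u z * ((\<kappa> (s + X n) z - \<kappa> s z) / X n) \<partial>M) \<longlonglongrightarrow> (\<integral>z. u z * \<kappa>' s z \<partial>M)"
  proof (rule integral_dominated_convergence[where w="\<lambda>z. \<bar>u z\<bar> * C"])
    show "AE z in M. (\<lambda>n. u z * ((\<kappa> (s + X n) z - \<kappa> s z) / X n)) \<longlonglongrightarrow> u z * \<kappa>' s z"
    proof (rule AE_I2)
      fix z
      have "((\<lambda>h. (\<kappa> (s + h) z - \<kappa> s z) / h) \<longlongrightarrow> \<kappa>' s z) (at 0)"
        using d[of z s] by (simp add: DERIV_def)
      then have "(\<lambda>n. (\<kappa> (s + X n) z - \<kappa> s z) / X n) \<longlonglongrightarrow> \<kappa>' s z"
        using X0 X by (auto simp: tendsto_at_iff_sequentially o_def)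
      then show "(\<lambda>n. u z * ((\<kappa> (s + X n) z - \<kappa> s z) / X n)) \<longlonglongrightarrow> u z * \<kappa>' s z"
        by (intro tendsto_intros)
    qed
    show "AE z in M. norm (u z * ((\<kappa> (s + X n) z - \<kappa> s z) / X n)) \<le> \<bar>u z\<bar> * C" for n
    proof (rule AE_I2)
      fix z
      have "\<bar>\<kappa> (s + X n) z - \<kappa> s z\<bar> \<le> C * \<bar>X n\<bar>"
        using abs_diff_le_of_deriv_bounded[of "\<lambda>s. \<kappa> s z" "\<lambda>s. \<kappa>' s z" C "s + X n" s] d b(2) by simp
      then have "\<bar>(\<kappa> (s + X n) z - \<kappa> s z) / X n\<bar> \<le> C"
        using X0 by (simp add: field_simps)
      then show "norm (u z * ((\<kappa> (s + X n) z - \<kappa> s z) / X n)) \<le> \<bar>u z\<bar> * C"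
        unfolding real_norm_def abs_mult by (intro mult_left_mono) auto
    qed
  qed (use u in auto)
  moreover have "(\<integral>z. u z * ((\<kappa> (s + X n) z - \<kappa> s z) / X n) \<partial>M)
      = ((\<integral>z. u z * \<kappa> (s + X n) z \<partial>M) - (\<integral>z. u z * \<kappa> s z \<partial>M)) / X n" for n
  proof -
    have "(\<integral>z. u z * ((\<kappa> (s + X n) z - \<kappa> s z) / X n) \<partial>M)
        = (\<integral>z. (u z * \<kappa> (s + X n) z - u z * \<kappa> s z) / X n \<partial>M)"
      by (simp only: times_divide_eq_right right_diff_distrib)
    also have "\<dots> = (\<integral>z. u z * \<kappa> (s + X n) z - u z * \<kappa> s z \<partial>M) / X n"
      by (rule integral_divide_zero)
    also have "\<dots> = ((\<integral>z. u z * \<kappa> (s + X n) z \<partial>M) - (\<integral>z. u z * \<kappa> s z \<partial>M)) / X n"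
      by (simp only: Bochner_Integration.integral_diff[OF i i])
    finally show ?thesis .
  qed
  ultimately show "((\<lambda>h. ((\<integral>z. u z * \<kappa> (s + h) z \<partial>M) - (\<integral>z. u z * \<kappa> s z \<partial>M)) / h) \<circ> X)
      \<longlonglongrightarrow> (\<integral>z. u z * \<kappa>' s z \<partial>M)"
    by (simp only: o_def)
qed

lemma continuous_under_integral:
  fixes \<kappa> :: "real \<Rightarrow> 'b \<Rightarrow> real"
  assumes u: "integrable M u" and c: "\<And>z. isCont (\<lambda>s. \<kappa> s z) s"
    and b: "\<And>s z. \<bar>\<kappa> s z\<bar> \<le> C" and m: "\<And>s. \<kappa> s \<in> borel_measurable M"
  shows "isCont (\<lambda>s. \<integral>z. u z * \<kappa> s z \<partial>M) s"
  unfolding continuous_at_sequentially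
proof (intro allI impI)
  fix X :: "nat \<Rightarrow> real" assume X: "X \<longlonglongrightarrow> s"
  have [measurable]: "u \<in> borel_measurable M" using u by (rule borel_measurable_integrable)
  note m[measurable]
  have "(\<lambda>n. \<integral>z. u z * \<kappa> (X n) z \<partial>M) \<longlonglongrightarrow> (\<integral>z. u z * \<kappa> s z \<partial>M)"
  proof (rule integral_dominated_convergence[where w="\<lambda>z. \<bar>u z\<bar> * C"])
    show "AE z in M. (\<lambda>n. u z * \<kappa> (X n) z) \<longlonglongrightarrow> u z * \<kappa> s z"
      using c X by (auto simp: continuous_at_sequentially o_def intro!: tendsto_intros)
    show "AE z in M. norm (u z * \<kappa> (X n) z) \<le> \<bar>u z\<bar> * C" for n
      using b by (auto simp: abs_mult intro!: mult_left_mono)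
  qed (use u in auto)
  then show "((\<lambda>s. \<integral>z. u z * \<kappa> s z \<partial>M) \<circ> X) \<longlonglongrightarrow> (\<integral>z. u z * \<kappa> s z \<partial>M)" by (simp add: o_def)
qed

lemma integrable_bounded_support:
  fixes u :: "'a::euclidean_space \<Rightarrow> real"
  assumes "u \<in> borel_measurable borel" "bounded S" "\<And>x. x \<notin> S \<Longrightarrow> u x = 0" "\<And>x. \<bar>u x\<bar> \<le> M"
  shows "integrable lborel u"
proof -
  obtain R where R: "S \<subseteq> cball 0 R" using assms(2) by (auto simp: bounded_iff subset_iff)
  have f: "integrable lborel (\<lambda>x. M * indicator (cball 0 R :: 'a set) x :: real)"
    using emeasure_bounded_finite[of "cball 0 R :: 'a set"] by (intro integrable_mult_right) simp
  show ?thesis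
  proof (rule Bochner_Integration.integrable_bound[OF f])
    show "AE x in lborel. norm (u x) \<le> norm (M * indicator (cball 0 R :: 'a set) x)"
    proof (rule AE_I2)
      fix x show "norm (u x) \<le> norm (M * indicator (cball 0 R :: 'a set) x)"
        using assms(3)[of x] assms(4)[of x] R by (cases "x \<in> cball 0 R") (auto simp: subset_iff)
    qed
  qed (use assms in simp)
qed

lemma L2_bounded_support:
  fixes u :: "'a::euclidean_space \<Rightarrow> real"
  assumes "u \<in> borel_measurable borel" "bounded S" "\<And>x. x \<notin> S \<Longrightarrow> u x = 0" "\<And>x. \<bar>u x\<bar> \<le> M"
  shows "L2 lborel u"
  unfolding L2_def
proof
  have "\<bar>(u x)^2\<bar> \<le> M^2" for x using power_mono[OF assms(4)[of x], of 2] by simp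
  then show "integrable lborel (\<lambda>x. (u x)^2)"
    by (intro integrable_bounded_support[OF _ assms(2)]) (use assms in auto)
qed (use assms in simp)

lemma L2_bounded_support_integrable:
  fixes u :: "'a::euclidean_space \<Rightarrow> real"
  assumes u: "L2 lborel u" and S: "bounded S" "\<And>x. x \<notin> S \<Longrightarrow> u x = 0"
  shows "integrable lborel u"
proof -
  obtain R where R: "S \<subseteq> cball 0 R" using S(1) by (auto simp: bounded_iff subset_iff)
  have "L2 lborel (indicator (cball 0 R :: 'a set) :: 'a \<Rightarrow> real)"
    by (rule L2_bounded_support[of _ "cball 0 R" 1]) (auto split: split_indicator intro!: borel_measurable_indicator)
  from L2_mult[OF u this] have "integrable lborel (\<lambda>x. u x * indicator (cball 0 R) x)" .
  moreover have "u x * indicator (cball 0 R) x = u x" for x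
    using S(2)[of x] R by (auto split: split_indicator simp: subset_iff)
  ultimately show ?thesis by simp
qed

text \<open>Difference quotients of an integrable function have integral 0 by translation
  invariance, and their dominated limit is \<open>H'\<close>. This takes the place of the divergence
  theorem.\<close>

lemma integral_directional_derivative_zero:
  fixes H :: "'a::euclidean_space \<Rightarrow> real"
  assumes d: "\<And>x. ((\<lambda>s. H (x + s *\<^sub>R b)) has_real_derivative H' x) (at 0)"
    and M: "\<And>x. \<bar>H' x\<bar> \<le> M" and m[measurable]: "H \<in> borel_measurable borel" "H' \<in> borel_measurable borel"
    and S: "bounded S" "\<And>x. x \<notin> S \<Longrightarrow> H x = 0" and iH: "integrable lborel H"
  shows "(\<integral>x. H' x \<partial>lborel) = 0"
proof -
  obtain R where R: "S \<subseteq> cball 0 R" using S(1) by (auto simp: bounded_iff subset_iff)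
  have ds: "((\<lambda>s. H (x + s *\<^sub>R b)) has_real_derivative H' (x + s *\<^sub>R b)) (at s)" for x s
  proof -
    have "((\<lambda>s'. H (x + s *\<^sub>R b + s' *\<^sub>R b)) has_real_derivative H' (x + s *\<^sub>R b)) (at 0)" by (rule d)
    then have "((\<lambda>s'. H (x + (s' + s) *\<^sub>R b)) has_real_derivative H' (x + s *\<^sub>R b)) (at 0)"
      by (simp add: scaleR_add_left algebra_simps)
    then show ?thesis using DERIV_shift[of "\<lambda>s. H (x + s *\<^sub>R b)" "H' (x + s *\<^sub>R b)" 0 s]
      by simp
  qed
  define h where "h n = inverse (real (Suc n))" for n
  have h: "h \<longlonglongrightarrow> 0" "\<And>n. h n \<noteq> 0" "\<And>n. 0 < h n" "\<And>n. h n \<le> 1"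
    using LIMSEQ_inverse_real_of_nat by (auto simp: h_def[abs_def] inverse_le_1_iff)
  \<comment> \<open>As \<open>h n \<le> 1\<close>, the shifts have length at most
    \<open>norm b\<close>, so all difference quotients are supported in this ball.\<close>
  define B where "B = cball (0::'a) (R + norm b)"
  have iB: "integrable lborel (\<lambda>x. M * indicator B x :: real)"
    unfolding B_def using emeasure_bounded_finite[of "cball (0::'a) (R + norm b)"]
    by (intro integrable_mult_right) simp
  have "(\<lambda>n. \<integral>x. (H (x + h n *\<^sub>R b) - H x) / h n \<partial>lborel) \<longlonglongrightarrow> (\<integral>x. H' x \<partial>lborel)"
  proof (rule integral_dominated_convergence[OF _ _ iB])
    show "AE x in lborel. (\<lambda>n. (H (x + h n *\<^sub>R b) - H x) / h n) \<longlonglongrightarrow> H' x"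
      using d h by (auto simp: DERIV_def tendsto_at_iff_sequentially o_def)
    show "AE x in lborel. norm ((H (x + h n *\<^sub>R b) - H x) / h n) \<le> M * indicator B x" for n
    proof (rule AE_I2)
      fix x :: 'a
      show "norm ((H (x + h n *\<^sub>R b) - H x) / h n) \<le> M * indicator B x"
      proof (cases "x \<in> B")
        case True
        have "\<bar>H (x + h n *\<^sub>R b) - H x\<bar> \<le> M * \<bar>h n\<bar>"
          using abs_diff_le_of_deriv_bounded[OF ds M, of x "h n" 0] by simp
        then show ?thesis using True h(3)[of n] by (simp add: field_simps)
      next
        case False
        then have x: "norm x > R + norm b" by (simp add: B_def)
        have "norm x \<le> norm (x + h n *\<^sub>R b) + norm (h n *\<^sub>R b)"
          using norm_triangle_ineq4[of "x + h n *\<^sub>R b" "h n *\<^sub>R b"] by simp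
        moreover have "norm (h n *\<^sub>R b) \<le> norm b"
          using h(3,4)[of n] mult_right_mono[of "h n" 1 "norm b"] by simp
        ultimately have "norm (x + h n *\<^sub>R b) > R" using x by linarith
        moreover have "norm x > R" using x norm_ge_zero[of b] by linarith
        ultimately have "H (x + h n *\<^sub>R b) = 0" "H x = 0" using R by (auto intro!: S(2))
        then show ?thesis using False by simp
      qed
    qed
  qed auto
  moreover have "(\<integral>x. (H (x + h n *\<^sub>R b) - H x) / h n \<partial>lborel) = 0" for n
  proof -
    have "integrable lborel (\<lambda>x. H (x + h n *\<^sub>R b))" using iH by (subst integrable_translate) auto
    then show ?thesis using iH integral_translate[of H "h n *\<^sub>R b"] by simp
  qed
  ultimately show ?thesis by (simp only: LIMSEQ_const_iff)
qed

subsection \<open>Weak gradients\<close>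

lemma test_fun_props:
  fixes \<phi> :: "'a::euclidean_space \<Rightarrow> real"
  assumes t: "test_fun U \<phi> D\<phi>"
  obtains K where "compact K" "K \<subseteq> U" "bounded K"
    "\<And>x. x \<notin> K \<Longrightarrow> \<phi> x = 0" "\<And>x. x \<notin> K \<Longrightarrow> D\<phi> x = 0"
    "continuous_on UNIV \<phi>" "continuous_on UNIV D\<phi>"
    "\<phi> \<in> borel_measurable borel" "D\<phi> \<in> borel_measurable borel"
    "\<And>x b. ((\<lambda>s. \<phi> (x + s *\<^sub>R b)) has_real_derivative D\<phi> x \<bullet> b) (at 0)"
proof
  define K where "K = closure {x. \<phi> x \<noteq> 0}"
  have d: "\<And>x. (\<phi> has_derivative (\<lambda>h. D\<phi> x \<bullet> h)) (at x)" and c: "continuous_on UNIV D\<phi>"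
    using t by (auto simp: test_fun_def)
  show K: "compact K" "K \<subseteq> U" using t by (auto simp: test_fun_def K_def)
  show bK: "bounded K" using K(1) by (rule compact_imp_bounded)
  show o: "\<phi> x = 0" if "x \<notin> K" for x using that closure_subset[of "{x. \<phi> x \<noteq> 0}"] by (auto simp: K_def)
  show "D\<phi> x = 0" if "x \<notin> K" for x
  proof -
    have "((\<lambda>x. 0) has_derivative (\<lambda>h. D\<phi> x \<bullet> h)) (at x)"
    proof (rule has_derivative_transform_within_open[OF d[of x]])
      show "open (- K)" using K(1) compact_imp_closed by blast
    qed (use that o in auto)
    then have "(\<lambda>h. D\<phi> x \<bullet> h) = (\<lambda>h. 0)"
      by (rule has_derivative_unique) (rule has_derivative_const)
    from fun_cong[OF this, of "D\<phi> x"] show ?thesis by simp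
  qed
  show c0: "continuous_on UNIV \<phi>"
    by (intro continuous_at_imp_continuous_on ballI has_derivative_continuous[OF d])
  show "continuous_on UNIV D\<phi>" by (rule c)
  show "\<phi> \<in> borel_measurable borel" "D\<phi> \<in> borel_measurable borel"
    using c c0 by (auto intro: borel_measurable_continuous_onI)
  show "((\<lambda>s. \<phi> (x + s *\<^sub>R b)) has_real_derivative D\<phi> x \<bullet> b) (at 0)" for x b
  proof -
    have "((\<lambda>s. x + s *\<^sub>R b) has_derivative (\<lambda>h. h *\<^sub>R b)) (at 0)"
      by (auto intro!: derivative_eq_intros)
    then have "((\<lambda>s. \<phi> (x + s *\<^sub>R b)) has_derivative (\<lambda>h. D\<phi> x \<bullet> (h *\<^sub>R b))) (at 0)"
      using has_derivative_compose[of "\<lambda>s. x + s *\<^sub>R b" "\<lambda>h. h *\<^sub>R b" 0 UNIV \<phi> "\<lambda>h. D\<phi> x \<bullet> h"] d[of x] by simp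
    then show ?thesis unfolding has_field_derivative_def
      by (rule has_derivative_eq_rhs) (simp add: fun_eq_iff)
  qed
qed

lemma test_fun_bounded:
  fixes \<phi> :: "'a::euclidean_space \<Rightarrow> real"
  assumes t: "test_fun U \<phi> D\<phi>"
  obtains M where "M > 0" "\<And>x. \<bar>\<phi> x\<bar> \<le> M" "\<And>x. norm (D\<phi> x) \<le> M"
proof -
  obtain K where P: "compact K" "K \<subseteq> U" "bounded K"
      "\<And>x. x \<notin> K \<Longrightarrow> \<phi> x = 0" "\<And>x. x \<notin> K \<Longrightarrow> D\<phi> x = 0"
      "continuous_on UNIV \<phi>" "continuous_on UNIV D\<phi>"
      "\<phi> \<in> borel_measurable borel" "D\<phi> \<in> borel_measurable borel"
      "\<And>x b. ((\<lambda>s. \<phi> (x + s *\<^sub>R b)) has_real_derivative D\<phi> x \<bullet> b) (at 0)"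
    using test_fun_props[OF t] by blast
  obtain M1 where "M1 > 0" "\<And>x. norm (\<phi> x) \<le> M1"
    using continuous_compact_support_bounded[OF P(6) P(1) P(4)] by blast
  moreover obtain M2 where "M2 > 0" "\<And>x. norm (D\<phi> x) \<le> M2"
    using continuous_compact_support_bounded[OF P(7) P(1) P(5)] by blast
  ultimately show ?thesis using that[of "max M1 M2"] by (auto simp: le_max_iff_disj)
qed

lemma test_fun_L2:
  fixes \<phi> :: "'a::euclidean_space \<Rightarrow> real"
  assumes t: "test_fun U \<phi> D\<phi>"
  shows "L2 lborel \<phi>" "L2 lborel (\<lambda>x. D\<phi> x \<bullet> b)"
proof -
  obtain K where P: "compact K" "K \<subseteq> U" "bounded K"
      "\<And>x. x \<notin> K \<Longrightarrow> \<phi> x = 0" "\<And>x. x \<notin> K \<Longrightarrow> D\<phi> x = 0"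
      "continuous_on UNIV \<phi>" "continuous_on UNIV D\<phi>"
      "\<phi> \<in> borel_measurable borel" "D\<phi> \<in> borel_measurable borel"
      "\<And>x b. ((\<lambda>s. \<phi> (x + s *\<^sub>R b)) has_real_derivative D\<phi> x \<bullet> b) (at 0)"
    using test_fun_props[OF t] by blast
  note P(8,9)[measurable]
  obtain M where M: "M > 0" "\<And>x. \<bar>\<phi> x\<bar> \<le> M" "\<And>x. norm (D\<phi> x) \<le> M" using test_fun_bounded[OF t] by blast
  show "L2 lborel \<phi>" by (rule L2_bounded_support[OF P(8) P(3)]) (use P(4) M in auto)
  show "L2 lborel (\<lambda>x. D\<phi> x \<bullet> b)"
  proof (rule L2_bounded_support[OF _ P(3)])
    show "\<bar>D\<phi> x \<bullet> b\<bar> \<le> M * norm b" for x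
      using Cauchy_Schwarz_ineq2[of "D\<phi> x" b] mult_right_mono[OF M(3)[of x], of "norm b"] by simp
  qed (use P(5) in auto)
qed

lemma test_fun_integral_zero:
  fixes \<phi> :: "'a::euclidean_space \<Rightarrow> real"
  assumes t: "test_fun U \<phi> D\<phi>"
  shows "(\<integral>x. D\<phi> x \<bullet> b \<partial>lborel) = 0"
proof -
  obtain K where P: "compact K" "K \<subseteq> U" "bounded K"
      "\<And>x. x \<notin> K \<Longrightarrow> \<phi> x = 0" "\<And>x. x \<notin> K \<Longrightarrow> D\<phi> x = 0"
      "continuous_on UNIV \<phi>" "continuous_on UNIV D\<phi>"
      "\<phi> \<in> borel_measurable borel" "D\<phi> \<in> borel_measurable borel"
      "\<And>x b. ((\<lambda>s. \<phi> (x + s *\<^sub>R b)) has_real_derivative D\<phi> x \<bullet> b) (at 0)"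
    using test_fun_props[OF t] by blast
  note P(8,9)[measurable]
  obtain M where M: "M > 0" "\<And>x. \<bar>\<phi> x\<bar> \<le> M" "\<And>x. norm (D\<phi> x) \<le> M" using test_fun_bounded[OF t] by blast
  show ?thesis
  proof (rule integral_directional_derivative_zero[OF P(10) _ _ _ P(3) P(4)])
    show "\<bar>D\<phi> x \<bullet> b\<bar> \<le> M * norm b" for x
      using Cauchy_Schwarz_ineq2[of "D\<phi> x" b] mult_right_mono[OF M(3)[of x], of "norm b"] by simp
    show "integrable lborel \<phi>"
      by (rule L2_bounded_support_integrable[OF test_fun_L2(1)[OF t] P(3) P(4)])
  qed auto
qed

lemma open_Om: "open Om" and bounded_Om: "bounded Om" and Om_sets [measurable]: "Om \<in> sets borel"
  by (auto simp: Om_def)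

text \<open>Whole-space form of \<open>weak_grad\<close>, meant for functions extended by zero. The
  test functions are still supported in \<open>Om\<close>, so no boundary values are
  imposed.\<close>

definition wgrad :: "('a::euclidean_space \<Rightarrow> real) \<Rightarrow> ('a \<Rightarrow> 'a) \<Rightarrow> bool" where
  "wgrad u G \<longleftrightarrow> (\<forall>\<phi> D\<phi>. test_fun Om \<phi> D\<phi> \<longrightarrow> (\<forall>b\<in>Basis.
     (\<integral>x. u x * (D\<phi> x \<bullet> b) \<partial>lborel) = - (\<integral>x. (G x \<bullet> b) * \<phi> x \<partial>lborel)))"

definition H1g :: "('a::euclidean_space \<Rightarrow> real) \<Rightarrow> ('a \<Rightarrow> 'a) \<Rightarrow> bool" where
  "H1g u G \<longleftrightarrow> L2 lborel u \<and> (\<forall>b\<in>Basis. L2 lborel (\<lambda>x. G x \<bullet> b)) \<and>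
     (\<forall>x. x \<notin> Om \<longrightarrow> u x = 0 \<and> G x = 0) \<and> wgrad u G"

lemma H1g_props:
  assumes "H1g u G"
  shows "L2 lborel u" "\<And>b. b \<in> Basis \<Longrightarrow> L2 lborel (\<lambda>x. G x \<bullet> b)"
    "\<And>x. x \<notin> Om \<Longrightarrow> u x = 0" "\<And>x. x \<notin> Om \<Longrightarrow> G x = 0" "wgrad u G"
  using assms by (auto simp: H1g_def)

lemma H1g_measurable:
  assumes "H1g u G" shows "u \<in> borel_measurable borel" "G \<in> borel_measurable borel"
  using H1g_props[OF assms] by (auto simp: L2_def borel_measurable_euclidean_space[of G])

text \<open>At a point of \<open>Om\<close> the mollified function is eventually an integral against
  a kernel supported in \<open>Om\<close>, hence 0; along a subsequence it also converges to
  \<open>k\<close> almost everywhere.\<close>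

lemma fundamental_lemma:
  fixes k :: "'a::euclidean_space \<Rightarrow> real"
  assumes k: "L2 lborel k" "\<And>x. x \<notin> Om \<Longrightarrow> k x = 0"
    and t: "\<And>\<phi> D\<phi>. test_fun Om \<phi> D\<phi> \<Longrightarrow> (\<integral>x. k x * \<phi> x \<partial>lborel) = 0"
  shows "AE x in lborel. k x = 0"
proof -
  have [measurable]: "k \<in> borel_measurable borel" using k by (simp add: L2_def)
  define \<delta> where "\<delta> n = inverse (real (Suc n))" for n
  have \<delta>: "\<delta> n > 0" "\<delta> \<longlonglongrightarrow> 0" for n
    using LIMSEQ_inverse_real_of_nat by (auto simp: \<delta>_def[abs_def])
  have "L2_lim lborel (\<lambda>n x. \<integral>r. kern (\<delta> n) r * k (x + r) \<partial>lborel) k"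
    by (rule mollify_kern[where j="\<lambda>r. r", OF k(1) \<delta>]) auto
  then obtain r where r: "strict_mono r"
      "AE x in lborel. (\<lambda>n. \<integral>y. kern (\<delta> (r n)) y * k (x + y) \<partial>lborel) \<longlonglongrightarrow> k x"
    by (rule L2_lim_AE_subseq)
  show ?thesis
    using r(2)
  proof eventually_elim
    case (elim x)
    show "k x = 0"
    proof (cases "x \<in> Om")
      case True
      then obtain e where e: "e > 0" "cball x e \<subseteq> Om" using open_Om open_contains_cball by blast
      have "(\<lambda>n. \<delta> (r n)) \<longlonglongrightarrow> 0" using LIMSEQ_subseq_LIMSEQ[OF \<delta>(2) r(1)] by (simp add: o_def)
      then have "\<forall>\<^sub>F n in sequentially. \<delta> (r n) < e" using e(1) by (rule order_tendstoD)
      then have "\<forall>\<^sub>F n in sequentially. (\<integral>y. kern (\<delta> (r n)) y * k (x + y) \<partial>lborel) = 0"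
      proof eventually_elim
        case (elim n)
        have "cball x (\<delta> (r n)) \<subseteq> Om" using e(2) elim by auto
        from t[OF test_fun_kern[OF \<delta>(1) this]] show ?case by (simp add: kern_convolution)
      qed
      then have "(\<lambda>n. \<integral>y. kern (\<delta> (r n)) y * k (x + y) \<partial>lborel) \<longlonglongrightarrow> 0" by (rule tendsto_eventually)
      then show ?thesis using elim LIMSEQ_unique by blast
    qed (rule k(2))
  qed
qed

lemma wgrad_unique:
  assumes "H1g u G" "H1g u G'" shows "AE x in lborel. G x = G' x"
proof -
  note A = H1g_props[OF assms(1)] and B = H1g_props[OF assms(2)]
  have "AE x in lborel. \<forall>b\<in>Basis. G x \<bullet> b - G' x \<bullet> b = 0"
  proof (subst AE_ball_countable[OF countable_finite[OF finite_Basis]], rule ballI, rule fundamental_lemma)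
    fix b :: 'a assume b: "b \<in> Basis"
    show "L2 lborel (\<lambda>x. G x \<bullet> b - G' x \<bullet> b)" using A(2) B(2) b by (intro L2_diff)
    fix \<phi> :: "'a \<Rightarrow> real" and D\<phi> assume t: "test_fun Om \<phi> D\<phi>"
    have "(\<integral>x. (G x \<bullet> b) * \<phi> x \<partial>lborel) = (\<integral>x. (G' x \<bullet> b) * \<phi> x \<partial>lborel)"
      using A(5) B(5) t b by (auto simp: wgrad_def)
    then show "(\<integral>x. (G x \<bullet> b - G' x \<bullet> b) * \<phi> x \<partial>lborel) = 0"
      using L2_mult[OF A(2)[OF b] test_fun_L2(1)[OF t]] L2_mult[OF B(2)[OF b] test_fun_L2(1)[OF t]]
      by (simp add: left_diff_distrib)
  qed (use A(4) B(4) in auto)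
  then show ?thesis by eventually_elim (auto simp: euclidean_eq_iff[of "G _"])
qed

text \<open>Classical for the mollified \<open>U n\<close>, whose derivative away from the boundary
  is the mollified gradient \<open>V n\<close>. In the limit the Lipschitz bound on
  \<open>\<gamma>\<close> makes \<open>\<gamma> (U n) * \<phi>\<close> converge strongly, as the
  pairing with \<open>V n\<close> requires.\<close>

lemma H1g_chain:
  fixes u :: "'a::euclidean_space \<Rightarrow> real"
  assumes u: "H1g u G"
    and d: "\<And>y. (\<beta> has_real_derivative \<gamma> y) (at y)" and b0: "\<beta> 0 = 0"
    and g: "\<And>y. \<bar>\<gamma> y\<bar> \<le> C" "\<And>y z. \<bar>\<gamma> y - \<gamma> z\<bar> \<le> L * \<bar>y - z\<bar>"
  shows "H1g (\<lambda>x. \<beta> (u x)) (\<lambda>x. \<gamma> (u x) *\<^sub>R G x)"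
proof -
  note P = H1g_props[OF u]
  note um[measurable] = H1g_measurable[OF u]
  have L0: "0 \<le> L" using g(2)[of 1 0] by simp
  have C0: "0 \<le> C" using g(1)[of 0] by linarith
  have blip: "\<bar>\<beta> y - \<beta> z\<bar> \<le> C * \<bar>y - z\<bar>" for y z
    by (rule abs_diff_le_of_deriv_bounded[OF d g(1)])
  have "continuous_on UNIV \<beta>" by (intro continuous_at_imp_continuous_on ballI DERIV_isCont[OF d])
  then have bm[measurable]: "\<beta> \<in> borel_measurable borel" by (rule borel_measurable_continuous_onI)
  have "L-lipschitz_on UNIV \<gamma>" using g(2) L0 by (auto simp: lipschitz_on_def dist_real_def)
  then have gm[measurable]: "\<gamma> \<in> borel_measurable borel"
    by (intro borel_measurable_continuous_onI lipschitz_on_continuous_on)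
  have Lb: "L2 lborel (\<lambda>x. \<beta> (u x))"
    by (rule L2_bound[OF L2_cmult[OF P(1), of C]]) (use blip[of _ 0] b0 C0 in \<open>auto simp: abs_mult\<close>)
  have iu: "integrable lborel u" by (rule L2_bounded_support_integrable[OF P(1) bounded_Om P(3)])
  have "wgrad (\<lambda>x. \<beta> (u x)) (\<lambda>x. \<gamma> (u x) *\<^sub>R G x)"
    unfolding wgrad_def
  proof (intro allI impI ballI)
    fix \<phi> :: "'a \<Rightarrow> real" and D\<phi> and b :: 'a
    assume t: "test_fun Om \<phi> D\<phi>" and b: "b \<in> Basis"
    obtain K where T: "compact K" "K \<subseteq> Om" "bounded K"
      "\<And>x. x \<notin> K \<Longrightarrow> \<phi> x = 0" "\<And>x. x \<notin> K \<Longrightarrow> D\<phi> x = 0"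
      "continuous_on UNIV \<phi>" "continuous_on UNIV D\<phi>"
      "\<phi> \<in> borel_measurable borel" "D\<phi> \<in> borel_measurable borel"
      "\<And>x b. ((\<lambda>s. \<phi> (x + s *\<^sub>R b)) has_real_derivative D\<phi> x \<bullet> b) (at 0)"
      using test_fun_props[OF t] by blast
    note T(8,9)[measurable]
    obtain M where M: "M > 0" "\<And>x. \<bar>\<phi> x\<bar> \<le> M" "\<And>x. norm (D\<phi> x) \<le> M"
      using test_fun_bounded[OF t] by blast
    have Mb: "\<bar>D\<phi> x \<bullet> b\<bar> \<le> M" for x
      using Basis_le_norm[OF b, of "D\<phi> x"] M(3)[of x] by linarith
    \<comment> \<open>Room around the support of \<open>\<phi>\<close>: for
      \<open>\<delta> n \<le> r\<close> every kernel centred in \<open>K\<close> stays inside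
      \<open>Om\<close>.\<close>
    obtain r where r: "r > 0" "(\<Union>x\<in>K. cball x r) \<subseteq> Om"
      by (rule compact_subset_open_imp_cball_epsilon_subset[OF T(1) open_Om T(2)])
    define \<delta> where "\<delta> n = r * inverse (real (Suc n))" for n
    have \<delta>: "\<delta> n > 0" "\<delta> \<longlonglongrightarrow> 0" "\<delta> n \<le> r" for n
    proof -
      show "\<delta> n > 0" using r by (simp add: \<delta>_def)
      show "\<delta> \<longlonglongrightarrow> 0" unfolding \<delta>_def[abs_def] by (intro tendsto_mult_right_zero LIMSEQ_inverse_real_of_nat)
      show "\<delta> n \<le> r" using r by (simp add: \<delta>_def inverse_le_1_iff mult_left_le)
    qed
    define U where "U n x = (\<integral>y. kern (\<delta> n) y * u (x + y) \<partial>lborel)" for n x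
    define V where "V n x = (\<integral>y. kern (\<delta> n) y * (G (x + y) \<bullet> b) \<partial>lborel)" for n x
    \<comment> \<open>The derivative of \<open>U n\<close> in direction \<open>b\<close>, with the
      derivative put on the kernel; the sign comes from the argument \<open>z - x\<close>.\<close>
    define P' where "P' n x = (\<integral>z. u z * (- (kernD (\<delta> n) (z - x) \<bullet> b)) \<partial>lborel)" for n x
    have lU: "L2_lim lborel U u" unfolding U_def
      by (rule mollify_kern[where j="\<lambda>r. r", OF P(1) \<delta>(1,2)]) auto
    have lV: "L2_lim lborel V (\<lambda>x. G x \<bullet> b)" unfolding V_def
      by (rule mollify_kern[where j="\<lambda>r. r" and F="\<lambda>x. G x \<bullet> b", OF P(2)[OF b] \<delta>(1,2)]) auto
    have mU[measurable]: "U n \<in> borel_measurable borel" for n unfolding U_def by measurable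
    have mP'[measurable]: "P' n \<in> borel_measurable borel" for n unfolding P'_def by measurable
    have U': "U n x = (\<integral>z. u z * kern (\<delta> n) (z - x) \<partial>lborel)" for n x
      unfolding U_def by (rule kern_convolution) measurable
    have idn: "(\<integral>x. \<beta> (U n x) * (D\<phi> x \<bullet> b) \<partial>lborel) = - (\<integral>x. V n x * (\<gamma> (U n x) * \<phi> x) \<partial>lborel)" for n
    proof -
      obtain N where N: "N > 0" "\<And>x::'a. \<bar>kern (\<delta> n) x\<bar> \<le> N" "\<And>x::'a. norm (kernD (\<delta> n) x) \<le> N"
        using kern_bounded[OF \<delta>(1), of n thesis] by blast
      have Nb: "\<bar>kernD (\<delta> n) z \<bullet> b\<bar> \<le> N" for z
        using Basis_le_norm[OF b, of "kernD (\<delta> n) z"] N(3)[of z] by linarith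
      have dU: "((\<lambda>s. U n (x + s *\<^sub>R b)) has_real_derivative P' n (x + s *\<^sub>R b)) (at s)" for x s
        unfolding U' P'_def
      proof (rule has_derivative_under_integral[OF iu, where C=N])
        fix s :: real and z :: 'a
        have "((\<lambda>s. z - (x + s *\<^sub>R b)) has_derivative (\<lambda>h. - (h *\<^sub>R b))) (at s)"
          by (auto intro!: derivative_eq_intros)
        from has_derivative_compose[OF this kern_has_derivative[of "\<delta> n" "z - (x + s *\<^sub>R b)"]]
        have "((\<lambda>s. kern (\<delta> n) (z - (x + s *\<^sub>R b))) has_derivative
             (\<lambda>h. kernD (\<delta> n) (z - (x + s *\<^sub>R b)) \<bullet> - (h *\<^sub>R b))) (at s)" .
        then show "((\<lambda>s. kern (\<delta> n) (z - (x + s *\<^sub>R b))) has_real_derivative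
             - (kernD (\<delta> n) (z - (x + s *\<^sub>R b)) \<bullet> b)) (at s)"
          unfolding has_field_derivative_def by (rule has_derivative_eq_rhs) (auto simp: fun_eq_iff)
      qed (use N Nb in auto)
      have bI: "\<bar>\<integral>z. u z * k z \<partial>lborel\<bar> \<le> (\<integral>z. \<bar>u z\<bar> \<partial>lborel) * N"
        if [measurable]: "k \<in> borel_measurable borel" and k: "\<And>z. \<bar>k z\<bar> \<le> N" for k
      proof -
        have "\<bar>\<integral>z. u z * k z \<partial>lborel\<bar> \<le> (\<integral>z. \<bar>u z * k z\<bar> \<partial>lborel)" by (rule integral_abs_bound)
        also have "\<dots> \<le> (\<integral>z. \<bar>u z\<bar> * N \<partial>lborel)"
        proof (rule integral_mono)
          show "integrable lborel (\<lambda>z. \<bar>u z * k z\<bar>)"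
            by (rule Bochner_Integration.integrable_bound[of _ "\<lambda>z. \<bar>u z\<bar> * N"])
               (use iu k N(1) in \<open>auto simp: abs_mult intro!: mult_left_mono\<close>)
          show "\<bar>u z * k z\<bar> \<le> \<bar>u z\<bar> * N" for z using k by (simp add: abs_mult mult_left_mono)
        qed (use iu in auto)
        finally show ?thesis by simp
      qed
      define A where "A = (\<integral>z. \<bar>u z\<bar> \<partial>lborel) * N"
      have A0: "0 \<le> A" using N(1) by (simp add: A_def)
      have bU: "\<bar>U n x\<bar> \<le> A" for x unfolding U' A_def by (rule bI) (use N in auto)
      have bP: "\<bar>P' n x\<bar> \<le> A" for x unfolding P'_def A_def by (rule bI) (use Nb in auto)
      have bb: "\<bar>\<beta> (U n x)\<bar> \<le> C * A" for x
        using blip[of "U n x" 0] b0 mult_left_mono[OF bU[of x] C0] by simp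
      \<comment> \<open>Product rule for \<open>\<beta> (U n) * \<phi>\<close>, whose directional
        derivative has integral 0.\<close>
      have "(\<integral>x. \<gamma> (U n x) * P' n x * \<phi> x + \<beta> (U n x) * (D\<phi> x \<bullet> b) \<partial>lborel) = 0"
      proof (rule integral_directional_derivative_zero[where H="\<lambda>x. \<beta> (U n x) * \<phi> x" and b=b and S="K"])
        fix x
        have 1: "((\<lambda>s. U n (x + s *\<^sub>R b)) has_real_derivative P' n x) (at 0)"
          using dU[of x 0] by simp
        have 2: "((\<lambda>s. \<beta> (U n (x + s *\<^sub>R b))) has_real_derivative \<gamma> (U n x) * P' n x) (at 0)"
          using DERIV_chain2[OF _ 1, of \<beta>] d by simp
        show "((\<lambda>s. \<beta> (U n (x + s *\<^sub>R b)) * \<phi> (x + s *\<^sub>R b)) has_real_derivative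
            \<gamma> (U n x) * P' n x * \<phi> x + \<beta> (U n x) * (D\<phi> x \<bullet> b)) (at 0)"
          using DERIV_mult[OF 2 T(10)[of x b]] by (simp add: mult.commute)
        have "\<bar>\<gamma> (U n x) * P' n x * \<phi> x\<bar> \<le> C * A * M"
          unfolding abs_mult by (intro mult_mono g(1) bP M(2)) (use C0 A0 in auto)
        moreover have "\<bar>\<beta> (U n x) * (D\<phi> x \<bullet> b)\<bar> \<le> C * A * M"
          unfolding abs_mult by (intro mult_mono bb Mb) (use C0 A0 in auto)
        ultimately show "\<bar>\<gamma> (U n x) * P' n x * \<phi> x + \<beta> (U n x) * (D\<phi> x \<bullet> b)\<bar> \<le> 2 * (C * A * M)"
          by linarith
        show "integrable lborel (\<lambda>x. \<beta> (U n x) * \<phi> x)"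
        proof (rule integrable_bounded_support[OF _ T(3)])
          show "\<bar>\<beta> (U n x) * \<phi> x\<bar> \<le> C * A * M" for x
            unfolding abs_mult by (intro mult_mono bb M(2)) (use C0 A0 in auto)
        qed (use T(4) in auto)
      qed (use T(3,4) in auto)
      moreover have "integrable lborel (\<lambda>x. \<gamma> (U n x) * P' n x * \<phi> x)"
      proof (rule integrable_bounded_support[OF _ T(3)])
        show "\<bar>\<gamma> (U n x) * P' n x * \<phi> x\<bar> \<le> C * A * M" for x
          unfolding abs_mult by (intro mult_mono g(1) bP M(2)) (use C0 A0 in auto)
      qed (use T(4) in auto)
      moreover have "integrable lborel (\<lambda>x. \<beta> (U n x) * (D\<phi> x \<bullet> b))"
      proof (rule integrable_bounded_support[OF _ T(3)])
        show "\<bar>\<beta> (U n x) * (D\<phi> x \<bullet> b)\<bar> \<le> C * A * M" for x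
          unfolding abs_mult by (intro mult_mono bb Mb) (use C0 A0 in auto)
      qed (use T(5) in auto)
      ultimately have "(\<integral>x. \<beta> (U n x) * (D\<phi> x \<bullet> b) \<partial>lborel) = - (\<integral>x. \<gamma> (U n x) * P' n x * \<phi> x \<partial>lborel)"
        by simp
      \<comment> \<open>\<open>P' n\<close> and \<open>V n\<close> agree where the kernel fits into
        \<open>Om\<close>, in particular on \<open>K\<close>; elsewhere \<open>\<phi>\<close>
        vanishes.\<close>
      also have "(\<integral>x. \<gamma> (U n x) * P' n x * \<phi> x \<partial>lborel) = (\<integral>x. V n x * (\<gamma> (U n x) * \<phi> x) \<partial>lborel)"
      proof (rule Bochner_Integration.integral_cong)
        fix x
        show "\<gamma> (U n x) * P' n x * \<phi> x = V n x * (\<gamma> (U n x) * \<phi> x)"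
        proof (cases "x \<in> K")
          case True
          then have "cball x r \<subseteq> Om" using r(2) by blast
          then have c: "cball x (\<delta> n) \<subseteq> Om" using subset_cball[OF \<delta>(3)[of n], of x] by blast
          have "(\<integral>z. u z * (kernD (\<delta> n) (z - x) \<bullet> b) \<partial>lborel) = - (\<integral>z. (G z \<bullet> b) * kern (\<delta> n) (z - x) \<partial>lborel)"
            using P(5) test_fun_kern[OF \<delta>(1) c] b unfolding wgrad_def by blast
          then have "P' n x = V n x"
            unfolding P'_def V_def by (subst kern_convolution) auto
          then show ?thesis by simp
        qed (use T(4) in auto)
      qed simp
      finally show ?thesis .
    qed
    have lim1: "(\<lambda>n. \<integral>x. \<beta> (U n x) * (D\<phi> x \<bullet> b) \<partial>lborel) \<longlonglongrightarrow> (\<integral>x. \<beta> (u x) * (D\<phi> x \<bullet> b) \<partial>lborel)"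
      by (rule L2_lim_inner[OF L2_lim_bound[OF lU _ Lb, where C=C] L2_lim_const[OF test_fun_L2(2)[OF t]]])
         (use blip in auto)
    have lim2: "(\<lambda>n. \<integral>x. V n x * (\<gamma> (U n x) * \<phi> x) \<partial>lborel) \<longlonglongrightarrow> (\<integral>x. (G x \<bullet> b) * (\<gamma> (u x) * \<phi> x) \<partial>lborel)"
    proof (rule L2_lim_inner[OF lV L2_lim_bound[OF lU, where C="L * M"]])
      show "L2 lborel (\<lambda>x. \<gamma> (u x) * \<phi> x)"
        by (rule L2_mult_bdd[OF test_fun_L2(1)[OF t]]) (use g in auto)
      show "AE x in lborel. \<bar>\<gamma> (U n x) * \<phi> x - \<gamma> (u x) * \<phi> x\<bar> \<le> L * M * \<bar>U n x - u x\<bar>" for n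
      proof (rule AE_I2)
        fix x
        have "\<bar>\<gamma> (U n x) * \<phi> x - \<gamma> (u x) * \<phi> x\<bar> = \<bar>\<gamma> (U n x) - \<gamma> (u x)\<bar> * \<bar>\<phi> x\<bar>"
          by (simp flip: abs_mult left_diff_distrib)
        also have "\<dots> \<le> (L * \<bar>U n x - u x\<bar>) * M" by (intro mult_mono g(2) M(2)) (use L0 in auto)
        finally show "\<bar>\<gamma> (U n x) * \<phi> x - \<gamma> (u x) * \<phi> x\<bar> \<le> L * M * \<bar>U n x - u x\<bar>" by (simp add: mult_ac)
      qed
    qed measurable
    have "(\<integral>x. \<beta> (u x) * (D\<phi> x \<bullet> b) \<partial>lborel) = - (\<integral>x. (G x \<bullet> b) * (\<gamma> (u x) * \<phi> x) \<partial>lborel)"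
      by (rule LIMSEQ_unique[OF lim1]) (unfold idn, rule tendsto_minus[OF lim2])
    then show "(\<integral>x. \<beta> (u x) * (D\<phi> x \<bullet> b) \<partial>lborel) = - (\<integral>x. ((\<gamma> (u x) *\<^sub>R G x) \<bullet> b) * \<phi> x \<partial>lborel)"
      by (simp add: mult_ac)
  qed
  moreover have "L2 lborel (\<lambda>x. (\<gamma> (u x) *\<^sub>R G x) \<bullet> b)" if "b \<in> Basis" for b
    using L2_mult_bdd[OF P(2)[OF that], of "\<lambda>x. \<gamma> (u x)" C] g(1) by simp
  ultimately show ?thesis using Lb P(3,4) b0 by (auto simp: H1g_def)
qed

subsection \<open>Sections of functions on the space-time cylinder\<close>

lemma lborel_Fubini:
  fixes h :: "'c::euclidean_space \<times> 'a::euclidean_space \<Rightarrow> real"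
  assumes h: "integrable lborel h"
  shows AE_integrable_slice: "AE t in lborel. integrable lborel (\<lambda>x. h (t, x))"
    and integrable_slice: "integrable lborel (\<lambda>t. \<integral>x. h (t, x) \<partial>lborel)"
    and integral_slice: "(\<integral>t. (\<integral>x. h (t, x) \<partial>lborel) \<partial>lborel) = (\<integral>p. h p \<partial>lborel)"
    and AE_integrable_slice2: "AE x in lborel. integrable lborel (\<lambda>t. h (t, x))"
    and integrable_slice2: "integrable lborel (\<lambda>x. \<integral>t. h (t, x) \<partial>lborel)"
    and integral_slice2: "(\<integral>x. (\<integral>t. h (t, x) \<partial>lborel) \<partial>lborel) = (\<integral>p. h p \<partial>lborel)"
proof -
  have h': "integrable (lborel \<Otimes>\<^sub>M lborel) (case_prod (\<lambda>t x. h (t, x)))"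
    using h by (simp add: lborel_prod)
  show "AE t in lborel. integrable lborel (\<lambda>x. h (t, x))" by (rule lborel_pair.AE_integrable_fst[OF h'])
  show "integrable lborel (\<lambda>t. \<integral>x. h (t, x) \<partial>lborel)" by (rule lborel_pair.integrable_fst[OF h'])
  show "(\<integral>t. (\<integral>x. h (t, x) \<partial>lborel) \<partial>lborel) = (\<integral>p. h p \<partial>lborel)"
    using lborel_pair.integral_fst[OF h'] by (simp add: lborel_prod)
  show "AE x in lborel. integrable lborel (\<lambda>t. h (t, x))" by (rule lborel_pair.AE_integrable_snd[OF h'])
  show "integrable lborel (\<lambda>x. \<integral>t. h (t, x) \<partial>lborel)" by (rule lborel_pair.integrable_snd[OF h'])
  show "(\<integral>x. (\<integral>t. h (t, x) \<partial>lborel) \<partial>lborel) = (\<integral>p. h p \<partial>lborel)"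
    using lborel_pair.integral_snd[OF h'] by (simp add: lborel_prod)
qed

lemma AE_slice:
  fixes P :: "'c::euclidean_space \<times> 'a::euclidean_space \<Rightarrow> bool"
  assumes "AE p in lborel. P p"
  shows "AE t in lborel. AE x in lborel. P (t, x)"
proof (rule lborel_pair.AE_pair)
  show "AE p in lborel \<Otimes>\<^sub>M lborel. P p" by (subst lborel_prod) (rule assms)
qed

lemma integrable_tensor:
  fixes k :: "'c::euclidean_space \<Rightarrow> real" and w :: "'a::euclidean_space \<Rightarrow> real"
  assumes k: "integrable lborel k" and w: "integrable lborel w"
  shows "integrable lborel (\<lambda>p. w (snd p) * k (fst p))"
proof -
  have [measurable]: "k \<in> borel_measurable borel" "w \<in> borel_measurable borel"
    using k w by (auto dest: borel_measurable_integrable)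
  have "integrable (lborel \<Otimes>\<^sub>M lborel) (\<lambda>p. w (snd p) * k (fst p))"
  proof (rule lborel_pair.Fubini_integrable)
    show "integrable lborel (\<lambda>x. \<integral>y. norm (w (snd (x, y)) * k (fst (x, y))) \<partial>lborel)"
      using k w by (simp add: abs_mult)
    show "AE x in lborel. integrable lborel (\<lambda>y. w (snd (x, y)) * k (fst (x, y)))"
      using w by simp
  qed measurable
  then show ?thesis by (simp add: lborel_prod)
qed

lemma L2_tensor:
  fixes k :: "'c::euclidean_space \<Rightarrow> real" and w :: "'a::euclidean_space \<Rightarrow> real"
  assumes k: "L2 lborel k" and w: "L2 lborel w"
  shows "L2 lborel (\<lambda>p. w (snd p) * k (fst p))"
proof -
  have [measurable]: "k \<in> borel_measurable borel" "w \<in> borel_measurable borel"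
    using k w by (auto simp: L2_def)
  have "(\<lambda>p. w (snd p) * k (fst p)) \<in> borel_measurable (lborel \<Otimes>\<^sub>M lborel)" by measurable
  then show ?thesis
    using integrable_tensor[OF L2_sq[OF k] L2_sq[OF w]]
    by (simp add: L2_def power_mult_distrib lborel_prod)
qed

lemma borel_measurable_slice:
  fixes h :: "'c::euclidean_space \<times> 'a::euclidean_space \<Rightarrow> 'd::topological_space"
  assumes "h \<in> borel_measurable borel"
  shows "(\<lambda>x. h (t, x)) \<in> borel_measurable borel" "(\<lambda>t. h (t, x)) \<in> borel_measurable borel"
  by (rule measurable_compose[OF _ assms], intro borel_measurable_continuous_onI continuous_intros)+

lemma Qc_sets [measurable]: "(Qc T :: (real \<times> 'a::euclidean_space) set) \<in> sets borel"
  and open_Qc: "open (Qc T :: (real \<times> 'a::euclidean_space) set)"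
  and bounded_Qc: "bounded (Qc T :: (real \<times> 'a::euclidean_space) set)"
proof -
  show o: "open (Qc T :: (real \<times> 'a) set)" unfolding Qc_def by (intro open_Times open_Om) auto
  show "(Qc T :: (real \<times> 'a) set) \<in> sets borel" using o by auto
  show "bounded (Qc T :: (real \<times> 'a) set)" unfolding Qc_def by (intro bounded_Times bounded_Om) auto
qed

definition QL2 :: "real \<Rightarrow> (real \<times> 'a::euclidean_space \<Rightarrow> real) \<Rightarrow> bool" where
  "QL2 T h \<longleftrightarrow> L2 lborel h \<and> (\<forall>p. p \<notin> Qc T \<longrightarrow> h p = 0)"

lemma QL2_diff: "QL2 T g \<Longrightarrow> QL2 T h \<Longrightarrow> QL2 T (\<lambda>p. g p - h p)"
  by (simp add: QL2_def L2_diff)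

lemma QL2_L2: "QL2 T h \<Longrightarrow> L2 lborel h"
  and QL2_meas: "QL2 T h \<Longrightarrow> h \<in> borel_measurable borel"
  and QL2_zero: "QL2 T h \<Longrightarrow> p \<notin> Qc T \<Longrightarrow> h p = 0"
  by (auto simp: QL2_def L2_def simp del: split_paired_All)

lemma AE_L2_slice:
  fixes h :: "'c::euclidean_space \<times> 'a::euclidean_space \<Rightarrow> real"
  assumes "L2 lborel h"
  shows "AE t in lborel. L2 lborel (\<lambda>x. h (t, x))" "AE x in lborel. L2 lborel (\<lambda>t. h (t, x))"
  using AE_integrable_slice[OF L2_sq[OF assms]] AE_integrable_slice2[OF L2_sq[OF assms]]
    borel_measurable_slice[of h] assms
  by (auto simp: L2_def elim: eventually_mono)

lemma AE_integrable_time_slice: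
  assumes h: "QL2 T h"
  shows "AE x in lborel. integrable lborel (\<lambda>\<tau>. h (\<tau>, x))"
  using AE_L2_slice(2)[OF QL2_L2[OF h]]
proof eventually_elim
  case (elim x)
  show ?case
    by (rule L2_bounded_support_integrable[OF elim, of "{0<..<T}"])
       (use QL2_zero[OF h] in \<open>auto simp: Qc_def\<close>)
qed

lemma indicator_interval_L2: "L2 lborel (indicator {a<..<b::real} :: real \<Rightarrow> real)"
  by (rule L2_bounded_support[of _ "{a<..<b}" 1]) (auto split: split_indicator)

text \<open>Norm in time at fixed \<open>x\<close>: up to constants, a majorant in \<open>L2\<close>
  for all bounded time averages of \<open>h\<close>.\<close>

definition tnorm :: "(real \<times> 'a::euclidean_space \<Rightarrow> real) \<Rightarrow> 'a \<Rightarrow> real" where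
  "tnorm h x = sqrt (\<integral>\<tau>. (h (\<tau>, x))^2 \<partial>lborel)"

lemma L2_tnorm:
  assumes h: "L2 lborel h" shows "L2 lborel (tnorm h)"
proof -
  have i: "integrable lborel (\<lambda>x. \<integral>\<tau>. (h (\<tau>, x))^2 \<partial>lborel)"
    by (rule integrable_slice2[OF L2_sq[OF h]])
  then have "(\<lambda>x. \<integral>\<tau>. (h (\<tau>, x))^2 \<partial>lborel) \<in> borel_measurable borel"
    by (auto dest: borel_measurable_integrable)
  then have "tnorm h \<in> borel_measurable borel" unfolding tnorm_def[abs_def] by measurable
  moreover have "(tnorm h x)^2 = (\<integral>\<tau>. (h (\<tau>, x))^2 \<partial>lborel)" for x unfolding tnorm_def by simp
  ultimately show ?thesis using i by (simp add: L2_def)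
qed

text \<open>Cauchy-Schwarz in time. The quantifier over \<open>k\<close> stands inside the
  almost-everywhere statement: one null set serves all kernels, so the kernel may later move with
  the time variable.\<close>

lemma time_integral_bound:
  fixes h :: "real \<times> 'a::euclidean_space \<Rightarrow> real"
  assumes h: "QL2 T h" and T: "T > 0"
  shows "AE x in lborel. \<forall>k N. k \<in> borel_measurable borel \<longrightarrow> (\<forall>s. \<bar>k s\<bar> \<le> N) \<longrightarrow>
     \<bar>\<integral>\<tau>. h (\<tau>, x) * k \<tau> \<partial>lborel\<bar> \<le> (N * sqrt T) * tnorm h x"
  using AE_L2_slice(2)[OF QL2_L2[OF h]]
proof eventually_elim
  case (elim x)
  show ?case
  proof (intro allI impI)
    fix k :: "real \<Rightarrow> real" and N :: real
    assume [measurable]: "k \<in> borel_measurable borel" and N: "\<forall>s. \<bar>k s\<bar> \<le> N"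
    let ?k = "\<lambda>\<tau>. N * indicator {0<..<T} \<tau> :: real"
    have N0: "0 \<le> N" using N[rule_format, of 0] by linarith
    have Lk: "L2 lborel ?k" by (intro L2_cmult indicator_interval_L2)
    have Lh: "L2 lborel (\<lambda>\<tau>. \<bar>h (\<tau>, x)\<bar>)" using elim by (auto simp: L2_def)
    have z: "h (\<tau>, x) = 0" if "\<tau> \<notin> {0<..<T}" for \<tau> using QL2_zero[OF h, of "(\<tau>, x)"] that by (auto simp: Qc_def)
    have "\<bar>\<integral>\<tau>. h (\<tau>, x) * k \<tau> \<partial>lborel\<bar> \<le> (\<integral>\<tau>. \<bar>h (\<tau>, x) * k \<tau>\<bar> \<partial>lborel)" by (rule integral_abs_bound)
    also have "\<dots> \<le> (\<integral>\<tau>. \<bar>h (\<tau>, x)\<bar> * ?k \<tau> \<partial>lborel)"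
    proof (rule integral_mono_AE')
      show "integrable lborel (\<lambda>\<tau>. \<bar>h (\<tau>, x)\<bar> * ?k \<tau>)" by (rule L2_mult[OF Lh Lk])
      show "AE \<tau> in lborel. \<bar>h (\<tau>, x) * k \<tau>\<bar> \<le> \<bar>h (\<tau>, x)\<bar> * ?k \<tau>"
      proof (rule AE_I2)
        fix \<tau>
        show "\<bar>h (\<tau>, x) * k \<tau>\<bar> \<le> \<bar>h (\<tau>, x)\<bar> * ?k \<tau>"
          using N z[of \<tau>] by (cases "\<tau> \<in> {0<..<T}") (auto simp: abs_mult intro!: mult_left_mono)
      qed
    qed (use N0 in auto)
    also have "\<dots> \<le> sqrt (\<integral>\<tau>. \<bar>h (\<tau>, x)\<bar>^2 \<partial>lborel) * sqrt (\<integral>\<tau>. (?k \<tau>)^2 \<partial>lborel)"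
      using L2_Cauchy_Schwarz[OF Lh Lk] by (simp only: abs_le_iff)
    also have "(\<integral>\<tau>. (?k \<tau>)^2 \<partial>lborel) = N^2 * T"
    proof -
      have "(\<integral>\<tau>. (?k \<tau>)^2 \<partial>lborel) = (\<integral>\<tau>. N^2 * indicator {0<..<T} \<tau> \<partial>lborel)"
        by (rule Bochner_Integration.integral_cong) (auto simp: power_mult_distrib split: split_indicator)
      then show ?thesis using T by simp
    qed
    finally show "\<bar>\<integral>\<tau>. h (\<tau>, x) * k \<tau> \<partial>lborel\<bar> \<le> (N * sqrt T) * tnorm h x"
      using N0 by (simp add: tnorm_def real_sqrt_mult mult_ac)
  qed
qed

lemma time_integral_L2:
  fixes h :: "real \<times> 'a::euclidean_space \<Rightarrow> real"
  assumes h: "QL2 T h" and T: "T > 0"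
    and k[measurable]: "k \<in> borel_measurable borel" and N: "\<And>s. \<bar>k s\<bar> \<le> N"
  shows "L2 lborel (\<lambda>x. \<integral>\<tau>. h (\<tau>, x) * k \<tau> \<partial>lborel)"
    and "L2 lborel w \<Longrightarrow> (\<integral>x. (\<integral>\<tau>. h (\<tau>, x) * k \<tau> \<partial>lborel) * w x \<partial>lborel)
      = (\<integral>p. h p * (w (snd p) * k (fst p)) \<partial>lborel)"
    and "L2 lborel w \<Longrightarrow> integrable lborel (\<lambda>p. h p * (w (snd p) * k (fst p)))"
proof -
  note QL2_meas[OF h, measurable]
  have N0: "0 \<le> N" using N[of 0] by linarith
  show "L2 lborel (\<lambda>x. \<integral>\<tau>. h (\<tau>, x) * k \<tau> \<partial>lborel)"
  proof (rule L2_bound[OF L2_cmult[OF L2_tnorm[OF QL2_L2[OF h]], of "N * sqrt T"]])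
    have [measurable]: "h \<in> borel_measurable (lborel \<Otimes>\<^sub>M lborel)" using QL2_meas[OF h] by (simp add: lborel_prod)
    show "(\<lambda>x. \<integral>\<tau>. h (\<tau>, x) * k \<tau> \<partial>lborel) \<in> borel_measurable lborel" by measurable
    show "AE x in lborel. \<bar>\<integral>\<tau>. h (\<tau>, x) * k \<tau> \<partial>lborel\<bar> \<le> \<bar>N * sqrt T * tnorm h x\<bar>"
      using time_integral_bound[OF h T]
    proof eventually_elim
      case (elim x)
      have "\<bar>\<integral>\<tau>. h (\<tau>, x) * k \<tau> \<partial>lborel\<bar> \<le> N * sqrt T * tnorm h x" using elim k N by blast
      then show ?case by linarith
    qed
  qed
  assume w: "L2 lborel w"
  \<comment> \<open>\<open>k\<close> is only bounded; cutting it off to \<open>(0,T)\<close> makes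
    it square-integrable and changes nothing, as \<open>h\<close> vanishes elsewhere.\<close>
  have Lk: "L2 lborel (\<lambda>\<tau>. k \<tau> * indicator {0<..<T} \<tau>)"
    by (rule L2_mult_bdd[OF indicator_interval_L2]) (use N in auto)
  have "integrable lborel (\<lambda>p. h p * (w (snd p) * (k (fst p) * indicator {0<..<T} (fst p))))"
    by (rule L2_mult[OF QL2_L2[OF h] L2_tensor[OF Lk w]])
  moreover have "h p * (w (snd p) * (k (fst p) * indicator {0<..<T} (fst p))) = h p * (w (snd p) * k (fst p))" for p
    using QL2_zero[OF h, of p] by (cases p) (auto simp: Qc_def split: split_indicator)
  ultimately show i: "integrable lborel (\<lambda>p. h p * (w (snd p) * k (fst p)))" by simp
  have "(\<integral>x. (\<integral>\<tau>. h (\<tau>, x) * k \<tau> \<partial>lborel) * w x \<partial>lborel)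
      = (\<integral>x. (\<integral>\<tau>. h (\<tau>, x) * (w x * k \<tau>) \<partial>lborel) \<partial>lborel)"
    by (rule Bochner_Integration.integral_cong)
       (auto simp: mult_ac simp flip: Bochner_Integration.integral_mult_right_zero)
  also have "\<dots> = (\<integral>p. h p * (w (snd p) * k (fst p)) \<partial>lborel)"
    using integral_slice2[OF i] by simp
  finally show "(\<integral>x. (\<integral>\<tau>. h (\<tau>, x) * k \<tau> \<partial>lborel) * w x \<partial>lborel)
      = (\<integral>p. h p * (w (snd p) * k (fst p)) \<partial>lborel)" .
qed

subsection \<open>Mollification in time\<close>

text \<open>The shifts act on the time component alone, so \<open>Om\<close> and the test functions
  in space are untouched.\<close>

definition tmol :: "real \<Rightarrow> (real \<times> 'a::euclidean_space \<Rightarrow> real) \<Rightarrow> real \<times> 'a \<Rightarrow> real" where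
  "tmol \<delta> h p = (\<integral>r. kern \<delta> r * h (p + (r, 0)) \<partial>lborel)"

definition tmolV :: "real \<Rightarrow> (real \<times> 'a::euclidean_space \<Rightarrow> 'a) \<Rightarrow> real \<times> 'a \<Rightarrow> 'a" where
  "tmolV \<delta> D p = (\<Sum>b\<in>Basis. tmol \<delta> (\<lambda>p. D p \<bullet> b) p *\<^sub>R b)"

lemma tmolV_inner: "b \<in> Basis \<Longrightarrow> tmolV \<delta> D p \<bullet> b = tmol \<delta> (\<lambda>p. D p \<bullet> b) p"
  by (simp add: tmolV_def)

lemma tmol_eq:
  assumes "h \<in> borel_measurable borel"
  shows "tmol \<delta> h (t, x) = (\<integral>\<tau>. h (\<tau>, x) * kern \<delta> (\<tau> - t) \<partial>lborel)"
  using kern_convolution[of "\<lambda>\<tau>. h (\<tau>, x)" \<delta> t] borel_measurable_slice[OF assms]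
  by (simp add: tmol_def)

lemma tmol_lim:
  assumes "QL2 T h" "\<And>n. \<delta> n > 0" "\<delta> \<longlonglongrightarrow> 0"
  shows "L2_lim lborel (\<lambda>n. tmol (\<delta> n) h) h"
  unfolding tmol_def[abs_def]
proof (rule mollify_kern[OF QL2_L2[OF assms(1)] assms(2,3)])
  show "(\<lambda>r::real. (r, 0::'a)) \<in> borel_measurable borel"
    by (intro borel_measurable_continuous_onI continuous_intros)
qed (auto simp: norm_Pair)

lemma tmol_L2:
  assumes "QL2 T h" "\<delta> > 0" shows "L2 lborel (tmol \<delta> h)"
  using tmol_lim[OF assms(1), of "\<lambda>n. \<delta> * inverse (real (Suc n))"] assms(2)
    tendsto_mult_right_zero[OF LIMSEQ_inverse_real_of_nat, of \<delta>]
  by (auto simp: L2_lim_def dest!: spec[of _ 0])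

lemma tmol_zero:
  assumes "QL2 T h" "x \<notin> Om" shows "tmol \<delta> h (t, x) = 0"
  using QL2_zero[OF assms(1), of "(_, x)"] assms(2)
  by (simp add: tmol_eq[OF QL2_meas[OF assms(1)]] Qc_def)

text \<open>For every \<open>t\<close> and not just almost every one: all time averages with the
  same bound on the kernel are dominated by a fixed multiple of \<open>tnorm h\<close>.\<close>

lemma tmol_L2_slice:
  assumes h: "QL2 T h" and T: "T > 0" and d: "\<delta> > 0"
  shows "L2 lborel (\<lambda>x. tmol \<delta> h (t, x))"
proof -
  obtain N where N: "\<And>x::real. \<bar>kern \<delta> x\<bar> \<le> N" by (rule kern_bounded[OF d, where 'a=real]) (rule that)
  show ?thesis unfolding tmol_eq[OF QL2_meas[OF h]]
    by (rule time_integral_L2(1)[OF h T]) (use N in auto)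
qed

lemma tmol_slice_integral:
  assumes h: "QL2 T h" and T: "T > 0" and d: "\<delta> > 0" and w: "L2 lborel w"
  shows "(\<integral>x. tmol \<delta> h (t, x) * w x \<partial>lborel) = (\<integral>p. h p * (w (snd p) * kern \<delta> (fst p - t)) \<partial>lborel)"
    and "integrable lborel (\<lambda>p. h p * (w (snd p) * kern \<delta> (fst p - t)))"
proof -
  obtain N where N: "\<And>x::real. \<bar>kern \<delta> x\<bar> \<le> N" by (rule kern_bounded[OF d, where 'a=real]) (rule that)
  show "(\<integral>x. tmol \<delta> h (t, x) * w x \<partial>lborel) = (\<integral>p. h p * (w (snd p) * kern \<delta> (fst p - t)) \<partial>lborel)"
    unfolding tmol_eq[OF QL2_meas[OF h]]
    by (rule time_integral_L2(2)[OF h T _ _ w]) (use N in auto)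
  show "integrable lborel (\<lambda>p. h p * (w (snd p) * kern \<delta> (fst p - t)))"
    by (rule time_integral_L2(3)[OF h T _ _ w]) (use N in auto)
qed

definition QV :: "real \<Rightarrow> (real \<times> 'a::euclidean_space \<Rightarrow> 'a) \<Rightarrow> bool" where
  "QV T D \<longleftrightarrow> (\<forall>b\<in>Basis. L2 lborel (\<lambda>p. D p \<bullet> b)) \<and> (\<forall>p. p \<notin> Qc T \<longrightarrow> D p = 0)"

lemma QV_comp: "QV T D \<Longrightarrow> b \<in> Basis \<Longrightarrow> QL2 T (\<lambda>p. D p \<bullet> b)"
  by (auto simp: QV_def QL2_def)

text \<open>Averaging in time repairs the exceptional times: the relation on almost every slice is
  integrated against the kernel and yields a weak gradient of the mollified function at every
  time.\<close>

lemma H1g_tmol: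
  assumes g: "QL2 T g" and D: "QV T D" and T: "T > 0" and d: "\<delta> > 0"
    and wg: "AE t in lborel. wgrad (\<lambda>x. g (t, x)) (\<lambda>x. D (t, x))"
  shows "H1g (\<lambda>x. tmol \<delta> g (t, x)) (\<lambda>x. tmolV \<delta> D (t, x))"
proof -
  have "wgrad (\<lambda>x. tmol \<delta> g (t, x)) (\<lambda>x. tmolV \<delta> D (t, x))"
    unfolding wgrad_def
  proof (intro allI impI ballI)
    fix \<phi> :: "'a \<Rightarrow> real" and D\<phi> and b :: 'a
    assume t: "test_fun Om \<phi> D\<phi>" and b: "b \<in> Basis"
    have L: "L2 lborel (\<lambda>x. D\<phi> x \<bullet> b)" "L2 lborel \<phi>" using test_fun_L2[OF t] by auto
    note S1 = tmol_slice_integral[OF g T d L(1)] and S2 = tmol_slice_integral[OF QV_comp[OF D b] T d L(2)]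
    have "(\<integral>x. tmol \<delta> g (t, x) * (D\<phi> x \<bullet> b) \<partial>lborel)
        = (\<integral>\<tau>. (\<integral>x. g (\<tau>, x) * ((D\<phi> x \<bullet> b) * kern \<delta> (\<tau> - t)) \<partial>lborel) \<partial>lborel)"
      unfolding S1(1) by (subst integral_slice[OF S1(2), symmetric]) simp
    also have "\<dots> = (\<integral>\<tau>. - (\<integral>x. (D (\<tau>, x) \<bullet> b) * (\<phi> x * kern \<delta> (\<tau> - t)) \<partial>lborel) \<partial>lborel)"
    proof (rule integral_cong_AE)
      show "(\<lambda>\<tau>. \<integral>x. g (\<tau>, x) * ((D\<phi> x \<bullet> b) * kern \<delta> (\<tau> - t)) \<partial>lborel) \<in> borel_measurable lborel"
        using borel_measurable_integrable[OF integrable_slice[OF S1(2)]] by simp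
      show "(\<lambda>\<tau>. - (\<integral>x. (D (\<tau>, x) \<bullet> b) * (\<phi> x * kern \<delta> (\<tau> - t)) \<partial>lborel)) \<in> borel_measurable lborel"
        using borel_measurable_integrable[OF integrable_slice[OF S2(2)]] by simp
      show "AE \<tau> in lborel. (\<integral>x. g (\<tau>, x) * ((D\<phi> x \<bullet> b) * kern \<delta> (\<tau> - t)) \<partial>lborel)
         = - (\<integral>x. (D (\<tau>, x) \<bullet> b) * (\<phi> x * kern \<delta> (\<tau> - t)) \<partial>lborel)"
        using wg
      proof eventually_elim
        case (elim \<tau>)
        then have "(\<integral>x. g (\<tau>, x) * (D\<phi> x \<bullet> b) \<partial>lborel) = - (\<integral>x. (D (\<tau>, x) \<bullet> b) * \<phi> x \<partial>lborel)"
          using t b by (simp add: wgrad_def)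
        then have "(\<integral>x. g (\<tau>, x) * (D\<phi> x \<bullet> b) \<partial>lborel) * kern \<delta> (\<tau> - t)
          = - ((\<integral>x. (D (\<tau>, x) \<bullet> b) * \<phi> x \<partial>lborel) * kern \<delta> (\<tau> - t))" by simp
        then show ?case by (simp add: mult.assoc flip: Bochner_Integration.integral_mult_left_zero)
      qed
    qed
    also have "\<dots> = - (\<integral>x. tmol \<delta> (\<lambda>p. D p \<bullet> b) (t, x) * \<phi> x \<partial>lborel)"
      unfolding S2(1) by (subst integral_slice[OF S2(2), symmetric]) simp
    finally show "(\<integral>x. tmol \<delta> g (t, x) * (D\<phi> x \<bullet> b) \<partial>lborel) = - (\<integral>x. (tmolV \<delta> D (t, x) \<bullet> b) * \<phi> x \<partial>lborel)"
      using b by (simp add: tmolV_inner)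
  qed
  moreover have "tmolV \<delta> D (t, x) = 0" if "x \<notin> Om" for x
    unfolding tmolV_def using tmol_zero[OF QV_comp[OF D] that] by simp
  ultimately show ?thesis
    unfolding H1g_def using tmol_L2_slice[OF g T d] tmol_L2_slice[OF QV_comp[OF D] T d] tmol_zero[OF g]
    by (auto simp: tmolV_inner)
qed

text \<open>The time derivative of \<open>tmol\<close>, taken on the kernel.\<close>

definition tmol' :: "real \<Rightarrow> (real \<times> 'a::euclidean_space \<Rightarrow> real) \<Rightarrow> real \<times> 'a \<Rightarrow> real" where
  "tmol' \<delta> h p = (\<integral>\<tau>. h (\<tau>, snd p) * (- kernD \<delta> (\<tau> - fst p)) \<partial>lborel)"

lemma tmol_deriv:
  fixes h :: "real \<times> 'a::euclidean_space \<Rightarrow> real"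
  assumes h: "QL2 T h" and d: "\<delta> > 0" and i: "integrable lborel (\<lambda>\<tau>. h (\<tau>, x))"
  shows "((\<lambda>s. tmol \<delta> h (s, x)) has_real_derivative tmol' \<delta> h (s, x)) (at s)"
    and "isCont (\<lambda>s. tmol' \<delta> h (s, x)) s"
proof -
  obtain N where N: "\<And>x::real. \<bar>kern \<delta> x\<bar> \<le> N" "\<And>x::real. norm (kernD \<delta> x) \<le> N"
    by (rule kern_bounded[OF d, where 'a=real]) (rule that)
  show "((\<lambda>s. tmol \<delta> h (s, x)) has_real_derivative tmol' \<delta> h (s, x)) (at s)"
    unfolding tmol_eq[OF QL2_meas[OF h]] tmol'_def fst_conv snd_conv
  proof (rule has_derivative_under_integral[OF i, where C=N])
    fix s z :: real
    have "((\<lambda>s. z - s) has_derivative (\<lambda>h. - h)) (at s)" by (auto intro!: derivative_eq_intros)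
    from has_derivative_compose[OF this kern_has_derivative[of \<delta> "z - s"]]
    show "((\<lambda>s. kern \<delta> (z - s)) has_real_derivative - kernD \<delta> (z - s)) (at s)"
      unfolding has_field_derivative_def by (rule has_derivative_eq_rhs) (auto simp: fun_eq_iff)
  qed (use N in auto)
  show "isCont (\<lambda>s. tmol' \<delta> h (s, x)) s"
    unfolding tmol'_def fst_conv snd_conv
  proof (rule continuous_under_integral[OF i, where C=N])
    have "isCont (kernD \<delta> :: real \<Rightarrow> real) y" for y
      using continuous_kernD[of \<delta>, where 'a=real] by (simp add: continuous_on_eq_continuous_at)
    then show "isCont (\<lambda>s. - kernD \<delta> (z - s)) s" for z :: real
      by (intro isCont_minus isCont_o2[where g="kernD \<delta>" and f="\<lambda>s. z - s"] continuous_intros)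
  qed (use N in auto)
qed

subsection \<open>The energy identity\<close>

text \<open>Weak form of \<open>g\<^sub>t = c * (a * \<Delta>g + F)\<close> with Neumann condition,
  tested with products of a space and a time function. The sign \<open>c\<close> treats forward and
  backward problems at once.\<close>

definition weq :: "real \<Rightarrow> real \<Rightarrow> real \<Rightarrow> (real \<times> 'a::euclidean_space \<Rightarrow> real)
    \<Rightarrow> (real \<times> 'a \<Rightarrow> 'a) \<Rightarrow> (real \<times> 'a \<Rightarrow> real) \<Rightarrow> bool" where
  "weq c T a g D F \<longleftrightarrow> QL2 T g \<and> QV T D \<and> QL2 T F \<and>
     (AE t in lborel. wgrad (\<lambda>x. g (t, x)) (\<lambda>x. D (t, x))) \<and>
     (\<forall>v G \<eta> D\<eta>. H1g v G \<longrightarrow> test_fun {0<..<T} \<eta> D\<eta> \<longrightarrow>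
        (\<integral>p. g p * (v (snd p) * D\<eta> (fst p)) \<partial>lborel)
        = c * (a * (\<Sum>b\<in>Basis. \<integral>p. (D p \<bullet> b) * ((G (snd p) \<bullet> b) * \<eta> (fst p)) \<partial>lborel)
               - (\<integral>p. F p * (v (snd p) * \<eta> (fst p)) \<partial>lborel)))"

text \<open>The kernel centred at \<open>t\<close> is taken as the time test function; the distance
  of \<open>t\<close> from the endpoints keeps its support in \<open>(0,T)\<close>.\<close>

lemma tmol'_slice_integral:
  assumes W: "weq c T a g D F" and T: "T > 0" and d: "\<delta> > 0" and t: "cball t \<delta> \<subseteq> {0<..<T}"
    and v: "H1g v G"
  shows "(\<integral>x. tmol' \<delta> g (t, x) * v x \<partial>lborel)
    = c * ((\<integral>x. tmol \<delta> F (t, x) * v x \<partial>lborel) - a * (\<Sum>b\<in>Basis. \<integral>x. tmol \<delta> (\<lambda>p. D p \<bullet> b) (t, x) * (G x \<bullet> b) \<partial>lborel))"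
proof -
  have g: "QL2 T g" and D: "QV T D" and F: "QL2 T F" using W by (auto simp: weq_def)
  note P = H1g_props[OF v]
  obtain N where N: "\<And>x::real. norm (kernD \<delta> x) \<le> N" by (rule kern_bounded[OF d, where 'a=real]) (rule that)
  have "(\<integral>x. tmol' \<delta> g (t, x) * v x \<partial>lborel) = (\<integral>p. g p * (v (snd p) * (- kernD \<delta> (fst p - t))) \<partial>lborel)"
    unfolding tmol'_def fst_conv snd_conv
    by (rule time_integral_L2(2)[OF g T _ _ P(1)]) (use N in auto)
  also have "\<dots> = - (\<integral>p. g p * (v (snd p) * kernD \<delta> (fst p - t)) \<partial>lborel)" by simp
  also have "(\<integral>p. g p * (v (snd p) * kernD \<delta> (fst p - t)) \<partial>lborel)
     = c * (a * (\<Sum>b\<in>Basis. \<integral>p. (D p \<bullet> b) * ((G (snd p) \<bullet> b) * kern \<delta> (fst p - t)) \<partial>lborel)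
               - (\<integral>p. F p * (v (snd p) * kern \<delta> (fst p - t)) \<partial>lborel))"
    using W v test_fun_kern[OF d t] unfolding weq_def by blast
  also have "(\<Sum>b\<in>Basis. \<integral>p. (D p \<bullet> b) * ((G (snd p) \<bullet> b) * kern \<delta> (fst p - t)) \<partial>lborel)
      = (\<Sum>b\<in>Basis. \<integral>x. tmol \<delta> (\<lambda>p. D p \<bullet> b) (t, x) * (G x \<bullet> b) \<partial>lborel)"
    by (rule sum.cong) (simp_all add: tmol_slice_integral(1)[OF QV_comp[OF D] T d P(2)])
  also have "(\<integral>p. F p * (v (snd p) * kern \<delta> (fst p - t)) \<partial>lborel) = (\<integral>x. tmol \<delta> F (t, x) * v x \<partial>lborel)"
    by (rule tmol_slice_integral(1)[OF F T d P(1), symmetric])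
  finally show ?thesis by (simp add: algebra_simps)
qed

text \<open>\<open>B\<close> is the energy density, its derivative \<open>\<beta>\<close> produces
  the test function, and \<open>\<gamma>\<close> is the weight of the dissipation. Bounded
  \<open>\<gamma>\<close> keeps \<open>\<beta> (g)\<close> and its gradient square-integrable; the
  Lipschitz bound serves the chain rule and the limit of the dissipation. Half the square is the
  instance for estimates, \<open>trB\<close> the one for comparison.\<close>

locale energy_fun =
  fixes B \<beta> \<gamma> :: "real \<Rightarrow> real" and L :: real
  assumes dB: "\<And>y. (B has_real_derivative \<beta> y) (at y)"
    and d\<beta>: "\<And>y. (\<beta> has_real_derivative \<gamma> y) (at y)"
    and zero: "B 0 = 0" "\<beta> 0 = 0"
    and \<gamma>_bound: "\<And>y. \<bar>\<gamma> y\<bar> \<le> 1"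
    and \<gamma>_lip: "\<And>y z. \<bar>\<gamma> y - \<gamma> z\<bar> \<le> L * \<bar>y - z\<bar>"
begin

lemma \<beta>_lip: "\<bar>\<beta> y - \<beta> z\<bar> \<le> \<bar>y - z\<bar>"
  using abs_diff_le_of_deriv_bounded[OF d\<beta> \<gamma>_bound, of y z] by simp

lemma \<beta>_bound: "\<bar>\<beta> y\<bar> \<le> \<bar>y\<bar>"
  using \<beta>_lip[of y 0] zero by simp

text \<open>\<open>\<beta>\<close> grows at most linearly, so \<open>B\<close> has a Lipschitz
  constant of the size of its arguments; this makes its integral continuous under strong convergence
  although \<open>B\<close> grows quadratically.\<close>

lemma B_diff: "\<bar>B y - B z\<bar> \<le> (\<bar>y\<bar> + \<bar>z\<bar>) * \<bar>y - z\<bar>"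
proof -
  have "norm (B y - B z) \<le> (\<bar>y\<bar> + \<bar>z\<bar>) * norm (y - z)"
  proof (rule field_differentiable_bound[where S="cball 0 (\<bar>y\<bar> + \<bar>z\<bar>)" and f'=\<beta>])
    show "(B has_real_derivative \<beta> x) (at x within cball 0 (\<bar>y\<bar> + \<bar>z\<bar>))" for x
      using dB by (rule has_field_derivative_at_within)
    show "norm (\<beta> x) \<le> \<bar>y\<bar> + \<bar>z\<bar>" if "x \<in> cball 0 (\<bar>y\<bar> + \<bar>z\<bar>)" for x
      using \<beta>_bound[of x] that by (simp add: dist_real_def)
  qed (auto simp: dist_real_def)
  then show ?thesis by simp
qed

lemma B_bound: "\<bar>B y\<bar> \<le> y^2"
  using B_diff[of y 0] zero by (simp add: power2_eq_square)

lemma measurable [measurable]: "B \<in> borel_measurable borel" "\<beta> \<in> borel_measurable borel" "\<gamma> \<in> borel_measurable borel"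
proof -
  have "continuous_on UNIV B" "continuous_on UNIV \<beta>"
    by (intro continuous_at_imp_continuous_on ballI DERIV_isCont[OF dB] DERIV_isCont[OF d\<beta>])+
  then show "B \<in> borel_measurable borel" "\<beta> \<in> borel_measurable borel"
    by (auto intro: borel_measurable_continuous_onI)
  have "0 \<le> L" using \<gamma>_lip[of 1 0] by simp
  then have "L-lipschitz_on UNIV \<gamma>" using \<gamma>_lip by (auto simp: lipschitz_on_def dist_real_def)
  then show "\<gamma> \<in> borel_measurable borel" by (intro borel_measurable_continuous_onI lipschitz_on_continuous_on)
qed

lemma L2_\<beta>: "L2 M u \<Longrightarrow> L2 M (\<lambda>x. \<beta> (u x))"
  by (rule L2_bound, assumption) (auto simp: L2_def \<beta>_bound)

lemma integrable_B: "L2 M u \<Longrightarrow> integrable M (\<lambda>x. B (u x))"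
  by (rule Bochner_Integration.integrable_bound[OF L2_sq]) (auto simp: L2_def B_bound)

lemma integral_B_lim:
  assumes X: "L2_lim M X u" shows "(\<lambda>n. \<integral>x. B (X n x) \<partial>M) \<longlonglongrightarrow> (\<integral>x. B (u x) \<partial>M)"
proof -
  have L: "L2 M (X n)" "L2 M u" for n using X by (auto simp: L2_lim_def)
  have [measurable]: "X n \<in> borel_measurable M" "u \<in> borel_measurable M" for n
    using L by (auto simp: L2_def)
  have A: "L2_lim M (\<lambda>n x. \<bar>X n x - u x\<bar>) (\<lambda>x. 0)"
    by (rule L2_lim_bound[OF X, where C=1]) auto
  have Bl: "L2_lim M (\<lambda>n x. \<bar>X n x\<bar> + \<bar>u x\<bar>) (\<lambda>x. \<bar>u x\<bar> + \<bar>u x\<bar>)"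
  proof (rule L2_lim_bound[OF X, where C=1])
    have "L2 M (\<lambda>x. \<bar>u x\<bar>)" using L(2) by (auto simp: L2_def)
    then show "L2 M (\<lambda>x. \<bar>u x\<bar> + \<bar>u x\<bar>)" by (intro L2_add)
  qed auto
  have lim: "(\<lambda>n. \<integral>x. (\<bar>X n x\<bar> + \<bar>u x\<bar>) * \<bar>X n x - u x\<bar> \<partial>M) \<longlonglongrightarrow> 0"
    using L2_lim_inner[OF Bl A] by simp
  have "(\<lambda>n. (\<integral>x. B (X n x) \<partial>M) - (\<integral>x. B (u x) \<partial>M)) \<longlonglongrightarrow> 0"
  proof (rule Lim_null_comparison[OF always_eventually lim], rule allI)
    fix n
    have "norm ((\<integral>x. B (X n x) \<partial>M) - (\<integral>x. B (u x) \<partial>M)) = norm (\<integral>x. B (X n x) - B (u x) \<partial>M)"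
      using integrable_B[OF L(1)] integrable_B[OF L(2)] by simp
    also have "\<dots> \<le> (\<integral>x. norm (B (X n x) - B (u x)) \<partial>M)" by (rule integral_norm_bound)
    also have "\<dots> \<le> (\<integral>x. (\<bar>X n x\<bar> + \<bar>u x\<bar>) * \<bar>X n x - u x\<bar> \<partial>M)"
    proof (rule integral_mono)
      show "integrable M (\<lambda>x. norm (B (X n x) - B (u x)))"
        using integrable_B[OF L(1)] integrable_B[OF L(2)] by (intro integrable_norm) auto
      show "integrable M (\<lambda>x. (\<bar>X n x\<bar> + \<bar>u x\<bar>) * \<bar>X n x - u x\<bar>)"
        by (rule L2_mult) (use A Bl in \<open>auto simp: L2_lim_def\<close>)
    qed (use B_diff in auto)
    finally show "norm ((\<integral>x. B (X n x) \<partial>M) - (\<integral>x. B (u x) \<partial>M)) \<le> (\<integral>x. (\<bar>X n x\<bar> + \<bar>u x\<bar>) * \<bar>X n x - u x\<bar> \<partial>M)" .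
  qed
  then show ?thesis by (simp add: LIM_zero_iff)
qed

end

lemma AE_lborel_prod_snd:
  assumes "AE x in (lborel :: 'a::euclidean_space measure). P x"
  shows "AE p in (lborel :: ('c::euclidean_space \<times> 'a) measure). P (snd p)"
proof -
  obtain N where N: "N \<in> null_sets (lborel :: 'a measure)" "{x. \<not> P x} \<subseteq> N"
    using assms by (auto simp: eventually_ae_filter)
  have "(UNIV :: 'c set) \<times> N \<in> null_sets (lborel \<Otimes>\<^sub>M lborel)"
    using N(1) by (intro lborel.times_in_null_sets2) auto
  then have "(UNIV :: 'c set) \<times> N \<in> null_sets lborel" by (simp add: lborel_prod)
  then show ?thesis by (rule AE_I') (use N(2) in auto)
qed

lemma borel_measurable_coord:
  fixes k :: "'c::euclidean_space \<Rightarrow> 'd::topological_space" and w :: "'a::euclidean_space \<Rightarrow> 'd"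
  shows "k \<in> borel_measurable borel \<Longrightarrow> (\<lambda>p::'c \<times> 'a. k (fst p)) \<in> borel_measurable borel"
    and "w \<in> borel_measurable borel \<Longrightarrow> (\<lambda>p::'c \<times> 'a. w (snd p)) \<in> borel_measurable borel"
  by (rule measurable_compose[OF borel_measurable_continuous_onI], intro continuous_intros, assumption)+

lemma tmol'_measurable:
  assumes g: "QL2 T g" shows "tmol' \<delta> (g :: real \<times> 'a::euclidean_space \<Rightarrow> real) \<in> borel_measurable borel"
proof -
  have [measurable]: "g \<in> borel_measurable (borel \<Otimes>\<^sub>M borel)"
    using QL2_meas[OF g] by (simp add: borel_prod)
  have "(\<lambda>p::real \<times> 'a. \<integral>\<tau>. g (\<tau>, snd p) * (- kernD \<delta> (\<tau> - fst p)) \<partial>lborel) \<in> borel_measurable (borel \<Otimes>\<^sub>M borel)"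
    by measurable
  then show ?thesis unfolding tmol'_def[abs_def] by (simp add: borel_prod)
qed

text \<open>\<open>time_integral_bound\<close> admits the kernel that moves with the time variable;
  the time cut-off makes the resulting bound square-integrable on the product.\<close>

lemma tmol'_L2:
  fixes g :: "real \<times> 'a::euclidean_space \<Rightarrow> real"
  assumes g: "QL2 T g" and T: "T > 0" and d: "\<delta> > 0"
  shows "L2 lborel (\<lambda>p. indicator {s1<..<s2} (fst p) * tmol' \<delta> g p)"
proof -
  obtain N where N: "\<And>x::real. norm (kernD \<delta> x) \<le> N" by (rule kern_bounded[OF d, where 'a=real]) (rule that)
  note tmol'_measurable[OF g, measurable]
  have "AE p in (lborel :: (real \<times> 'a) measure).
     \<forall>k N. k \<in> borel_measurable borel \<longrightarrow> (\<forall>s. \<bar>k s\<bar> \<le> N) \<longrightarrow>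
     \<bar>\<integral>\<tau>. g (\<tau>, snd p) * k \<tau> \<partial>lborel\<bar> \<le> (N * sqrt T) * tnorm g (snd p)"
    by (rule AE_lborel_prod_snd[OF time_integral_bound[OF g T]])
  then have bd: "AE p in (lborel :: (real \<times> 'a) measure). \<bar>tmol' \<delta> g p\<bar> \<le> (N * sqrt T) * tnorm g (snd p)"
  proof eventually_elim
    case (elim p)
    show ?case unfolding tmol'_def using elim[rule_format, of "\<lambda>\<tau>. - kernD \<delta> (\<tau> - fst p)" N] N by simp
  qed
  show ?thesis
  proof (rule L2_bound[OF L2_cmult[OF L2_tensor[OF indicator_interval_L2 L2_tnorm[OF QL2_L2[OF g]]], of "N * sqrt T"]])
    show "(\<lambda>p. indicator {s1<..<s2} (fst p) * tmol' \<delta> g p) \<in> borel_measurable lborel"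
      using borel_measurable_coord(1)[of "indicator {s1<..<s2} :: real \<Rightarrow> real"] tmol'_measurable[OF g]
      by (auto intro!: borel_measurable_times)
    show "AE p in lborel. \<bar>indicator {s1<..<s2} (fst p) * tmol' \<delta> g p\<bar>
      \<le> \<bar>N * sqrt T * (tnorm g (snd p) * indicator {s1<..<s2} (fst p))\<bar>"
      using bd by eventually_elim (auto split: split_indicator)
  qed
qed

context energy_fun
begin

text \<open>The space-time integral of \<open>\<beta> (u)\<close> times the time derivative is
  evaluated in both orders: time first gives the difference of energies by the fundamental theorem
  of calculus, space first gives the equation tested at each time with
  \<open>\<beta> (u)\<close>.\<close>

lemma energy_mollified:
  fixes g :: "real \<times> 'a::euclidean_space \<Rightarrow> real"
  assumes W: "weq c T a g D F" and T: "T > 0" and d: "\<delta> > 0"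
    and s: "\<delta> < s1" "s1 \<le> s2" "s2 < T - \<delta>"
  defines "u \<equiv> tmol \<delta> g"
  shows "(\<integral>x. B (u (s2, x)) \<partial>lborel) - (\<integral>x. B (u (s1, x)) \<partial>lborel)
    = (\<integral>p. indicator {s1<..<s2} (fst p) * (c * (tmol \<delta> F p * \<beta> (u p)
         - a * (\<Sum>b\<in>Basis. tmol \<delta> (\<lambda>p. D p \<bullet> b) p * (\<gamma> (u p) * tmol \<delta> (\<lambda>p. D p \<bullet> b) p)))) \<partial>lborel)"
proof -
  have g: "QL2 T g" and D: "QV T D" and F: "QL2 T F"
    and wg: "AE t in lborel. wgrad (\<lambda>x. g (t, x)) (\<lambda>x. D (t, x))"
    using W by (auto simp: weq_def)
  define ud where "ud = tmol' \<delta> g"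
  define Db where "Db b = tmol \<delta> (\<lambda>p. D p \<bullet> b)" for b
  define I where "I p = \<beta> (u p) * (indicator {s1<..<s2} (fst p) * ud p)" for p
  define K where "K p = c * (tmol \<delta> F p * \<beta> (u p) - a * (\<Sum>b\<in>Basis. Db b p * (\<gamma> (u p) * Db b p)))" for p
  have Lu: "L2 lborel u" unfolding u_def by (rule tmol_L2[OF g d])
  have LF: "L2 lborel (tmol \<delta> F)" by (rule tmol_L2[OF F d])
  have LD: "L2 lborel (Db b)" if "b \<in> Basis" for b
    unfolding Db_def by (rule tmol_L2[OF QV_comp[OF D that] d])
  have mu[measurable]: "u \<in> borel_measurable borel" using Lu by (simp add: L2_def)
  have iI: "integrable lborel I"
    unfolding I_def ud_def by (intro L2_mult L2_\<beta> Lu tmol'_L2[OF g T d])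
  have iK: "integrable lborel K"
    unfolding K_def
    by (intro integrable_mult_right Bochner_Integration.integrable_diff Bochner_Integration.integrable_sum
        L2_mult L2_\<beta> Lu LF LD L2_mult_bdd[OF LD _ \<gamma>_bound]) auto
  have mi: "(\<lambda>p::real \<times> 'a. indicator {s1<..<s2} (fst p) :: real) \<in> borel_measurable borel"
    by (rule borel_measurable_coord(1)) auto
  have iK1: "integrable lborel (\<lambda>p. indicator {s1<..<s2} (fst p) * K p)"
    by (rule Bochner_Integration.integrable_bound[OF iK])
       (use borel_measurable_integrable[OF iK] mi in \<open>auto split: split_indicator\<close>)
  have Bi: "integrable lborel (\<lambda>x. B (u (t, x)))" for t
    unfolding u_def by (rule integrable_B[OF tmol_L2_slice[OF g T d]])
  have "(\<integral>p. I p \<partial>lborel) = (\<integral>x. (\<integral>t. I (t, x) \<partial>lborel) \<partial>lborel)"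
    by (rule integral_slice2[OF iI, symmetric])
  also have "\<dots> = (\<integral>x. B (u (s2, x)) - B (u (s1, x)) \<partial>lborel)"
  proof (rule integral_cong_AE)
    show "(\<lambda>x. \<integral>t. I (t, x) \<partial>lborel) \<in> borel_measurable lborel"
      using borel_measurable_integrable[OF integrable_slice2[OF iI]] by simp
    show "(\<lambda>x. B (u (s2, x)) - B (u (s1, x))) \<in> borel_measurable lborel"
      using borel_measurable_integrable[OF Bochner_Integration.integrable_diff[OF Bi[of s2] Bi[of s1]]] .
    show "AE x in lborel. (\<integral>t. I (t, x) \<partial>lborel) = B (u (s2, x)) - B (u (s1, x))"
      using AE_integrable_time_slice[OF g]
    proof eventually_elim
      case (elim x)
      note td = tmol_deriv[OF g d elim]
      have du: "((\<lambda>s. u (s, x)) has_real_derivative ud (s, x)) (at s)" for s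
        unfolding u_def ud_def by (rule td)
      have "(\<integral>t. (\<beta> (u (t, x)) * ud (t, x)) * indicator {s1..s2} t \<partial>lborel) = B (u (s2, x)) - B (u (s1, x))"
      proof (rule integral_FTC_Icc_real[OF s(2)])
        fix t
        show "((\<lambda>t. B (u (t, x))) has_real_derivative \<beta> (u (t, x)) * ud (t, x)) (at t)"
          by (rule DERIV_chain2[OF dB du])
        have "isCont (\<lambda>t. u (t, x)) t" by (rule DERIV_isCont[OF du])
        moreover have "isCont \<beta> (u (t, x))" by (rule DERIV_isCont[OF d\<beta>])
        ultimately have "isCont (\<lambda>t. \<beta> (u (t, x))) t" by (rule isCont_o2)
        then show "isCont (\<lambda>t. \<beta> (u (t, x)) * ud (t, x)) t"
          using td(2) unfolding ud_def by (intro isCont_mult)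
      qed
      also have "(\<integral>t. (\<beta> (u (t, x)) * ud (t, x)) * indicator {s1..s2} t \<partial>lborel) = (\<integral>t. I (t, x) \<partial>lborel)"
      proof (rule integral_cong_AE)
        have m: "(\<lambda>t. \<beta> (u (t, x)) * ud (t, x)) \<in> borel_measurable borel"
          using borel_measurable_slice(2)[OF mu, where x=x] borel_measurable_slice(2)[OF tmol'_measurable[OF g], where x=x]
          unfolding ud_def by (intro borel_measurable_times measurable_compose[OF _ measurable(2)]) auto
        show "(\<lambda>t. (\<beta> (u (t, x)) * ud (t, x)) * indicator {s1..s2} t) \<in> borel_measurable lborel"
          using m by auto
        have "(\<lambda>t. (\<beta> (u (t, x)) * ud (t, x)) * indicator {s1<..<s2} t) \<in> borel_measurable lborel"
          using m by auto
        then show "(\<lambda>t. I (t, x)) \<in> borel_measurable lborel" by (simp add: I_def mult_ac)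
        show "AE t in lborel. (\<beta> (u (t, x)) * ud (t, x)) * indicator {s1..s2} t = I (t, x)"
          using AE_lborel_singleton[of s1] AE_lborel_singleton[of s2]
          by eventually_elim (auto simp: I_def split: split_indicator)
      qed
      finally show ?case by simp
    qed
  qed
  also have "\<dots> = (\<integral>x. B (u (s2, x)) \<partial>lborel) - (\<integral>x. B (u (s1, x)) \<partial>lborel)"
    by (rule Bochner_Integration.integral_diff[OF Bi Bi])
  finally have 1: "(\<integral>x. B (u (s2, x)) \<partial>lborel) - (\<integral>x. B (u (s1, x)) \<partial>lborel) = (\<integral>p. I p \<partial>lborel)" by simp
  have "(\<integral>p. I p \<partial>lborel) = (\<integral>t. (\<integral>x. I (t, x) \<partial>lborel) \<partial>lborel)"
    by (rule integral_slice[OF iI, symmetric])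
  also have "\<dots> = (\<integral>t. (\<integral>x. indicator {s1<..<s2} (fst (t, x)) * K (t, x) \<partial>lborel) \<partial>lborel)"
  proof (rule Bochner_Integration.integral_cong[OF refl])
    fix t
    show "(\<integral>x. I (t, x) \<partial>lborel) = (\<integral>x. indicator {s1<..<s2} (fst (t, x)) * K (t, x) \<partial>lborel)"
    proof (cases "t \<in> {s1<..<s2}")
      case True
      \<comment> \<open>Strictly between \<open>s1\<close> and \<open>s2\<close> the kernel stays
        inside \<open>(0,T)\<close>, because both times are more than \<open>\<delta>\<close> away
        from the endpoints.\<close>
      have cb: "cball t \<delta> \<subseteq> {0<..<T}" using True s by (auto simp: dist_real_def abs_if split: if_splits)
      have Hu: "H1g (\<lambda>x. u (t, x)) (\<lambda>x. tmolV \<delta> D (t, x))"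
        unfolding u_def by (rule H1g_tmol[OF g D T d wg])
      have v: "H1g (\<lambda>x. \<beta> (u (t, x))) (\<lambda>x. \<gamma> (u (t, x)) *\<^sub>R tmolV \<delta> D (t, x))"
        by (rule H1g_chain[OF Hu d\<beta> zero(2) \<gamma>_bound \<gamma>_lip])
      note Pv = H1g_props[OF v]
      have lF: "L2 lborel (\<lambda>x. tmol \<delta> F (t, x))" by (rule tmol_L2_slice[OF F T d])
      have lD: "L2 lborel (\<lambda>x. Db b (t, x))" if "b \<in> Basis" for b
        unfolding Db_def by (rule tmol_L2_slice[OF QV_comp[OF D that] T d])
      have lG: "L2 lborel (\<lambda>x. \<gamma> (u (t, x)) * Db b (t, x))" if "b \<in> Basis" for b
        using Pv(2)[OF that] that by (simp add: tmolV_inner Db_def)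
      have "(\<integral>x. I (t, x) \<partial>lborel) = (\<integral>x. tmol' \<delta> g (t, x) * \<beta> (u (t, x)) \<partial>lborel)"
        using True by (simp add: I_def ud_def mult.commute)
      also have "\<dots> = c * ((\<integral>x. tmol \<delta> F (t, x) * \<beta> (u (t, x)) \<partial>lborel)
         - a * (\<Sum>b\<in>Basis. \<integral>x. Db b (t, x) * (\<gamma> (u (t, x)) * Db b (t, x)) \<partial>lborel))"
        unfolding tmol'_slice_integral[OF W T d cb v]
        by (simp add: tmolV_inner Db_def cong: sum.cong)
      also have "\<dots> = (\<integral>x. K (t, x) \<partial>lborel)"
        unfolding K_def using L2_mult[OF lF Pv(1)] L2_mult[OF lD lG]
        by (simp add: Bochner_Integration.integral_sum Bochner_Integration.integral_diff
            Bochner_Integration.integrable_sum)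
      finally show ?thesis using True by simp
    qed (simp add: I_def)
  qed
  also have "\<dots> = (\<integral>p. indicator {s1<..<s2} (fst p) * K p \<partial>lborel)"
    by (rule integral_slice[OF iK1])
  finally show ?thesis unfolding 1 by (simp add: K_def Db_def)
qed

end

text \<open>The factors \<open>Y n\<close> converge only almost everywhere; their boundedness
  compensates. The error is split into \<open>Y n * (X n - u)\<close>, controlled by
  \<open>C\<close>, and \<open>(Y n - w) * u\<close>, controlled by domination.\<close>

lemma L2_lim_mult_bdd:
  assumes X: "L2_lim M X u" and m: "\<And>n. Y n \<in> borel_measurable M" "w \<in> borel_measurable M"
    and b: "\<And>n x. \<bar>Y n x\<bar> \<le> C" "\<And>x. \<bar>w x\<bar> \<le> C" and lim: "AE x in M. (\<lambda>n. Y n x) \<longlonglongrightarrow> w x"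
  shows "L2_lim M (\<lambda>n x. Y n x * X n x) (\<lambda>x. w x * u x)"
proof -
  have L: "L2 M (X n)" "L2 M u" for n using X by (auto simp: L2_lim_def)
  note m[measurable]
  have Lm: "L2 M (\<lambda>x. Y n x * v x)" "L2 M (\<lambda>x. w x * v x)" if "L2 M v" for n v
    using L2_mult_bdd[OF that m(1) b(1)] L2_mult_bdd[OF that m(2) b(2)] by auto
  have 1: "L2_lim M (\<lambda>n x. Y n x * u x) (\<lambda>x. w x * u x)"
  proof (rule L2_lim_dominated[OF L2_cmult[of _ "\<lambda>x. \<bar>u x\<bar>" C]])
    show "L2 M (\<lambda>x. \<bar>u x\<bar>)" using L(2) by (auto simp: L2_def)
    show "AE x in M. (\<lambda>n. Y n x * u x) \<longlonglongrightarrow> w x * u x"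
      using lim by eventually_elim (intro tendsto_intros)
    show "AE x in M. \<bar>Y n x * u x\<bar> \<le> C * \<bar>u x\<bar>" for n
      using b(1) by (auto simp: abs_mult intro!: mult_right_mono)
  qed (use L2_meas[OF Lm(1)[OF L(2)]] L2_meas[OF Lm(2)[OF L(2)]] in auto)
  have d: "(\<integral>x. (Y n x * X n x - w x * u x)^2 \<partial>M)
      \<le> 2 * (C^2 * (\<integral>x. (X n x - u x)^2 \<partial>M)) + 2 * (\<integral>x. (Y n x * u x - w x * u x)^2 \<partial>M)" for n
  proof -
    have "(\<integral>x. (Y n x * X n x - Y n x * u x)^2 \<partial>M) \<le> (\<integral>x. (C * (X n x - u x))^2 \<partial>M)"
    proof (rule L2_sq_mono[OF L2_cmult[OF L2_diff[OF L]]])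
      show "(\<lambda>x. Y n x * X n x - Y n x * u x) \<in> borel_measurable M"
        using L2_meas[OF L2_diff[OF Lm(1)[OF L(1)] Lm(1)[OF L(2)]]] .
      show "AE x in M. \<bar>Y n x * X n x - Y n x * u x\<bar> \<le> \<bar>C * (X n x - u x)\<bar>"
      proof (rule AE_I2)
        fix x
        have "\<bar>Y n x\<bar> \<le> \<bar>C\<bar>" using b(1)[of n x] by linarith
        then show "\<bar>Y n x * X n x - Y n x * u x\<bar> \<le> \<bar>C * (X n x - u x)\<bar>"
          by (simp add: abs_mult mult_right_mono flip: right_diff_distrib)
      qed
    qed
    then show ?thesis
      using L2_triangle_diff[OF Lm(1)[OF L(1)] Lm(1)[OF L(2)] Lm(2)[OF L(2)], of n n n]
      by (simp add: power_mult_distrib)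
  qed
  have lim2: "(\<lambda>n. 2 * (C^2 * (\<integral>x. (X n x - u x)^2 \<partial>M)) + 2 * (\<integral>x. (Y n x * u x - w x * u x)^2 \<partial>M)) \<longlonglongrightarrow> 0"
    using X 1 unfolding L2_lim_def by (auto intro!: tendsto_eq_intros)
  have "(\<lambda>n. \<integral>x. (Y n x * X n x - w x * u x)^2 \<partial>M) \<longlonglongrightarrow> 0"
    by (rule Lim_null_comparison[OF always_eventually lim2]) (use d in auto)
  then show ?thesis using Lm L by (simp add: L2_lim_def)
qed

text \<open>Fubini turns strong convergence on the product into \<open>L1\<close> convergence of the
  squared slice errors, which vanish almost everywhere along a subsequence.\<close>

lemma L2_lim_slice_subseq:
  fixes X :: "nat \<Rightarrow> 'c::euclidean_space \<times> 'a::euclidean_space \<Rightarrow> real"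
  assumes X: "L2_lim lborel X u"
  obtains r where "strict_mono r" "AE t in lborel. L2_lim lborel (\<lambda>n x. X (r n) (t, x)) (\<lambda>x. u (t, x))"
proof -
  have L: "L2 lborel (X n)" "L2 lborel u" for n using X by (auto simp: L2_lim_def)
  note i = L2_sq[OF L2_diff[OF L]]
  define e where "e n t = (\<integral>x. (X n (t, x) - u (t, x))^2 \<partial>lborel)" for n t
  have ie: "integrable lborel (e n)" for n
    using integrable_slice[OF i[of n]] unfolding e_def .
  have "(\<lambda>n. \<integral>t. norm (e n t) \<partial>lborel) \<longlonglongrightarrow> 0"
  proof -
    have "norm (e n t) = e n t" for n t by (simp add: e_def)
    moreover have "(\<integral>t. e n t \<partial>lborel) = (\<integral>p. (X n p - u p)^2 \<partial>lborel)" for n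
      unfolding e_def using integral_slice[OF i[of n]] .
    ultimately show ?thesis using X by (simp add: L2_lim_def)
  qed
  from tendsto_L1_AE_subseq[OF ie this] obtain r where
    r: "strict_mono r" "AE t in lborel. (\<lambda>n. e (r n) t) \<longlonglongrightarrow> 0" by blast
  have "AE t in lborel. \<forall>n. L2 lborel (\<lambda>x. X n (t, x))"
    using AE_L2_slice(1)[OF L(1)] by (simp add: AE_all_countable)
  then have "AE t in lborel. L2_lim lborel (\<lambda>n x. X (r n) (t, x)) (\<lambda>x. u (t, x))"
    using r(2) AE_L2_slice(1)[OF L(2)]
    by eventually_elim (auto simp: L2_lim_def e_def)
  then show ?thesis using r(1) that by blast
qed

context energy_fun
begin

text \<open>The null set is fixed before \<open>s1\<close> and \<open>s2\<close>: the identity holds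
  for all good times simultaneously, so that one of them can later run to an endpoint.\<close>

lemma energy_identity:
  fixes g :: "real \<times> 'a::euclidean_space \<Rightarrow> real"
  assumes W: "weq c T a g D F" and T: "T > 0"
  obtains N where "N \<in> null_sets lborel"
    "\<And>t. t \<notin> N \<Longrightarrow> L2 lborel (\<lambda>x. g (t, x))"
    "\<And>s1 s2. 0 < s1 \<Longrightarrow> s1 \<le> s2 \<Longrightarrow> s2 < T \<Longrightarrow> s1 \<notin> N \<Longrightarrow> s2 \<notin> N \<Longrightarrow>
      (\<integral>x. B (g (s2, x)) \<partial>lborel) - (\<integral>x. B (g (s1, x)) \<partial>lborel)
      = (\<integral>p. indicator {s1<..<s2} (fst p) * (c * (F p * \<beta> (g p)
         - a * (\<Sum>b\<in>Basis. (D p \<bullet> b) * (\<gamma> (g p) * (D p \<bullet> b))))) \<partial>lborel)"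
proof -
  have g: "QL2 T g" and D: "QV T D" and F: "QL2 T F" using W by (auto simp: weq_def)
  define \<delta> where "\<delta> n = inverse (real (Suc n))" for n
  have \<delta>: "\<delta> n > 0" "\<delta> \<longlonglongrightarrow> 0" for n
    using LIMSEQ_inverse_real_of_nat by (auto simp: \<delta>_def[abs_def])
  have lg: "L2_lim lborel (\<lambda>n. tmol (\<delta> n) g) g" by (rule tmol_lim[OF g \<delta>])
  \<comment> \<open>The first subsequence gives pointwise convergence, for the factor
    \<open>\<gamma> (g)\<close>; the second gives convergence of the slices at almost every time,
    for the energies.\<close>
  obtain r1 where r1: "strict_mono r1" "AE p in lborel. (\<lambda>n. tmol (\<delta> (r1 n)) g p) \<longlonglongrightarrow> g p"
    using L2_lim_AE_subseq[OF lg] by blast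
  obtain r2 where r2: "strict_mono r2"
      "AE t in lborel. L2_lim lborel (\<lambda>n x. tmol (\<delta> (r1 (r2 n))) g (t, x)) (\<lambda>x. g (t, x))"
    using L2_lim_slice_subseq[OF L2_lim_subseq[OF lg r1(1)]] by blast
  define \<epsilon> where "\<epsilon> n = \<delta> (r1 (r2 n))" for n
  have e0: "\<epsilon> n > 0" for n by (simp add: \<epsilon>_def \<delta>)
  have "(\<delta> \<circ> (r1 \<circ> r2)) \<longlonglongrightarrow> 0"
    by (rule LIMSEQ_subseq_LIMSEQ[OF \<delta>(2) strict_mono_o[OF r1(1) r2(1)]])
  then have e1: "\<epsilon> \<longlonglongrightarrow> 0" by (simp add: \<epsilon>_def[abs_def] o_def)
  define U where "U n = tmol (\<epsilon> n) g" for n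
  have lU: "L2_lim lborel U g" unfolding U_def by (rule tmol_lim[OF g e0 e1])
  have lF: "L2_lim lborel (\<lambda>n. tmol (\<epsilon> n) F) F" by (rule tmol_lim[OF F e0 e1])
  have lD: "L2_lim lborel (\<lambda>n. tmol (\<epsilon> n) (\<lambda>p. D p \<bullet> b)) (\<lambda>p. D p \<bullet> b)" if "b \<in> Basis" for b
    by (rule tmol_lim[OF QV_comp[OF D that] e0 e1])
  have mU[measurable]: "U n \<in> borel_measurable borel" and mg[measurable]: "g \<in> borel_measurable borel" for n
    using lU by (auto simp: L2_lim_def L2_def)
  have aeU: "AE p in lborel. (\<lambda>n. U n p) \<longlonglongrightarrow> g p"
    using r1(2) by eventually_elim (use LIMSEQ_subseq_LIMSEQ[OF _ r2(1)] in \<open>force simp: U_def \<epsilon>_def o_def\<close>)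
  have lB: "L2_lim lborel (\<lambda>n p. \<beta> (U n p)) (\<lambda>p. \<beta> (g p))"
    by (rule L2_lim_bound[OF lU, where C=1]) (use \<beta>_lip L2_\<beta>[OF QL2_L2[OF g]] in auto)
  have ae\<gamma>: "AE p in lborel. (\<lambda>n. \<gamma> (U n p)) \<longlonglongrightarrow> \<gamma> (g p)"
    using aeU
  proof eventually_elim
    case (elim p)
    have lim: "(\<lambda>n. L * \<bar>U n p - g p\<bar>) \<longlonglongrightarrow> 0"
      using elim by (auto intro!: tendsto_eq_intros)
    have "(\<lambda>n. \<gamma> (U n p) - \<gamma> (g p)) \<longlonglongrightarrow> 0"
      by (rule Lim_null_comparison[OF always_eventually lim]) (use \<gamma>_lip in auto)
    then show ?case by (simp add: LIM_zero_iff)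
  qed
  have l\<gamma>: "L2_lim lborel (\<lambda>n p. \<gamma> (U n p) * tmol (\<epsilon> n) (\<lambda>p. D p \<bullet> b) p) (\<lambda>p. \<gamma> (g p) * (D p \<bullet> b))"
    if "b \<in> Basis" for b
    by (rule L2_lim_mult_bdd[OF lD[OF that] _ _ \<gamma>_bound \<gamma>_bound ae\<gamma>]) auto
  obtain N where N: "N \<in> null_sets lborel"
      "{t. \<not> L2_lim lborel (\<lambda>n x. U n (t, x)) (\<lambda>x. g (t, x))} \<subseteq> N"
    using r2(2) by (auto simp: eventually_ae_filter U_def \<epsilon>_def)
  show ?thesis
  proof (rule that[OF N(1)])
    fix t assume "t \<notin> N"
    then show "L2 lborel (\<lambda>x. g (t, x))" using N(2) by (auto simp: L2_lim_def)
  next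
    fix s1 s2 :: real assume s: "0 < s1" "s1 \<le> s2" "s2 < T" and n: "s1 \<notin> N" "s2 \<notin> N"
    let ?i = "\<lambda>p::real \<times> 'a. indicator {s1<..<s2} (fst p) :: real"
    have mi: "?i \<in> borel_measurable borel"
      by (rule borel_measurable_coord(1)) auto
    have ib: "\<bar>?i p\<bar> \<le> 1" for p by (simp split: split_indicator)
    have lim1: "(\<lambda>n. (\<integral>x. B (U n (s2, x)) \<partial>lborel) - (\<integral>x. B (U n (s1, x)) \<partial>lborel))
      \<longlonglongrightarrow> (\<integral>x. B (g (s2, x)) \<partial>lborel) - (\<integral>x. B (g (s1, x)) \<partial>lborel)"
      by (intro tendsto_diff integral_B_lim) (use N(2) n in auto)
    \<comment> \<open>The shape common to the mollified and the limiting integrand;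
      \<open>split\<close> writes its integral as a combination of inner products, each of which
      converges by \<open>L2_lim_inner\<close>.\<close>
    define R where "R f h d p = ?i p * (c * (f p * h p - a * (\<Sum>b\<in>Basis. fst (d b) p * snd (d b) p)))"
      for f h and d :: "'a \<Rightarrow> (real \<times> 'a \<Rightarrow> real) \<times> (real \<times> 'a \<Rightarrow> real)" and p
    have split: "(\<integral>p. R f h d p \<partial>lborel) = c * ((\<integral>p. f p * (?i p * h p) \<partial>lborel)
        - a * (\<Sum>b\<in>Basis. \<integral>p. fst (d b) p * (?i p * snd (d b) p) \<partial>lborel))"
      if "L2 lborel f" "L2 lborel h" "\<And>b. b \<in> Basis \<Longrightarrow> L2 lborel (fst (d b))" "\<And>b. b \<in> Basis \<Longrightarrow> L2 lborel (snd (d b))"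
      for f h d
    proof -
      have Li: "L2 lborel (\<lambda>p. ?i p * k p)" if "L2 lborel k" for k
        by (rule L2_mult_bdd[OF that _ ib]) (use mi in simp)
      have "(\<integral>p. R f h d p \<partial>lborel) = (\<integral>p. c * (f p * (?i p * h p)
          - a * (\<Sum>b\<in>Basis. fst (d b) p * (?i p * snd (d b) p))) \<partial>lborel)"
        by (rule Bochner_Integration.integral_cong) (auto simp: R_def sum_distrib_left algebra_simps split: split_indicator)
      also have "\<dots> = c * ((\<integral>p. f p * (?i p * h p) \<partial>lborel)
        - a * (\<Sum>b\<in>Basis. \<integral>p. fst (d b) p * (?i p * snd (d b) p) \<partial>lborel))"
        using L2_mult[OF that(1) Li[OF that(2)]] L2_mult[OF that(3) Li[OF that(4)]]
        by (simp add: Bochner_Integration.integral_sum Bochner_Integration.integral_diff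
            Bochner_Integration.integrable_sum)
      finally show ?thesis .
    qed
    have li: "L2_lim lborel (\<lambda>n p. ?i p * X n p) (\<lambda>p. ?i p * k p)" if "L2_lim lborel X k" for X k
      by (rule L2_lim_mult_bdd[OF that _ _ ib ib]) (use mi in auto)
    define d where "d n b = (tmol (\<epsilon> n) (\<lambda>p. D p \<bullet> b), \<lambda>p. \<gamma> (U n p) * tmol (\<epsilon> n) (\<lambda>p. D p \<bullet> b) p)" for n b
    define d' where "d' b = (\<lambda>p. D p \<bullet> b, \<lambda>p. \<gamma> (g p) * (D p \<bullet> b))" for b
    have "(\<lambda>n. \<integral>p. R (tmol (\<epsilon> n) F) (\<lambda>p. \<beta> (U n p)) (d n) p \<partial>lborel)
        \<longlonglongrightarrow> (\<integral>p. R F (\<lambda>p. \<beta> (g p)) d' p \<partial>lborel)"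
    proof -
      have "(\<lambda>n. c * ((\<integral>p. tmol (\<epsilon> n) F p * (?i p * \<beta> (U n p)) \<partial>lborel)
          - a * (\<Sum>b\<in>Basis. \<integral>p. fst (d n b) p * (?i p * snd (d n b) p) \<partial>lborel)))
        \<longlonglongrightarrow> c * ((\<integral>p. F p * (?i p * \<beta> (g p)) \<partial>lborel)
          - a * (\<Sum>b\<in>Basis. \<integral>p. fst (d' b) p * (?i p * snd (d' b) p) \<partial>lborel))"
        unfolding d_def d'_def fst_conv snd_conv
        by (intro tendsto_mult tendsto_diff tendsto_sum tendsto_const L2_lim_inner lF lD li lB l\<gamma>)
      moreover have "L2 lborel (tmol (\<epsilon> n) F)" "L2 lborel F" "L2 lborel (\<lambda>p. \<beta> (U n p))" "L2 lborel (\<lambda>p. \<beta> (g p))" for n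
        using lF lB by (auto simp: L2_lim_def)
      moreover have "L2 lborel (fst (d n b))" "L2 lborel (snd (d n b))" "L2 lborel (fst (d' b))" "L2 lborel (snd (d' b))"
        if "b \<in> Basis" for n b
        using lD[OF that] l\<gamma>[OF that] by (auto simp: L2_lim_def d_def d'_def)
      ultimately show ?thesis by (simp add: split)
    qed
    moreover have "\<forall>\<^sub>F n in sequentially. (\<integral>p. R (tmol (\<epsilon> n) F) (\<lambda>p. \<beta> (U n p)) (d n) p \<partial>lborel)
        = (\<integral>x. B (U n (s2, x)) \<partial>lborel) - (\<integral>x. B (U n (s1, x)) \<partial>lborel)"
    proof -
      \<comment> \<open>The mollified identity is available once the kernel is narrower than the
        distance of both times to the endpoints.\<close>
      have "\<forall>\<^sub>F n in sequentially. \<epsilon> n < s1" "\<forall>\<^sub>F n in sequentially. \<epsilon> n < T - s2"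
        using order_tendstoD(2)[OF e1, of s1] order_tendstoD(2)[OF e1, of "T - s2"] s by auto
      then show ?thesis
      proof eventually_elim
        case (elim n)
        have "s2 < T - \<epsilon> n" using elim by simp
        from energy_mollified[OF W T e0 elim(1) s(2) this]
        show ?case unfolding R_def d_def fst_conv snd_conv U_def by simp
      qed
    qed
    ultimately have "(\<lambda>n. (\<integral>x. B (U n (s2, x)) \<partial>lborel) - (\<integral>x. B (U n (s1, x)) \<partial>lborel))
        \<longlonglongrightarrow> (\<integral>p. R F (\<lambda>p. \<beta> (g p)) d' p \<partial>lborel)"
      by (rule Lim_transform_eventually)
    from LIMSEQ_unique[OF lim1 this]
    show "(\<integral>x. B (g (s2, x)) \<partial>lborel) - (\<integral>x. B (g (s1, x)) \<partial>lborel)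
      = (\<integral>p. ?i p * (c * (F p * \<beta> (g p) - a * (\<Sum>b\<in>Basis. (D p \<bullet> b) * (\<gamma> (g p) * (D p \<bullet> b))))) \<partial>lborel)"
      unfolding R_def d'_def fst_conv snd_conv by simp
  qed
qed

end

subsection \<open>Traces\<close>

definition ctrace :: "real \<Rightarrow> (real \<times> 'a::euclidean_space \<Rightarrow> real) \<Rightarrow> real \<Rightarrow> ('a \<Rightarrow> real) \<Rightarrow> bool" where
  "ctrace T g t0 h \<longleftrightarrow> L2 lborel h \<and> (\<forall>e>0. \<exists>d>0. AE t in lborel.
     0 < t \<and> t < T \<and> \<bar>t - t0\<bar> < d \<longrightarrow> (\<integral>x. (g (t, x) - h x)^2 \<partial>lborel) < e)"

lemma null_set_avoid:
  assumes "N \<in> null_sets lborel" "a < (b::real)"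
  shows "\<exists>t. a < t \<and> t < b \<and> t \<notin> N"
proof (rule ccontr)
  assume "\<not> ?thesis"
  then have "{a<..<b} \<subseteq> N" by auto
  then have "emeasure lborel {a<..<b} \<le> emeasure lborel N" using assms(1) by (intro emeasure_mono) auto
  moreover have "emeasure lborel N = 0" using assms(1) by (rule null_setsD1)
  ultimately show False using assms(2) by simp
qed

lemma near_endpoint:
  assumes "t0 = 0 \<or> t0 = T" "T > 0" "d > 0" "N \<in> null_sets lborel"
  shows "\<exists>t. 0 < t \<and> t < T \<and> \<bar>t - t0\<bar> < d \<and> t \<notin> (N :: real set)"
  using assms(1)
proof
  assume t0: "t0 = 0"
  have "\<exists>t. 0 < t \<and> t < min d T \<and> t \<notin> N"
    by (rule null_set_avoid[OF assms(4)]) (use assms(2,3) in simp)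
  then obtain t where "0 < t" "t < min d T" "t \<notin> N" by blast
  then show ?thesis using t0 by (intro exI[of _ t]) simp
next
  assume t0: "t0 = T"
  have "\<exists>t. max 0 (T - d) < t \<and> t < T \<and> t \<notin> N"
    by (rule null_set_avoid[OF assms(4)]) (use assms(2,3) in simp)
  then obtain t where "max 0 (T - d) < t" "t < T" "t \<notin> N" by blast
  then show ?thesis using t0 by (intro exI[of _ t]) simp
qed

text \<open>A trace controls only almost every time near \<open>t0\<close>. One time for each
  accuracy \<open>1/(n+1)\<close> is picked outside the given null set and outside that of the
  trace.\<close>

lemma ctrace_seq:
  assumes tr: "ctrace T g t0 h" and t0: "t0 = 0 \<or> t0 = T" and T: "T > 0" and N: "N \<in> null_sets lborel"
  obtains s where "\<And>n. 0 < s n" "\<And>n. s n < T" "\<And>n. s n \<notin> N" "s \<longlonglongrightarrow> t0"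
    "(\<lambda>n. \<integral>x. (g (s n, x) - h x)^2 \<partial>lborel) \<longlonglongrightarrow> 0"
proof -
  have "\<forall>n. \<exists>t. 0 < t \<and> t < T \<and> t \<notin> N \<and> \<bar>t - t0\<bar> < inverse (real (Suc n))
      \<and> (\<integral>x. (g (t, x) - h x)^2 \<partial>lborel) < inverse (real (Suc n))"
  proof
    fix n
    have e: "inverse (real (Suc n)) > 0" by simp
    obtain d where d: "d > 0" "AE t in lborel. 0 < t \<and> t < T \<and> \<bar>t - t0\<bar> < d \<longrightarrow>
        (\<integral>x. (g (t, x) - h x)^2 \<partial>lborel) < inverse (real (Suc n))"
      using tr e unfolding ctrace_def by blast
    obtain M where M: "M \<in> null_sets lborel" "{t. \<not> (0 < t \<and> t < T \<and> \<bar>t - t0\<bar> < d \<longrightarrow>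
        (\<integral>x. (g (t, x) - h x)^2 \<partial>lborel) < inverse (real (Suc n)))} \<subseteq> M"
      using d(2) by (auto simp: eventually_ae_filter)
    have "min d (inverse (real (Suc n))) > 0" using d(1) e by simp
    from near_endpoint[OF t0 T this null_sets.Un[OF N M(1)]]
    obtain t where t: "0 < t" "t < T" "\<bar>t - t0\<bar> < min d (inverse (real (Suc n)))" "t \<notin> N" "t \<notin> M" by blast
    then have "(\<integral>x. (g (t, x) - h x)^2 \<partial>lborel) < inverse (real (Suc n))" using M(2) by (simp add: subset_iff) blast
    then show "\<exists>t. 0 < t \<and> t < T \<and> t \<notin> N \<and> \<bar>t - t0\<bar> < inverse (real (Suc n))
      \<and> (\<integral>x. (g (t, x) - h x)^2 \<partial>lborel) < inverse (real (Suc n))"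
      using t by (intro exI[of _ t]) (simp only: min_less_iff_conj simp_thms)
  qed
  from choice[OF this] obtain s where s: "\<And>n. 0 < s n" "\<And>n. s n < T" "\<And>n. s n \<notin> N" "\<And>n. \<bar>s n - t0\<bar> < inverse (real (Suc n))"
     "\<And>n. (\<integral>x. (g (s n, x) - h x)^2 \<partial>lborel) < inverse (real (Suc n))"
    by blast
  have "(\<lambda>n. s n - t0) \<longlonglongrightarrow> 0"
    by (rule Lim_null_comparison[OF always_eventually LIMSEQ_inverse_real_of_nat])
       (use s(4) in \<open>auto intro: less_imp_le\<close>)
  then have "s \<longlonglongrightarrow> t0" by (simp add: LIM_zero_iff)
  moreover have "(\<lambda>n. \<integral>x. (g (s n, x) - h x)^2 \<partial>lborel) \<longlonglongrightarrow> 0"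
    by (rule Lim_null_comparison[OF always_eventually LIMSEQ_inverse_real_of_nat])
       (use s(5) in \<open>auto intro: less_imp_le\<close>)
  ultimately show ?thesis using that s(1-3) by blast
qed

lemma ctrace_diff:
  assumes g: "QL2 T g1" "QL2 T g2" and t: "ctrace T g1 t0 h1" "ctrace T g2 t0 h2"
  shows "ctrace T (\<lambda>p. g1 p - g2 p) t0 (\<lambda>x. h1 x - h2 x)"
  unfolding ctrace_def
proof (intro conjI allI impI)
  have h: "L2 lborel h1" "L2 lborel h2" using t by (auto simp: ctrace_def)
  then show "L2 lborel (\<lambda>x. h1 x - h2 x)" by (rule L2_diff)
  fix e :: real assume "e > 0"
  then have "e / 4 > 0" by simp
  then obtain d1 d2 where d: "d1 > 0" "d2 > 0"
    "AE t in lborel. 0 < t \<and> t < T \<and> \<bar>t - t0\<bar> < d1 \<longrightarrow> (\<integral>x. (g1 (t, x) - h1 x)^2 \<partial>lborel) < e / 4"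
    "AE t in lborel. 0 < t \<and> t < T \<and> \<bar>t - t0\<bar> < d2 \<longrightarrow> (\<integral>x. (g2 (t, x) - h2 x)^2 \<partial>lborel) < e / 4"
    using t unfolding ctrace_def by meson
  have "AE t in lborel. 0 < t \<and> t < T \<and> \<bar>t - t0\<bar> < min d1 d2 \<longrightarrow>
      (\<integral>x. (g1 (t, x) - g2 (t, x) - (h1 x - h2 x))^2 \<partial>lborel) < e"
    using d(3,4) AE_L2_slice(1)[OF QL2_L2[OF g(1)]] AE_L2_slice(1)[OF QL2_L2[OF g(2)]]
  proof eventually_elim
    case (elim t)
    have "(\<integral>x. ((g1 (t, x) - h1 x) + - (g2 (t, x) - h2 x))^2 \<partial>lborel)
       \<le> 2 * (\<integral>x. (g1 (t, x) - h1 x)^2 \<partial>lborel) + 2 * (\<integral>x. (- (g2 (t, x) - h2 x))^2 \<partial>lborel)"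
      by (intro L2_triangle L2_minus L2_diff elim h)
    moreover have "(\<integral>x. ((g1 (t, x) - h1 x) + - (g2 (t, x) - h2 x))^2 \<partial>lborel)
       = (\<integral>x. (g1 (t, x) - g2 (t, x) - (h1 x - h2 x))^2 \<partial>lborel)"
      by (rule Bochner_Integration.integral_cong) (auto simp: algebra_simps)
    moreover have "(\<integral>x. (- (g2 (t, x) - h2 x))^2 \<partial>lborel) = (\<integral>x. (g2 (t, x) - h2 x)^2 \<partial>lborel)"
      by (rule Bochner_Integration.integral_cong) (auto simp: power2_commute)
    ultimately show ?case using elim(1,2) by auto
  qed
  then show "\<exists>d>0. AE t in lborel. 0 < t \<and> t < T \<and> \<bar>t - t0\<bar> < d \<longrightarrow>
      (\<integral>x. (g1 (t, x) - g2 (t, x) - (h1 x - h2 x))^2 \<partial>lborel) < e"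
    using d(1,2) by (intro exI[of _ "min d1 d2"]) simp
qed

text \<open>Where \<open>g (s n, x) \<le> 0\<close>, the positive part of \<open>h x\<close> is at
  most \<open>\<bar>g (s n, x) - h x\<bar>\<close>, and this distance tends to 0 in
  \<open>L2\<close> along good times. In this way order relations on the cylinder reach its two
  ends.\<close>

lemma ctrace_nonpos:
  assumes g: "QL2 T g" and T: "T > 0" and t0: "t0 = 0 \<or> t0 = T"
    and tr: "ctrace T g t0 h" and le: "AE p in lborel. g p \<le> 0"
  shows "AE x in lborel. h x \<le> 0"
proof -
  have h: "L2 lborel h" using tr by (simp add: ctrace_def)
  have [measurable]: "h \<in> borel_measurable lborel" using h by (simp add: L2_def)
  have "AE t in lborel. L2 lborel (\<lambda>x. g (t, x)) \<and> (AE x in lborel. g (t, x) \<le> 0)"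
    using AE_L2_slice(1)[OF QL2_L2[OF g]] AE_slice[OF le] by eventually_elim simp
  then obtain N where N: "N \<in> null_sets lborel"
      "{t. \<not> (L2 lborel (\<lambda>x. g (t, x)) \<and> (AE x in lborel. g (t, x) \<le> 0))} \<subseteq> N"
    by (auto simp: eventually_ae_filter)
  obtain s where s: "\<And>n. s n \<notin> N" "(\<lambda>n. \<integral>x. (g (s n, x) - h x)^2 \<partial>lborel) \<longlonglongrightarrow> 0"
    by (rule ctrace_seq[OF tr t0 T N(1)]) (rule that)
  have L: "L2 lborel (\<lambda>x. max 0 (h x))" by (rule L2_bound[OF h]) auto
  have "(\<integral>x. (max 0 (h x))^2 \<partial>lborel) \<le> (\<integral>x. (g (s n, x) - h x)^2 \<partial>lborel)" for n
  proof (rule L2_sq_mono)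
    have A: "L2 lborel (\<lambda>x. g (s n, x))" "AE x in lborel. g (s n, x) \<le> 0" using N(2) s(1)[of n] by auto
    show "L2 lborel (\<lambda>x. g (s n, x) - h x)" by (intro L2_diff A h)
    show "AE x in lborel. \<bar>max 0 (h x)\<bar> \<le> \<bar>g (s n, x) - h x\<bar>"
      using A(2) by eventually_elim auto
  qed measurable
  then have "(\<integral>x. (max 0 (h x))^2 \<partial>lborel) \<le> 0"
    by (intro LIMSEQ_le_const[OF s(2)]) auto
  from L2_AE_zero[OF L this] show ?thesis by eventually_elim simp
qed

subsection \<open>Comparison principle and energy estimates\<close>

text \<open>Forward problems (\<open>c = 1\<close>) carry their data at time \<open>0\<close>, backward ones (\<open>c = -1\<close>) at time \<open>T\<close>.\<close>
definition dir :: "real \<Rightarrow> real \<Rightarrow> real \<Rightarrow> bool" where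
  "dir T c t0 \<longleftrightarrow> (c = 1 \<and> t0 = 0) \<or> (c = -1 \<and> t0 = T)"

lemma dir_endpoint: "dir T c t0 \<Longrightarrow> t0 = 0 \<or> t0 = T"
  by (auto simp: dir_def)

text \<open>An unordered interval, so that forward and backward problems share one formula.\<close>

abbreviation tween :: "real \<Rightarrow> real \<Rightarrow> real set" where
  "tween s t \<equiv> {min s t<..<max s t}"

lemma indicator_fst_measurable:
  "(\<lambda>p::real \<times> 'a::euclidean_space. indicator {a<..<b} (fst p) :: real) \<in> borel_measurable borel"
  by (rule borel_measurable_coord(1)) auto

text \<open>The indicators converge wherever \<open>fst p\<close> differs from \<open>s0\<close>; as
  \<open>s0\<close> is an endpoint, the remaining slice lies outside the cylinder, where
  \<open>J\<close> vanishes.\<close>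

lemma tween_lim:
  fixes J :: "real \<times> 'a::euclidean_space \<Rightarrow> real"
  assumes J: "integrable lborel J" "\<And>p. p \<notin> Qc T \<Longrightarrow> J p = 0" and s: "s \<longlonglongrightarrow> s0" and s0: "s0 = 0 \<or> s0 = T"
  shows "(\<lambda>n. \<integral>p. indicator (tween (s n) t) (fst p) * J p \<partial>lborel)
    \<longlonglongrightarrow> (\<integral>p. indicator (tween s0 t) (fst p) * J p \<partial>lborel)"
proof (rule integral_dominated_convergence[where w="\<lambda>p. \<bar>J p\<bar>"])
  have [measurable]: "J \<in> borel_measurable borel" using J(1) by (auto dest: borel_measurable_integrable)
  show "(\<lambda>p. indicator (tween s0 t) (fst p) * J p) \<in> borel_measurable lborel"
    "(\<lambda>p. indicator (tween (s n) t) (fst p) * J p) \<in> borel_measurable lborel" for n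
    using indicator_fst_measurable[where 'a='a] by (auto intro!: borel_measurable_times)
  show "integrable lborel (\<lambda>p. \<bar>J p\<bar>)" using J(1) by simp
  show "AE p in lborel. (\<lambda>n. indicator (tween (s n) t) (fst p) * J p) \<longlonglongrightarrow> indicator (tween s0 t) (fst p) * J p"
  proof (rule AE_I2)
    fix p
    show "(\<lambda>n. indicator (tween (s n) t) (fst p) * J p) \<longlonglongrightarrow> indicator (tween s0 t) (fst p) * J p"
    proof (cases "p \<in> Qc T")
      case True
      then have "fst p \<noteq> s0" using s0 by (auto simp: Qc_def)
      then have "\<forall>\<^sub>F n in sequentially. (s n < fst p \<longleftrightarrow> s0 < fst p) \<and> (fst p < s n \<longleftrightarrow> fst p < s0)"
      proof (cases "s0 < fst p")
        case True
        from order_tendstoD(2)[OF s this] show ?thesis by eventually_elim (use True in auto)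
      next
        case False
        then have "fst p < s0" using \<open>fst p \<noteq> s0\<close> by simp
        from order_tendstoD(1)[OF s this] show ?thesis by eventually_elim (use \<open>fst p < s0\<close> in auto)
      qed
      then have "\<forall>\<^sub>F n in sequentially. indicator (tween (s n) t) (fst p) * J p = indicator (tween s0 t) (fst p) * J p"
        by eventually_elim (auto simp: indicator_def min_less_iff_disj less_max_iff_disj)
      then show ?thesis by (rule tendsto_eventually)
    qed (use J(2) in simp)
  qed
  show "AE p in lborel. norm (indicator (tween (s n) t) (fst p) * J p) \<le> \<bar>J p\<bar>" for n
    by (rule AE_I2) (auto split: split_indicator)
qed

context energy_fun
begin

text \<open>One of the two times of the energy identity is moved to the endpoint carrying the data,
  along good times at which the slices converge to the trace.\<close>

lemma energy_equality:
  fixes g :: "real \<times> 'a::euclidean_space \<Rightarrow> real"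
  assumes W: "weq c T a g D F" and T: "T > 0" and c: "dir T c t0" and tr: "ctrace T g t0 h"
  obtains N where "N \<in> null_sets lborel"
    "\<And>t. t \<notin> N \<Longrightarrow> L2 lborel (\<lambda>x. g (t, x))"
    "\<And>t. 0 < t \<Longrightarrow> t < T \<Longrightarrow> t \<notin> N \<Longrightarrow> (\<integral>x. B (g (t, x)) \<partial>lborel) = (\<integral>x. B (h x) \<partial>lborel)
      + (\<integral>p. indicator (tween t0 t) (fst p) * (F p * \<beta> (g p)
         - a * (\<Sum>b\<in>Basis. (D p \<bullet> b) * (\<gamma> (g p) * (D p \<bullet> b)))) \<partial>lborel)"
proof -
  have g: "QL2 T g" and D: "QV T D" and F: "QL2 T F" using W by (auto simp: weq_def)
  have [measurable]: "g \<in> borel_measurable borel" by (rule QL2_meas[OF g])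
  define J where "J p = F p * \<beta> (g p) - a * (\<Sum>b\<in>Basis. (D p \<bullet> b) * (\<gamma> (g p) * (D p \<bullet> b)))" for p
  have LD: "L2 lborel (\<lambda>p. D p \<bullet> b)" if "b \<in> Basis" for b using D that by (simp add: QV_def)
  have iJ: "integrable lborel J" unfolding J_def
    by (intro integrable_mult_right Bochner_Integration.integrable_diff Bochner_Integration.integrable_sum
        L2_mult L2_\<beta> QL2_L2[OF g] QL2_L2[OF F] LD L2_mult_bdd[OF LD _ \<gamma>_bound]) auto
  have Jz: "J p = 0" if "p \<notin> Qc T" for p
    using QL2_zero[OF F that] D that by (simp add: J_def QV_def del: split_paired_All)
  obtain N where N: "N \<in> null_sets lborel"
    "\<And>t. t \<notin> N \<Longrightarrow> L2 lborel (\<lambda>x. g (t, x))"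
    "\<And>s1 s2. 0 < s1 \<Longrightarrow> s1 \<le> s2 \<Longrightarrow> s2 < T \<Longrightarrow> s1 \<notin> N \<Longrightarrow> s2 \<notin> N \<Longrightarrow>
      (\<integral>x. B (g (s2, x)) \<partial>lborel) - (\<integral>x. B (g (s1, x)) \<partial>lborel)
      = (\<integral>p. indicator {s1<..<s2} (fst p) * (c * J p) \<partial>lborel)"
    using energy_identity[OF W T] unfolding J_def by blast
  have h: "L2 lborel h" using tr by (simp add: ctrace_def)
  obtain s where s: "\<And>n. 0 < s n" "\<And>n. s n < T" "\<And>n. s n \<notin> N" "s \<longlonglongrightarrow> t0"
    "(\<lambda>n. \<integral>x. (g (s n, x) - h x)^2 \<partial>lborel) \<longlonglongrightarrow> 0"
    using ctrace_seq[OF tr dir_endpoint[OF c] T N(1)] by blast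
  have "L2_lim lborel (\<lambda>n x. g (s n, x)) h" using N(2)[OF s(3)] h s(5) by (simp add: L2_lim_def)
  note lB = integral_B_lim[OF this]
  show ?thesis
  proof (rule that[OF N(1,2)])
    fix t assume t: "0 < t" "t < T" "t \<notin> N"
    \<comment> \<open>In the backward case the order of the two times is reversed, which cancels the
      sign \<open>c\<close>; both directions give the same equation.\<close>
    have "\<forall>\<^sub>F n in sequentially. (\<integral>x. B (g (s n, x)) \<partial>lborel) + (\<integral>p. indicator (tween (s n) t) (fst p) * J p \<partial>lborel)
        = (\<integral>x. B (g (t, x)) \<partial>lborel)"
      using c unfolding dir_def
    proof
      assume c: "c = 1 \<and> t0 = 0"
      from s(4) have "\<forall>\<^sub>F n in sequentially. s n < t" by (rule order_tendstoD) (use c t in auto)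
      then show ?thesis
      proof eventually_elim
        case (elim n)
        then show ?case using N(3)[OF s(1)[of n] _ t(2) s(3)[of n] t(3)] c by (simp add: min_def max_def)
      qed
    next
      assume c: "c = - 1 \<and> t0 = T"
      from s(4) have "\<forall>\<^sub>F n in sequentially. t < s n" by (rule order_tendstoD) (use c t in auto)
      then show ?thesis
      proof eventually_elim
        case (elim n)
        then show ?case using N(3)[OF t(1) _ s(2)[of n] t(3) s(3)[of n]] c by (simp add: min_def max_def)
      qed
    qed
    moreover have "(\<lambda>n. (\<integral>x. B (g (s n, x)) \<partial>lborel) + (\<integral>p. indicator (tween (s n) t) (fst p) * J p \<partial>lborel))
       \<longlonglongrightarrow> (\<integral>x. B (h x) \<partial>lborel) + (\<integral>p. indicator (tween t0 t) (fst p) * J p \<partial>lborel)"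
      by (rule tendsto_add[OF lB tween_lim[OF iJ Jz s(4) dir_endpoint[OF c]]])
    ultimately have "(\<lambda>n::nat. \<integral>x. B (g (t, x)) \<partial>lborel)
       \<longlonglongrightarrow> (\<integral>x. B (h x) \<partial>lborel) + (\<integral>p. indicator (tween t0 t) (fst p) * J p \<partial>lborel)"
      by (rule Lim_transform_eventually[rotated])
    then show "(\<integral>x. B (g (t, x)) \<partial>lborel) = (\<integral>x. B (h x) \<partial>lborel)
      + (\<integral>p. indicator (tween t0 t) (fst p) * (F p * \<beta> (g p)
         - a * (\<Sum>b\<in>Basis. (D p \<bullet> b) * (\<gamma> (g p) * (D p \<bullet> b)))) \<partial>lborel)"
      by (simp add: LIMSEQ_const_iff J_def)
  qed
qed

end

lemma has_derivative_pos_part_cube: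
  "((\<lambda>s. (max 0 s)^3) has_real_derivative 3 * (max 0 s)^2) (at s)" for s :: real
proof -
  consider "s > 0" | "s < 0" | "s = 0" by linarith
  then show ?thesis
  proof cases
    case 1
    have "((\<lambda>s. s^3) has_real_derivative 3 * (max 0 s)^2) (at s)"
      using 1 by (auto intro!: derivative_eq_intros)
    then show ?thesis
      by (rule has_field_derivative_transform_within_open[where S="{0<..}"]) (use 1 in auto)
  next
    case 2
    have "((\<lambda>s. 0) has_real_derivative 3 * (max 0 s)^2) (at s)" using 2 by auto
    then show ?thesis
      by (rule has_field_derivative_transform_within_open[where S="{..<0}"]) (use 2 in auto)
  next
    case 3
    have "((\<lambda>h::real. ((max 0 h)^3) / h) \<longlongrightarrow> 0) (at 0)"
    proof (rule Lim_null_comparison[OF always_eventually])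
      show "\<forall>h::real. norm ((max 0 h)^3 / h) \<le> \<bar>h\<bar>^2"
        by (auto simp: max_def power3_eq_cube power2_eq_square)
    qed (auto intro!: tendsto_eq_intros)
    then show ?thesis using 3 by (simp add: DERIV_def)
  qed
qed

text \<open>A convex \<open>C2\<close> substitute for half the square of the positive part, whose second derivative is Lipschitz.\<close>
definition trB :: "real \<Rightarrow> real" where "trB y = ((max 0 y)^3 - (max 0 (y - 1))^3) / 6"
definition tr\<beta> :: "real \<Rightarrow> real" where "tr\<beta> y = ((max 0 y)^2 - (max 0 (y - 1))^2) / 2"
definition tr\<gamma> :: "real \<Rightarrow> real" where "tr\<gamma> y = max 0 y - max 0 (y - 1)"

text \<open>\<open>tr\<gamma>\<close> rises linearly from 0 to 1 on the unit interval and is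
  constant outside; the constant 2 adds the Lipschitz constants of its two positive parts.\<close>

lemma tr_energy: "energy_fun trB tr\<beta> tr\<gamma> 2"
proof
  fix y z :: real
  have d: "((\<lambda>y. y - 1) has_real_derivative 1) (at y)" by (auto intro!: derivative_eq_intros)
  have s1: "((\<lambda>y. (max 0 (y - 1))^3) has_real_derivative 3 * (max 0 (y - 1))^2) (at y)"
    using DERIV_chain2[where f="\<lambda>s. (max 0 s)^3", OF has_derivative_pos_part_cube d] by simp
  have s2: "((\<lambda>y. (max 0 (y - 1))^2) has_real_derivative 2 * max 0 (y - 1)) (at y)"
    using DERIV_chain2[where f="\<lambda>s. (max 0 s)^2", OF has_derivative_pos_part_sq d] by simp
  show "(trB has_real_derivative tr\<beta> y) (at y)"
    unfolding trB_def[abs_def] tr\<beta>_def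
    by (rule DERIV_cong[OF DERIV_cdivide[OF DERIV_diff[OF has_derivative_pos_part_cube s1]]]) simp
  show "(tr\<beta> has_real_derivative tr\<gamma> y) (at y)"
    unfolding tr\<beta>_def[abs_def] tr\<gamma>_def
    by (rule DERIV_cong[OF DERIV_cdivide[OF DERIV_diff[OF has_derivative_pos_part_sq s2]]]) simp
  show "\<bar>tr\<gamma> y\<bar> \<le> 1" "\<bar>tr\<gamma> y - tr\<gamma> z\<bar> \<le> 2 * \<bar>y - z\<bar>"
    by (auto simp: tr\<gamma>_def max_def)
qed (auto simp: trB_def tr\<beta>_def)

lemma tr_nonneg: "0 \<le> trB y" "0 \<le> tr\<beta> y" "0 \<le> tr\<gamma> y"
proof -
  have "max 0 (y - 1) \<le> max 0 y" by auto
  then show "0 \<le> trB y" "0 \<le> tr\<beta> y" "0 \<le> tr\<gamma> y"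
    using power_mono[of "max 0 (y - 1)" "max 0 y"] by (auto simp: trB_def tr\<beta>_def tr\<gamma>_def)
qed

lemma tr_nonpos: "y \<le> 0 \<Longrightarrow> trB y = 0" "y \<le> 0 \<Longrightarrow> tr\<beta> y = 0"
  by (auto simp: trB_def tr\<beta>_def)

lemma trB_pos: "trB y \<le> 0 \<Longrightarrow> y \<le> 0"
proof (rule ccontr)
  assume "trB y \<le> 0" "\<not> y \<le> 0"
  moreover have "(max 0 (y - 1))^3 < (max 0 y)^3"
    using \<open>\<not> y \<le> 0\<close> by (intro power_strict_mono) auto
  ultimately show False by (simp add: trB_def)
qed

lemma AE_nonpos_of_slices:
  fixes g :: "real \<times> 'a::euclidean_space \<Rightarrow> real"
  assumes g: "g \<in> borel_measurable borel" and s: "AE t in lborel. AE x in lborel. g (t, x) \<le> 0"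
  shows "AE p in lborel. g p \<le> 0"
proof -
  have [measurable]: "g \<in> borel_measurable (lborel \<Otimes>\<^sub>M lborel)" using g by (simp add: lborel_prod)
  have "AE p in lborel \<Otimes>\<^sub>M lborel. g p \<le> 0"
    by (rule lborel_pair.AE_pair_measure[OF _ s]) measurable
  then show ?thesis by (subst (asm) lborel_prod)
qed

text \<open>The energy \<open>trB\<close> of \<open>g\<close> starts at 0 and cannot grow:
  \<open>tr\<beta> (g)\<close> lives where \<open>g > 0\<close>, where the source is not positive,
  and the diffusion term has the right sign since \<open>trB\<close> is convex. A vanishing
  \<open>trB\<close> means \<open>g \<le> 0\<close>.\<close>

lemma comparison:
  fixes g :: "real \<times> 'a::euclidean_space \<Rightarrow> real"
  assumes W: "weq c T a g D F" and T: "T > 0" and c: "dir T c t0" and tr: "ctrace T g t0 h"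
    and a: "0 \<le> a" and h: "AE x in lborel. h x \<le> 0"
    and F: "AE p in lborel. 0 < g p \<longrightarrow> F p \<le> 0"
  shows "AE p in lborel. g p \<le> 0"
proof -
  interpret energy_fun trB tr\<beta> tr\<gamma> 2 by (rule tr_energy)
  have g: "QL2 T g" using W by (auto simp: weq_def)
  obtain N where N: "N \<in> null_sets lborel"
    "\<And>t. t \<notin> N \<Longrightarrow> L2 lborel (\<lambda>x. g (t, x))"
    "\<And>t. 0 < t \<Longrightarrow> t < T \<Longrightarrow> t \<notin> N \<Longrightarrow> (\<integral>x. trB (g (t, x)) \<partial>lborel) = (\<integral>x. trB (h x) \<partial>lborel)
      + (\<integral>p. indicator (tween t0 t) (fst p) * (F p * tr\<beta> (g p)
         - a * (\<Sum>b\<in>Basis. (D p \<bullet> b) * (tr\<gamma> (g p) * (D p \<bullet> b)))) \<partial>lborel)"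
    using energy_equality[OF W T c tr] by blast
  have "AE x in lborel. trB (h x) = 0" using h by eventually_elim (simp add: tr_nonpos)
  then have h0: "(\<integral>x. trB (h x) \<partial>lborel) = 0" by (rule integral_eq_zero_AE)
  have sl: "AE x in lborel. g (t, x) \<le> 0" if t: "t \<notin> N" for t
  proof (cases "0 < t \<and> t < T")
    case True
    have "(\<integral>p. indicator (tween t0 t) (fst p) * (F p * tr\<beta> (g p)
         - a * (\<Sum>b\<in>Basis. (D p \<bullet> b) * (tr\<gamma> (g p) * (D p \<bullet> b)))) \<partial>lborel) \<le> 0"
    proof -
      have "AE p in lborel. 0 \<le> - (indicator (tween t0 t) (fst p) * (F p * tr\<beta> (g p)
         - a * (\<Sum>b\<in>Basis. (D p \<bullet> b) * (tr\<gamma> (g p) * (D p \<bullet> b)))))"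
        using F
      proof eventually_elim
        case (elim p)
        have "F p * tr\<beta> (g p) \<le> 0"
          using elim tr_nonneg(2)[of "g p"] tr_nonpos(2)[of "g p"]
          by (cases "0 < g p") (auto intro: mult_nonpos_nonneg)
        moreover have "0 \<le> a * (\<Sum>b\<in>Basis. (D p \<bullet> b) * (tr\<gamma> (g p) * (D p \<bullet> b)))"
        proof (rule mult_nonneg_nonneg[OF a sum_nonneg])
          fix b
          have "0 \<le> tr\<gamma> (g p) * (D p \<bullet> b)^2" using tr_nonneg(3) by simp
          then show "0 \<le> (D p \<bullet> b) * (tr\<gamma> (g p) * (D p \<bullet> b))" by (simp add: power2_eq_square mult_ac)
        qed
        ultimately show ?case by (auto split: split_indicator)
      qed
      from integral_nonneg_AE[OF this] show ?thesis by simp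
    qed
    then have "(\<integral>x. trB (g (t, x)) \<partial>lborel) \<le> 0" using N(3) True t h0 by simp
    moreover have "0 \<le> (\<integral>x. trB (g (t, x)) \<partial>lborel)" by (simp add: tr_nonneg)
    ultimately have "AE x in lborel. trB (g (t, x)) = 0"
      using integral_nonneg_eq_0_iff_AE[OF integrable_B[OF N(2)[OF t]]] tr_nonneg(1) by simp
    then show ?thesis by eventually_elim (simp add: trB_pos)
  next
    case False
    then have "g (t, x) = 0" for x by (intro QL2_zero[OF g]) (auto simp: Qc_def)
    then show ?thesis by simp
  qed
  have "AE t in lborel. t \<notin> N" by (rule AE_not_in[OF N(1)])
  then have "AE t in lborel. AE x in lborel. g (t, x) \<le> 0" by eventually_elim (rule sl)
  then show ?thesis by (rule AE_nonpos_of_slices[OF QL2_meas[OF g]])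
qed

text \<open>Young's inequality for \<open>F * g\<close>. The norm of \<open>g\<close> over the
  cylinder stays on the right, because it is under control whenever the estimate is applied; thus no
  Gronwall argument enters.\<close>

lemma energy_estimate:
  fixes g :: "real \<times> 'a::euclidean_space \<Rightarrow> real"
  assumes W: "weq c T a g D F" and T: "T > 0" and c: "dir T c t0" and tr: "ctrace T g t0 h" and a: "0 \<le> a"
  defines "R \<equiv> (\<integral>x. (h x)^2 \<partial>lborel) + (\<integral>p. (F p)^2 \<partial>lborel) + (\<integral>p. (g p)^2 \<partial>lborel)"
  shows "AE t in lborel. (\<integral>x. (g (t, x))^2 \<partial>lborel) \<le> R"
    and "2 * a * (\<Sum>b\<in>Basis. \<integral>p. (D p \<bullet> b)^2 \<partial>lborel) \<le> R"
proof -
  have quad: "energy_fun (\<lambda>y. y^2 / 2) (\<lambda>y. y) (\<lambda>y. 1) 0"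
    by standard (auto intro!: derivative_eq_intros)
  have g: "QL2 T g" and D: "QV T D" and F: "QL2 T F" using W by (auto simp: weq_def)
  have Lg: "L2 lborel g" and LF: "L2 lborel F" by (auto intro: QL2_L2 g F)
  have LD: "L2 lborel (\<lambda>p. D p \<bullet> b)" if "b \<in> Basis" for b using D that by (simp add: QV_def)
  have R0: "0 \<le> R" unfolding R_def by simp
  obtain N where N: "N \<in> null_sets lborel"
    "\<And>t. t \<notin> N \<Longrightarrow> L2 lborel (\<lambda>x. g (t, x))"
    "\<And>t. 0 < t \<Longrightarrow> t < T \<Longrightarrow> t \<notin> N \<Longrightarrow> (\<integral>x. (g (t, x))^2 / 2 \<partial>lborel) = (\<integral>x. (h x)^2 / 2 \<partial>lborel)
      + (\<integral>p. indicator (tween t0 t) (fst p) * (F p * g p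
         - a * (\<Sum>b\<in>Basis. (D p \<bullet> b) * (1 * (D p \<bullet> b)))) \<partial>lborel)"
    using energy_fun.energy_equality[OF quad W T c tr] by blast
  define Q where "Q p = (\<Sum>b\<in>Basis. (D p \<bullet> b)^2)" for p
  have Q: "(\<Sum>b\<in>Basis. (D p \<bullet> b) * (1 * (D p \<bullet> b))) = Q p" for p by (simp add: Q_def power2_eq_square)
  have iQ: "integrable lborel Q" unfolding Q_def by (intro Bochner_Integration.integrable_sum L2_sq LD)
  have iFg: "integrable lborel (\<lambda>p. F p * g p)" by (rule L2_mult[OF LF Lg])
  have ind: "integrable lborel (\<lambda>p::real \<times> 'a. indicator (tween s t) (fst p) * k p)" if "integrable lborel k"
    for k :: "real \<times> 'a \<Rightarrow> real" and s t
  proof (rule Bochner_Integration.integrable_bound[OF that])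
    have "k \<in> borel_measurable borel" using borel_measurable_integrable[OF that] by simp
    then have "(\<lambda>p. indicator (tween s t) (fst p) * k p) \<in> borel_measurable borel"
      by (rule borel_measurable_times[OF indicator_fst_measurable])
    then show "(\<lambda>p. indicator (tween s t) (fst p) * k p) \<in> borel_measurable lborel" by simp
    show "AE p in lborel. norm (indicator (tween s t) (fst p) * k p) \<le> norm (k p)"
      by (rule AE_I2) (simp add: indicator_def)
  qed
  have key: "(\<integral>x. (g (t, x))^2 \<partial>lborel) + 2 * a * (\<integral>p. indicator (tween t0 t) (fst p) * Q p \<partial>lborel) \<le> R"
    if t: "0 < t" "t < T" "t \<notin> N" for t
  proof -
    have "(\<integral>p. indicator (tween t0 t) (fst p) * (F p * g p - a * Q p) \<partial>lborel)
      = (\<integral>p. indicator (tween t0 t) (fst p) * (F p * g p) - a * (indicator (tween t0 t) (fst p) * Q p) \<partial>lborel)"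
      by (rule Bochner_Integration.integral_cong) (auto simp: algebra_simps)
    also have "\<dots> = (\<integral>p. indicator (tween t0 t) (fst p) * (F p * g p) \<partial>lborel)
        - a * (\<integral>p. indicator (tween t0 t) (fst p) * Q p \<partial>lborel)"
      using ind[OF iFg] ind[OF iQ] by simp
    also have "(\<integral>p. indicator (tween t0 t) (fst p) * (F p * g p) \<partial>lborel)
        \<le> (\<integral>p. ((F p)^2 + (g p)^2) / 2 \<partial>lborel)"
    proof (rule integral_mono)
      show "integrable lborel (\<lambda>p. ((F p)^2 + (g p)^2) / 2)" using L2_sq[OF LF] L2_sq[OF Lg] by simp
      fix p :: "real \<times> 'a"
      have "0 \<le> (F p - g p)^2" by simp
      then have "F p * g p \<le> ((F p)^2 + (g p)^2) / 2" by (simp add: power2_diff)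
      then show "indicator (tween t0 t) (fst p) * (F p * g p) \<le> ((F p)^2 + (g p)^2) / 2"
        by (simp split: split_indicator)
    qed (rule ind[OF iFg])
    also have "(\<integral>p. ((F p)^2 + (g p)^2) / 2 \<partial>lborel) = ((\<integral>p. (F p)^2 \<partial>lborel) + (\<integral>p. (g p)^2 \<partial>lborel)) / 2"
      using L2_sq[OF LF] L2_sq[OF Lg] by simp
    finally show ?thesis using N(3)[OF t] unfolding Q R_def by (simp add: algebra_simps)
  qed
  show "AE t in lborel. (\<integral>x. (g (t, x))^2 \<partial>lborel) \<le> R"
    using AE_not_in[OF N(1)]
  proof eventually_elim
    case (elim t)
    show ?case
    proof (cases "0 < t \<and> t < T")
      case True
      have "0 \<le> (\<integral>p. indicator (tween t0 t) (fst p) * Q p \<partial>lborel)"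
        by (intro integral_nonneg_AE AE_I2) (auto simp: Q_def intro!: sum_nonneg mult_nonneg_nonneg)
      then have "0 \<le> 2 * a * (\<integral>p. indicator (tween t0 t) (fst p) * Q p \<partial>lborel)" using a by simp
      then show ?thesis using key[of t] True elim by linarith
    next
      case False
      then have "g (t, x) = 0" for x by (intro QL2_zero[OF g]) (auto simp: Qc_def)
      then show ?thesis using R0 by simp
    qed
  qed
  \<comment> \<open>The endpoint opposite to the data: letting the time tend to it extends the
    gradient bound to the whole cylinder.\<close>
  define t1 where "t1 = T - t0"
  have t1: "t1 = 0 \<or> t1 = T" using dir_endpoint[OF c] by (auto simp: t1_def)
  have "\<forall>n. \<exists>t. 0 < t \<and> t < T \<and> \<bar>t - t1\<bar> < inverse (real (Suc n)) \<and> t \<notin> N"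
    by (intro allI near_endpoint[OF t1 T _ N(1)]) simp
  from choice[OF this] obtain s where s: "\<And>n. 0 < s n" "\<And>n. s n < T" "\<And>n. \<bar>s n - t1\<bar> < inverse (real (Suc n))" "\<And>n. s n \<notin> N"
    by blast
  have "(\<lambda>n. s n - t1) \<longlonglongrightarrow> 0"
    by (rule Lim_null_comparison[OF always_eventually LIMSEQ_inverse_real_of_nat])
       (use s(3) in \<open>auto intro: less_imp_le\<close>)
  then have st: "s \<longlonglongrightarrow> t1" by (simp add: LIM_zero_iff)
  have Qz: "Q p = 0" if "p \<notin> Qc T" for p using D that by (simp add: Q_def QV_def del: split_paired_All)
  have "tween (s n) t0 = tween t0 (s n)" for n by (simp add: min.commute max.commute)
  then have "(\<lambda>n. \<integral>p. indicator (tween t0 (s n)) (fst p) * Q p \<partial>lborel)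
      \<longlonglongrightarrow> (\<integral>p. indicator (tween t1 t0) (fst p) * Q p \<partial>lborel)"
    using tween_lim[OF iQ Qz st t1, of t0] by simp
  moreover have "(\<integral>p. indicator (tween t1 t0) (fst p) * Q p \<partial>lborel) = (\<integral>p. Q p \<partial>lborel)"
  proof (rule Bochner_Integration.integral_cong[OF refl])
    fix p :: "real \<times> 'a"
    have "tween t1 t0 = {0<..<T}" using dir_endpoint[OF c] T by (auto simp: t1_def)
    then show "indicator (tween t1 t0) (fst p) * Q p = Q p"
      using Qz[of p] by (cases "p \<in> Qc T") (auto simp: Qc_def)
  qed
  ultimately have "(\<lambda>n. 2 * a * (\<integral>p. indicator (tween t0 (s n)) (fst p) * Q p \<partial>lborel)) \<longlonglongrightarrow> 2 * a * (\<integral>p. Q p \<partial>lborel)"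
    by (intro tendsto_mult_left) simp
  moreover have "2 * a * (\<integral>p. indicator (tween t0 (s n)) (fst p) * Q p \<partial>lborel) \<le> R" for n
  proof -
    have "0 \<le> (\<integral>x. (g (s n, x))^2 \<partial>lborel)" by simp
    then show ?thesis using key[OF s(1,2,4), of n] by linarith
  qed
  ultimately have "2 * a * (\<integral>p. Q p \<partial>lborel) \<le> R" by (intro LIMSEQ_le_const2) auto
  moreover have "(\<integral>p. Q p \<partial>lborel) = (\<Sum>b\<in>Basis. \<integral>p. (D p \<bullet> b)^2 \<partial>lborel)"
    unfolding Q_def by (rule Bochner_Integration.integral_sum) (rule L2_sq[OF LD])
  ultimately show "2 * a * (\<Sum>b\<in>Basis. \<integral>p. (D p \<bullet> b)^2 \<partial>lborel) \<le> R" by simp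
qed

subsection \<open>Differences and limits of weak solutions\<close>

lemma test_fun_H1g_tensor:
  assumes v: "H1g v G" and t: "test_fun {0<..<T} \<eta> D\<eta>"
  shows "L2 lborel (\<lambda>p. v (snd p) * D\<eta> (fst p :: real))" "L2 lborel (\<lambda>p. v (snd p) * \<eta> (fst p))"
    "b \<in> Basis \<Longrightarrow> L2 lborel (\<lambda>p. (G (snd p) \<bullet> b) * \<eta> (fst p))"
  using L2_tensor[OF _ H1g_props(1)[OF v], of D\<eta>] L2_tensor[OF _ H1g_props(1)[OF v], of \<eta>]
    L2_tensor[OF _ H1g_props(2)[OF v], of \<eta> b] test_fun_L2(1)[OF t] test_fun_L2(2)[OF t, of 1]
  by auto

text \<open>Linearity: the nonlinear term has been frozen into the source, so differences of
  solutions are again solutions.\<close>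

lemma weq_diff:
  fixes g1 g2 :: "real \<times> 'a::euclidean_space \<Rightarrow> real"
  assumes W1: "weq c T a g1 D1 F1" and W2: "weq c T a g2 D2 F2"
  shows "weq c T a (\<lambda>p. g1 p - g2 p) (\<lambda>p. D1 p - D2 p) (\<lambda>p. F1 p - F2 p)"
proof -
  note w1 = W1[unfolded weq_def] and w2 = W2[unfolded weq_def]
  have LD: "L2 lborel (\<lambda>p. D1 p \<bullet> b)" "L2 lborel (\<lambda>p. D2 p \<bullet> b)" if "b \<in> Basis" for b
    using w1 w2 that by (auto simp: QV_def)
  have Lg: "L2 lborel g1" "L2 lborel g2" "L2 lborel F1" "L2 lborel F2"
    using w1 w2 by (auto intro: QL2_L2)
  have q: "QL2 T (\<lambda>p. g1 p - g2 p)" "QL2 T (\<lambda>p. F1 p - F2 p)" using w1 w2 by (auto intro: QL2_diff)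
  have QD: "QV T (\<lambda>p. D1 p - D2 p)"
    using w1 w2 by (auto simp: QV_def inner_diff_left intro!: L2_diff)
  have sl: "AE t in lborel. \<forall>b\<in>Basis. L2 lborel (\<lambda>x. D1 (t, x) \<bullet> b) \<and> L2 lborel (\<lambda>x. D2 (t, x) \<bullet> b)"
  proof (subst AE_ball_countable[OF countable_finite[OF finite_Basis]], rule ballI)
    fix b :: 'a assume "b \<in> Basis"
    show "AE t in lborel. L2 lborel (\<lambda>x. D1 (t, x) \<bullet> b) \<and> L2 lborel (\<lambda>x. D2 (t, x) \<bullet> b)"
      using AE_L2_slice(1)[OF LD(1)[OF \<open>b \<in> Basis\<close>]] AE_L2_slice(1)[OF LD(2)[OF \<open>b \<in> Basis\<close>]]
      by eventually_elim simp
  qed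
  have wg1: "AE t in lborel. wgrad (\<lambda>x. g1 (t, x)) (\<lambda>x. D1 (t, x))"
    and wg2: "AE t in lborel. wgrad (\<lambda>x. g2 (t, x)) (\<lambda>x. D2 (t, x))" using w1 w2 by auto
  have wg: "AE t in lborel. wgrad (\<lambda>x. g1 (t, x) - g2 (t, x)) (\<lambda>x. D1 (t, x) - D2 (t, x))"
    using wg1 wg2 AE_L2_slice(1)[OF Lg(1)] AE_L2_slice(1)[OF Lg(2)] sl
  proof eventually_elim
    case (elim t)
    show ?case unfolding wgrad_def
    proof (intro allI impI ballI)
      fix \<phi> :: "'a \<Rightarrow> real" and D\<phi> and b :: 'a
      assume t: "test_fun Om \<phi> D\<phi>" and b: "b \<in> Basis"
      note T = test_fun_L2[OF t]
      have "(\<integral>x. (g1 (t, x) - g2 (t, x)) * (D\<phi> x \<bullet> b) \<partial>lborel)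
        = (\<integral>x. g1 (t, x) * (D\<phi> x \<bullet> b) \<partial>lborel) - (\<integral>x. g2 (t, x) * (D\<phi> x \<bullet> b) \<partial>lborel)"
        using L2_mult[OF elim(3) T(2)] L2_mult[OF elim(4) T(2)] by (simp add: left_diff_distrib)
      also have "\<dots> = - (\<integral>x. (D1 (t, x) \<bullet> b) * \<phi> x \<partial>lborel) + (\<integral>x. (D2 (t, x) \<bullet> b) * \<phi> x \<partial>lborel)"
        using elim(1,2) t b by (simp add: wgrad_def)
      also have "\<dots> = - (\<integral>x. ((D1 (t, x) - D2 (t, x)) \<bullet> b) * \<phi> x \<partial>lborel)"
        using L2_mult[OF _ T(1), of "\<lambda>x. D1 (t, x) \<bullet> b"] L2_mult[OF _ T(1), of "\<lambda>x. D2 (t, x) \<bullet> b"] elim(5) b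
        by (simp add: inner_diff_left left_diff_distrib)
      finally show "(\<integral>x. (g1 (t, x) - g2 (t, x)) * (D\<phi> x \<bullet> b) \<partial>lborel)
          = - (\<integral>x. ((D1 (t, x) - D2 (t, x)) \<bullet> b) * \<phi> x \<partial>lborel)" .
    qed
  qed
  have eq: "(\<integral>p. (g1 p - g2 p) * (v (snd p) * D\<eta> (fst p)) \<partial>lborel)
        = c * (a * (\<Sum>b\<in>Basis. \<integral>p. ((D1 p - D2 p) \<bullet> b) * ((G (snd p) \<bullet> b) * \<eta> (fst p)) \<partial>lborel)
               - (\<integral>p. (F1 p - F2 p) * (v (snd p) * \<eta> (fst p)) \<partial>lborel))"
    if v: "H1g v G" and t: "test_fun {0<..<T} \<eta> D\<eta>" for v G \<eta> D\<eta>
  proof -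
    note Z = test_fun_H1g_tensor[OF v t]
    have s: "(\<Sum>b\<in>Basis. \<integral>p. ((D1 p - D2 p) \<bullet> b) * ((G (snd p) \<bullet> b) * \<eta> (fst p)) \<partial>lborel)
        = (\<Sum>b\<in>Basis. \<integral>p. (D1 p \<bullet> b) * ((G (snd p) \<bullet> b) * \<eta> (fst p)) \<partial>lborel)
          - (\<Sum>b\<in>Basis. \<integral>p. (D2 p \<bullet> b) * ((G (snd p) \<bullet> b) * \<eta> (fst p)) \<partial>lborel)"
      unfolding sum_subtractf[symmetric]
      by (rule sum.cong) (use L2_mult[OF LD(1) Z(3)] L2_mult[OF LD(2) Z(3)] in \<open>auto simp: inner_diff_left left_diff_distrib\<close>)
    have i: "(\<integral>p. (k1 p - k2 p) * z p \<partial>lborel) = (\<integral>p. k1 p * z p \<partial>lborel) - (\<integral>p. k2 p * z p \<partial>lborel)"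
      if "L2 lborel k1" "L2 lborel k2" "L2 lborel z" for k1 k2 z :: "real \<times> 'a \<Rightarrow> real"
      using L2_mult[OF that(1,3)] L2_mult[OF that(2,3)] by (simp add: left_diff_distrib)
    have e1: "(\<integral>p. g1 p * (v (snd p) * D\<eta> (fst p)) \<partial>lborel)
        = c * (a * (\<Sum>b\<in>Basis. \<integral>p. (D1 p \<bullet> b) * ((G (snd p) \<bullet> b) * \<eta> (fst p)) \<partial>lborel)
               - (\<integral>p. F1 p * (v (snd p) * \<eta> (fst p)) \<partial>lborel))" using w1 v t by blast
    have e2: "(\<integral>p. g2 p * (v (snd p) * D\<eta> (fst p)) \<partial>lborel)
        = c * (a * (\<Sum>b\<in>Basis. \<integral>p. (D2 p \<bullet> b) * ((G (snd p) \<bullet> b) * \<eta> (fst p)) \<partial>lborel)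
               - (\<integral>p. F2 p * (v (snd p) * \<eta> (fst p)) \<partial>lborel))" using w2 v t by blast
    show ?thesis unfolding s i[OF Lg(1,2) Z(1)] i[OF Lg(3,4) Z(2)] e1 e2 by (simp add: algebra_simps)
  qed
  show ?thesis unfolding weq_def using q QD wg eq by blast
qed

text \<open>One common subsequence for all components of a gradient, obtained by passing to
  successive subsequences.\<close>

lemma L2_lim_slice_subseq_family:
  fixes X :: "'i \<Rightarrow> nat \<Rightarrow> 'c::euclidean_space \<times> 'a::euclidean_space \<Rightarrow> real"
  assumes "finite I" "\<And>i. i \<in> I \<Longrightarrow> L2_lim lborel (X i) (u i)"
  shows "\<exists>r. strict_mono r \<and> (\<forall>i\<in>I. AE t in lborel. L2_lim lborel (\<lambda>n x. X i (r n) (t, x)) (\<lambda>x. u i (t, x)))"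
  using assms
proof (induction I rule: finite_induct)
  case empty
  show ?case by (intro exI[of _ id]) (auto simp: strict_mono_def)
next
  case (insert j I)
  then obtain r where r: "strict_mono r" "\<forall>i\<in>I. AE t in lborel. L2_lim lborel (\<lambda>n x. X i (r n) (t, x)) (\<lambda>x. u i (t, x))"
    by auto
  have "L2_lim lborel (\<lambda>n. X j (r n)) (u j)" by (rule L2_lim_subseq[OF _ r(1)]) (use insert in auto)
  then obtain s where s: "strict_mono s" "AE t in lborel. L2_lim lborel (\<lambda>n x. X j (r (s n)) (t, x)) (\<lambda>x. u j (t, x))"
    by (rule L2_lim_slice_subseq)
  have "AE t in lborel. L2_lim lborel (\<lambda>n x. X i (r (s n)) (t, x)) (\<lambda>x. u i (t, x))" if "i \<in> I" for i
    using r(2)[rule_format, OF that] by eventually_elim (rule L2_lim_subseq[OF _ s(1)])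
  moreover have "strict_mono (\<lambda>n. r (s n))" using strict_mono_o[OF r(1) s(1)] by (simp only: o_def)
  ultimately show ?case using s(2) by (intro exI[of _ "\<lambda>n. r (s n)"]) auto
qed

text \<open>Each term of the tested equation is bilinear in the solution and the test function,
  hence passes to strong limits. The gradient relation is a statement on slices and needs a
  subsequence along which almost every slice converges.\<close>

lemma weq_lim:
  fixes g :: "nat \<Rightarrow> real \<times> 'a::euclidean_space \<Rightarrow> real"
  assumes W: "\<And>n. weq c T a (g n) (D n) (F n)"
    and lg: "L2_lim lborel g g'" and lD: "\<And>b. b \<in> Basis \<Longrightarrow> L2_lim lborel (\<lambda>n p. D n p \<bullet> b) (\<lambda>p. D' p \<bullet> b)"
    and lF: "L2_lim lborel F F'" and z: "QL2 T g'" "QV T D'" "QL2 T F'"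
  shows "weq c T a g' D' F'"
proof -
  note w = W[unfolded weq_def]
  obtain r where r: "strict_mono r" "AE t in lborel. L2_lim lborel (\<lambda>n x. g (r n) (t, x)) (\<lambda>x. g' (t, x))"
    by (rule L2_lim_slice_subseq[OF lg])
  obtain s where s: "strict_mono s"
    "\<forall>b\<in>Basis. AE t in lborel. L2_lim lborel (\<lambda>n x. D (r (s n)) (t, x) \<bullet> b) (\<lambda>x. D' (t, x) \<bullet> b)"
    using L2_lim_slice_subseq_family[OF finite_Basis, of "\<lambda>b n p. D (r n) p \<bullet> b" "\<lambda>b p. D' p \<bullet> b"]
      L2_lim_subseq[OF lD r(1)] by auto
  have s2: "AE t in lborel. \<forall>b\<in>Basis. L2_lim lborel (\<lambda>n x. D (r (s n)) (t, x) \<bullet> b) (\<lambda>x. D' (t, x) \<bullet> b)"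
    using s(2) by (subst AE_ball_countable[OF countable_finite[OF finite_Basis]])
  have s1: "AE t in lborel. \<forall>n. wgrad (\<lambda>x. g n (t, x)) (\<lambda>x. D n (t, x))"
    using w by (simp add: AE_all_countable)
  have wg: "AE t in lborel. wgrad (\<lambda>x. g' (t, x)) (\<lambda>x. D' (t, x))"
    using r(2) s2 s1
  proof eventually_elim
    case (elim t)
    show ?case unfolding wgrad_def
    proof (intro allI impI ballI)
      fix \<phi> :: "'a \<Rightarrow> real" and D\<phi> and b :: 'a
      assume t: "test_fun Om \<phi> D\<phi>" and b: "b \<in> Basis"
      note T = test_fun_L2[OF t]
      have "(\<lambda>n. \<integral>x. g (r (s n)) (t, x) * (D\<phi> x \<bullet> b) \<partial>lborel) \<longlonglongrightarrow> (\<integral>x. g' (t, x) * (D\<phi> x \<bullet> b) \<partial>lborel)"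
        by (intro L2_lim_inner L2_lim_const T L2_lim_subseq[OF elim(1) s(1)])
      moreover have "(\<lambda>n. - (\<integral>x. (D (r (s n)) (t, x) \<bullet> b) * \<phi> x \<partial>lborel)) \<longlonglongrightarrow> - (\<integral>x. (D' (t, x) \<bullet> b) * \<phi> x \<partial>lborel)"
        by (intro tendsto_minus L2_lim_inner L2_lim_const T) (use elim(2) b in blast)
      moreover have "(\<integral>x. g (r (s n)) (t, x) * (D\<phi> x \<bullet> b) \<partial>lborel) = - (\<integral>x. (D (r (s n)) (t, x) \<bullet> b) * \<phi> x \<partial>lborel)" for n
        using elim(3) t b by (simp add: wgrad_def)
      ultimately show "(\<integral>x. g' (t, x) * (D\<phi> x \<bullet> b) \<partial>lborel) = - (\<integral>x. (D' (t, x) \<bullet> b) * \<phi> x \<partial>lborel)"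
        by (simp only: LIMSEQ_unique)
    qed
  qed
  have eq: "(\<integral>p. g' p * (v (snd p) * D\<eta> (fst p)) \<partial>lborel)
        = c * (a * (\<Sum>b\<in>Basis. \<integral>p. (D' p \<bullet> b) * ((G (snd p) \<bullet> b) * \<eta> (fst p)) \<partial>lborel)
               - (\<integral>p. F' p * (v (snd p) * \<eta> (fst p)) \<partial>lborel))"
    if v: "H1g v G" and t: "test_fun {0<..<T} \<eta> D\<eta>" for v G \<eta> D\<eta>
  proof (rule LIMSEQ_unique)
    note Z = test_fun_H1g_tensor[OF v t]
    show "(\<lambda>n. \<integral>p. g n p * (v (snd p) * D\<eta> (fst p)) \<partial>lborel) \<longlonglongrightarrow> (\<integral>p. g' p * (v (snd p) * D\<eta> (fst p)) \<partial>lborel)"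
      by (intro L2_lim_inner L2_lim_const lg Z)
    have "(\<integral>p. g n p * (v (snd p) * D\<eta> (fst p)) \<partial>lborel)
        = c * (a * (\<Sum>b\<in>Basis. \<integral>p. (D n p \<bullet> b) * ((G (snd p) \<bullet> b) * \<eta> (fst p)) \<partial>lborel)
               - (\<integral>p. F n p * (v (snd p) * \<eta> (fst p)) \<partial>lborel))" for n using w[of n] v t by blast
    then show "(\<lambda>n. \<integral>p. g n p * (v (snd p) * D\<eta> (fst p)) \<partial>lborel) \<longlonglongrightarrow>
       c * (a * (\<Sum>b\<in>Basis. \<integral>p. (D' p \<bullet> b) * ((G (snd p) \<bullet> b) * \<eta> (fst p)) \<partial>lborel)
               - (\<integral>p. F' p * (v (snd p) * \<eta> (fst p)) \<partial>lborel))"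
      by (simp only:) (intro tendsto_mult tendsto_diff tendsto_sum tendsto_const L2_lim_inner L2_lim_const lD lF Z)
  qed
  show ?thesis unfolding weq_def using z wg eq by blast
qed

lemma L2_lim_Cauchy:
  assumes X: "L2_lim M X u" and e: "e > 0"
  shows "\<exists>N. \<forall>m\<ge>N. \<forall>n\<ge>N. (\<integral>x. (X m x - X n x)^2 \<partial>M) < e"
proof -
  have L: "L2 M (X n)" "L2 M u" for n using X by (auto simp: L2_lim_def)
  have "(\<lambda>n. \<integral>x. (X n x - u x)^2 \<partial>M) \<longlonglongrightarrow> 0" using X by (simp add: L2_lim_def)
  from LIMSEQ_D[OF this, of "e / 4"] e obtain N where N: "\<And>n. n \<ge> N \<Longrightarrow> (\<integral>x. (X n x - u x)^2 \<partial>M) < e / 4" by auto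
  have "(\<integral>x. (X m x - X n x)^2 \<partial>M) < e" if "m \<ge> N" "n \<ge> N" for m n
  proof -
    have "(\<integral>x. (u x - X n x)^2 \<partial>M) = (\<integral>x. (X n x - u x)^2 \<partial>M)" by (simp add: power2_commute)
    then show ?thesis using L2_triangle_diff[OF L(1)[of m] L(2) L(1)[of n]] N[OF that(1)] N[OF that(2)] by linarith
  qed
  then show ?thesis by blast
qed

text \<open>Uniformity in time permits fixing one large \<open>n\<close> before \<open>t\<close>
  approaches \<open>t0\<close>. The two nested triangle inequalities cost \<open>2 + 4 + 4\<close>
  times the tolerance, whence \<open>e / 16\<close>.\<close>

lemma ctrace_lim:
  fixes g :: "nat \<Rightarrow> real \<times> 'a::euclidean_space \<Rightarrow> real"
  assumes tr: "\<And>n. ctrace T (g n) t0 (h n)" and lh: "L2_lim lborel h h'"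
    and q: "\<And>n. QL2 T (g n)" "QL2 T g'"
    and u: "\<And>e. e > 0 \<Longrightarrow> \<exists>N. \<forall>n\<ge>N. AE t in lborel. (\<integral>x. (g n (t, x) - g' (t, x))^2 \<partial>lborel) \<le> e"
  shows "ctrace T g' t0 h'"
  unfolding ctrace_def
proof (intro conjI allI impI)
  have Lh: "L2 lborel (h n)" "L2 lborel h'" for n using lh by (auto simp: L2_lim_def)
  then show "L2 lborel h'" by simp
  fix e :: real assume e: "e > 0"
  obtain N1 where N1: "\<And>n. n \<ge> N1 \<Longrightarrow> AE t in lborel. (\<integral>x. (g n (t, x) - g' (t, x))^2 \<partial>lborel) \<le> e / 16"
    using u[of "e / 16"] e by auto
  have "(\<lambda>n. \<integral>x. (h n x - h' x)^2 \<partial>lborel) \<longlonglongrightarrow> 0" using lh by (simp add: L2_lim_def)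
  from LIMSEQ_D[OF this, of "e / 16"] e obtain N2 where
    N2: "\<And>n. n \<ge> N2 \<Longrightarrow> (\<integral>x. (h n x - h' x)^2 \<partial>lborel) < e / 16" by auto
  define n where "n = max N1 N2"
  obtain d where d: "d > 0" "AE t in lborel. 0 < t \<and> t < T \<and> \<bar>t - t0\<bar> < d \<longrightarrow>
      (\<integral>x. (g n (t, x) - h n x)^2 \<partial>lborel) < e / 16"
    using tr[of n] e unfolding ctrace_def by (meson divide_pos_pos zero_less_numeral)
  have "AE t in lborel. (\<integral>x. (g n (t, x) - g' (t, x))^2 \<partial>lborel) \<le> e / 16"
    using N1[of n] by (simp add: n_def)
  then have "AE t in lborel. 0 < t \<and> t < T \<and> \<bar>t - t0\<bar> < d \<longrightarrow> (\<integral>x. (g' (t, x) - h' x)^2 \<partial>lborel) < e"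
    using d(2) AE_L2_slice(1)[OF QL2_L2[OF q(1)[of n]]] AE_L2_slice(1)[OF QL2_L2[OF q(2)]]
  proof eventually_elim
    case (elim t)
    show ?case
    proof
      assume t: "0 < t \<and> t < T \<and> \<bar>t - t0\<bar> < d"
      have "(\<integral>x. (g' (t, x) - g n (t, x))^2 \<partial>lborel) \<le> e / 16" using elim(1) by (simp add: power2_commute)
      moreover have "(\<integral>x. (g n (t, x) - h n x)^2 \<partial>lborel) < e / 16" using elim(2) t by blast
      moreover have "(\<integral>x. (h n x - h' x)^2 \<partial>lborel) < e / 16" using N2[of n] by (simp add: n_def)
      ultimately show "(\<integral>x. (g' (t, x) - h' x)^2 \<partial>lborel) < e"
        using L2_triangle_diff[OF elim(4) elim(3) Lh(2)] L2_triangle_diff[OF elim(3) Lh(1)[of n] Lh(2)] e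
        by linarith
    qed
  qed
  then show "\<exists>d>0. AE t in lborel. 0 < t \<and> t < T \<and> \<bar>t - t0\<bar> < d \<longrightarrow> (\<integral>x. (g' (t, x) - h' x)^2 \<partial>lborel) < e"
    using d(1) by blast
qed

text \<open>By the energy estimate for differences, \<open>R m n\<close> majorises the slice
  distance at almost every time and, up to the factor \<open>2 * a\<close>, the gradient distance.
  The limit gradient is then found by completeness.\<close>

lemma weq_limit:
  fixes g :: "nat \<Rightarrow> real \<times> 'a::euclidean_space \<Rightarrow> real"
  assumes W: "\<And>n. weq c T a (g n) (D n) (F n)" and T: "T > 0" and c: "dir T c t0" and a: "0 < a"
    and tr: "\<And>n. ctrace T (g n) t0 (h n)"
    and lg: "L2_lim lborel g g'" and lF: "L2_lim lborel F F'" and lh: "L2_lim lborel h h'"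
    and z: "QL2 T g'" "QL2 T F'"
  obtains D' where "weq c T a g' D' F'" "ctrace T g' t0 h'"
    "\<And>e. e > 0 \<Longrightarrow> \<exists>N. \<forall>n\<ge>N. AE t in lborel. (\<integral>x. (g n (t, x) - g' (t, x))^2 \<partial>lborel) \<le> e"
proof -
  have q: "QL2 T (g n)" "QV T (D n)" "QL2 T (F n)" for n using W[of n] by (auto simp: weq_def)
  define R where "R m n = (\<integral>x. (h m x - h n x)^2 \<partial>lborel) + (\<integral>p. (F m p - F n p)^2 \<partial>lborel)
      + (\<integral>p. (g m p - g n p)^2 \<partial>lborel)" for m n
  have est: "AE t in lborel. (\<integral>x. (g m (t, x) - g n (t, x))^2 \<partial>lborel) \<le> R m n"
      "2 * a * (\<Sum>b\<in>Basis. \<integral>p. ((D m p - D n p) \<bullet> b)^2 \<partial>lborel) \<le> R m n" for m n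
    using energy_estimate[OF weq_diff[OF W W] T c ctrace_diff[OF q(1) q(1) tr tr], of m n] a
    by (auto simp: R_def)
  have RC: "\<exists>N. \<forall>m\<ge>N. \<forall>n\<ge>N. R m n < e" if "e > 0" for e
  proof -
    have e3: "e / 3 > 0" using that by simp
    obtain N1 N2 N3 where
      "\<forall>m\<ge>N1. \<forall>n\<ge>N1. (\<integral>x. (h m x - h n x)^2 \<partial>lborel) < e / 3"
      "\<forall>m\<ge>N2. \<forall>n\<ge>N2. (\<integral>p. (F m p - F n p)^2 \<partial>lborel) < e / 3"
      "\<forall>m\<ge>N3. \<forall>n\<ge>N3. (\<integral>p. (g m p - g n p)^2 \<partial>lborel) < e / 3"
      using L2_lim_Cauchy[OF lh e3] L2_lim_Cauchy[OF lF e3] L2_lim_Cauchy[OF lg e3] by blast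
    then have "R m n < e" if "m \<ge> max N1 (max N2 N3)" "n \<ge> max N1 (max N2 N3)" for m n
    proof -
      have "(\<integral>x. (h m x - h n x)^2 \<partial>lborel) < e / 3" "(\<integral>p. (F m p - F n p)^2 \<partial>lborel) < e / 3"
        "(\<integral>p. (g m p - g n p)^2 \<partial>lborel) < e / 3"
        using that \<open>\<forall>m\<ge>N1. _\<close> \<open>\<forall>m\<ge>N2. _\<close> \<open>\<forall>m\<ge>N3. _\<close> by auto
      then show ?thesis unfolding R_def by linarith
    qed
    then show ?thesis by blast
  qed
  have "\<exists>d. L2_lim lborel (\<lambda>n p. D n p \<bullet> b) d" if b: "b \<in> Basis" for b
  proof -
    have LD: "L2 lborel (\<lambda>p. D n p \<bullet> b)" for n using q(2)[of n] b by (simp add: QV_def)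
    have "\<exists>N. \<forall>m\<ge>N. \<forall>n\<ge>N. (\<integral>p. (D m p \<bullet> b - D n p \<bullet> b)^2 \<partial>lborel) < e" if e: "e > 0" for e
    proof -
      have "2 * a * e > 0" using a e by simp
      from RC[OF this] obtain N where N: "\<forall>m\<ge>N. \<forall>n\<ge>N. R m n < 2 * a * e" by blast
      have "(\<integral>p. (D m p \<bullet> b - D n p \<bullet> b)^2 \<partial>lborel) < e" if "m \<ge> N" "n \<ge> N" for m n
      proof -
        have "(\<integral>p. ((D m p - D n p) \<bullet> b)^2 \<partial>lborel) \<le> (\<Sum>b\<in>Basis. \<integral>p. ((D m p - D n p) \<bullet> b)^2 \<partial>lborel)"
          by (rule member_le_sum[OF b]) auto
        then have "2 * a * (\<integral>p. ((D m p - D n p) \<bullet> b)^2 \<partial>lborel) \<le> R m n"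
          using est(2)[of m n] a by (meson mult_left_mono order_trans less_imp_le zero_less_mult_iff zero_less_numeral)
        also have "\<dots> < 2 * a * e" using N that by blast
        finally show ?thesis using a by (simp add: inner_diff_left)
      qed
      then show ?thesis by blast
    qed
    from L2_complete[OF LD this] show ?thesis by blast
  qed
  then obtain d where d: "\<And>b. b \<in> Basis \<Longrightarrow> L2_lim lborel (\<lambda>n p. D n p \<bullet> b) (d b)" by metis
  \<comment> \<open>The limits \<open>d b\<close> are determined only almost everywhere and may be
    nonzero off the cylinder, whereas \<open>QV\<close> asks for exact zeros there.\<close>
  define D' where "D' p = (\<Sum>b\<in>Basis. (d b p * indicator (Qc T) p) *\<^sub>R b)" for p
  have D'b: "D' p \<bullet> b = d b p * indicator (Qc T) p" if "b \<in> Basis" for b p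
    using that by (simp add: D'_def)
  have lD: "L2_lim lborel (\<lambda>n p. D n p \<bullet> b) (\<lambda>p. D' p \<bullet> b)" if b: "b \<in> Basis" for b
  proof (rule L2_lim_bound[OF d[OF b], where C=1])
    have Ld: "L2 lborel (d b)" and LD: "L2 lborel (\<lambda>p. D n p \<bullet> b)" for n using d[OF b] by (auto simp: L2_lim_def)
    then show "(\<lambda>p. D n p \<bullet> b) \<in> borel_measurable lborel" for n by (simp add: L2_def)
    have "L2 lborel (\<lambda>p. indicator (Qc T) p * d b p)"
      by (rule L2_mult_bdd[OF Ld, of _ 1]) (auto split: split_indicator)
    then show "L2 lborel (\<lambda>p. D' p \<bullet> b)" by (simp add: D'b b mult.commute)
    show "AE p in lborel. \<bar>D n p \<bullet> b - D' p \<bullet> b\<bar> \<le> 1 * \<bar>D n p \<bullet> b - d b p\<bar>" for n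
      using q(2)[of n] by (auto simp: D'b b QV_def split: split_indicator)
  qed
  have z': "QV T D'" using lD by (auto simp: QV_def L2_lim_def D'_def)
  have W': "weq c T a g' D' F'" by (rule weq_lim[OF W lg lD lF z(1) z' z(2)])
  have u: "\<exists>N. \<forall>n\<ge>N. AE t in lborel. (\<integral>x. (g n (t, x) - g' (t, x))^2 \<partial>lborel) \<le> e" if e: "e > 0" for e
  proof -
    from RC[OF e] obtain N where N: "\<forall>m\<ge>N. \<forall>n\<ge>N. R m n < e" by blast
    \<comment> \<open>In the estimate for \<open>g m - g n\<close> the index \<open>m\<close> goes
      to infinity along a subsequence that converges on almost every slice.\<close>
    obtain r where r: "strict_mono r" "AE t in lborel. L2_lim lborel (\<lambda>n x. g (r n) (t, x)) (\<lambda>x. g' (t, x))"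
      by (rule L2_lim_slice_subseq[OF lg])
    have "AE t in lborel. (\<integral>x. (g n (t, x) - g' (t, x))^2 \<partial>lborel) \<le> e" if n: "n \<ge> N" for n
    proof -
      have "AE t in lborel. \<forall>m. (\<integral>x. (g m (t, x) - g n (t, x))^2 \<partial>lborel) \<le> R m n"
        using est(1)[of _ n] by (simp add: AE_all_countable)
      then show ?thesis using r(2) AE_L2_slice(1)[OF QL2_L2[OF q(1)[of n]]]
      proof eventually_elim
        case (elim t)
        have ll: "L2_lim lborel (\<lambda>m x. g (r m) (t, x) - g n (t, x)) (\<lambda>x. g' (t, x) - g n (t, x))"
        proof (rule L2_lim_bound[OF elim(2), where C=1])
          have "L2 lborel (\<lambda>x. g (r m) (t, x))" "L2 lborel (\<lambda>x. g' (t, x))" for m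
            using elim(2) by (auto simp: L2_lim_def)
          note L = L2_diff[OF this(1) elim(3)] L2_diff[OF this(2) elim(3)]
          show "(\<lambda>x. g (r m) (t, x) - g n (t, x)) \<in> borel_measurable lborel" for m
            by (rule L2_meas[OF L(1)])
          show "L2 lborel (\<lambda>x. g' (t, x) - g n (t, x))" by (rule L(2))
        qed auto
        have "(\<integral>x. (g' (t, x) - g n (t, x))^2 \<partial>lborel) \<le> e"
        proof (rule LIMSEQ_le_const2[OF L2_lim_sq[OF ll]])
          have "(\<integral>x. (g (r m) (t, x) - g n (t, x))^2 \<partial>lborel) \<le> e" if "m \<ge> N" for m
          proof -
            have "r m \<ge> N" using strict_mono_imp_increasing[OF r(1), of m] that by simp
            then have "R (r m) n < e" using N n by blast
            then show ?thesis using elim(1)[rule_format, of "r m"] by linarith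
          qed
          then show "\<exists>N. \<forall>m\<ge>N. (\<integral>x. (g (r m) (t, x) - g n (t, x))^2 \<partial>lborel) \<le> e" by blast
        qed
        then show ?case by (simp add: power2_commute)
      qed
    qed
    then show ?thesis by blast
  qed
  show ?thesis by (rule that[OF W' ctrace_lim[OF tr lh q(1) z(1) u] u])
qed

subsection \<open>Borel representatives\<close>

lemma AE_lebesgue_on_iff:
  assumes "S \<in> sets borel"
  shows "(AE x in lebesgue_on S. P x) \<longleftrightarrow> (AE x in lborel. x \<in> S \<longrightarrow> P x)"
proof -
  have "(AE x in lebesgue_on S. P x) \<longleftrightarrow> (AE x in lebesgue. x \<in> S \<longrightarrow> P x)"
    by (rule AE_restrict_space_iff) (use assms in auto)
  then show ?thesis by (simp only: AE_completion_iff)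
qed

text \<open>Such a \<open>u'\<close> has over the whole space the integral that \<open>u\<close> has
  over \<open>S\<close>. Exact zeros outside \<open>S\<close>, not merely almost everywhere, make
  slices and products vanish there as well.\<close>

definition isrep :: "'b::euclidean_space set \<Rightarrow> ('b \<Rightarrow> real) \<Rightarrow> ('b \<Rightarrow> real) \<Rightarrow> bool" where
  "isrep S u u' \<longleftrightarrow> u' \<in> borel_measurable borel \<and> (\<forall>x. x \<notin> S \<longrightarrow> u' x = 0) \<and>
     (AE x in lborel. x \<in> S \<longrightarrow> u' x = u x)"

lemma isrep_AE: "isrep S u u' \<Longrightarrow> AE x in lborel. x \<in> S \<longrightarrow> u' x = u x"
  and isrep_measurable: "isrep S u u' \<Longrightarrow> u' \<in> borel_measurable borel"
  and isrep_zero: "isrep S u u' \<Longrightarrow> x \<notin> S \<Longrightarrow> u' x = 0"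
  by (auto simp only: isrep_def)

lemma isrep_self: "u \<in> borel_measurable borel \<Longrightarrow> (\<And>x. x \<notin> S \<Longrightarrow> u x = 0) \<Longrightarrow> isrep S u u"
  by (simp only: isrep_def) auto

text \<open>Completeness of Lebesgue measure: equality almost everywhere with a Borel function
  already forces measurability.\<close>

lemma isrep_meas_orig:
  assumes S: "S \<in> sets borel" and r: "isrep S u u'"
  shows "u \<in> borel_measurable (lebesgue_on S)"
proof -
  have ae: "AE x in lebesgue. indicator S x *\<^sub>R u x = u' x"
  proof (rule AE_completion)
    show "AE x in lborel. indicator S x *\<^sub>R u x = u' x"
      using isrep_AE[OF r]
    proof eventually_elim
      case (elim x)
      then show ?case using isrep_zero[OF r, of x] by (cases "x \<in> S") auto
    qed
  qed
  have "(\<lambda>x. indicator S x *\<^sub>R u x) \<in> borel_measurable lebesgue"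
  proof (rule measurableI)
    fix A :: "real set" assume A: "A \<in> sets borel"
    show "(\<lambda>x. indicator S x *\<^sub>R u x) -` A \<inter> space lebesgue \<in> sets lebesgue"
    proof (rule completion.in_sets_AE)
      show "AE x in lebesgue. (x \<in> u' -` A \<inter> space lborel) = (x \<in> (\<lambda>x. indicator S x *\<^sub>R u x) -` A \<inter> space lebesgue)"
        using ae by eventually_elim simp
      have "u' -` A \<inter> space lborel \<in> sets lborel"
        by (rule measurable_sets[OF _ A]) (use isrep_measurable[OF r] in simp)
      then show "u' -` A \<inter> space lborel \<in> sets lebesgue" by (rule sets_completionI_sets)
    qed simp
  qed simp
  then show ?thesis using S by (subst borel_measurable_restrict_space_iff) auto
qed

lemma isrep_integral:
  assumes S: "S \<in> sets borel" and r: "isrep S u u'"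
  shows "(\<integral>x. u x \<partial>lebesgue_on S) = (\<integral>x. u' x \<partial>lborel)"
    and "integrable (lebesgue_on S) u \<longleftrightarrow> integrable lborel u'"
proof -
  have S': "S \<inter> space lebesgue \<in> sets lebesgue" using S by auto
  have m: "u' \<in> borel_measurable lborel" using isrep_measurable[OF r] by simp
  then have m': "u' \<in> borel_measurable lebesgue" by (rule measurable_completion)
  have mu: "(\<lambda>x. indicator S x *\<^sub>R u x) \<in> borel_measurable lebesgue"
    using isrep_meas_orig[OF S r] S by (subst (asm) borel_measurable_restrict_space_iff) auto
  have ae: "AE x in lebesgue. indicator S x *\<^sub>R u x = u' x"
  proof (rule AE_completion)
    show "AE x in lborel. indicator S x *\<^sub>R u x = u' x"
      using isrep_AE[OF r]
    proof eventually_elim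
      case (elim x)
      then show ?case using isrep_zero[OF r, of x] by (cases "x \<in> S") auto
    qed
  qed
  show "(\<integral>x. u x \<partial>lebesgue_on S) = (\<integral>x. u' x \<partial>lborel)"
    unfolding integral_restrict_space[OF S'] integral_cong_AE[OF mu m' ae]
    by (rule integral_completion[OF m])
  show "integrable (lebesgue_on S) u \<longleftrightarrow> integrable lborel u'"
    unfolding integrable_restrict_space[OF S'] integrable_cong_AE[OF mu m' ae]
    by (rule integrable_completion[OF m])
qed

lemma isrep_exists:
  assumes S: "S \<in> sets borel" and u: "u \<in> borel_measurable (lebesgue_on S)"
  obtains u' where "isrep S u u'"
proof -
  have "(\<lambda>x. indicator S x *\<^sub>R u x) \<in> borel_measurable lebesgue"
    using u S by (subst (asm) borel_measurable_restrict_space_iff) auto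
  then obtain k where k: "k \<in> borel_measurable lborel" "AE x in lborel. indicator S x *\<^sub>R u x = k x"
    using completion_ex_borel_measurable_real by blast
  have "isrep S u (\<lambda>x. indicator S x * k x)"
    unfolding isrep_def
  proof (intro conjI allI impI)
    show "(\<lambda>x. indicator S x * k x) \<in> borel_measurable borel"
      using S k(1) by (intro borel_measurable_times borel_measurable_indicator) auto
    show "AE x in lborel. x \<in> S \<longrightarrow> indicator S x * k x = u x"
      using k(2) by eventually_elim auto
  qed auto
  then show ?thesis by (rule that)
qed

lemma isrep_mult:
  assumes "isrep S u u'" "isrep S v v'" shows "isrep S (\<lambda>x. u x * v x) (\<lambda>x. u' x * v' x)"
  unfolding isrep_def
proof (intro conjI allI impI)
  show "AE x in lborel. x \<in> S \<longrightarrow> u' x * v' x = u x * v x"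
    using assms[THEN isrep_AE] by eventually_elim simp
qed (use assms[THEN isrep_measurable] isrep_zero[OF assms(1)] in \<open>auto intro: borel_measurable_times\<close>)

lemma isrep_mult_borel:
  assumes "isrep S u u'" "k \<in> borel_measurable borel" shows "isrep S (\<lambda>x. u x * k x) (\<lambda>x. u' x * k x)"
  unfolding isrep_def
proof (intro conjI allI impI)
  show "AE x in lborel. x \<in> S \<longrightarrow> u' x * k x = u x * k x"
    using isrep_AE[OF assms(1)] by eventually_elim simp
qed (use isrep_measurable[OF assms(1)] assms(2) isrep_zero[OF assms(1)] in \<open>auto intro: borel_measurable_times\<close>)

lemma isrep_diff:
  assumes "isrep S u u'" "isrep S v v'" shows "isrep S (\<lambda>x. u x - v x) (\<lambda>x. u' x - v' x)"
  unfolding isrep_def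
proof (intro conjI allI impI)
  show "AE x in lborel. x \<in> S \<longrightarrow> u' x - v' x = u x - v x"
    using assms[THEN isrep_AE] by eventually_elim simp
qed (use assms[THEN isrep_measurable] isrep_zero[OF assms(1)] isrep_zero[OF assms(2)] in
     \<open>auto intro: borel_measurable_diff\<close>)

lemma isrep_divide:
  assumes "isrep S u u'" "isrep S v v'" shows "isrep S (\<lambda>x. u x / v x) (\<lambda>x. u' x / v' x)"
  unfolding isrep_def
proof (intro conjI allI impI)
  show "AE x in lborel. x \<in> S \<longrightarrow> u' x / v' x = u x / v x"
    using assms[THEN isrep_AE] by eventually_elim simp
qed (use assms[THEN isrep_measurable] isrep_zero[OF assms(1)] in \<open>auto intro: borel_measurable_divide\<close>)

lemma isrep_sum:
  assumes "\<And>i. i \<in> I \<Longrightarrow> isrep S (u i) (u' i)"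
  shows "isrep S (\<lambda>x. \<Sum>i\<in>I. u i x) (\<lambda>x. \<Sum>i\<in>I. u' i x)"
  using assms
proof (induction I rule: infinite_finite_induct)
  case (insert j I)
  then have 1: "isrep S (u j) (u' j)" and 2: "isrep S (\<lambda>x. \<Sum>i\<in>I. u i x) (\<lambda>x. \<Sum>i\<in>I. u' i x)" by auto
  have "isrep S (\<lambda>x. u j x + (\<Sum>i\<in>I. u i x)) (\<lambda>x. u' j x + (\<Sum>i\<in>I. u' i x))"
    unfolding isrep_def
  proof (intro conjI allI impI)
    show "AE x in lborel. x \<in> S \<longrightarrow> u' j x + (\<Sum>i\<in>I. u' i x) = u j x + (\<Sum>i\<in>I. u i x)"
      using 1[THEN isrep_AE] 2[THEN isrep_AE] by eventually_elim simp
    show "(\<lambda>x. u' j x + (\<Sum>i\<in>I. u' i x)) \<in> borel_measurable borel"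
      by (rule borel_measurable_add[OF 1[THEN isrep_measurable] 2[THEN isrep_measurable]])
    fix x assume "x \<notin> S"
    then show "u' j x + (\<Sum>i\<in>I. u' i x) = 0" using isrep_zero[OF 1, of x] isrep_zero[OF 2, of x] by simp
  qed
  then show ?case using insert by simp
qed (auto simp: isrep_def)

lemma isrep_L2:
  assumes S: "S \<in> sets borel" and r: "isrep S u u'"
  shows "L2 (lebesgue_on S) u \<longleftrightarrow> L2 lborel u'"
    and "(\<integral>x. (u x)^2 \<partial>lebesgue_on S) = (\<integral>x. (u' x)^2 \<partial>lborel)"
proof -
  have r2: "isrep S (\<lambda>x. (u x)^2) (\<lambda>x. (u' x)^2)" unfolding power2_eq_square by (rule isrep_mult[OF r r])
  show "L2 (lebesgue_on S) u \<longleftrightarrow> L2 lborel u'"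
    using isrep_integral(2)[OF S r2] isrep_meas_orig[OF S r] isrep_measurable[OF r] by (simp add: L2_def)
  show "(\<integral>x. (u x)^2 \<partial>lebesgue_on S) = (\<integral>x. (u' x)^2 \<partial>lborel)" by (rule isrep_integral(1)[OF S r2])
qed

lemma isrep_slice:
  fixes g :: "real \<Rightarrow> 'a::euclidean_space \<Rightarrow> real"
  assumes r: "isrep (Qc T) (\<lambda>p. g (fst p) (snd p)) g'"
  shows "AE t in lborel. 0 < t \<and> t < T \<longrightarrow> isrep Om (g t) (\<lambda>x. g' (t, x))"
  using AE_slice[OF isrep_AE[OF r]]
proof eventually_elim
  case (elim t)
  show ?case
  proof
    assume t: "0 < t \<and> t < T"
    show "isrep Om (g t) (\<lambda>x. g' (t, x))"
      unfolding isrep_def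
    proof (intro conjI allI impI)
      show "(\<lambda>x. g' (t, x)) \<in> borel_measurable borel" by (rule borel_measurable_slice(1)[OF isrep_measurable[OF r]])
      show "g' (t, x) = 0" if "x \<notin> Om" for x using isrep_zero[OF r, of "(t, x)"] that by (simp add: Qc_def)
      show "AE x in lborel. x \<in> Om \<longrightarrow> g' (t, x) = g t x" using elim by eventually_elim (use t in \<open>simp add: Qc_def\<close>)
    qed
  qed
qed

lemma pairing_measurable:
  fixes g' :: "real \<times> 'a::euclidean_space \<Rightarrow> real"
  assumes g: "g' \<in> borel_measurable borel" and v[measurable]: "v' \<in> borel_measurable borel"
  shows "(\<lambda>t. \<integral>x. g' (t, x) * v' x \<partial>lborel) \<in> borel_measurable borel"
proof -
  have [measurable]: "g' \<in> borel_measurable (borel \<Otimes>\<^sub>M borel)" using g by (simp add: borel_prod)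
  show ?thesis by measurable
qed

lemma isrep_pairing:
  fixes g :: "real \<Rightarrow> 'a::euclidean_space \<Rightarrow> real"
  assumes r: "isrep (Qc T) (\<lambda>p. g (fst p) (snd p)) g'" and v: "isrep Om v v'"
  shows "isrep {0<..<T} (\<lambda>t. \<integral>x. g t x * v x \<partial>lebesgue_on Om) (\<lambda>t. \<integral>x. g' (t, x) * v' x \<partial>lborel)"
  unfolding isrep_def
proof (intro conjI allI impI)
  show "(\<lambda>t. \<integral>x. g' (t, x) * v' x \<partial>lborel) \<in> borel_measurable borel"
    by (rule pairing_measurable[OF isrep_measurable[OF r] isrep_measurable[OF v]])
  show "(\<integral>x. g' (t, x) * v' x \<partial>lborel) = 0" if "t \<notin> {0<..<T}" for t
  proof -
    have "g' (t, x) = 0" for x using that by (intro isrep_zero[OF r]) (auto simp: Qc_def)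
    then show ?thesis by simp
  qed
  show "AE t in lborel. t \<in> {0<..<T} \<longrightarrow> (\<integral>x. g' (t, x) * v' x \<partial>lborel) = (\<integral>x. g t x * v x \<partial>lebesgue_on Om)"
    using isrep_slice[OF r]
  proof eventually_elim
    case (elim t)
    show ?case
    proof
      assume "t \<in> {0<..<T}"
      then have "isrep Om (g t) (\<lambda>x. g' (t, x))" using elim by simp
      from isrep_integral(1)[OF Om_sets isrep_mult[OF this v]]
      show "(\<integral>x. g' (t, x) * v' x \<partial>lborel) = (\<integral>x. g t x * v x \<partial>lebesgue_on Om)" by simp
    qed
  qed
qed

lemma pairing_integral:
  fixes g' :: "real \<times> 'a::euclidean_space \<Rightarrow> real"
  assumes g: "L2 lborel g'" and v: "L2 lborel v'" and k: "L2 lborel k"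
  shows "(\<integral>t. (\<integral>x. g' (t, x) * v' x \<partial>lborel) * k t \<partial>lborel) = (\<integral>p. g' p * (v' (snd p) * k (fst p)) \<partial>lborel)"
    and "integrable lborel (\<lambda>t. (\<integral>x. g' (t, x) * v' x \<partial>lborel) * k t)"
proof -
  have i: "integrable lborel (\<lambda>p. g' p * (v' (snd p) * k (fst p)))"
    by (rule L2_mult[OF g L2_tensor[OF k v]])
  have e: "(\<integral>x. g' (t, x) * v' x \<partial>lborel) * k t = (\<integral>x. g' (t, x) * (v' x * k t) \<partial>lborel)" for t
    by (simp add: mult.assoc flip: Bochner_Integration.integral_mult_left_zero)
  show "(\<integral>t. (\<integral>x. g' (t, x) * v' x \<partial>lborel) * k t \<partial>lborel) = (\<integral>p. g' p * (v' (snd p) * k (fst p)) \<partial>lborel)"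
    unfolding e using integral_slice[OF i] by simp
  show "integrable lborel (\<lambda>t. (\<integral>x. g' (t, x) * v' x \<partial>lborel) * k t)"
    unfolding e using integrable_slice[OF i] by simp
qed

subsection \<open>Weak gradients of representatives\<close>

lemma weak_grad_isrep:
  assumes u: "isrep Om u u'" and G: "\<And>b. b \<in> Basis \<Longrightarrow> isrep Om (\<lambda>x. G x \<bullet> b) (\<lambda>x. G' x \<bullet> b)"
  shows "weak_grad u G \<longleftrightarrow> wgrad u' G'"
proof -
  have "(\<integral>x. u x * (D\<phi> x \<bullet> b) \<partial>lebesgue_on Om) = (\<integral>x. u' x * (D\<phi> x \<bullet> b) \<partial>lborel)"
    "(\<integral>x. (G x \<bullet> b) * \<phi> x \<partial>lebesgue_on Om) = (\<integral>x. (G' x \<bullet> b) * \<phi> x \<partial>lborel)"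
    if t: "test_fun Om \<phi> D\<phi>" and b: "b \<in> Basis" for \<phi> D\<phi> b
  proof -
    have m: "\<phi> \<in> borel_measurable borel" "(\<lambda>x. D\<phi> x \<bullet> b) \<in> borel_measurable borel"
      using test_fun_L2[OF t] by (auto simp: L2_def)
    show "(\<integral>x. u x * (D\<phi> x \<bullet> b) \<partial>lebesgue_on Om) = (\<integral>x. u' x * (D\<phi> x \<bullet> b) \<partial>lborel)"
      by (rule isrep_integral(1)[OF Om_sets isrep_mult_borel[OF u m(2)]])
    show "(\<integral>x. (G x \<bullet> b) * \<phi> x \<partial>lebesgue_on Om) = (\<integral>x. (G' x \<bullet> b) * \<phi> x \<partial>lborel)"
      by (rule isrep_integral(1)[OF Om_sets isrep_mult_borel[OF G[OF b] m(1)]])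
  qed
  then show ?thesis unfolding weak_grad_def wgrad_def by simp
qed

lemma vector_isrep_exists:
  fixes G :: "'b::euclidean_space \<Rightarrow> 'a::euclidean_space"
  assumes S: "S \<in> sets borel" and G: "\<And>b. b \<in> Basis \<Longrightarrow> L2 (lebesgue_on S) (\<lambda>x. G x \<bullet> b)"
  obtains G' where "\<And>b. b \<in> Basis \<Longrightarrow> isrep S (\<lambda>x. G x \<bullet> b) (\<lambda>x. G' x \<bullet> b)"
    "\<And>b. b \<in> Basis \<Longrightarrow> L2 lborel (\<lambda>x. G' x \<bullet> b)" "\<And>x. x \<notin> S \<Longrightarrow> G' x = 0"
proof -
  have "\<forall>b\<in>Basis. \<exists>k. isrep S (\<lambda>x. G x \<bullet> b) k"
  proof
    fix b :: 'a assume "b \<in> Basis"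
    then show "\<exists>k. isrep S (\<lambda>x. G x \<bullet> b) k"
      using isrep_exists[OF S L2_meas[OF G]] by blast
  qed
  from bchoice[OF this] obtain k where k: "\<And>b. b \<in> Basis \<Longrightarrow> isrep S (\<lambda>x. G x \<bullet> b) (k b)" by blast
  define G' where "G' x = (\<Sum>b\<in>Basis. k b x *\<^sub>R b)" for x
  have e: "(\<lambda>x. G' x \<bullet> b) = k b" if "b \<in> Basis" for b using that by (simp add: G'_def)
  show ?thesis
  proof (rule that)
    fix b :: 'a assume b: "b \<in> Basis"
    show "isrep S (\<lambda>x. G x \<bullet> b) (\<lambda>x. G' x \<bullet> b)" unfolding e[OF b] by (rule k[OF b])
    show "L2 lborel (\<lambda>x. G' x \<bullet> b)" unfolding e[OF b] using isrep_L2(1)[OF S k[OF b]] G[OF b] by simp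
  next
    fix x assume "x \<notin> S"
    then show "G' x = 0" unfolding G'_def using isrep_zero[OF k] by (auto intro!: sum.neutral)
  qed
qed

lemma H1_rep:
  assumes v: "H1 (v :: 'a::euclidean_space \<Rightarrow> real)"
  obtains v' G' where "H1g v' G'" "isrep Om v v'" "\<And>b. b \<in> Basis \<Longrightarrow> isrep Om (\<lambda>x. grad v x \<bullet> b) (\<lambda>x. G' x \<bullet> b)"
proof -
  have L: "L2 (lebesgue_on Om) v" and ex: "\<exists>G. L2grad G \<and> weak_grad v G" using v by (auto simp: H1_def)
  have g: "L2grad (grad v)" "weak_grad v (grad v)" using someI_ex[OF ex] by (auto simp: grad_def)
  obtain v' where v': "isrep Om v v'" using isrep_exists[OF Om_sets L2_meas[OF L]] by blast
  have LG: "\<And>b. b \<in> Basis \<Longrightarrow> L2 (lebesgue_on Om) (\<lambda>x. grad v x \<bullet> b)" using g(1) by (simp add: L2grad_def)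
  obtain G' where G': "\<And>b. b \<in> Basis \<Longrightarrow> isrep Om (\<lambda>x. grad v x \<bullet> b) (\<lambda>x. G' x \<bullet> b)"
    "\<And>b. b \<in> Basis \<Longrightarrow> L2 lborel (\<lambda>x. G' x \<bullet> b)" "\<And>x. x \<notin> Om \<Longrightarrow> G' x = 0"
    using vector_isrep_exists[OF Om_sets LG] by blast
  have "wgrad v' G'" using weak_grad_isrep[OF v' G'(1)] g(2) by simp
  then have "H1g v' G'" using G'(2,3) isrep_L2(1)[OF Om_sets v'] L isrep_zero[OF v'] by (simp add: H1g_def)
  then show ?thesis using that v' G'(1) by blast
qed

text \<open>\<open>grad\<close> picks an arbitrary weak gradient by choice; uniqueness almost
  everywhere identifies it with any given \<open>G\<close>.\<close>

lemma H1g_imp: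
  fixes v :: "'a::euclidean_space \<Rightarrow> real"
  assumes v: "isrep Om v v'" and vG: "H1g v' G"
  shows "H1 v" "\<And>b. b \<in> Basis \<Longrightarrow> isrep Om (\<lambda>x. grad v x \<bullet> b) (\<lambda>x. G x \<bullet> b)"
proof -
  note P = H1g_props[OF vG]
  have rG: "isrep Om (\<lambda>x. G x \<bullet> b) (\<lambda>x. G x \<bullet> b)" if "b \<in> Basis" for b
    by (rule isrep_self) (use P(2)[OF that] P(4) in \<open>auto simp: L2_def\<close>)
  have "L2grad G" unfolding L2grad_def
  proof
    fix b :: 'a assume b: "b \<in> Basis"
    show "L2 (lebesgue_on Om) (\<lambda>x. G x \<bullet> b)" using isrep_L2(1)[OF Om_sets rG[OF b]] P(2)[OF b] by simp
  qed
  moreover have "weak_grad v G" using weak_grad_isrep[OF v rG] P(5) by simp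
  ultimately show H: "H1 v" using isrep_L2(1)[OF Om_sets v] P(1) by (auto simp: H1_def)
  obtain v2 G2 where 2: "H1g v2 G2" "isrep Om v v2" "\<And>b. b \<in> Basis \<Longrightarrow> isrep Om (\<lambda>x. grad v x \<bullet> b) (\<lambda>x. G2 x \<bullet> b)"
    using H1_rep[OF H] by blast
  note P2 = H1g_props[OF 2(1)]
  have eq: "AE x in lborel. v2 x = v' x"
    using isrep_AE[OF v] isrep_AE[OF 2(2)]
  proof eventually_elim
    case (elim x)
    then show ?case using isrep_zero[OF v, of x] isrep_zero[OF 2(2), of x] by (cases "x \<in> Om") auto
  qed
  \<comment> \<open>The representative \<open>v2\<close> supplied by \<open>H1_rep\<close> need not
    be \<open>v'\<close>; both agree almost everywhere, so \<open>G2\<close> is a weak gradient of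
    \<open>v'\<close> too.\<close>
  have "wgrad v' G2"
    unfolding wgrad_def
  proof (intro allI impI ballI)
    fix \<phi> :: "'a \<Rightarrow> real" and D\<phi> and b :: 'a
    assume t: "test_fun Om \<phi> D\<phi>" and b: "b \<in> Basis"
    have "(\<integral>x. v' x * (D\<phi> x \<bullet> b) \<partial>lborel) = (\<integral>x. v2 x * (D\<phi> x \<bullet> b) \<partial>lborel)"
    proof (rule integral_cong_AE)
      show "AE x in lborel. v' x * (D\<phi> x \<bullet> b) = v2 x * (D\<phi> x \<bullet> b)" using eq by eventually_elim simp
    qed (use L2_mult[OF P(1) test_fun_L2(2)[OF t]] L2_mult[OF P2(1) test_fun_L2(2)[OF t]] in
         \<open>auto dest: borel_measurable_integrable\<close>)
    then show "(\<integral>x. v' x * (D\<phi> x \<bullet> b) \<partial>lborel) = - (\<integral>x. (G2 x \<bullet> b) * \<phi> x \<partial>lborel)"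
      using P2(5) t b by (simp add: wgrad_def)
  qed
  then have "H1g v' G2" using P P2 by (auto simp: H1g_def)
  from wgrad_unique[OF this vG] have u: "AE x in lborel. G2 x = G x" .
  fix b :: 'a assume b: "b \<in> Basis"
  show "isrep Om (\<lambda>x. grad v x \<bullet> b) (\<lambda>x. G x \<bullet> b)"
    unfolding isrep_def
  proof (intro conjI allI impI)
    show "AE x in lborel. x \<in> Om \<longrightarrow> G x \<bullet> b = grad v x \<bullet> b"
      using isrep_AE[OF 2(3)[OF b]] u by eventually_elim simp
  qed (use P(2)[OF b] P(4) in \<open>auto simp: L2_def\<close>)
qed

subsection \<open>Transfer of weak solutions\<close>

lemma isrep_pairing_grad:
  fixes D :: "real \<Rightarrow> 'a::euclidean_space \<Rightarrow> 'a"
  assumes D: "\<And>b. b \<in> Basis \<Longrightarrow> isrep (Qc T) (\<lambda>p. D (fst p) (snd p) \<bullet> b) (\<lambda>p. D' p \<bullet> b)"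
    and G: "\<And>b. b \<in> Basis \<Longrightarrow> isrep Om (\<lambda>x. G x \<bullet> b) (\<lambda>x. G' x \<bullet> b)"
    and L: "\<And>b. b \<in> Basis \<Longrightarrow> L2 lborel (\<lambda>p. D' p \<bullet> b)" "\<And>b. b \<in> Basis \<Longrightarrow> L2 lborel (\<lambda>x. G' x \<bullet> b)"
  shows "isrep {0<..<T} (\<lambda>t. \<integral>x. D t x \<bullet> G x \<partial>lebesgue_on Om)
     (\<lambda>t. \<Sum>b\<in>Basis. \<integral>x. (D' (t, x) \<bullet> b) * (G' x \<bullet> b) \<partial>lborel)"
proof -
  have P: "isrep {0<..<T} (\<lambda>t. \<Sum>b\<in>Basis. \<integral>x. (D t x \<bullet> b) * (G x \<bullet> b) \<partial>lebesgue_on Om)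
     (\<lambda>t. \<Sum>b\<in>Basis. \<integral>x. (D' (t, x) \<bullet> b) * (G' x \<bullet> b) \<partial>lborel)"
    by (rule isrep_sum, rule isrep_pairing[of T "\<lambda>t x. D t x \<bullet> _"]) (use D G in auto)
  have "AE t in lborel. \<forall>b\<in>Basis. (0 < t \<and> t < T \<longrightarrow> isrep Om (\<lambda>x. D t x \<bullet> b) (\<lambda>x. D' (t, x) \<bullet> b))
      \<and> L2 lborel (\<lambda>x. D' (t, x) \<bullet> b)"
  proof (subst AE_ball_countable[OF countable_finite[OF finite_Basis]], rule ballI)
    fix b :: 'a assume b: "b \<in> Basis"
    show "AE t in lborel. (0 < t \<and> t < T \<longrightarrow> isrep Om (\<lambda>x. D t x \<bullet> b) (\<lambda>x. D' (t, x) \<bullet> b))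
      \<and> L2 lborel (\<lambda>x. D' (t, x) \<bullet> b)"
      using isrep_slice[OF D[OF b]] AE_L2_slice(1)[OF L(1)[OF b]] by eventually_elim simp
  qed
  then have "AE t in lborel. t \<in> {0<..<T} \<longrightarrow> (\<integral>x. D t x \<bullet> G x \<partial>lebesgue_on Om)
      = (\<Sum>b\<in>Basis. \<integral>x. (D t x \<bullet> b) * (G x \<bullet> b) \<partial>lebesgue_on Om)"
  proof eventually_elim
    case (elim t)
    show ?case
    proof
      assume "t \<in> {0<..<T}"
      then have r: "isrep Om (\<lambda>x. D t x \<bullet> b) (\<lambda>x. D' (t, x) \<bullet> b)" "L2 lborel (\<lambda>x. D' (t, x) \<bullet> b)"
        if "b \<in> Basis" for b using elim that by auto
      have i: "integrable (lebesgue_on Om) (\<lambda>x. (D t x \<bullet> b) * (G x \<bullet> b))" if "b \<in> Basis" for b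
        using isrep_integral(2)[OF Om_sets isrep_mult[OF r(1)[OF that] G[OF that]]]
          L2_mult[OF r(2)[OF that] L(2)[OF that]] by simp
      have "(\<lambda>x. D t x \<bullet> G x) = (\<lambda>x. \<Sum>b\<in>Basis. (D t x \<bullet> b) * (G x \<bullet> b))"
        by (rule ext) (rule euclidean_inner)
      then show "(\<integral>x. D t x \<bullet> G x \<partial>lebesgue_on Om) = (\<Sum>b\<in>Basis. \<integral>x. (D t x \<bullet> b) * (G x \<bullet> b) \<partial>lebesgue_on Om)"
        using i by (simp only: Bochner_Integration.integral_sum)
    qed
  qed
  then have "AE t in lborel. t \<in> {0<..<T} \<longrightarrow> (\<Sum>b\<in>Basis. \<integral>x. (D' (t, x) \<bullet> b) * (G' x \<bullet> b) \<partial>lborel)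
      = (\<integral>x. D t x \<bullet> G x \<partial>lebesgue_on Om)"
    using isrep_AE[OF P] by eventually_elim simp
  then show ?thesis using P unfolding isrep_def by blast
qed

lemma isrep_integral_mult:
  fixes u :: "real \<Rightarrow> real"
  assumes r: "isrep {0<..<T} u u'" and t: "test_fun {0<..<T} \<eta> D\<eta>"
  shows "(\<integral>t. u t * \<eta> t \<partial>lebesgue_on {0<..<T}) = (\<integral>t. u' t * \<eta> t \<partial>lborel)"
    "(\<integral>t. u t * D\<eta> t \<partial>lebesgue_on {0<..<T}) = (\<integral>t. u' t * D\<eta> t \<partial>lborel)"
  using isrep_integral(1)[OF _ isrep_mult_borel[OF r], of \<eta>] isrep_integral(1)[OF _ isrep_mult_borel[OF r], of D\<eta>]
    test_fun_L2(1)[OF t] test_fun_L2(2)[OF t, of 1]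
  by (auto simp: L2_def)

text \<open>The duality pairing prescribed by the weak form of \<open>c * g\<^sub>t = a * \<Delta>g + F\<close> with Neumann condition.\<close>
definition wpair :: "real \<Rightarrow> real \<Rightarrow> (real \<Rightarrow> 'a::euclidean_space \<Rightarrow> 'a) \<Rightarrow> (real \<Rightarrow> 'a \<Rightarrow> real)
    \<Rightarrow> real \<Rightarrow> ('a \<Rightarrow> real) \<Rightarrow> real" where
  "wpair c a D F t v = c * ((\<integral>x. F t x * v x \<partial>lebesgue_on Om) - a * (\<integral>x. D t x \<bullet> grad v x \<partial>lebesgue_on Om))"

text \<open>Prepares both translations between \<open>dual_dt\<close> and \<open>weq\<close>: the
  pairing becomes measurable in time, and its integral against \<open>\<eta>\<close> becomes one
  over the cylinder.\<close>

lemma isrep_wpair: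
  fixes D :: "real \<Rightarrow> 'a::euclidean_space \<Rightarrow> 'a"
  assumes D: "\<And>b. b \<in> Basis \<Longrightarrow> isrep (Qc T) (\<lambda>p. D (fst p) (snd p) \<bullet> b) (\<lambda>p. D' p \<bullet> b)" "QV T D'"
    and F: "isrep (Qc T) (\<lambda>p. F (fst p) (snd p)) F'" "L2 lborel F'"
    and v: "isrep Om v v'" "H1g v' G"
  shows "isrep {0<..<T} (\<lambda>t. wpair c a D F t v)
     (\<lambda>t. c * ((\<integral>x. F' (t, x) * v' x \<partial>lborel) - a * (\<Sum>b\<in>Basis. \<integral>x. (D' (t, x) \<bullet> b) * (G x \<bullet> b) \<partial>lborel)))"
    and "test_fun {0<..<T} \<eta> D\<eta> \<Longrightarrow> (\<integral>t. wpair c a D F t v * \<eta> t \<partial>lebesgue_on {0<..<T})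
      = c * ((\<integral>p. F' p * (v' (snd p) * \<eta> (fst p)) \<partial>lborel)
         - a * (\<Sum>b\<in>Basis. \<integral>p. (D' p \<bullet> b) * ((G (snd p) \<bullet> b) * \<eta> (fst p)) \<partial>lborel))"
proof -
  have Lv: "L2 lborel v'" and LG: "\<And>b. b \<in> Basis \<Longrightarrow> L2 lborel (\<lambda>x. G x \<bullet> b)" using H1g_props[OF v(2)] by auto
  have LD: "\<And>b. b \<in> Basis \<Longrightarrow> L2 lborel (\<lambda>p. D' p \<bullet> b)" using D(2) by (simp add: QV_def)
  note r1 = isrep_pairing[OF F(1) v(1)] and r2 = isrep_pairing_grad[OF D(1) H1g_imp(2)[OF v] LD LG]
  have k: "isrep S (\<lambda>x. c * u x) (\<lambda>x. c * u' x)" if "isrep S u u'" for S :: "real set" and u u' and c :: real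
    using isrep_mult_borel[OF that, of "\<lambda>x. c"] by (simp add: mult.commute)
  show R: "isrep {0<..<T} (\<lambda>t. wpair c a D F t v)
     (\<lambda>t. c * ((\<integral>x. F' (t, x) * v' x \<partial>lborel) - a * (\<Sum>b\<in>Basis. \<integral>x. (D' (t, x) \<bullet> b) * (G x \<bullet> b) \<partial>lborel)))"
    unfolding wpair_def by (intro k isrep_diff r1 r2)
  assume t: "test_fun {0<..<T} \<eta> D\<eta>"
  note L\<eta> = test_fun_L2(1)[OF t]
  note pF = pairing_integral[OF F(2) Lv L\<eta>] and pD = pairing_integral[OF LD LG L\<eta>]
  have "(\<integral>t. wpair c a D F t v * \<eta> t \<partial>lebesgue_on {0<..<T})
    = (\<integral>t. c * ((\<integral>x. F' (t, x) * v' x \<partial>lborel) - a * (\<Sum>b\<in>Basis. \<integral>x. (D' (t, x) \<bullet> b) * (G x \<bullet> b) \<partial>lborel)) * \<eta> t \<partial>lborel)"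
    by (rule isrep_integral_mult(1)[OF R t])
  also have "\<dots> = (\<integral>t. c * ((\<integral>x. F' (t, x) * v' x \<partial>lborel) * \<eta> t
        - a * (\<Sum>b\<in>Basis. (\<integral>x. (D' (t, x) \<bullet> b) * (G x \<bullet> b) \<partial>lborel) * \<eta> t)) \<partial>lborel)"
    by (rule Bochner_Integration.integral_cong) (simp_all only: sum_distrib_right[symmetric], simp add: algebra_simps)
  also have "\<dots> = c * ((\<integral>t. (\<integral>x. F' (t, x) * v' x \<partial>lborel) * \<eta> t \<partial>lborel)
        - a * (\<Sum>b\<in>Basis. \<integral>t. (\<integral>x. (D' (t, x) \<bullet> b) * (G x \<bullet> b) \<partial>lborel) * \<eta> t \<partial>lborel))"
    using pF(2) pD(2) by (simp add: Bochner_Integration.integral_sum Bochner_Integration.integrable_sum)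
  finally show "(\<integral>t. wpair c a D F t v * \<eta> t \<partial>lebesgue_on {0<..<T})
      = c * ((\<integral>p. F' p * (v' (snd p) * \<eta> (fst p)) \<partial>lborel)
         - a * (\<Sum>b\<in>Basis. \<integral>p. (D' p \<bullet> b) * ((G (snd p) \<bullet> b) * \<eta> (fst p)) \<partial>lborel))"
    by (simp add: pF(1) pD(1) cong: sum.cong)
qed

lemma Ioo_sets: "{0<..<T::real} \<in> sets borel" by simp

text \<open>Integrated against \<open>\<eta>\<close>, the equation for almost every time turns into
  an identity over the cylinder, and the duality pairing \<open>w\<close> drops out through the
  definition of the time derivative.\<close>

lemma weq_of_weak:
  fixes g F :: "real \<Rightarrow> 'a::euclidean_space \<Rightarrow> real"
  assumes g: "L2H1 T g Dg" and w: "dual_dt T g w"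
    and rg: "isrep (Qc T) (\<lambda>p. g (fst p) (snd p)) g'"
    and rF: "isrep (Qc T) (\<lambda>p. F (fst p) (snd p)) F'" and LF: "L2 lborel F'"
    and eq: "AE t in lebesgue_on {0<..<T}. \<forall>v. H1 v \<longrightarrow> w t v = wpair c a Dg F t v"
  obtains D' where "weq c T a g' D' F'"
proof -
  have Lg: "L2 (lebesgue_on (Qc T)) (\<lambda>p. g (fst p) (snd p))"
    and LD: "\<And>b. b \<in> Basis \<Longrightarrow> L2 (lebesgue_on (Qc T)) (\<lambda>p. Dg (fst p) (snd p) \<bullet> b)"
    and wg: "AE t in lebesgue_on {0<..<T}. weak_grad (g t) (Dg t)"
    using g by (auto simp: L2H1_def)
  obtain D' where rD: "\<And>b. b \<in> Basis \<Longrightarrow> isrep (Qc T) (\<lambda>p. Dg (fst p) (snd p) \<bullet> b) (\<lambda>p. D' p \<bullet> b)"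
    "\<And>b. b \<in> Basis \<Longrightarrow> L2 lborel (\<lambda>p. D' p \<bullet> b)" "\<And>p. p \<notin> Qc T \<Longrightarrow> D' p = 0"
    using vector_isrep_exists[OF Qc_sets LD] by blast
  have q: "QL2 T g'" "QL2 T F'"
    using isrep_L2(1)[OF Qc_sets rg] Lg LF isrep_zero[OF rg] isrep_zero[OF rF]
    unfolding QL2_def by blast+
  have qD: "QV T D'" using rD(2,3) by (simp only: QV_def) blast
  have slD: "AE t in lborel. \<forall>b\<in>Basis. 0 < t \<and> t < T \<longrightarrow> isrep Om (\<lambda>x. Dg t x \<bullet> b) (\<lambda>x. D' (t, x) \<bullet> b)"
    by (subst AE_ball_countable[OF countable_finite[OF finite_Basis]], rule ballI, rule isrep_slice, rule rD(1))
  have wg': "AE t in lborel. t \<in> {0<..<T} \<longrightarrow> weak_grad (g t) (Dg t)"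
    using wg by (simp only: AE_lebesgue_on_iff[OF Ioo_sets])
  have "AE t in lborel. wgrad (\<lambda>x. g' (t, x)) (\<lambda>x. D' (t, x))"
    using slD wg' isrep_slice[OF rg]
  proof eventually_elim
    case (elim t)
    show ?case
    proof (cases "t \<in> {0<..<T}")
      case True
      then have "isrep Om (g t) (\<lambda>x. g' (t, x))" "\<And>b. b \<in> Basis \<Longrightarrow> isrep Om (\<lambda>x. Dg t x \<bullet> b) (\<lambda>x. D' (t, x) \<bullet> b)"
        using elim by auto
      from weak_grad_isrep[OF this] show ?thesis using elim(2) True by simp
    next
      case False
      then have "g' (t, x) = 0" "D' (t, x) = 0" for x
        by (auto intro!: isrep_zero[OF rg] rD(3) simp: Qc_def)
      then show ?thesis by (simp add: wgrad_def)
    qed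
  qed
  moreover have "(\<integral>p. g' p * (v (snd p) * D\<eta> (fst p)) \<partial>lborel)
        = c * (a * (\<Sum>b\<in>Basis. \<integral>p. (D' p \<bullet> b) * ((G (snd p) \<bullet> b) * \<eta> (fst p)) \<partial>lborel)
               - (\<integral>p. F' p * (v (snd p) * \<eta> (fst p)) \<partial>lborel))"
    if v: "H1g v G" and t: "test_fun {0<..<T} \<eta> D\<eta>" for v G \<eta> D\<eta>
  proof -
    have rv: "isrep Om v v" by (rule isrep_self[OF H1g_measurable(1)[OF v] H1g_props(3)[OF v]])
    have Hv: "H1 v" by (rule H1g_imp(1)[OF rv v])
    have LD\<eta>: "L2 lborel D\<eta>" using test_fun_L2(2)[OF t, of 1] by simp
    have m: "\<eta> \<in> borel_measurable (lebesgue_on {0<..<T})"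
    proof -
      have "\<eta> \<in> borel_measurable lborel" by (rule L2_meas[OF test_fun_L2(1)[OF t]])
      then show ?thesis by (intro measurable_restrict_space1 measurable_completion)
    qed
    have mw: "(\<lambda>t. w t v) \<in> borel_measurable (lebesgue_on {0<..<T})" using w Hv by (simp add: dual_dt_def)
    note rw = isrep_wpair[OF rD(1) qD rF QL2_L2[OF q(2)] rv v, where c=c and a=a]
    have "(\<integral>p. g' p * (v (snd p) * D\<eta> (fst p)) \<partial>lborel)
        = (\<integral>t. (\<integral>x. g' (t, x) * v x \<partial>lborel) * D\<eta> t \<partial>lborel)"
      by (rule pairing_integral(1)[OF QL2_L2[OF q(1)] H1g_props(1)[OF v] LD\<eta>, symmetric])
    also have "\<dots> = (\<integral>t. (\<integral>x. g t x * v x \<partial>lebesgue_on Om) * D\<eta> t \<partial>lebesgue_on {0<..<T})"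
      by (rule isrep_integral_mult(2)[OF isrep_pairing[OF rg rv] t, symmetric])
    also have "\<dots> = - (\<integral>t. w t v * \<eta> t \<partial>lebesgue_on {0<..<T})"
      using w Hv t unfolding dual_dt_def by blast
    also have "(\<integral>t. w t v * \<eta> t \<partial>lebesgue_on {0<..<T}) = (\<integral>t. wpair c a Dg F t v * \<eta> t \<partial>lebesgue_on {0<..<T})"
    proof (rule integral_cong_AE)
      show "(\<lambda>t. w t v * \<eta> t) \<in> borel_measurable (lebesgue_on {0<..<T})" by (rule borel_measurable_times[OF mw m])
      show "(\<lambda>t. wpair c a Dg F t v * \<eta> t) \<in> borel_measurable (lebesgue_on {0<..<T})"
        by (rule borel_measurable_times[OF isrep_meas_orig[OF Ioo_sets rw(1)] m])
      show "AE t in lebesgue_on {0<..<T}. w t v * \<eta> t = wpair c a Dg F t v * \<eta> t"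
        using eq by eventually_elim (use Hv in simp)
    qed
    also have "\<dots> = c * ((\<integral>p. F' p * (v (snd p) * \<eta> (fst p)) \<partial>lborel)
         - a * (\<Sum>b\<in>Basis. \<integral>p. (D' p \<bullet> b) * ((G (snd p) \<bullet> b) * \<eta> (fst p)) \<partial>lborel))"
      by (rule rw(2)[OF _ t])
    finally show ?thesis by (simp add: algebra_simps)
  qed
  ultimately have "weq c T a g' D' F'" unfolding weq_def using q qD by blast
  then show ?thesis by (rule that)
qed

lemma H1g_lincomb:
  assumes 1: "H1g v1 G1" and 2: "H1g v2 G2"
  shows "H1g (\<lambda>x. a * v1 x + b * v2 x) (\<lambda>x. a *\<^sub>R G1 x + b *\<^sub>R G2 x)"
proof -
  note P = H1g_props[OF 1] and R = H1g_props[OF 2]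
  have "wgrad (\<lambda>x. a * v1 x + b * v2 x) (\<lambda>x. a *\<^sub>R G1 x + b *\<^sub>R G2 x)"
    unfolding wgrad_def
  proof (intro allI impI ballI)
    fix \<phi> :: "'a \<Rightarrow> real" and D\<phi> and e :: 'a
    assume t: "test_fun Om \<phi> D\<phi>" and e: "e \<in> Basis"
    note T = test_fun_L2[OF t]
    have "(\<integral>x. (a * v1 x + b * v2 x) * (D\<phi> x \<bullet> e) \<partial>lborel)
       = a * (\<integral>x. v1 x * (D\<phi> x \<bullet> e) \<partial>lborel) + b * (\<integral>x. v2 x * (D\<phi> x \<bullet> e) \<partial>lborel)"
      using L2_mult[OF P(1) T(2)] L2_mult[OF R(1) T(2)] by (simp add: distrib_right mult.assoc)
    also have "\<dots> = - (a * (\<integral>x. (G1 x \<bullet> e) * \<phi> x \<partial>lborel) + b * (\<integral>x. (G2 x \<bullet> e) * \<phi> x \<partial>lborel))"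
      using P(5) R(5) t e by (simp add: wgrad_def)
    also have "\<dots> = - (\<integral>x. ((a *\<^sub>R G1 x + b *\<^sub>R G2 x) \<bullet> e) * \<phi> x \<partial>lborel)"
      using L2_mult[OF P(2)[OF e] T(1)] L2_mult[OF R(2)[OF e] T(1)]
      by (simp add: inner_add_left distrib_right mult.assoc)
    finally show "(\<integral>x. (a * v1 x + b * v2 x) * (D\<phi> x \<bullet> e) \<partial>lborel)
        = - (\<integral>x. ((a *\<^sub>R G1 x + b *\<^sub>R G2 x) \<bullet> e) * \<phi> x \<partial>lborel)" .
  qed
  then show ?thesis using P R by (auto simp: H1g_def inner_add_left intro!: L2_add L2_cmult)
qed

lemma isrep_lincomb:
  assumes "isrep S u u'" "isrep S v v'" shows "isrep S (\<lambda>x. a * u x + b * v x) (\<lambda>x. a * u' x + b * v' x)"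
  using isrep_diff[OF isrep_mult_borel[OF assms(1), of "\<lambda>x. a"] isrep_mult_borel[OF assms(2), of "\<lambda>x. - b"]]
  by (simp add: mult.commute)

lemma inner_integral_rep:
  fixes D G :: "'a::euclidean_space \<Rightarrow> 'a"
  assumes D: "\<And>b. b \<in> Basis \<Longrightarrow> isrep Om (\<lambda>x. D x \<bullet> b) (\<lambda>x. D' x \<bullet> b)" "\<And>b. b \<in> Basis \<Longrightarrow> L2 lborel (\<lambda>x. D' x \<bullet> b)"
    and G: "\<And>b. b \<in> Basis \<Longrightarrow> isrep Om (\<lambda>x. G x \<bullet> b) (\<lambda>x. G' x \<bullet> b)" "\<And>b. b \<in> Basis \<Longrightarrow> L2 lborel (\<lambda>x. G' x \<bullet> b)"
  shows "(\<integral>x. D x \<bullet> G x \<partial>lebesgue_on Om) = (\<Sum>b\<in>Basis. \<integral>x. (D' x \<bullet> b) * (G' x \<bullet> b) \<partial>lborel)"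
proof -
  have r: "isrep Om (\<lambda>x. (D x \<bullet> b) * (G x \<bullet> b)) (\<lambda>x. (D' x \<bullet> b) * (G' x \<bullet> b))" if "b \<in> Basis" for b
    by (rule isrep_mult[OF D(1)[OF that] G(1)[OF that]])
  have i: "integrable (lebesgue_on Om) (\<lambda>x. (D x \<bullet> b) * (G x \<bullet> b))" if "b \<in> Basis" for b
    using isrep_integral(2)[OF Om_sets r[OF that]] L2_mult[OF D(2)[OF that] G(2)[OF that]] by simp
  have "(\<lambda>x. D x \<bullet> G x) = (\<lambda>x. \<Sum>b\<in>Basis. (D x \<bullet> b) * (G x \<bullet> b))"
    by (rule ext) (rule euclidean_inner)
  then have "(\<integral>x. D x \<bullet> G x \<partial>lebesgue_on Om) = (\<Sum>b\<in>Basis. \<integral>x. (D x \<bullet> b) * (G x \<bullet> b) \<partial>lebesgue_on Om)"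
    using i by (simp only: Bochner_Integration.integral_sum)
  also have "\<dots> = (\<Sum>b\<in>Basis. \<integral>x. (D' x \<bullet> b) * (G' x \<bullet> b) \<partial>lborel)"
    by (rule sum.cong[OF refl]) (rule isrep_integral(1)[OF Om_sets r])
  finally show ?thesis .
qed

text \<open>The norm of a time slice; these norms make up the bound on the pairing that
  \<open>dual_dt\<close> requires.\<close>

definition snorm :: "(real \<times> 'a::euclidean_space \<Rightarrow> real) \<Rightarrow> real \<Rightarrow> real" where
  "snorm h t = sqrt (\<integral>x. (h (t, x))^2 \<partial>lborel)"

lemma L2_snorm:
  assumes h: "L2 lborel h" shows "L2 lborel (snorm h)"
proof -
  have i: "integrable lborel (\<lambda>t. \<integral>x. (h (t, x))^2 \<partial>lborel)"
    by (rule integrable_slice[OF L2_sq[OF h]])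
  then have "(\<lambda>t. \<integral>x. (h (t, x))^2 \<partial>lborel) \<in> borel_measurable borel"
    by (auto dest: borel_measurable_integrable)
  then have "snorm h \<in> borel_measurable borel" unfolding snorm_def[abs_def] by measurable
  moreover have "(snorm h t)^2 = (\<integral>x. (h (t, x))^2 \<partial>lborel)" for t unfolding snorm_def by simp
  ultimately show ?thesis using i by (simp add: L2_def)
qed

lemma L2_lborel_imp_L2_lebesgue_on:
  assumes S: "S \<in> sets borel" and C: "L2 lborel (C :: 'b::euclidean_space \<Rightarrow> real)"
  shows "L2 (lebesgue_on S) C"
proof -
  have m: "C \<in> borel_measurable borel" using C by (simp add: L2_def)
  have "isrep S C (\<lambda>x. indicator S x * C x)"
    unfolding isrep_def using S m by (auto intro!: borel_measurable_times borel_measurable_indicator)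
  moreover have "L2 lborel (\<lambda>x. indicator S x * C x)"
    by (rule L2_mult_bdd[OF C, of _ 1]) (use S in \<open>auto split: split_indicator intro!: borel_measurable_indicator\<close>)
  ultimately show ?thesis using isrep_L2(1)[OF S] by blast
qed

text \<open>The right hand side of the weak equation is itself taken as the time derivative:
  Cauchy-Schwarz on slices bounds it by a square-integrable multiple of \<open>H1norm\<close>, and
  \<open>weq\<close> says that it is the distributional derivative of \<open>g\<close>.\<close>

lemma weak_of_weq:
  fixes g F :: "real \<Rightarrow> 'a::euclidean_space \<Rightarrow> real" and D' :: "real \<times> 'a \<Rightarrow> 'a"
  assumes W: "weq c T a g' D' F'" and rg: "isrep (Qc T) (\<lambda>p. g (fst p) (snd p)) g'"
    and rF: "isrep (Qc T) (\<lambda>p. F (fst p) (snd p)) F'"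
  defines "D \<equiv> \<lambda>t x. D' (t, x)"
  shows "L2H1 T g D" "dual_dt T g (wpair c a D F)"
proof -
  have q: "QL2 T g'" "QV T D'" "QL2 T F'" using W by (auto simp: weq_def)
  have wg: "AE t in lborel. wgrad (\<lambda>x. g' (t, x)) (\<lambda>x. D' (t, x))" using W by (auto simp: weq_def)
  have LD: "\<And>b. b \<in> Basis \<Longrightarrow> L2 lborel (\<lambda>p. D' p \<bullet> b)" using q(2) by (simp add: QV_def)
  have rD: "isrep (Qc T) (\<lambda>p. D (fst p) (snd p) \<bullet> b) (\<lambda>p. D' p \<bullet> b)" if "b \<in> Basis" for b
    unfolding D_def prod.collapse
    by (rule isrep_self[OF L2_meas[OF LD[OF that], simplified]])
       (use q(2) in \<open>simp add: QV_def del: split_paired_All\<close>)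
  have slD: "AE t in lborel. \<forall>b\<in>Basis. (0 < t \<and> t < T \<longrightarrow> isrep Om (\<lambda>x. D t x \<bullet> b) (\<lambda>x. D' (t, x) \<bullet> b))
      \<and> L2 lborel (\<lambda>x. D' (t, x) \<bullet> b)"
  proof (subst AE_ball_countable[OF countable_finite[OF finite_Basis]], rule ballI)
    fix b :: 'a assume b: "b \<in> Basis"
    show "AE t in lborel. (0 < t \<and> t < T \<longrightarrow> isrep Om (\<lambda>x. D t x \<bullet> b) (\<lambda>x. D' (t, x) \<bullet> b))
      \<and> L2 lborel (\<lambda>x. D' (t, x) \<bullet> b)"
      using isrep_slice[OF rD[OF b]] AE_L2_slice(1)[OF LD[OF b]] by eventually_elim simp
  qed
  have wgl: "AE t in lebesgue_on {0<..<T}. weak_grad (g t) (D t)"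
    unfolding AE_lebesgue_on_iff[OF Ioo_sets]
    using slD wg isrep_slice[OF rg]
  proof eventually_elim
    case (elim t)
    show ?case
    proof
      assume "t \<in> {0<..<T}"
      then have "isrep Om (g t) (\<lambda>x. g' (t, x))" "\<And>b. b \<in> Basis \<Longrightarrow> isrep Om (\<lambda>x. D t x \<bullet> b) (\<lambda>x. D' (t, x) \<bullet> b)"
        using elim by auto
      from weak_grad_isrep[OF this] show "weak_grad (g t) (D t)" using elim(2) by simp
    qed
  qed
  show "L2H1 T g D"
    unfolding L2H1_def
  proof (intro conjI ballI)
    show "L2 (lebesgue_on (Qc T)) (\<lambda>p. g (fst p) (snd p))"
      using isrep_L2(1)[OF Qc_sets rg] QL2_L2[OF q(1)] by simp
    fix b :: 'a assume b: "b \<in> Basis"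
    show "L2 (lebesgue_on (Qc T)) (\<lambda>p. D (fst p) (snd p) \<bullet> b)"
      using isrep_L2(1)[OF Qc_sets rD[OF b]] LD[OF b] by simp
  qed (rule wgl)
  define C where "C t = \<bar>c\<bar> * (snorm F' t + \<bar>a\<bar> * (\<Sum>b\<in>Basis. snorm (\<lambda>p. D' p \<bullet> b) t))" for t
  have LC: "L2 (lebesgue_on {0<..<T}) C"
    unfolding C_def
    by (intro L2_lborel_imp_L2_lebesgue_on[OF Ioo_sets] L2_cmult L2_add L2_sum L2_snorm LD QL2_L2[OF q(3)])
  have main: "AE t in lebesgue_on {0<..<T}.
           (\<forall>v1 v2 \<alpha> \<beta>. H1 v1 \<longrightarrow> H1 v2 \<longrightarrow> wpair c a D F t (\<lambda>x. \<alpha> * v1 x + \<beta> * v2 x)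
               = \<alpha> * wpair c a D F t v1 + \<beta> * wpair c a D F t v2) \<and>
           (\<forall>v. H1 v \<longrightarrow> \<bar>wpair c a D F t v\<bar> \<le> C t * H1norm v)"
    unfolding AE_lebesgue_on_iff[OF Ioo_sets]
    using slD isrep_slice[OF rF] AE_L2_slice(1)[OF QL2_L2[OF q(3)]]
  proof eventually_elim
    case (elim t)
    show ?case
    proof
      assume t: "t \<in> {0<..<T}"
      have sD: "\<And>b. b \<in> Basis \<Longrightarrow> isrep Om (\<lambda>x. D t x \<bullet> b) (\<lambda>x. D' (t, x) \<bullet> b)"
        "\<And>b. b \<in> Basis \<Longrightarrow> L2 lborel (\<lambda>x. D' (t, x) \<bullet> b)" using elim(1) t by auto
      have sF: "isrep Om (F t) (\<lambda>x. F' (t, x))" "L2 lborel (\<lambda>x. F' (t, x))" using elim(2,3) t by auto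
      \<comment> \<open>On a good slice the pairing is computed from representatives for all
        \<open>v\<close> at once: the exceptional times do not depend on \<open>v\<close>.\<close>
      have wp: "wpair c a D F t v = c * ((\<integral>x. F' (t, x) * v' x \<partial>lborel)
          - a * (\<Sum>b\<in>Basis. \<integral>x. (D' (t, x) \<bullet> b) * (G x \<bullet> b) \<partial>lborel))"
        if v: "isrep Om v v'" "H1g v' G" for v v' G
      proof -
        have "(\<integral>x. D t x \<bullet> grad v x \<partial>lebesgue_on Om) = (\<Sum>b\<in>Basis. \<integral>x. (D' (t, x) \<bullet> b) * (G x \<bullet> b) \<partial>lborel)"
          by (rule inner_integral_rep[OF sD H1g_imp(2)[OF v] H1g_props(2)[OF v(2)]])
        then show ?thesis unfolding wpair_def isrep_integral(1)[OF Om_sets isrep_mult[OF sF(1) v(1)]] by simp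
      qed
      show "(\<forall>v1 v2 \<alpha> \<beta>. H1 v1 \<longrightarrow> H1 v2 \<longrightarrow> wpair c a D F t (\<lambda>x. \<alpha> * v1 x + \<beta> * v2 x)
               = \<alpha> * wpair c a D F t v1 + \<beta> * wpair c a D F t v2) \<and>
           (\<forall>v. H1 v \<longrightarrow> \<bar>wpair c a D F t v\<bar> \<le> C t * H1norm v)"
      proof (intro conjI allI impI)
        fix v1 v2 :: "'a \<Rightarrow> real" and \<alpha> \<beta> :: real
        assume "H1 v1" "H1 v2"
        then obtain w1 G1 w2 G2 where r: "H1g w1 G1" "isrep Om v1 w1" "H1g w2 G2" "isrep Om v2 w2"
          using H1_rep by metis
        note L1 = H1g_props[OF r(1)] and L2' = H1g_props[OF r(3)]
        have e1: "(\<integral>x. F' (t, x) * (\<alpha> * w1 x + \<beta> * w2 x) \<partial>lborel)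
          = \<alpha> * (\<integral>x. F' (t, x) * w1 x \<partial>lborel) + \<beta> * (\<integral>x. F' (t, x) * w2 x \<partial>lborel)"
          using L2_mult[OF sF(2) L1(1)] L2_mult[OF sF(2) L2'(1)] by (simp add: distrib_left mult.left_commute)
        have "(\<Sum>b\<in>Basis. \<integral>x. (D' (t, x) \<bullet> b) * ((\<alpha> *\<^sub>R G1 x + \<beta> *\<^sub>R G2 x) \<bullet> b) \<partial>lborel)
          = (\<Sum>b\<in>Basis. \<alpha> * (\<integral>x. (D' (t, x) \<bullet> b) * (G1 x \<bullet> b) \<partial>lborel) + \<beta> * (\<integral>x. (D' (t, x) \<bullet> b) * (G2 x \<bullet> b) \<partial>lborel))"
          by (rule sum.cong[OF refl])
             (use L2_mult[OF sD(2) L1(2)] L2_mult[OF sD(2) L2'(2)] in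
               \<open>simp add: inner_add_left distrib_left mult.left_commute\<close>)
        then have e2: "(\<Sum>b\<in>Basis. \<integral>x. (D' (t, x) \<bullet> b) * ((\<alpha> *\<^sub>R G1 x + \<beta> *\<^sub>R G2 x) \<bullet> b) \<partial>lborel)
          = \<alpha> * (\<Sum>b\<in>Basis. \<integral>x. (D' (t, x) \<bullet> b) * (G1 x \<bullet> b) \<partial>lborel)
            + \<beta> * (\<Sum>b\<in>Basis. \<integral>x. (D' (t, x) \<bullet> b) * (G2 x \<bullet> b) \<partial>lborel)"
          by (simp only: sum.distrib sum_distrib_left)
        show "wpair c a D F t (\<lambda>x. \<alpha> * v1 x + \<beta> * v2 x) = \<alpha> * wpair c a D F t v1 + \<beta> * wpair c a D F t v2"
          unfolding wp[OF r(2,1)] wp[OF r(4,3)] wp[OF isrep_lincomb[OF r(2,4)] H1g_lincomb[OF r(1,3)]] e1 e2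
          by (simp add: algebra_simps)
      next
        fix v :: "'a \<Rightarrow> real" assume "H1 v"
        then obtain w G where r: "H1g w G" "isrep Om v w" using H1_rep by metis
        note L = H1g_props[OF r(1)]
        note rG = H1g_imp(2)[OF r(2,1)]
        have n2: "(\<integral>x. (norm (grad v x))^2 \<partial>lebesgue_on Om) = (\<Sum>b\<in>Basis. \<integral>x. (G x \<bullet> b)^2 \<partial>lborel)"
          unfolding power2_norm_eq_inner using inner_integral_rep[OF rG L(2) rG L(2)] by (simp add: power2_eq_square)
        have H: "H1norm v = sqrt ((\<integral>x. (w x)^2 \<partial>lborel) + (\<Sum>b\<in>Basis. \<integral>x. (G x \<bullet> b)^2 \<partial>lborel))"
          unfolding H1norm_def n2 isrep_L2(2)[OF Om_sets r(2)] ..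
        have S0: "0 \<le> (\<Sum>b\<in>Basis. \<integral>x. (G x \<bullet> b)^2 \<partial>lborel)" by (intro sum_nonneg) simp
        have H1: "sqrt (\<integral>x. (w x)^2 \<partial>lborel) \<le> H1norm v" unfolding H using S0 by simp
        have H2: "sqrt (\<integral>x. (G x \<bullet> b)^2 \<partial>lborel) \<le> H1norm v" if "b \<in> Basis" for b
        proof -
          have "(\<integral>x. (G x \<bullet> b)^2 \<partial>lborel) \<le> (\<Sum>b\<in>Basis. \<integral>x. (G x \<bullet> b)^2 \<partial>lborel)"
            by (rule member_le_sum[OF that]) auto
          moreover have "0 \<le> (\<integral>x. (w x)^2 \<partial>lborel)" by simp
          ultimately show ?thesis unfolding H by (intro real_sqrt_le_mono) linarith
        qed
        have b1: "\<bar>\<integral>x. F' (t, x) * w x \<partial>lborel\<bar> \<le> snorm F' t * H1norm v"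
          by (rule order_trans[OF L2_Cauchy_Schwarz[OF sF(2) L(1)]])
             (unfold snorm_def, intro mult_left_mono H1, simp)
        have b2: "\<bar>\<integral>x. (D' (t, x) \<bullet> b) * (G x \<bullet> b) \<partial>lborel\<bar> \<le> snorm (\<lambda>p. D' p \<bullet> b) t * H1norm v" if b: "b \<in> Basis" for b
          by (rule order_trans[OF L2_Cauchy_Schwarz[OF sD(2)[OF b] L(2)[OF b]]])
             (unfold snorm_def, intro mult_left_mono H2 b, simp)
        have b3: "\<bar>\<Sum>b\<in>Basis. \<integral>x. (D' (t, x) \<bullet> b) * (G x \<bullet> b) \<partial>lborel\<bar> \<le> (\<Sum>b\<in>Basis. snorm (\<lambda>p. D' p \<bullet> b) t) * H1norm v"
          unfolding sum_distrib_right by (rule order_trans[OF sum_abs sum_mono]) (rule b2)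
        have "\<bar>(\<integral>x. F' (t, x) * w x \<partial>lborel) - a * (\<Sum>b\<in>Basis. \<integral>x. (D' (t, x) \<bullet> b) * (G x \<bullet> b) \<partial>lborel)\<bar>
          \<le> snorm F' t * H1norm v + \<bar>a\<bar> * ((\<Sum>b\<in>Basis. snorm (\<lambda>p. D' p \<bullet> b) t) * H1norm v)"
          using b1 mult_left_mono[OF b3, of "\<bar>a\<bar>"]
          by (intro order_trans[OF abs_triangle_ineq4] add_mono) (auto simp: abs_mult)
        then have "\<bar>c\<bar> * \<bar>(\<integral>x. F' (t, x) * w x \<partial>lborel) - a * (\<Sum>b\<in>Basis. \<integral>x. (D' (t, x) \<bullet> b) * (G x \<bullet> b) \<partial>lborel)\<bar>
          \<le> \<bar>c\<bar> * (snorm F' t * H1norm v + \<bar>a\<bar> * ((\<Sum>b\<in>Basis. snorm (\<lambda>p. D' p \<bullet> b) t) * H1norm v))"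
          by (rule mult_left_mono) simp
        also have "\<dots> = C t * H1norm v" by (simp add: C_def algebra_simps)
        finally show "\<bar>wpair c a D F t v\<bar> \<le> C t * H1norm v"
          unfolding wp[OF r(2,1)] abs_mult[of c] .
      qed
    qed
  qed
  show "dual_dt T g (wpair c a D F)"
    unfolding dual_dt_def
  proof (intro conjI)
    show "\<exists>C. L2 (lebesgue_on {0<..<T}) C \<and>
        (AE t in lebesgue_on {0<..<T}.
           (\<forall>v1 v2 \<alpha> \<beta>. H1 v1 \<longrightarrow> H1 v2 \<longrightarrow> wpair c a D F t (\<lambda>x. \<alpha> * v1 x + \<beta> * v2 x)
               = \<alpha> * wpair c a D F t v1 + \<beta> * wpair c a D F t v2) \<and>
           (\<forall>v. H1 v \<longrightarrow> \<bar>wpair c a D F t v\<bar> \<le> C t * H1norm v))"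
      using LC main by blast
    show "\<forall>v. H1 v \<longrightarrow> (\<lambda>t. wpair c a D F t v) \<in> borel_measurable (lebesgue_on {0<..<T})"
    proof (intro allI impI)
      fix v :: "'a \<Rightarrow> real" assume "H1 v"
      then obtain w G where r: "H1g w G" "isrep Om v w" using H1_rep by metis
      show "(\<lambda>t. wpair c a D F t v) \<in> borel_measurable (lebesgue_on {0<..<T})"
        by (rule isrep_meas_orig[OF Ioo_sets isrep_wpair(1)[OF rD q(2) rF QL2_L2[OF q(3)] r(2,1)]])
    qed
    show "\<forall>v \<eta> D\<eta>. H1 v \<longrightarrow> test_fun {0<..<T} \<eta> D\<eta> \<longrightarrow>
        (\<integral>t. (\<integral>x. g t x * v x \<partial>lebesgue_on Om) * D\<eta> t \<partial>lebesgue_on {0<..<T})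
          = - (\<integral>t. wpair c a D F t v * \<eta> t \<partial>lebesgue_on {0<..<T})"
    proof (intro allI impI)
      fix v :: "'a \<Rightarrow> real" and \<eta> D\<eta> :: "real \<Rightarrow> real" assume "H1 v" and t: "test_fun {0<..<T} \<eta> D\<eta>"
      then obtain w G where r: "H1g w G" "isrep Om v w" using H1_rep by metis
      have LD\<eta>: "L2 lborel D\<eta>" using test_fun_L2(2)[OF t, of 1] by simp
      have "(\<integral>t. (\<integral>x. g t x * v x \<partial>lebesgue_on Om) * D\<eta> t \<partial>lebesgue_on {0<..<T})
         = (\<integral>p. g' p * (w (snd p) * D\<eta> (fst p)) \<partial>lborel)"
        unfolding isrep_integral_mult(2)[OF isrep_pairing[OF rg r(2)] t]
        by (rule pairing_integral(1)[OF QL2_L2[OF q(1)] H1g_props(1)[OF r(1)] LD\<eta>])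
      also have "\<dots> = c * (a * (\<Sum>b\<in>Basis. \<integral>p. (D' p \<bullet> b) * ((G (snd p) \<bullet> b) * \<eta> (fst p)) \<partial>lborel)
               - (\<integral>p. F' p * (w (snd p) * \<eta> (fst p)) \<partial>lborel))"
        using W r(1) t unfolding weq_def by blast
      also have "\<dots> = - (\<integral>t. wpair c a D F t v * \<eta> t \<partial>lebesgue_on {0<..<T})"
      proof -
        have "(\<integral>t. wpair c a D F t v * \<eta> t \<partial>lebesgue_on {0<..<T})
          = c * ((\<integral>p. F' p * (w (snd p) * \<eta> (fst p)) \<partial>lborel)
             - a * (\<Sum>b\<in>Basis. \<integral>p. (D' p \<bullet> b) * ((G (snd p) \<bullet> b) * \<eta> (fst p)) \<partial>lborel))"
          by (rule isrep_wpair(2)[OF rD q(2) rF QL2_L2[OF q(3)] r(2,1) t])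
        then show ?thesis by (simp add: algebra_simps)
      qed
      finally show "(\<integral>t. (\<integral>x. g t x * v x \<partial>lebesgue_on Om) * D\<eta> t \<partial>lebesgue_on {0<..<T})
          = - (\<integral>t. wpair c a D F t v * \<eta> t \<partial>lebesgue_on {0<..<T})" .
    qed
  qed
qed

lemma has_trace_iff_ctrace:
  fixes g :: "real \<Rightarrow> 'a::euclidean_space \<Rightarrow> real"
  assumes rg: "isrep (Qc T) (\<lambda>p. g (fst p) (snd p)) g'" and rh: "isrep Om h h'"
  shows "has_trace T g t0 h \<longleftrightarrow> ctrace T g' t0 h'"
proof -
  have eq: "AE t in lborel. t \<in> {0<..<T} \<longrightarrow>
      (\<integral>x. (g t x - h x)^2 \<partial>lebesgue_on Om) = (\<integral>x. (g' (t, x) - h' x)^2 \<partial>lborel)"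
    using isrep_slice[OF rg]
  proof eventually_elim
    case (elim t)
    show ?case
    proof
      assume "t \<in> {0<..<T}"
      then have "isrep Om (g t) (\<lambda>x. g' (t, x))" using elim by simp
      from isrep_L2(2)[OF Om_sets isrep_diff[OF this rh]]
      show "(\<integral>x. (g t x - h x)^2 \<partial>lebesgue_on Om) = (\<integral>x. (g' (t, x) - h' x)^2 \<partial>lborel)" .
    qed
  qed
  have "(AE t in lebesgue_on {0<..<T}. \<bar>t - t0\<bar> < d \<longrightarrow> (\<integral>x. (g t x - h x)^2 \<partial>lebesgue_on Om) < e)
     \<longleftrightarrow> (AE t in lborel. 0 < t \<and> t < T \<and> \<bar>t - t0\<bar> < d \<longrightarrow> (\<integral>x. (g' (t, x) - h' x)^2 \<partial>lborel) < e)" for d e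
    unfolding AE_lebesgue_on_iff[OF Ioo_sets]
  proof
    assume "AE t in lborel. t \<in> {0<..<T} \<longrightarrow> \<bar>t - t0\<bar> < d \<longrightarrow> (\<integral>x. (g t x - h x)^2 \<partial>lebesgue_on Om) < e"
    then show "AE t in lborel. 0 < t \<and> t < T \<and> \<bar>t - t0\<bar> < d \<longrightarrow> (\<integral>x. (g' (t, x) - h' x)^2 \<partial>lborel) < e"
      using eq by eventually_elim simp
  next
    assume "AE t in lborel. 0 < t \<and> t < T \<and> \<bar>t - t0\<bar> < d \<longrightarrow> (\<integral>x. (g' (t, x) - h' x)^2 \<partial>lborel) < e"
    then show "AE t in lborel. t \<in> {0<..<T} \<longrightarrow> \<bar>t - t0\<bar> < d \<longrightarrow> (\<integral>x. (g t x - h x)^2 \<partial>lebesgue_on Om) < e"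
      using eq by eventually_elim simp
  qed
  then show ?thesis unfolding has_trace_def ctrace_def isrep_L2(1)[OF Om_sets rh] by simp
qed

subsection \<open>The nonlinearity and spatially constant solutions\<close>

text \<open>Rounding \<open>z\<close> down to multiples of \<open>1/(n+1)\<close> leaves countably
  many values, for which measurability in \<open>x\<close> suffices; continuity in the second
  argument recovers the limit.\<close>

lemma caratheodory_measurable:
  fixes f :: "'a::euclidean_space \<Rightarrow> real \<Rightarrow> real" and z :: "real \<times> 'a \<Rightarrow> real"
  assumes m: "\<And>\<xi>. (\<lambda>x. f x \<xi>) \<in> borel_measurable (lebesgue_on Om)"
    and c: "\<And>x. x \<in> Om \<Longrightarrow> continuous_on UNIV (f x)"
    and z: "z \<in> borel_measurable (lebesgue_on (Qc T))"
  shows "(\<lambda>p. f (snd p) (z p)) \<in> borel_measurable (lebesgue_on (Qc T))"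
proof (rule borel_measurable_LIMSEQ_real)
  have mf: "(\<lambda>p::real \<times> 'a. f (snd p) \<xi>) \<in> borel_measurable (lebesgue_on (Qc T))" for \<xi>
  proof -
    obtain k where k: "isrep Om (\<lambda>x. f x \<xi>) k" using isrep_exists[OF Om_sets m] by blast
    have mk: "(\<lambda>p::real \<times> 'a. k (snd p)) \<in> borel_measurable borel"
      by (rule borel_measurable_coord(2)[OF isrep_measurable[OF k]])
    have "isrep (Qc T) (\<lambda>p::real \<times> 'a. f (snd p) \<xi>) (\<lambda>p. indicator (Qc T) p * k (snd p))"
      unfolding isrep_def
    proof (intro conjI allI impI)
      show "(\<lambda>p. indicator (Qc T) p * k (snd p)) \<in> borel_measurable borel"
        using mk by (intro borel_measurable_times borel_measurable_indicator) auto
      show "AE p in lborel. p \<in> Qc T \<longrightarrow> indicator (Qc T) p * k (snd p) = f (snd p) \<xi>"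
        using AE_lborel_prod_snd[OF isrep_AE[OF k]] by eventually_elim (auto simp: Qc_def)
    qed simp
    then show ?thesis by (rule isrep_meas_orig[OF Qc_sets])
  qed
  fix n :: nat
  show "(\<lambda>p. f (snd p) (real_of_int \<lfloor>z p * real (Suc n)\<rfloor> / real (Suc n))) \<in> borel_measurable (lebesgue_on (Qc T))"
  proof (rule measurable_compose_countable[where f="\<lambda>i p. f (snd p) (real_of_int i / real (Suc n))"])
    show "(\<lambda>p. \<lfloor>z p * real (Suc n)\<rfloor>) \<in> measurable (lebesgue_on (Qc T)) (count_space UNIV)"
      by (rule measurable_compose[OF _ measurable_real_floor]) (use z in simp)
  qed (rule mf)
next
  fix p assume "p \<in> space (lebesgue_on (Qc T :: (real \<times> 'a) set))"
  then have x: "snd p \<in> Om" by (auto simp: Qc_def)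
  have "(\<lambda>n. real_of_int \<lfloor>z p * real (Suc n)\<rfloor> / real (Suc n) - z p) \<longlonglongrightarrow> 0"
  proof (rule Lim_null_comparison[OF always_eventually LIMSEQ_inverse_real_of_nat], rule allI)
    fix n
    have e: "real_of_int \<lfloor>z p * real (Suc n)\<rfloor> / real (Suc n) - z p
      = (real_of_int \<lfloor>z p * real (Suc n)\<rfloor> - z p * real (Suc n)) / real (Suc n)" by (simp add: field_simps)
    have "\<bar>real_of_int \<lfloor>z p * real (Suc n)\<rfloor> - z p * real (Suc n)\<bar> \<le> 1" by linarith
    then show "norm (real_of_int \<lfloor>z p * real (Suc n)\<rfloor> / real (Suc n) - z p) \<le> inverse (real (Suc n))"
      unfolding e by (simp add: divide_inverse abs_mult mult_left_le_one_le)
  qed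
  then have l: "(\<lambda>n. real_of_int \<lfloor>z p * real (Suc n)\<rfloor> / real (Suc n)) \<longlonglongrightarrow> z p" by (simp only: LIM_zero_iff)
  have "isCont (f (snd p)) (z p)" using c[OF x] by (simp add: continuous_on_eq_continuous_at)
  from isCont_tendsto_compose[OF this l]
  show "(\<lambda>n. f (snd p) (real_of_int \<lfloor>z p * real (Suc n)\<rfloor> / real (Suc n))) \<longlonglongrightarrow> f (snd p) (z p)" .
qed

text \<open>The product \<open>e * \<eta>\<close> has compact support, so its derivative integrates
  to 0.\<close>

lemma time_integration_by_parts:
  fixes e e' :: "real \<Rightarrow> real"
  assumes t: "test_fun {0<..<T} \<eta> D\<eta>"
    and e: "\<And>t. (e has_real_derivative e' t) (at t)" and e': "continuous_on UNIV e'"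
  shows "integrable lborel (\<lambda>t. e t * D\<eta> t)" "integrable lborel (\<lambda>t. e' t * \<eta> t)"
    "(\<integral>t. e t * D\<eta> t \<partial>lborel) = - (\<integral>t. e' t * \<eta> t \<partial>lborel)"
proof -
  obtain K where P: "compact K" "K \<subseteq> {0<..<T}" "bounded K"
      "\<And>x. x \<notin> K \<Longrightarrow> \<eta> x = 0" "\<And>x. x \<notin> K \<Longrightarrow> D\<eta> x = 0"
      "continuous_on UNIV \<eta>" "continuous_on UNIV D\<eta>"
      "\<eta> \<in> borel_measurable borel" "D\<eta> \<in> borel_measurable borel"
      "\<And>x b. ((\<lambda>s. \<eta> (x + s *\<^sub>R b)) has_real_derivative D\<eta> x \<bullet> b) (at 0)"
    using test_fun_props[OF t] by blast
  have ce: "continuous_on UNIV e" by (intro continuous_at_imp_continuous_on ballI DERIV_isCont[OF e])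
  have int: "integrable lborel k" if k: "continuous_on UNIV k" "\<And>x. x \<notin> K \<Longrightarrow> k x = 0" for k :: "real \<Rightarrow> real"
  proof -
    obtain M where "\<And>x. norm (k x) \<le> M" using continuous_compact_support_bounded[OF k(1) P(1) k(2)] by blast
    then show ?thesis
      by (intro integrable_bounded_support[OF borel_measurable_continuous_onI[OF k(1)] P(3) k(2)]) auto
  qed
  show i1: "integrable lborel (\<lambda>t. e t * D\<eta> t)"
    by (rule int) (use ce P(5,7) in \<open>auto intro: continuous_on_mult\<close>)
  show i2: "integrable lborel (\<lambda>t. e' t * \<eta> t)"
    by (rule int) (use e' P(4,6) in \<open>auto intro: continuous_on_mult\<close>)
  have c: "continuous_on UNIV (\<lambda>t. e' t * \<eta> t + e t * D\<eta> t)"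
    by (intro continuous_on_add continuous_on_mult ce e' P(6,7))
  obtain M where M: "\<And>x. norm (e' x * \<eta> x + e x * D\<eta> x) \<le> M"
    by (rule continuous_compact_support_bounded[OF c P(1)]) (use P(4,5) in auto)
  have "(\<integral>t. e' t * \<eta> t + e t * D\<eta> t \<partial>lborel) = 0"
  proof (rule integral_directional_derivative_zero[where H="\<lambda>t. e t * \<eta> t" and b=1 and S=K and M=M])
    fix x
    have "((\<lambda>s. e (x + s)) has_real_derivative e' x) (at 0)"
      using e[of x] DERIV_shift[of e "e' x" 0 x] by (simp add: add.commute)
    moreover have "((\<lambda>s. \<eta> (x + s)) has_real_derivative D\<eta> x) (at 0)" using P(10)[of x 1] by simp
    ultimately show "((\<lambda>s. e (x + s *\<^sub>R 1) * \<eta> (x + s *\<^sub>R 1)) has_real_derivative e' x * \<eta> x + e x * D\<eta> x) (at 0)"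
      using DERIV_mult[of "\<lambda>s. e (x + s)" "e' x" 0 UNIV "\<lambda>s. \<eta> (x + s)" "D\<eta> x"] by (simp add: mult.commute add.commute)
    show "\<bar>e' x * \<eta> x + e x * D\<eta> x\<bar> \<le> M" using M[of x] by simp
    have ch: "continuous_on UNIV (\<lambda>t. e t * \<eta> t)" by (intro continuous_on_mult ce P(6))
    show "(\<lambda>t. e t * \<eta> t) \<in> borel_measurable borel" by (rule borel_measurable_continuous_onI[OF ch])
    show "(\<lambda>x. e' x * \<eta> x + e x * D\<eta> x) \<in> borel_measurable borel" by (rule borel_measurable_continuous_onI[OF c])
    show "integrable lborel (\<lambda>t. e t * \<eta> t)" by (rule int[OF ch]) (use P(4) in auto)
  qed (use P(3,4) in auto)
  then show "(\<integral>t. e t * D\<eta> t \<partial>lborel) = - (\<integral>t. e' t * \<eta> t \<partial>lborel)" using i1 i2 by simp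
qed

lemma time_fun_L2:
  assumes e: "continuous_on UNIV (e :: real \<Rightarrow> real)"
  shows "QL2 T (\<lambda>p::real \<times> 'a::euclidean_space. e (fst p) * indicator (Qc T) p)"
proof -
  have "compact (e ` {0..T})" by (rule compact_continuous_image[OF continuous_on_subset[OF e]]) auto
  then have "bounded (e ` {0..T})" by (rule compact_imp_bounded)
  then obtain M where M: "\<And>t. t \<in> {0..T} \<Longrightarrow> \<bar>e t\<bar> \<le> M"
    unfolding bounded_iff real_norm_def by blast
  have M': "\<bar>e (fst p) * indicator (Qc T) p\<bar> \<le> \<bar>M\<bar>" for p :: "real \<times> 'a"
    using M[of "fst p"] by (cases "p \<in> Qc T") (auto simp: Qc_def)
  have "(\<lambda>p::real \<times> 'a. e (fst p) * indicator (Qc T) p) \<in> borel_measurable borel"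
    by (intro borel_measurable_times borel_measurable_indicator borel_measurable_coord(1)
        borel_measurable_continuous_onI[OF e]) auto
  from L2_bounded_support[OF this bounded_Qc[of T] _ M'] show ?thesis by (simp add: QL2_def)
qed

text \<open>A function of time alone has gradient 0 and meets the Neumann condition automatically,
  which makes it a convenient barrier. Its source is \<open>c * e'\<close> because
  \<open>c * c = 1\<close>.\<close>

lemma weq_time:
  fixes e e' :: "real \<Rightarrow> real"
  assumes e: "\<And>t. (e has_real_derivative e' t) (at t)" and e': "continuous_on UNIV e'" and c: "c * c = 1"
  shows "weq c T a (\<lambda>p::real \<times> 'a::euclidean_space. e (fst p) * indicator (Qc T) p) (\<lambda>p. 0)
     (\<lambda>p. c * e' (fst p) * indicator (Qc T) p)"
proof -
  have ce: "continuous_on UNIV e" by (intro continuous_at_imp_continuous_on ballI DERIV_isCont[OF e])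
  have q: "QL2 T (\<lambda>p::real \<times> 'a. e (fst p) * indicator (Qc T) p)" by (rule time_fun_L2[OF ce])
  have qF: "QL2 T (\<lambda>p::real \<times> 'a. c * e' (fst p) * indicator (Qc T) p)"
    by (rule time_fun_L2[where e="\<lambda>t. c * e' t"]) (intro continuous_intros e')
  have "wgrad (\<lambda>x. e (fst (t, x)) * indicator (Qc T) (t, x)) (\<lambda>x::'a. 0)" for t
    unfolding wgrad_def
  proof (intro allI impI ballI)
    fix \<phi> :: "'a \<Rightarrow> real" and D\<phi> and b :: 'a
    assume t: "test_fun Om \<phi> D\<phi>"
    obtain K where K: "K \<subseteq> Om" "\<And>x. x \<notin> K \<Longrightarrow> D\<phi> x = 0"
      by (rule test_fun_props[OF t]) (rule that)
    \<comment> \<open>On the support of the test function the slice is constant, so the integral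
      reduces to that of a derivative of \<open>\<phi>\<close>, which is 0.\<close>
    have eq: "e (fst (t, x)) * indicator (Qc T) (t, x) * (D\<phi> x \<bullet> b) = (e t * indicator {0<..<T} t) * (D\<phi> x \<bullet> b)" for x
    proof (cases "x \<in> Om")
      case True
      then show ?thesis by (simp add: Qc_def indicator_def)
    next
      case False
      then have "D\<phi> x = 0" using K by blast
      then show ?thesis by simp
    qed
    have "(\<integral>x. e (fst (t, x)) * indicator (Qc T) (t, x) * (D\<phi> x \<bullet> b) \<partial>lborel) = (e t * indicator {0<..<T} t) * (\<integral>x. D\<phi> x \<bullet> b \<partial>lborel)"
      unfolding eq by (rule integral_mult_right_zero)
    then show "(\<integral>x. e (fst (t, x)) * indicator (Qc T) (t, x) * (D\<phi> x \<bullet> b) \<partial>lborel) = - (\<integral>x. ((0::'a) \<bullet> b) * \<phi> x \<partial>lborel)"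
      unfolding test_fun_integral_zero[OF t, of b] by simp
  qed
  then have wg: "AE t in lborel. wgrad (\<lambda>x. e (fst (t, x)) * indicator (Qc T) (t, x)) (\<lambda>x::'a. 0)" by simp
  have eq: "(\<integral>p. (e (fst p) * indicator (Qc T) p) * (v (snd p) * D\<eta> (fst p)) \<partial>lborel)
        = c * (a * (\<Sum>b\<in>Basis. \<integral>p. (0 \<bullet> b) * ((G (snd p) \<bullet> b) * \<eta> (fst p)) \<partial>lborel)
               - (\<integral>p. (c * e' (fst p) * indicator (Qc T) p) * (v (snd p) * \<eta> (fst p)) \<partial>lborel))"
    if v: "H1g v G" and t: "test_fun {0<..<T} \<eta> D\<eta>" for v :: "'a \<Rightarrow> real" and G \<eta> D\<eta>
  proof -
    note I = time_integration_by_parts[OF t e e']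
    have iv: "integrable lborel v" by (rule L2_bounded_support_integrable[OF H1g_props(1)[OF v] bounded_Om H1g_props(3)[OF v]])
    obtain K where K: "K \<subseteq> {0<..<T}" "\<And>x. x \<notin> K \<Longrightarrow> \<eta> x = 0" "\<And>x. x \<notin> K \<Longrightarrow> D\<eta> x = 0"
      by (rule test_fun_props[OF t]) (rule that)
    have T: "(\<integral>p. v (snd p) * k (fst p) \<partial>lborel) = (\<integral>x. v x \<partial>lborel) * (\<integral>t. k t \<partial>lborel)"
      if k: "integrable lborel k" for k :: "real \<Rightarrow> real"
      using integral_slice[OF integrable_tensor[OF k iv]] by simp
    \<comment> \<open>The indicator may be dropped: \<open>v\<close> vanishes outside
      \<open>Om\<close>, and \<open>\<eta>\<close> and \<open>D\<eta>\<close> vanish outside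
      \<open>(0,T)\<close>.\<close>
    have s: "(e (fst p) * indicator (Qc T) p) * (v (snd p) * D\<eta> (fst p)) = v (snd p) * (e (fst p) * D\<eta> (fst p))"
       "(c * e' (fst p) * indicator (Qc T) p) * (v (snd p) * \<eta> (fst p)) = c * (v (snd p) * (e' (fst p) * \<eta> (fst p)))" for p
    proof (atomize (full), cases "p \<in> Qc T")
      case True
      then show "(e (fst p) * indicator (Qc T) p) * (v (snd p) * D\<eta> (fst p)) = v (snd p) * (e (fst p) * D\<eta> (fst p)) \<and>
       (c * e' (fst p) * indicator (Qc T) p) * (v (snd p) * \<eta> (fst p)) = c * (v (snd p) * (e' (fst p) * \<eta> (fst p)))"
        by simp
    next
      case False
      then have "fst p \<notin> K \<or> snd p \<notin> Om" using K(1) by (cases p) (auto simp: Qc_def)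
      then have "v (snd p) = 0 \<or> (\<eta> (fst p) = 0 \<and> D\<eta> (fst p) = 0)" using K(2,3) H1g_props(3)[OF v] by blast
      then show "(e (fst p) * indicator (Qc T) p) * (v (snd p) * D\<eta> (fst p)) = v (snd p) * (e (fst p) * D\<eta> (fst p)) \<and>
       (c * e' (fst p) * indicator (Qc T) p) * (v (snd p) * \<eta> (fst p)) = c * (v (snd p) * (e' (fst p) * \<eta> (fst p)))"
        using False by auto
    qed
    have "c * (c * X) = X" for X :: real using c by (simp flip: mult.assoc)
    then show ?thesis unfolding s by (simp add: T[OF I(1)] T[OF I(2)] I(3))
  qed
  have "QV T (\<lambda>p::real \<times> 'a. 0::'a)" by (simp add: QV_def)
  then show ?thesis unfolding weq_def using q qF wg eq by blast
qed

lemma ctrace_time: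
  assumes e: "continuous_on UNIV (e :: real \<Rightarrow> real)"
  shows "ctrace T (\<lambda>p::real \<times> 'a::euclidean_space. e (fst p) * indicator (Qc T) p) t0 (\<lambda>x. e t0 * indicator Om x)"
  unfolding ctrace_def
proof (intro conjI allI impI)
  have LO: "L2 lborel (indicator Om :: 'a \<Rightarrow> real)"
    by (rule L2_bounded_support[of _ Om 1, OF _ bounded_Om]) (auto split: split_indicator)
  show "L2 lborel (\<lambda>x::'a. e t0 * indicator Om x)" by (rule L2_cmult[OF LO])
  fix r :: real assume r: "r > 0"
  define m where "m = (\<integral>x. (indicator Om x :: real)^2 \<partial>(lborel :: 'a measure))"
  have m0: "0 \<le> m" by (simp add: m_def)
  have "isCont e t0" using e by (simp add: continuous_on_eq_continuous_at)
  then have "isCont (\<lambda>t. (e t - e t0)^2 * m) t0" by (intro continuous_intros)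
  then obtain d where d: "d > 0" "\<And>t. \<bar>t - t0\<bar> < d \<Longrightarrow> \<bar>(e t - e t0)^2 * m - (e t0 - e t0)^2 * m\<bar> < r"
    unfolding continuous_at_eps_delta dist_real_def using r by blast
  have "(\<integral>x. (e (fst (t, x)) * indicator (Qc T) (t, x) - e t0 * indicator Om x)^2 \<partial>(lborel :: 'a measure)) < r"
    if t: "0 < t \<and> t < T \<and> \<bar>t - t0\<bar> < d" for t
  proof -
    have "(\<integral>x. (e (fst (t, x)) * indicator (Qc T) (t, x) - e t0 * indicator Om x)^2 \<partial>(lborel :: 'a measure))
        = (\<integral>x. (e t - e t0)^2 * (indicator Om x :: real)^2 \<partial>(lborel :: 'a measure))"
      by (rule Bochner_Integration.integral_cong) (use t in \<open>auto simp: Qc_def split: split_indicator\<close>)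
    also have "\<dots> = (e t - e t0)^2 * m" by (simp add: m_def)
    finally show ?thesis using d(2)[of t] t m0 by simp
  qed
  then show "\<exists>d>0. AE t in lborel. 0 < t \<and> t < T \<and> \<bar>t - t0\<bar> < d \<longrightarrow>
      (\<integral>x. (e (fst (t, x)) * indicator (Qc T) (t, x) - e t0 * indicator Om x)^2 \<partial>(lborel :: 'a measure)) < r"
    using d(1) by (intro exI[of _ d]) auto
qed

text \<open>The infimum is attained: countably many admissible bounds approach it, and their null
  sets can be united. The assumption \<open>b\<close> keeps the set of bounds nonempty.\<close>

lemma Linf_norm_AE:
  fixes u :: "'a::euclidean_space \<Rightarrow> real"
  assumes b: "\<exists>M. AE x in lebesgue_on Om. \<bar>u x\<bar> \<le> M"
  shows "AE x in lborel. x \<in> Om \<longrightarrow> \<bar>u x\<bar> \<le> Linf_norm u"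
proof -
  let ?S = "{M. AE x in lebesgue_on (Om :: 'a set). \<bar>u x\<bar> \<le> M}"
  have AS: "AE x in lborel. x \<in> Om \<longrightarrow> \<bar>u x\<bar> \<le> M" if "M \<in> ?S" for M
    using that by (simp add: AE_lebesgue_on_iff[OF Om_sets])
  have ne: "?S \<noteq> {}" using b by blast
  have all: "AE x in lborel. x \<in> Om \<longrightarrow> \<bar>u x\<bar> \<le> Linf_norm u + inverse (real (Suc n))" for n
  proof -
    have "0 < inverse (real (Suc n))" by simp
    then have "Inf ?S < Linf_norm u + inverse (real (Suc n))" unfolding Linf_norm_def by linarith
    from cInf_lessD[OF ne this] obtain M where M: "M \<in> ?S" "M < Linf_norm u + inverse (real (Suc n))" by blast
    from AS[OF M(1)] show ?thesis
    proof eventually_elim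
      case (elim x)
      then show ?case using M(2) by linarith
    qed
  qed
  have "AE x in lborel. \<forall>n. x \<in> Om \<longrightarrow> \<bar>u x\<bar> \<le> Linf_norm u + inverse (real (Suc n))"
    unfolding AE_all_countable using all by blast
  then show ?thesis
  proof eventually_elim
    case (elim x)
    show ?case
    proof
      assume "x \<in> Om"
      then have le: "\<bar>u x\<bar> \<le> Linf_norm u + inverse (real (Suc n))" for n using elim by blast
      have "(\<lambda>n. Linf_norm u + inverse (real (Suc n))) \<longlonglongrightarrow> Linf_norm u + 0"
        by (intro tendsto_add tendsto_const LIMSEQ_inverse_real_of_nat)
      from LIMSEQ_le_const[OF this, of "\<bar>u x\<bar>"] le show "\<bar>u x\<bar> \<le> Linf_norm u" by simp
    qed
  qed
qed

lemma isrep_cong: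
  assumes "isrep S u u'" "AE x in lborel. x \<in> S \<longrightarrow> u x = v x"
  shows "isrep S v u'"
  unfolding isrep_def
proof (intro conjI allI impI)
  show "AE x in lborel. x \<in> S \<longrightarrow> u' x = v x"
    using isrep_AE[OF assms(1)] assms(2) by eventually_elim simp
qed (use isrep_measurable[OF assms(1)] isrep_zero[OF assms(1)] in auto)

text \<open>\<open>ctrace_nonpos\<close> for the difference between the constant \<open>e\<close> on
  the cylinder and \<open>g\<close>. It carries the lower bound on \<open>\<phi>\<close> to time 0,
  where \<open>\<phi>\<close> becomes a denominator.\<close>

lemma ctrace_lower:
  fixes g :: "real \<times> 'a::euclidean_space \<Rightarrow> real"
  assumes T: "T > 0" and t0: "t0 = 0 \<or> t0 = T" and g: "QL2 T g" and tr: "ctrace T g t0 h"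
    and le: "AE p in lborel. p \<in> Qc T \<longrightarrow> e \<le> g p"
  shows "AE x in lborel. x \<in> Om \<longrightarrow> e \<le> h x"
proof -
  have c: "continuous_on UNIV (\<lambda>t::real. e)" by simp
  note q = time_fun_L2[OF c, of T, where 'a='a] and tr0 = ctrace_time[OF c, of T t0, where 'a='a]
  have "AE p in lborel. e * indicator (Qc T) p - g p \<le> 0"
    using le
  proof eventually_elim
    case (elim p)
    then show ?case using QL2_zero[OF g, of p] by (cases "p \<in> Qc T") auto
  qed
  from ctrace_nonpos[OF QL2_diff[OF q g] T t0 ctrace_diff[OF q g tr0 tr] this]
  show ?thesis by eventually_elim auto
qed

lemma ctrace_mono:
  fixes g :: "real \<times> 'a::euclidean_space \<Rightarrow> real"
  assumes T: "T > 0" and t0: "t0 = 0 \<or> t0 = T" and g: "QL2 T g" "QL2 T g'"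
    and tr: "ctrace T g t0 h" "ctrace T g' t0 h'" and le: "AE p in lborel. g p \<le> g' p"
  shows "AE x in lborel. h x \<le> h' x"
proof -
  have "AE p in lborel. g p - g' p \<le> 0" using le by eventually_elim simp
  from ctrace_nonpos[OF QL2_diff[OF g] T t0 ctrace_diff[OF g tr] this]
  show ?thesis by eventually_elim simp
qed

text \<open>\<open>\<kappa>\<close> may be any bound for \<open>f\<close>; the theorem takes
  \<open>f_sup f\<close>.\<close>

locale coupled_system =
  fixes T \<sigma> \<kappa> :: real and f :: "'a::euclidean_space \<Rightarrow> real \<Rightarrow> real"
  assumes T_pos: "T > 0" and sigma_pos: "\<sigma> > 0"
    and f_meas: "\<And>\<xi>. (\<lambda>x. f x \<xi>) \<in> borel_measurable (lebesgue_on Om)"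
    and f_cont: "\<And>x. x \<in> Om \<Longrightarrow> continuous_on UNIV (f x)"
    and f_mono: "\<And>x. x \<in> Om \<Longrightarrow> antimono (f x)"
    and f_bound: "\<And>x \<xi>. x \<in> Om \<Longrightarrow> \<bar>f x \<xi>\<bar> \<le> \<kappa>"
    and f_nonpos: "\<And>x \<xi>. x \<in> Om \<Longrightarrow> f x \<xi> \<le> 0"
begin

lemma kappa_nonneg: "0 \<le> \<kappa>"
proof -
  have "(Om :: 'a set) \<noteq> {}" by (auto simp: Om_def box_eq_empty)
  then obtain x :: 'a where "x \<in> Om" by blast
  from f_bound[OF this, of 0] show ?thesis by linarith
qed

text \<open>\<open>g\<close> is the unknown and \<open>k\<close> the given factor; since the product
  in the argument of \<open>f\<close> is symmetric, one expression covers both equations.\<close>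

definition NL :: "(real \<times> 'a \<Rightarrow> real) \<Rightarrow> (real \<times> 'a \<Rightarrow> real) \<Rightarrow> real \<times> 'a \<Rightarrow> real" where
  "NL g k p = f (snd p) (g p * k p) * g p / \<sigma>^2"

lemma NL_bound: "p \<in> Qc T \<Longrightarrow> \<bar>NL g k p\<bar> \<le> (\<kappa> / \<sigma>^2) * \<bar>g p\<bar>"
proof -
  assume "p \<in> Qc T"
  then have "\<bar>f (snd p) (g p * k p)\<bar> * \<bar>g p\<bar> \<le> \<kappa> * \<bar>g p\<bar>"
    by (intro mult_right_mono f_bound) (auto simp: Qc_def)
  then have "\<bar>f (snd p) (g p * k p)\<bar> * \<bar>g p\<bar> / \<sigma>^2 \<le> \<kappa> * \<bar>g p\<bar> / \<sigma>^2"
    by (intro divide_right_mono) auto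
  then show ?thesis by (simp add: NL_def abs_mult)
qed

lemma NL_isrep:
  assumes g: "QL2 T g" and k: "k \<in> borel_measurable borel"
  obtains F where "isrep (Qc T) (NL g k) F" "QL2 T F"
proof -
  have m: "h \<in> borel_measurable (lebesgue_on (Qc T :: (real \<times> 'a) set))" if "h \<in> borel_measurable borel" for h :: "real \<times> 'a \<Rightarrow> real"
    using that by (intro measurable_restrict_space1 measurable_completion) simp
  have mg: "g \<in> borel_measurable (lebesgue_on (Qc T))" by (rule m[OF QL2_meas[OF g]])
  have mz: "(\<lambda>p. g p * k p) \<in> borel_measurable (lebesgue_on (Qc T))"
    by (rule borel_measurable_times[OF mg m[OF k]])
  have "NL g k \<in> borel_measurable (lebesgue_on (Qc T))"
    unfolding NL_def[abs_def]
    by (intro borel_measurable_divide borel_measurable_times mg borel_measurable_const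
        caratheodory_measurable[OF f_meas f_cont mz])
  then obtain F where F: "isrep (Qc T) (NL g k) F" using isrep_exists[OF Qc_sets] by blast
  have "L2 lborel F"
  proof (rule L2_bound[OF L2_cmult[OF QL2_L2[OF g], of "\<kappa> / \<sigma>^2"]])
    show "F \<in> borel_measurable lborel" using isrep_measurable[OF F] by simp
    show "AE p in lborel. \<bar>F p\<bar> \<le> \<bar>\<kappa> / \<sigma>^2 * g p\<bar>"
      using isrep_AE[OF F]
    proof eventually_elim
      case (elim p)
      show ?case
      proof (cases "p \<in> Qc T")
        case True
        then show ?thesis using elim NL_bound[OF True, of g k] kappa_nonneg by (simp add: abs_mult)
      next
        case False
        then show ?thesis using isrep_zero[OF F False] by simp
      qed
    qed
  qed
  then have "QL2 T F" unfolding QL2_def using isrep_zero[OF F] by blast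
  then show ?thesis using that F by blast
qed

text \<open>The one-component problem common to both equations; \<open>h\<close> is the datum at the
  endpoint determined by \<open>c\<close>, while gradient and source are hidden.\<close>

definition csol :: "real \<Rightarrow> (real \<times> 'a \<Rightarrow> real) \<Rightarrow> (real \<times> 'a \<Rightarrow> real) \<Rightarrow> ('a \<Rightarrow> real) \<Rightarrow> bool" where
  "csol c g k h \<longleftrightarrow> (\<exists>D F t0. weq c T (\<sigma>^2 / 2) g D F \<and> isrep (Qc T) (NL g k) F \<and> dir T c t0 \<and> ctrace T g t0 h)"

lemma csol_QL2: "csol c g k h \<Longrightarrow> QL2 T g"
  by (auto simp: csol_def weq_def)

lemma dir_sq: "dir T c t0 \<Longrightarrow> c * c = 1"
  by (auto simp: dir_def)

lemma dir_unique: "dir T c t0 \<Longrightarrow> dir T c t1 \<Longrightarrow> t0 = t1"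
  by (auto simp: dir_def)

text \<open>For \<open>comparison\<close> only points with \<open>g1 > g2\<close> matter. There
  \<open>g1 * k1 \<ge> g2 * k2\<close>, so \<open>f\<close> is smaller at the first product, and as
  \<open>f \<le> 0\<close>, multiplying by the larger \<open>g1\<close> lowers the source
  further.\<close>

lemma csol_compare:
  assumes 1: "csol c g1 k1 h1" and 2: "csol c g2 k2 h2"
    and k: "AE p in lborel. p \<in> Qc T \<longrightarrow> 0 \<le> k2 p \<and> k2 p \<le> k1 p"
    and g: "AE p in lborel. 0 \<le> g2 p" and h: "AE x in lborel. h1 x \<le> h2 x"
  shows "AE p in lborel. g1 p \<le> g2 p"
proof -
  obtain D1 F1 t0 where s1: "weq c T (\<sigma>^2 / 2) g1 D1 F1" "isrep (Qc T) (NL g1 k1) F1" "dir T c t0" "ctrace T g1 t0 h1"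
    using 1 by (auto simp: csol_def)
  obtain D2 F2 t1 where s2: "weq c T (\<sigma>^2 / 2) g2 D2 F2" "isrep (Qc T) (NL g2 k2) F2" "dir T c t1" "ctrace T g2 t1 h2"
    using 2 by (auto simp: csol_def)
  have t: "t1 = t0" by (rule dir_unique[OF s2(3) s1(3)])
  have "AE p in lborel. g1 p - g2 p \<le> 0"
  proof (rule comparison[OF weq_diff[OF s1(1) s2(1)] T_pos s1(3)
        ctrace_diff[OF csol_QL2[OF 1] csol_QL2[OF 2] s1(4) s2(4)[unfolded t]]])
    show "AE x in lborel. h1 x - h2 x \<le> 0" using h by eventually_elim simp
    show "AE p in lborel. 0 < g1 p - g2 p \<longrightarrow> F1 p - F2 p \<le> 0"
      using isrep_AE[OF s1(2)] isrep_AE[OF s2(2)] k g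
    proof eventually_elim
      case (elim p)
      show ?case
      proof
        assume pos: "0 < g1 p - g2 p"
        have Q: "p \<in> Qc T"
          using pos QL2_zero[OF csol_QL2[OF 1], of p] QL2_zero[OF csol_QL2[OF 2], of p] by fastforce
        then have x: "snd p \<in> Om" by (auto simp: Qc_def)
        have "g2 p * k2 p \<le> g1 p * k1 p" using pos elim(3,4) Q by (intro mult_mono) auto
        then have "f (snd p) (g1 p * k1 p) \<le> f (snd p) (g2 p * k2 p)" by (rule antimonoD[OF f_mono[OF x]])
        then have "f (snd p) (g1 p * k1 p) * g1 p \<le> f (snd p) (g2 p * k2 p) * g1 p"
          using pos elim(4) by (intro mult_right_mono) auto
        also have "\<dots> \<le> f (snd p) (g2 p * k2 p) * g2 p"
          using pos f_nonpos[OF x] by (intro mult_left_mono_neg) auto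
        finally have "NL g1 k1 p \<le> NL g2 k2 p"
          unfolding NL_def by (intro divide_right_mono) auto
        then show "F1 p - F2 p \<le> 0" using elim(1,2) Q by simp
      qed
    qed
  qed simp
  then show ?thesis by eventually_elim simp
qed

text \<open>Where \<open>g < e\<close>, the bounds \<open>- \<kappa> \<le> f \<le> 0\<close> give
  \<open>f * g \<ge> f * e \<ge> - \<kappa> * e\<close>, so the source of \<open>g\<close> is at
  least that of the spatially constant barrier.\<close>

lemma csol_above:
  fixes e e' :: "real \<Rightarrow> real"
  assumes g: "csol c g k h" and e: "\<And>t. (e has_real_derivative e' t) (at t)" and e': "continuous_on UNIV e'"
    and t0: "dir T c t0" and h: "AE x in lborel. x \<in> Om \<longrightarrow> e t0 \<le> h x"
    and nonneg: "\<And>t. 0 \<le> e t" and ode: "\<And>t. c * e' t \<le> - (\<kappa> / \<sigma>^2) * e t"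
  shows "AE p in lborel. p \<in> Qc T \<longrightarrow> e (fst p) \<le> g p"
proof -
  obtain D F t1 where s: "weq c T (\<sigma>^2 / 2) g D F" "isrep (Qc T) (NL g k) F" "dir T c t1" "ctrace T g t1 h"
    using g by (auto simp: csol_def)
  have t: "t1 = t0" by (rule dir_unique[OF s(3) t0])
  have ce: "continuous_on UNIV e" by (intro continuous_at_imp_continuous_on ballI DERIV_isCont[OF e])
  let ?E = "\<lambda>p::real \<times> 'a. e (fst p) * indicator (Qc T) p"
  have W: "weq c T (\<sigma>^2 / 2) ?E (\<lambda>p. 0) (\<lambda>p. c * e' (fst p) * indicator (Qc T) p)"
    by (rule weq_time[OF e e' dir_sq[OF t0]])
  \<comment> \<open>\<open>h\<close> is bounded below on \<open>Om\<close> only, while the barrier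
    has trace 0 outside. The cut-off \<open>H\<close> is still a trace of \<open>g\<close>, because
    \<open>g\<close> vanishes outside \<open>Om\<close>.\<close>
  obtain H where H: "isrep Om h H" "ctrace T g t0 H" "AE x in lborel. x \<in> Om \<longrightarrow> e t0 \<le> H x"
  proof -
    have L: "L2 lborel h" using s(4) by (simp add: ctrace_def)
    have m: "h \<in> borel_measurable borel" using L by (simp add: L2_def)
    let ?H = "\<lambda>x. indicator Om x * h x"
    have r: "isrep Om h ?H" unfolding isrep_def using m by auto
    have "ctrace T g t0 ?H"
      unfolding ctrace_def
    proof (intro conjI allI impI)
      show LH: "L2 lborel ?H" by (rule L2_mult_bdd[OF L, of _ 1]) (auto split: split_indicator)
      fix r :: real assume "r > 0"
      then obtain d where d: "d > 0" "AE t in lborel. 0 < t \<and> t < T \<and> \<bar>t - t0\<bar> < d \<longrightarrow> (\<integral>x. (g (t, x) - h x)^2 \<partial>lborel) < r"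
        using s(4)[unfolded t] unfolding ctrace_def by blast
      have "AE t in lborel. 0 < t \<and> t < T \<and> \<bar>t - t0\<bar> < d \<longrightarrow> (\<integral>x. (g (t, x) - ?H x)^2 \<partial>lborel) < r"
        using d(2) AE_L2_slice(1)[OF QL2_L2[OF csol_QL2[OF g]]]
      proof eventually_elim
        case (elim t)
        have "(\<integral>x. (g (t, x) - ?H x)^2 \<partial>lborel) \<le> (\<integral>x. (g (t, x) - h x)^2 \<partial>lborel)"
        proof (rule L2_sq_mono[OF L2_diff[OF elim(2) L] L2_meas[OF L2_diff[OF elim(2) LH]]], rule AE_I2)
          fix x
          show "\<bar>g (t, x) - ?H x\<bar> \<le> \<bar>g (t, x) - h x\<bar>"
            using QL2_zero[OF csol_QL2[OF g], of "(t, x)"] by (cases "x \<in> Om") (auto simp: Qc_def)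
        qed
        then show ?case using elim(1) by auto
      qed
      then show "\<exists>d>0. AE t in lborel. 0 < t \<and> t < T \<and> \<bar>t - t0\<bar> < d \<longrightarrow> (\<integral>x. (g (t, x) - ?H x)^2 \<partial>lborel) < r"
        using d(1) by blast
    qed
    moreover have "AE x in lborel. x \<in> Om \<longrightarrow> e t0 \<le> ?H x" using h by eventually_elim auto
    ultimately show ?thesis using that r by blast
  qed
  have "AE p in lborel. ?E p - g p \<le> 0"
  proof (rule comparison[OF weq_diff[OF W s(1)] T_pos t0 ctrace_diff[OF time_fun_L2[OF ce] csol_QL2[OF g] ctrace_time[OF ce] H(2)]])
    show "AE x in lborel. e t0 * indicator Om x - H x \<le> 0"
      using H(3)
    proof eventually_elim
      case (elim x)
      then show ?case using isrep_zero[OF H(1), of x] by (cases "x \<in> Om") auto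
    qed
    show "AE p in lborel. 0 < ?E p - g p \<longrightarrow> c * e' (fst p) * indicator (Qc T) p - F p \<le> 0"
      using isrep_AE[OF s(2)]
    proof eventually_elim
      case (elim p)
      show ?case
      proof
        assume pos: "0 < ?E p - g p"
        have Q: "p \<in> Qc T"
        proof (rule ccontr)
          assume "p \<notin> Qc T"
          then show False using pos QL2_zero[OF csol_QL2[OF g], of p] by simp
        qed
        then have x: "snd p \<in> Om" by (auto simp: Qc_def)
        let ?f = "f (snd p) (g p * k p)"
        have le: "g p \<le> e (fst p)" using pos Q by simp
        have "- \<kappa> * e (fst p) \<le> ?f * e (fst p)"
          using f_bound[OF x, of "g p * k p"] nonneg[of "fst p"] by (intro mult_right_mono) auto
        also have "\<dots> \<le> ?f * g p" using le f_nonpos[OF x] by (rule mult_left_mono_neg)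
        finally have "- \<kappa> * e (fst p) / \<sigma>^2 \<le> NL g k p" unfolding NL_def by (intro divide_right_mono) auto
        then show "c * e' (fst p) * indicator (Qc T) p - F p \<le> 0"
          using ode[of "fst p"] elim Q by simp
      qed
    qed
  qed simp
  then show ?thesis by eventually_elim (auto split: split_indicator_asm)
qed

lemma csol_nonneg:
  assumes g: "csol c g k h" and h: "AE x in lborel. 0 \<le> h x"
  shows "AE p in lborel. 0 \<le> g p"
proof -
  obtain t0 where t0: "dir T c t0" using g by (auto simp: csol_def)
  have "AE p in lborel. p \<in> Qc T \<longrightarrow> 0 \<le> g p"
  proof (rule csol_above[OF g, of "\<lambda>t. 0" "\<lambda>t. 0"])
    show "AE x in lborel. x \<in> Om \<longrightarrow> 0 \<le> h x" using h by eventually_elim simp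
  qed (use t0 in auto)
  then show ?thesis
  proof eventually_elim
    case (elim p)
    then show ?case using QL2_zero[OF csol_QL2[OF g], of p] by (cases "p \<in> Qc T") auto
  qed
qed

text \<open>The barrier \<open>exp (\<kappa> / \<sigma>^2 * t + C)\<close> satisfies the required
  differential inequality with equality, equals \<open>exp (- U / \<sigma>^2)\<close> at time
  \<open>T\<close>, and decreases backward in time to \<open>exp C\<close>, which is the origin of
  the constant \<open>\<epsilon>\<close> in the theorem.\<close>

lemma csol_lower:
  assumes g: "csol (-1) g k h" and h: "AE x in lborel. x \<in> Om \<longrightarrow> exp (- U / \<sigma>^2) \<le> h x"
  shows "AE p in lborel. p \<in> Qc T \<longrightarrow> exp (- (1 / \<sigma>^2) * (U + \<kappa> * T)) \<le> g p"
proof -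
  define C where "C = - (1 / \<sigma>^2) * (U + \<kappa> * T)"
  define e where "e t = exp ((\<kappa> / \<sigma>^2) * t + C)" for t
  have "((\<lambda>t. (\<kappa> / \<sigma>^2) * t + C) has_real_derivative \<kappa> / \<sigma>^2) (at t)" for t
    by (rule DERIV_cong[OF DERIV_add[OF DERIV_cmult[OF DERIV_ident] DERIV_const]]) simp
  from DERIV_chain2[OF DERIV_exp this] have de: "(e has_real_derivative (\<kappa> / \<sigma>^2) * e t) (at t)" for t
    unfolding e_def[abs_def] by (simp only: mult.commute)
  have ce: "continuous_on UNIV (\<lambda>t. (\<kappa> / \<sigma>^2) * e t)"
    by (intro continuous_on_mult continuous_on_const continuous_at_imp_continuous_on ballI DERIV_isCont[OF de])
  have eT: "e T = exp (- U / \<sigma>^2)"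
    by (simp add: e_def C_def add_divide_distrib)
  have "AE p in lborel. p \<in> Qc T \<longrightarrow> e (fst p) \<le> g p"
  proof (rule csol_above[OF g de ce])
    show "dir T (-1) T" by (simp add: dir_def)
    show "AE x in lborel. x \<in> Om \<longrightarrow> e T \<le> h x" unfolding eT by (rule h)
    show "0 \<le> e t" for t by (simp add: e_def)
    show "- 1 * (\<kappa> / \<sigma>^2 * e t) \<le> - (\<kappa> / \<sigma>^2) * e t" for t by simp
  qed
  then show ?thesis
  proof eventually_elim
    case (elim p)
    show ?case
    proof
      assume Q: "p \<in> Qc T"
      have "0 \<le> (\<kappa> / \<sigma>^2) * fst p" using Q kappa_nonneg by (intro mult_nonneg_nonneg) (auto simp: Qc_def)
      then have "exp C \<le> e (fst p)" by (simp add: e_def)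
      then show "exp (- (1 / \<sigma>^2) * (U + \<kappa> * T)) \<le> g p" using elim Q unfolding C_def by simp
    qed
  qed
qed

definition Ft :: "(real \<Rightarrow> 'a \<Rightarrow> real) \<Rightarrow> (real \<Rightarrow> 'a \<Rightarrow> real) \<Rightarrow> real \<Rightarrow> 'a \<Rightarrow> real" where
  "Ft u k t x = f x (u t x * k t x) * u t x / \<sigma>^2"

lemma Ft_isrep:
  assumes u: "isrep (Qc T) (\<lambda>p. u (fst p) (snd p)) u'" and k: "isrep (Qc T) (\<lambda>p. k (fst p) (snd p)) k'"
  shows "isrep (Qc T) (\<lambda>p. Ft u k (fst p) (snd p)) F \<longleftrightarrow> isrep (Qc T) (NL u' k') F"
proof -
  have eq: "AE p in lborel. p \<in> Qc T \<longrightarrow> Ft u k (fst p) (snd p) = NL u' k' p"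
    using isrep_AE[OF u] isrep_AE[OF k] by eventually_elim (simp add: Ft_def NL_def)
  then have eq': "AE p in lborel. p \<in> Qc T \<longrightarrow> NL u' k' p = Ft u k (fst p) (snd p)" by eventually_elim simp
  show ?thesis using isrep_cong[OF _ eq] isrep_cong[OF _ eq'] by blast
qed

lemma Ft_integral:
  "(\<integral>x. Ft u k t x * v x \<partial>lebesgue_on Om) = (1 / \<sigma>^2) * (\<integral>x. f x (u t x * k t x) * u t x * v x \<partial>lebesgue_on Om)"
  unfolding Ft_def by (simp flip: integral_mult_right_zero)

lemma csol_of_weak:
  assumes g: "L2H1 T u Du" "dual_dt T u w" and c: "dir T c t0"
    and u: "isrep (Qc T) (\<lambda>p. u (fst p) (snd p)) u'" and k: "isrep (Qc T) (\<lambda>p. k (fst p) (snd p)) k'"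
    and h: "has_trace T u t0 h" "isrep Om h h'"
    and eq: "AE t in lebesgue_on {0<..<T}. \<forall>v. H1 v \<longrightarrow> w t v = wpair c (\<sigma>^2 / 2) Du (Ft u k) t v"
  shows "csol c u' k' h'"
proof -
  have Lu: "L2 lborel u'" using g(1) isrep_L2(1)[OF Qc_sets u] by (simp add: L2H1_def)
  then have q: "QL2 T u'" unfolding QL2_def using isrep_zero[OF u] by blast
  obtain F where F: "isrep (Qc T) (NL u' k') F" "QL2 T F" using NL_isrep[OF q isrep_measurable[OF k]] by blast
  have rF: "isrep (Qc T) (\<lambda>p. Ft u k (fst p) (snd p)) F" using F(1) Ft_isrep[OF u k] by simp
  obtain D where "weq c T (\<sigma>^2 / 2) u' D F" by (rule weq_of_weak[OF g u rF QL2_L2[OF F(2)] eq])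
  moreover have "ctrace T u' t0 h'" using h has_trace_iff_ctrace[OF u h(2)] by simp
  ultimately show ?thesis unfolding csol_def using F(1) c by blast
qed

text \<open>For \<open>c = -1\<close> and \<open>c = 1\<close> the right hand side becomes the
  equation in \<open>Phi_sol\<close> and \<open>Psi_sol\<close>, respectively.\<close>

lemma wpair_iff:
  "w = wpair c (\<sigma>^2 / 2) D (Ft u k) t v \<longleftrightarrow>
   w + c * (\<sigma>^2 / 2 * (\<integral>x. D t x \<bullet> grad v x \<partial>lebesgue_on Om))
     = c * ((1 / \<sigma>^2) * (\<integral>x. f x (u t x * k t x) * u t x * v x \<partial>lebesgue_on Om))"
  unfolding wpair_def Ft_integral by (auto simp: algebra_simps)

lemma Phi_sol_iff:
  "Phi_sol T \<sigma> f uT \<psi> \<phi> \<longleftrightarrow> (\<exists>D w. L2H1 T \<phi> D \<and> dual_dt T \<phi> w \<and> has_trace T \<phi> T (\<lambda>x. exp (uT x / \<sigma>^2)) \<and>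
     (AE t in lebesgue_on {0<..<T}. \<forall>v. H1 v \<longrightarrow> w t v = wpair (-1) (\<sigma>^2 / 2) D (Ft \<phi> \<psi>) t v))"
  unfolding Phi_sol_def wpair_iff by simp

lemma Psi_sol_iff:
  "Psi_sol T \<sigma> f m0 \<phi> \<psi> \<longleftrightarrow> (\<exists>D w. L2H1 T \<psi> D \<and> dual_dt T \<psi> w \<and>
     (\<exists>h. has_trace T \<phi> 0 h \<and> has_trace T \<psi> 0 (\<lambda>x. m0 x / h x)) \<and>
     (AE t in lebesgue_on {0<..<T}. \<forall>v. H1 v \<longrightarrow> w t v = wpair 1 (\<sigma>^2 / 2) D (Ft \<psi> \<phi>) t v))"
  unfolding Psi_sol_def wpair_iff by (simp add: mult.commute[of "\<psi> _ _" "\<phi> _ _"])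

end

section \<open>Translating the two solution operators into the common problem and back\<close>

context coupled_system
begin

lemma csolE:
  assumes "csol c g k h" "dir T c t0"
  shows "\<exists>D F. weq c T (\<sigma>^2 / 2) g D F \<and> isrep (Qc T) (NL g k) F \<and> ctrace T g t0 h"
  using assms dir_unique by (fastforce simp: csol_def)

lemma weak_isrep_exists:
  assumes "L2H1 T u D" obtains u' where "isrep (Qc T) (\<lambda>p. u (fst p) (snd p)) u'"
proof -
  have "L2 (lebesgue_on (Qc T)) (\<lambda>p. u (fst p) (snd p))" using assms by (simp add: L2H1_def)
  from isrep_exists[OF Qc_sets L2_meas[OF this]] that show ?thesis by blast
qed

lemma Phi_sol_L2H1: "Phi_sol T \<sigma> f uT \<psi> \<phi> \<Longrightarrow> \<exists>D w. L2H1 T \<phi> D \<and> dual_dt T \<phi> w"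
  and Psi_sol_L2H1: "Psi_sol T \<sigma> f m0 \<phi> \<psi> \<Longrightarrow> \<exists>D w. L2H1 T \<psi> D \<and> dual_dt T \<psi> w"
  unfolding Phi_sol_def Psi_sol_def by blast+

lemma dir_bwd: "dir T (- 1) T" and dir_fwd: "dir T 1 0"
  by (auto simp: dir_def)

lemma Phi_csol:
  assumes s: "Phi_sol T \<sigma> f uT \<psi> \<phi>"
    and r: "isrep (Qc T) (\<lambda>p. \<phi> (fst p) (snd p)) \<phi>'" "isrep (Qc T) (\<lambda>p. \<psi> (fst p) (snd p)) \<psi>'"
    and H: "isrep Om (\<lambda>x. exp (uT x / \<sigma>^2)) H"
  shows "csol (- 1) \<phi>' \<psi>' H"
proof -
  obtain D w where "L2H1 T \<phi> D" "dual_dt T \<phi> w" "has_trace T \<phi> T (\<lambda>x. exp (uT x / \<sigma>^2))"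
     "AE t in lebesgue_on {0<..<T}. \<forall>v. H1 v \<longrightarrow> w t v = wpair (-1) (\<sigma>^2 / 2) D (Ft \<phi> \<psi>) t v"
    using s unfolding Phi_sol_iff by blast
  then show ?thesis using csol_of_weak[OF _ _ dir_bwd r _ H] by blast
qed

text \<open>The trace \<open>K\<close> of \<open>\<phi>'\<close> is exposed together with the
  solution, because the data of \<open>\<psi>'\<close> depend on it and must be compared between
  iterates.\<close>

lemma Psi_csol:
  assumes s: "Psi_sol T \<sigma> f m0 \<phi> \<psi>"
    and r: "isrep (Qc T) (\<lambda>p. \<phi> (fst p) (snd p)) \<phi>'" "isrep (Qc T) (\<lambda>p. \<psi> (fst p) (snd p)) \<psi>'"
    and M0: "isrep Om m0 M0"
  shows "\<exists>K. K \<in> borel_measurable borel \<and> (\<forall>x. x \<notin> Om \<longrightarrow> K x = 0) \<and> ctrace T \<phi>' 0 K \<and> csol 1 \<psi>' \<phi>' (\<lambda>x. M0 x / K x)"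
proof -
  obtain D w h where s: "L2H1 T \<psi> D" "dual_dt T \<psi> w" and h: "has_trace T \<phi> 0 h" "has_trace T \<psi> 0 (\<lambda>x. m0 x / h x)"
     and e: "AE t in lebesgue_on {0<..<T}. \<forall>v. H1 v \<longrightarrow> w t v = wpair 1 (\<sigma>^2 / 2) D (Ft \<psi> \<phi>) t v"
    using s unfolding Psi_sol_iff by blast
  have "L2 (lebesgue_on Om) h" using h(1) by (simp add: has_trace_def)
  then obtain K where K: "isrep Om h K" using isrep_exists[OF Om_sets L2_meas] by blast
  have "csol 1 \<psi>' \<phi>' (\<lambda>x. M0 x / K x)"
    by (rule csol_of_weak[OF s dir_fwd r(2,1) h(2) isrep_divide[OF M0 K] e])
  moreover have "ctrace T \<phi>' 0 K" using has_trace_iff_ctrace[OF r(1) K] h(1) by simp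
  ultimately show ?thesis using isrep_measurable[OF K] isrep_zero[OF K] by blast
qed

text \<open>Continuity of \<open>f\<close> in its second argument gives pointwise convergence of the
  sources, boundedness of \<open>f\<close> the dominating function
  \<open>\<kappa> / \<sigma>^2 * z\<close>.\<close>

lemma NL_lim:
  assumes z: "L2 lborel z" and F: "\<And>n. isrep (Qc T) (NL (g n) (k n)) (F n)" and F': "isrep (Qc T) (NL g' k') F'"
    and lim: "AE p in lborel. (\<lambda>n. g n p) \<longlonglongrightarrow> g' p" "AE p in lborel. (\<lambda>n. k n p) \<longlonglongrightarrow> k' p"
    and b: "\<And>n. AE p in lborel. \<bar>g n p\<bar> \<le> z p"
  shows "L2_lim lborel F F'"
proof (rule L2_lim_dominated[OF L2_cmult[OF z, of "\<kappa> / \<sigma>^2"]])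
  have eqF: "AE p in lborel. \<forall>n. p \<in> Qc T \<longrightarrow> F n p = NL (g n) (k n) p"
    unfolding AE_all_countable using isrep_AE[OF F] by blast
  show "AE p in lborel. (\<lambda>n. F n p) \<longlonglongrightarrow> F' p"
    using eqF isrep_AE[OF F'] lim
  proof eventually_elim
    case (elim p)
    show ?case
    proof (cases "p \<in> Qc T")
      case True
      then have x: "snd p \<in> Om" by (auto simp: Qc_def)
      have "isCont (f (snd p)) (g' p * k' p)" using f_cont[OF x] by (simp add: continuous_on_eq_continuous_at)
      from isCont_tendsto_compose[OF this tendsto_mult[OF elim(3,4)]]
      have "(\<lambda>n. NL (g n) (k n) p) \<longlonglongrightarrow> NL g' k' p"
        unfolding NL_def using elim(3) sigma_pos by (intro tendsto_divide tendsto_mult tendsto_const) auto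
      then show ?thesis using elim(1,2) True by simp
    next
      case False
      then show ?thesis using isrep_zero[OF F] isrep_zero[OF F'] by simp
    qed
  qed
  show "AE p in lborel. \<bar>F n p\<bar> \<le> \<kappa> / \<sigma>^2 * z p" for n
    using isrep_AE[OF F[of n]] b[of n]
  proof eventually_elim
    case (elim p)
    have c: "0 \<le> \<kappa> / \<sigma>^2" using kappa_nonneg by simp
    have le: "(\<kappa> / \<sigma>^2) * \<bar>g n p\<bar> \<le> \<kappa> / \<sigma>^2 * z p" using elim(2) c by (rule mult_left_mono)
    show ?case
    proof (cases "p \<in> Qc T")
      case True
      then show ?thesis using elim(1) order_trans[OF NL_bound[OF True, of "g n" "k n"] le] by simp
    next
      case False
      have "0 \<le> \<kappa> / \<sigma>^2 * \<bar>g n p\<bar>" using c by (rule mult_nonneg_nonneg) simp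
      then show ?thesis using isrep_zero[OF F False] le by simp
    qed
  qed
qed (use isrep_measurable[OF F] isrep_measurable[OF F'] in auto)

lemma Phi_sol_of_weq:
  assumes W: "weq (- 1) T (\<sigma>^2 / 2) \<phi>' D F" and F: "isrep (Qc T) (NL \<phi>' \<psi>') F"
    and r: "isrep (Qc T) (\<lambda>p. \<phi> (fst p) (snd p)) \<phi>'" "isrep (Qc T) (\<lambda>p. \<psi> (fst p) (snd p)) \<psi>'"
    and H: "isrep Om (\<lambda>x. exp (uT x / \<sigma>^2)) H" "ctrace T \<phi>' T H"
  shows "Phi_sol T \<sigma> f uT \<psi> \<phi>"
proof -
  have rF: "isrep (Qc T) (\<lambda>p. Ft \<phi> \<psi> (fst p) (snd p)) F" using F Ft_isrep[OF r] by simp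
  have "has_trace T \<phi> T (\<lambda>x. exp (uT x / \<sigma>^2))" using has_trace_iff_ctrace[OF r(1) H(1)] H(2) by simp
  then show ?thesis unfolding Phi_sol_iff using weak_of_weq[OF W r(1) rF] by blast
qed

lemma Psi_sol_of_weq:
  assumes W: "weq 1 T (\<sigma>^2 / 2) \<psi>' D F" and F: "isrep (Qc T) (NL \<psi>' \<phi>') F"
    and r: "isrep (Qc T) (\<lambda>p. \<phi> (fst p) (snd p)) \<phi>'" "isrep (Qc T) (\<lambda>p. \<psi> (fst p) (snd p)) \<psi>'"
    and M0: "isrep Om m0 M0" and K: "isrep Om K K" "ctrace T \<phi>' 0 K" and t: "ctrace T \<psi>' 0 (\<lambda>x. M0 x / K x)"
  shows "Psi_sol T \<sigma> f m0 \<phi> \<psi>"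
proof -
  have rF: "isrep (Qc T) (\<lambda>p. Ft \<psi> \<phi> (fst p) (snd p)) F" using F Ft_isrep[OF r(2,1)] by simp
  have "has_trace T \<phi> 0 K" using has_trace_iff_ctrace[OF r(1) K(1)] K(2) by simp
  moreover have "has_trace T \<psi> 0 (\<lambda>x. m0 x / K x)"
    using has_trace_iff_ctrace[OF r(2) isrep_divide[OF M0 K(1)]] t by simp
  ultimately show ?thesis unfolding Psi_sol_iff using weak_of_weq[OF W r(2) rF] by blast
qed

end

text \<open>A constant solves an equation with zero gradient and zero source, so
  \<open>weak_of_weq\<close> supplies its time derivative. This covers the argument of
  \<open>\<Psi>(\<epsilon>)\<close> and the starting value 0 of the iteration.\<close>

lemma inPe_const:
  fixes \<epsilon> T :: real
  shows "inPe T \<epsilon> (\<lambda>t (x::'a::euclidean_space). \<epsilon>)"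
proof -
  have d: "((\<lambda>t. \<epsilon>) has_real_derivative 0) (at t)" for t :: real by simp
  have W: "weq 1 T 0 (\<lambda>p::real \<times> 'a. \<epsilon> * indicator (Qc T) p) (\<lambda>p. 0) (\<lambda>p. 1 * 0 * indicator (Qc T) p)"
    by (rule weq_time[OF d]) auto
  have r: "isrep (Qc T) (\<lambda>p::real \<times> 'a. \<epsilon>) (\<lambda>p. \<epsilon> * indicator (Qc T) p)"
    "isrep (Qc T) (\<lambda>p::real \<times> 'a. 0) (\<lambda>p. 1 * 0 * indicator (Qc T) p)"
    by (auto simp: isrep_def)
  have "inP T (\<lambda>t (x::'a). \<epsilon>)"
    unfolding inP_def using weak_of_weq[OF W, of "\<lambda>t x. \<epsilon>" "\<lambda>t x. 0"] r by blast
  then show ?thesis by (simp add: inPe_def)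
qed

lemma monotone_convergence_AE:
  fixes X :: "nat \<Rightarrow> 'b::euclidean_space \<Rightarrow> real"
  assumes m: "AE p in lborel. monoseq (\<lambda>n. X n p)"
    and b: "\<And>n. AE p in lborel. 0 \<le> X n p \<and> X n p \<le> z p"
  shows "AE p in lborel. (\<lambda>n. X n p) \<longlonglongrightarrow> lim (\<lambda>n. X n p)"
proof -
  have "AE p in lborel. \<forall>n. 0 \<le> X n p \<and> X n p \<le> z p" unfolding AE_all_countable using b by blast
  then show ?thesis using m
  proof eventually_elim
    case (elim p)
    have "norm (X n p) \<le> \<bar>z p\<bar>" for n using elim(1)[rule_format, of n] by simp
    then have "Bseq (\<lambda>n. X n p)" by (rule BseqI')
    then have "convergent (\<lambda>n. X n p)" using elim(2) by (rule Bseq_monoseq_convergent)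
    then show ?case by (simp add: convergent_LIMSEQ_iff)
  qed
qed

theorem theorem1:
  fixes T \<sigma> :: real
    and f :: "'a::euclidean_space \<Rightarrow> real \<Rightarrow> real"
    and uT m0 :: "'a \<Rightarrow> real"
    and phih psi :: "nat \<Rightarrow> real \<Rightarrow> 'a \<Rightarrow> real"
  assumes T_pos: "T > 0" and sigma_pos: "\<sigma> > 0"
    and f_meas: "\<forall>\<xi>. (\<lambda>x. f x \<xi>) \<in> borel_measurable (lebesgue_on Om)"
    and f_cont: "\<forall>x\<in>Om. continuous_on UNIV (f x)"
    and f_mono: "\<forall>x\<in>Om. antimono (f x)"
    and f_bdd: "bdd_above ((\<lambda>p. \<bar>f (fst p) (snd p)\<bar>) ` (Om \<times> UNIV))"
    and f_nonpos: "\<forall>x\<in>Om. \<forall>\<xi>. f x \<xi> \<le> 0"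
    and uT_meas: "uT \<in> borel_measurable (lebesgue_on Om)"
    and uT_bdd: "\<exists>M. AE x in lebesgue_on Om. \<bar>uT x\<bar> \<le> M"
    and m0_L2: "L2 (lebesgue_on Om) m0"
    and m0_nonneg: "AE x in lebesgue_on Om. m0 x \<ge> 0"
    and Phi_wd: "\<forall>\<psi>. inPe T 0 \<psi> \<longrightarrow>
        (\<exists>\<phi>. Phi_sol T \<sigma> f uT \<psi> \<phi>) \<and>
        (\<forall>\<phi>1 \<phi>2. Phi_sol T \<sigma> f uT \<psi> \<phi>1 \<longrightarrow> Phi_sol T \<sigma> f uT \<psi> \<phi>2 \<longrightarrow>
           (AE p in lebesgue_on (Qc T). \<phi>1 (fst p) (snd p) = \<phi>2 (fst p) (snd p)))"
    and Psi_wd: "\<forall>\<phi>. inPe T (exp (- (1 / \<sigma>^2) * (Linf_norm uT + f_sup f * T))) \<phi> \<longrightarrow>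
        (\<exists>\<psi>. Psi_sol T \<sigma> f m0 \<phi> \<psi>) \<and>
        (\<forall>\<psi>1 \<psi>2. Psi_sol T \<sigma> f m0 \<phi> \<psi>1 \<longrightarrow> Psi_sol T \<sigma> f m0 \<phi> \<psi>2 \<longrightarrow>
           (AE p in lebesgue_on (Qc T). \<psi>1 (fst p) (snd p) = \<psi>2 (fst p) (snd p)))"
    and psi0: "psi 0 = (\<lambda>t x. 0)"
    and phih_rec: "\<forall>n. Phi_sol T \<sigma> f uT (psi n) (phih n)"
    and psi_rec: "\<forall>n. Psi_sol T \<sigma> f m0 (phih n) (psi (Suc n))"
  shows "let \<epsilon> = exp (- (1 / \<sigma>^2) * (Linf_norm uT + f_sup f * T)) in
    (\<forall>n. inPe T \<epsilon> (phih n) \<and>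
         (AE p in lebesgue_on (Qc T). phih (Suc n) (fst p) (snd p) \<le> phih n (fst p) (snd p)))
  \<and> (\<forall>n. inPe T 0 (psi n) \<and>
         (AE p in lebesgue_on (Qc T). psi n (fst p) (snd p) \<le> psi (Suc n) (fst p) (snd p)) \<and>
         (\<forall>Z. Psi_sol T \<sigma> f m0 (\<lambda>t x. \<epsilon>) Z \<longrightarrow>
            (AE p in lebesgue_on (Qc T). psi n (fst p) (snd p) \<le> Z (fst p) (snd p))))
  \<and> (\<exists>\<phi> \<psi>.
       (AE p in lebesgue_on (Qc T).
          (\<lambda>n. phih n (fst p) (snd p)) \<longlonglongrightarrow> \<phi> (fst p) (snd p) \<and>
          (\<lambda>n. psi n (fst p) (snd p)) \<longlonglongrightarrow> \<psi> (fst p) (snd p)) \<and>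
       (\<lambda>n. \<integral>p. (phih n (fst p) (snd p) - \<phi> (fst p) (snd p))^2 \<partial>lebesgue_on (Qc T)) \<longlonglongrightarrow> 0 \<and>
       (\<lambda>n. \<integral>p. (psi n (fst p) (snd p) - \<psi> (fst p) (snd p))^2 \<partial>lebesgue_on (Qc T)) \<longlonglongrightarrow> 0 \<and>
       inPe T \<epsilon> \<phi> \<and> inPe T 0 \<psi> \<and>
       Phi_sol T \<sigma> f uT \<psi> \<phi> \<and> Psi_sol T \<sigma> f m0 \<phi> \<psi>)"
proof -
  define \<kappa> U where "\<kappa> = f_sup f" and "U = Linf_norm uT"
  define \<epsilon> where "\<epsilon> = exp (- (1 / \<sigma>^2) * (U + \<kappa> * T))"
  have e0: "0 < \<epsilon>" by (simp add: \<epsilon>_def)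
  interpret coupled_system T \<sigma> \<kappa> f
  proof
    fix x :: 'a and \<xi> :: real assume x: "x \<in> Om"
    have "(x, \<xi>) \<in> Om \<times> UNIV" using x by simp
    from cSUP_upper[OF this f_bdd] show "\<bar>f x \<xi>\<bar> \<le> \<kappa>" by (simp add: \<kappa>_def f_sup_def)
  qed (use T_pos sigma_pos f_meas f_cont f_mono f_nonpos in blast)+
  have a: "0 < \<sigma>^2 / 2" using sigma_pos by simp
  have t00: "(0::real) = 0 \<or> 0 = T" and t0T: "T = 0 \<or> T = T" by auto

  \<comment> \<open>Borel representatives of the iterates and of the data\<close>
  have "\<forall>n. \<exists>p. isrep (Qc T) (\<lambda>q. phih n (fst q) (snd q)) p"
    using Phi_sol_L2H1 phih_rec weak_isrep_exists by metis
  from choice[OF this] obtain P where P: "\<And>n. isrep (Qc T) (\<lambda>q. phih n (fst q) (snd q)) (P n)" by blast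
  have "\<exists>s. isrep (Qc T) (\<lambda>q. psi n (fst q) (snd q)) s" for n
  proof (cases n)
    case 0
    have "isrep (Qc T) (\<lambda>q. psi n (fst q) (snd q)) (\<lambda>q. 0)" using 0 psi0 by (simp add: isrep_def)
    then show ?thesis by blast
  next
    case (Suc m)
    obtain D w where "L2H1 T (psi (Suc m)) D" using Psi_sol_L2H1[OF psi_rec[rule_format, of m]] by blast
    then show ?thesis unfolding Suc by (rule weak_isrep_exists) blast
  qed
  then have "\<forall>n. \<exists>s. isrep (Qc T) (\<lambda>q. psi n (fst q) (snd q)) s" by blast
  from choice[OF this] obtain S where S: "\<And>n. isrep (Qc T) (\<lambda>q. psi n (fst q) (snd q)) (S n)" by blast
  obtain H where H: "isrep Om (\<lambda>x. exp (uT x / \<sigma>^2)) H"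
  proof -
    have "L2 (lebesgue_on Om) (\<lambda>x. exp (uT x / \<sigma>^2))"
      using phih_rec[rule_format, of 0] by (auto simp: Phi_sol_def has_trace_def)
    from isrep_exists[OF Om_sets L2_meas[OF this]] that show thesis by blast
  qed
  obtain M0 where M0: "isrep Om m0 M0" using isrep_exists[OF Om_sets L2_meas[OF m0_L2]] by blast
  have LM0: "L2 lborel M0" using isrep_L2(1)[OF Om_sets M0] m0_L2 by simp

  \<comment> \<open>The iterates as solutions of the common problem\<close>
  have cP: "csol (- 1) (P n) (S n) H" for n by (rule Phi_csol[OF phih_rec[rule_format] P S H])
  \<comment> \<open>\<open>K n\<close> is the trace of \<open>P n\<close> at time 0, selected once
    so that the denominators of successive steps can be compared.\<close>
  have "\<forall>n. \<exists>K. K \<in> borel_measurable borel \<and> (\<forall>x. x \<notin> Om \<longrightarrow> K x = 0) \<and> ctrace T (P n) 0 K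
      \<and> csol 1 (S (Suc n)) (P n) (\<lambda>x. M0 x / K x)"
    using Psi_csol[OF psi_rec[rule_format] P S M0] by blast
  from choice[OF this] obtain K where K: "\<And>n. K n \<in> borel_measurable borel" "\<And>n x. x \<notin> Om \<Longrightarrow> K n x = 0"
    "\<And>n. ctrace T (P n) 0 (K n)" "\<And>n. csol 1 (S (Suc n)) (P n) (\<lambda>x. M0 x / K n x)" by blast
  have qP: "QL2 T (P n)" for n by (rule csol_QL2[OF cP])
  have S0: "S 0 p = 0" if "p \<notin> Qc T" for p using isrep_zero[OF S that] .
  \<comment> \<open>The starting value does not come from an equation, and its representative is
    known to vanish only almost everywhere; hence the separate cases for index 0.\<close>
  have S0': "AE p in lborel. S 0 p = 0"
    using isrep_AE[OF S[of 0]]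
  proof eventually_elim
    case (elim p)
    then show ?case using S0[of p] by (cases "p \<in> Qc T") (auto simp: psi0)
  qed
  have qS: "QL2 T (S n)" for n
  proof (cases n)
    case 0
    have "L2 lborel (S 0)"
      by (rule L2_bound[OF L2_zero]) (use isrep_measurable[OF S[of 0]] S0' in auto)
    then show ?thesis unfolding 0 QL2_def using S0 by blast
  qed (use csol_QL2[OF K(4)] in simp)

  \<comment> \<open>Lower bounds, signs and quotients of initial data\<close>
  have Hlow: "AE x in lborel. x \<in> Om \<longrightarrow> exp (- U / \<sigma>^2) \<le> H x"
    using isrep_AE[OF H] Linf_norm_AE[OF uT_bdd]
  proof eventually_elim
    case (elim x)
    show ?case
    proof
      assume x: "x \<in> Om"
      then have "- U \<le> uT x" using elim(2) by (auto simp: U_def)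
      then have "- U / \<sigma>^2 \<le> uT x / \<sigma>^2" by (intro divide_right_mono) auto
      then show "exp (- U / \<sigma>^2) \<le> H x" using elim(1) x by simp
    qed
  qed
  have Plow: "AE p in lborel. p \<in> Qc T \<longrightarrow> \<epsilon> \<le> P n p" for n
    unfolding \<epsilon>_def by (rule csol_lower[OF cP Hlow])
  have Pnn: "AE p in lborel. 0 \<le> P n p" for n
    using Plow[of n]
  proof eventually_elim
    case (elim p)
    then show ?case using e0 isrep_zero[OF P, of p n] by (cases "p \<in> Qc T") auto
  qed
  have Klow: "AE x in lborel. x \<in> Om \<longrightarrow> \<epsilon> \<le> K n x" for n
    by (rule ctrace_lower[OF T_pos t00 qP K(3) Plow])
  have M0nn: "AE x in lborel. 0 \<le> M0 x"
    using isrep_AE[OF M0] m0_nonneg[unfolded AE_lebesgue_on_iff[OF Om_sets]]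
  proof eventually_elim
    case (elim x)
    then show ?case using isrep_zero[OF M0, of x] by (cases "x \<in> Om") auto
  qed
  \<comment> \<open>Off \<open>Om\<close> the numerator vanishes, so the values of the denominators
    there do not matter.\<close>
  have quot: "AE x in lborel. 0 \<le> M0 x / k1 x \<and> M0 x / k1 x \<le> M0 x / k2 x"
    if k: "AE x in lborel. k2 x \<le> k1 x" "AE x in lborel. x \<in> Om \<longrightarrow> \<epsilon> \<le> k2 x" for k1 k2
    using k M0nn
  proof eventually_elim
    case (elim x)
    show ?case
    proof (cases "x \<in> Om")
      case True
      then have "0 < k2 x" "k2 x \<le> k1 x" using elim e0 by auto
      then show ?thesis using elim(3) by (auto intro: divide_left_mono mult_pos_pos)
    qed (use isrep_zero[OF M0, of x] in simp)
  qed
  have Snn: "AE p in lborel. 0 \<le> S n p" for n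
  proof (cases n)
    case 0
    show ?thesis unfolding 0 using S0' by eventually_elim simp
  next
    case (Suc m)
    have "AE x in lborel. 0 \<le> M0 x / K m x"
      using quot[of "K m" "K m", OF _ Klow] by (auto elim: eventually_mono)
    then show ?thesis unfolding Suc by (rule csol_nonneg[OF K(4)])
  qed

  \<comment> \<open>Monotonicity of the iteration\<close>
  have Pmono1: "AE p in lborel. P (Suc n) p \<le> P n p" if s: "AE p in lborel. S n p \<le> S (Suc n) p" for n
  proof (rule csol_compare[OF cP cP])
    show "AE p in lborel. p \<in> Qc T \<longrightarrow> 0 \<le> S n p \<and> S n p \<le> S (Suc n) p"
      using s Snn[of n] by eventually_elim simp
  qed (use Pnn in auto)
  have Kmono1: "AE x in lborel. K (Suc n) x \<le> K n x" if "AE p in lborel. P (Suc n) p \<le> P n p" for n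
    by (rule ctrace_mono[OF T_pos t00 qP qP K(3) K(3) that])
  \<comment> \<open>One turn of the induction: a larger \<open>S\<close> lowers \<open>P\<close>,
    hence its trace \<open>K\<close>, hence raises the quotient \<open>M0 / K\<close>; the smaller
    factor and the larger datum both raise the next \<open>S\<close>.\<close>
  have Smono: "AE p in lborel. S n p \<le> S (Suc n) p" for n
  proof (induction n)
    case 0
    show ?case using S0' Snn[of 1] by eventually_elim simp
  next
    case (Suc n)
    note Pm = Pmono1[OF Suc]
    show ?case
    proof (rule csol_compare[OF K(4) K(4)])
      show "AE p in lborel. p \<in> Qc T \<longrightarrow> 0 \<le> P (Suc n) p \<and> P (Suc n) p \<le> P n p"
        using Pm Pnn[of "Suc n"] by eventually_elim simp
      show "AE x in lborel. M0 x / K n x \<le> M0 x / K (Suc n) x"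
        using quot[OF Kmono1[OF Pm] Klow] by eventually_elim simp
    qed (rule Snn)
  qed
  have Pmono: "AE p in lborel. P (Suc n) p \<le> P n p" for n by (rule Pmono1[OF Smono])
  have Kmono: "AE x in lborel. K (Suc n) x \<le> K n x" for n by (rule Kmono1[OF Pmono])

  \<comment> \<open>Upper bound by the solution for the constant factor
    \<open>\<epsilon>\<close>\<close>
  let ?E = "\<lambda>p::real \<times> 'a. \<epsilon> * indicator (Qc T) p"
  have rE: "isrep (Qc T) (\<lambda>p::real \<times> 'a. \<epsilon>) ?E" by (auto simp: isrep_def)
  have qE: "QL2 T ?E" using time_fun_L2[of "\<lambda>t. \<epsilon>" T, where 'a='a] by simp
  have SZ: "AE p in lborel. S n p \<le> Z' p"
    if Z: "Psi_sol T \<sigma> f m0 (\<lambda>t x. \<epsilon>) Z" and rZ: "isrep (Qc T) (\<lambda>p. Z (fst p) (snd p)) Z'" for Z Z' n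
  proof -
    obtain k where k: "ctrace T ?E 0 k" "csol 1 Z' ?E (\<lambda>x. M0 x / k x)"
      using Psi_csol[OF Z rE rZ M0] by blast
    have klow: "AE x in lborel. x \<in> Om \<longrightarrow> \<epsilon> \<le> k x"
      by (rule ctrace_lower[OF T_pos t00 qE k(1)]) auto
    have "AE x in lborel. 0 \<le> M0 x / k x" using quot[of k k, OF _ klow] by (auto elim: eventually_mono)
    then have Znn: "AE p in lborel. 0 \<le> Z' p" by (rule csol_nonneg[OF k(2)])
    show ?thesis
    proof (cases n)
      case 0
      show ?thesis unfolding 0 using S0' Znn by eventually_elim simp
    next
      case (Suc m)
      \<comment> \<open>The constant lies below \<open>P m\<close>, and by
        \<open>ctrace_mono\<close> its trace lies below \<open>K m\<close>; the smaller factor and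
        the larger datum both push \<open>Z'\<close> above \<open>S (Suc m)\<close>.\<close>
      have EP: "AE p in lborel. ?E p \<le> P m p"
        using Plow[of m] Pnn[of m] by eventually_elim (auto split: split_indicator)
      show ?thesis unfolding Suc
      proof (rule csol_compare[OF K(4) k(2)])
        show "AE p in lborel. p \<in> Qc T \<longrightarrow> 0 \<le> ?E p \<and> ?E p \<le> P m p"
          using EP by eventually_elim (use e0 in auto)
        show "AE x in lborel. M0 x / K m x \<le> M0 x / k x"
          using quot[OF ctrace_mono[OF T_pos t00 qE qP k(1) K(3) EP] klow] by eventually_elim simp
      qed (rule Znn)
    qed
  qed

  \<comment> \<open>One such solution is fixed as dominating function for the increasing
    sequence.\<close>
  obtain Z where Z: "Psi_sol T \<sigma> f m0 (\<lambda>t x. \<epsilon>) Z"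
    using Psi_wd inPe_const[of T \<epsilon>] unfolding \<epsilon>_def \<kappa>_def U_def by blast
  obtain Z' where rZ: "isrep (Qc T) (\<lambda>p. Z (fst p) (snd p)) Z'"
    using Psi_sol_L2H1[OF Z] weak_isrep_exists by metis
  have LZ: "L2 lborel Z'"
    using Psi_csol[OF Z rE rZ M0] csol_QL2 QL2_L2 by blast

  \<comment> \<open>Pointwise and strong limits\<close>
  define p' s' k' where "p' = (\<lambda>p. lim (\<lambda>n. P n p))" and "s' = (\<lambda>p. lim (\<lambda>n. S n p))"
    and "k' = (\<lambda>x. lim (\<lambda>n. K n x))"
  have [measurable]: "P n \<in> borel_measurable borel" "S n \<in> borel_measurable borel" "K n \<in> borel_measurable borel" for n
    using isrep_measurable[OF P] isrep_measurable[OF S] K(1) by auto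
  have m': "p' \<in> borel_measurable borel" "s' \<in> borel_measurable borel" "k' \<in> borel_measurable borel"
    unfolding p'_def s'_def k'_def by measurable
  \<comment> \<open>Off the cylinder the sequences are constantly 0, so their pointwise
    \<open>lim\<close> is exactly 0 there.\<close>
  have z': "p' p = 0" "s' p = 0" if "p \<notin> Qc T" for p
    unfolding p'_def s'_def using isrep_zero[OF P that] isrep_zero[OF S that] by (simp_all add: lim_const)
  have zk: "k' x = 0" if "x \<notin> Om" for x unfolding k'_def using K(2)[OF that] by (simp add: lim_const)
  have Pdec: "AE p in lborel. \<forall>n. P (Suc n) p \<le> P n p" unfolding AE_all_countable using Pmono by blast
  have Kdec: "AE x in lborel. \<forall>n. K (Suc n) x \<le> K n x" unfolding AE_all_countable using Kmono by blast
  have Sinc: "AE p in lborel. \<forall>n. S n p \<le> S (Suc n) p" unfolding AE_all_countable using Smono by blast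
  have P0: "AE p in lborel. 0 \<le> P n p \<and> P n p \<le> P 0 p" for n
    using Pdec Pnn[of n]
  proof eventually_elim
    case (elim p)
    have "decseq (\<lambda>n. P n p)" using elim(1) by (simp add: decseq_Suc_iff)
    then show ?case using elim(2) by (simp add: decseq_def)
  qed
  have K0: "AE x in lborel. 0 \<le> K n x \<and> K n x \<le> K 0 x" for n
    using Kdec Klow[of n]
  proof eventually_elim
    case (elim x)
    have "decseq (\<lambda>n. K n x)" using elim(1) by (simp add: decseq_Suc_iff)
    then show ?case using elim(2) e0 K(2)[of x n] K(2)[of x 0] by (cases "x \<in> Om") (auto simp: decseq_def)
  qed
  have SZ0: "AE p in lborel. 0 \<le> S n p \<and> S n p \<le> Z' p" for n
    using Snn[of n] SZ[OF Z rZ, of n] by eventually_elim simp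
  have limP: "AE p in lborel. (\<lambda>n. P n p) \<longlonglongrightarrow> p' p"
    unfolding p'_def by (rule monotone_convergence_AE[OF _ P0]) (use Pdec in \<open>eventually_elim, simp add: monoseq_Suc\<close>)
  have limS: "AE p in lborel. (\<lambda>n. S n p) \<longlonglongrightarrow> s' p"
    unfolding s'_def by (rule monotone_convergence_AE[OF _ SZ0]) (use Sinc in \<open>eventually_elim, simp add: monoseq_Suc\<close>)
  have limK: "AE x in lborel. (\<lambda>n. K n x) \<longlonglongrightarrow> k' x"
    unfolding k'_def by (rule monotone_convergence_AE[OF _ K0]) (use Kdec in \<open>eventually_elim, simp add: monoseq_Suc\<close>)
  have limS1: "AE p in lborel. (\<lambda>n. S (Suc n) p) \<longlonglongrightarrow> s' p"
    using limS by eventually_elim (rule LIMSEQ_Suc)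
  have bP: "AE p in lborel. \<bar>P n p\<bar> \<le> P 0 p" for n using P0[of n] by eventually_elim simp
  have bS: "AE p in lborel. \<bar>S n p\<bar> \<le> Z' p" for n using SZ0[of n] by eventually_elim simp
  have bK: "AE x in lborel. \<bar>K n x\<bar> \<le> K 0 x" for n using K0[of n] by eventually_elim simp
  have lP: "L2_lim lborel P p'"
    by (rule L2_lim_dominated[OF QL2_L2[OF qP[of 0]] _ _ limP bP]) (use m' in auto)
  have lS: "L2_lim lborel S s'"
    by (rule L2_lim_dominated[OF LZ _ _ limS bS]) (use m' in auto)
  have lS1: "L2_lim lborel (\<lambda>n. S (Suc n)) s'"
    by (rule L2_lim_dominated[OF LZ _ _ limS1 bS]) (use m' in auto)
  have LK: "L2 lborel (K 0)" using K(3)[of 0] by (simp add: ctrace_def)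
  have lK: "L2_lim lborel K k'"
    by (rule L2_lim_dominated[OF LK _ _ limK bK]) (use m' in auto)
  have Kall: "AE x in lborel. \<forall>n. x \<in> Om \<longrightarrow> \<epsilon> \<le> K n x" unfolding AE_all_countable using Klow by blast
  have Pall: "AE p in lborel. \<forall>n. p \<in> Qc T \<longrightarrow> \<epsilon> \<le> P n p" unfolding AE_all_countable using Plow by blast
  have klow: "AE x in lborel. x \<in> Om \<longrightarrow> \<epsilon> \<le> k' x"
    using Kall limK
  proof eventually_elim
    case (elim x)
    then show ?case using LIMSEQ_le_const[OF elim(2), of \<epsilon>] by blast
  qed
  have plow: "AE p in lborel. p \<in> Qc T \<longrightarrow> \<epsilon> \<le> p' p"
    using Pall limP
  proof eventually_elim
    case (elim p)
    then show ?case using LIMSEQ_le_const[OF elim(2), of \<epsilon>] by blast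
  qed
  have snn: "AE p in lborel. 0 \<le> s' p"
  proof -
    have "AE p in lborel. \<forall>n. 0 \<le> S n p" unfolding AE_all_countable using Snn by blast
    then show ?thesis using limS
    proof eventually_elim
      case (elim p)
      then show ?case using LIMSEQ_le_const[OF elim(2), of 0] by blast
    qed
  qed
  have mM[measurable]: "M0 \<in> borel_measurable borel" by (rule isrep_measurable[OF M0])
  \<comment> \<open>The uniform lower bound on the traces supplies the dominating function
    \<open>M0 / \<epsilon>\<close>.\<close>
  have lQ: "L2_lim lborel (\<lambda>n x. M0 x / K n x) (\<lambda>x. M0 x / k' x)"
  proof (rule L2_lim_dominated[OF L2_cmult[OF LM0, of "1 / \<epsilon>"]])
    show "AE x in lborel. (\<lambda>n. M0 x / K n x) \<longlonglongrightarrow> M0 x / k' x"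
      using limK klow
    proof eventually_elim
      case (elim x)
      show ?case
      proof (cases "x \<in> Om")
        case True
        then show ?thesis using elim e0 by (intro tendsto_divide tendsto_const) auto
      qed (simp add: isrep_zero[OF M0])
    qed
    show "AE x in lborel. \<bar>M0 x / K n x\<bar> \<le> 1 / \<epsilon> * M0 x" for n
      using M0nn Klow[of n]
    proof eventually_elim
      case (elim x)
      show ?case
      proof (cases "x \<in> Om")
        case True
        then have k: "0 < K n x" "\<epsilon> \<le> K n x" using elim e0 by auto
        then have "M0 x / K n x \<le> M0 x / \<epsilon>" using elim(1) e0 by (intro divide_left_mono) auto
        then show ?thesis using elim(1) k by simp
      qed (simp add: isrep_zero[OF M0])
    qed
    show "(\<lambda>x. M0 x / k' x) \<in> borel_measurable lborel" using m'(3) mM by simp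
  qed simp
  have qp': "QL2 T p'" and qs': "QL2 T s'"
    using lP lS z' unfolding QL2_def L2_lim_def by blast+
  obtain F1 where F1: "isrep (Qc T) (NL p' s') F1" "QL2 T F1" using NL_isrep[OF qp' m'(2)] by blast
  obtain F2 where F2: "isrep (Qc T) (NL s' p') F2" "QL2 T F2" using NL_isrep[OF qs' m'(1)] by blast

  \<comment> \<open>Passage to the limit in both equations\<close>
  have "\<forall>n. \<exists>DF. weq (- 1) T (\<sigma>^2 / 2) (P n) (fst DF) (snd DF) \<and> isrep (Qc T) (NL (P n) (S n)) (snd DF) \<and> ctrace T (P n) T H"
    using csolE[OF cP dir_bwd] by (metis fst_conv snd_conv)
  from choice[OF this] obtain DF where DF: "\<And>n. weq (- 1) T (\<sigma>^2 / 2) (P n) (fst (DF n)) (snd (DF n))"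
    "\<And>n. isrep (Qc T) (NL (P n) (S n)) (snd (DF n))" "\<And>n. ctrace T (P n) T H" by blast
  have lF: "L2_lim lborel (\<lambda>n. snd (DF n)) F1"
    by (rule NL_lim[OF QL2_L2[OF qP[of 0]] DF(2) F1(1) limP limS bP])
  have LH: "L2 lborel H" using DF(3)[of 0] by (simp add: ctrace_def)
  obtain D1 where D1: "weq (- 1) T (\<sigma>^2 / 2) p' D1 F1" "ctrace T p' T H"
    "\<And>e. e > 0 \<Longrightarrow> \<exists>N. \<forall>n\<ge>N. AE t in lborel. (\<integral>x. (P n (t, x) - p' (t, x))^2 \<partial>lborel) \<le> e"
    using weq_limit[OF DF(1) T_pos dir_bwd a DF(3) lP lF L2_lim_const[OF LH] qp' F1(2)] by blast
  \<comment> \<open>Time 0 is the endpoint opposite to the data of the backward problem, so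
    \<open>D1(2)\<close> is silent about it; the uniform convergence in time \<open>D1(3)\<close>
    identifies the trace there.\<close>
  have trp: "ctrace T p' 0 k'" by (rule ctrace_lim[OF K(3) lK qP qp' D1(3)])

  \<comment> \<open>Index shift: \<open>S (Suc n)\<close> solves the equation with factor
    \<open>P n\<close>, and the shifted sequence has the same limit.\<close>
  have "\<forall>n. \<exists>DF. weq 1 T (\<sigma>^2 / 2) (S (Suc n)) (fst DF) (snd DF) \<and> isrep (Qc T) (NL (S (Suc n)) (P n)) (snd DF)
      \<and> ctrace T (S (Suc n)) 0 (\<lambda>x. M0 x / K n x)"
    using csolE[OF K(4) dir_fwd] by (metis fst_conv snd_conv)
  from choice[OF this] obtain DG where DG: "\<And>n. weq 1 T (\<sigma>^2 / 2) (S (Suc n)) (fst (DG n)) (snd (DG n))"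
    "\<And>n. isrep (Qc T) (NL (S (Suc n)) (P n)) (snd (DG n))" "\<And>n. ctrace T (S (Suc n)) 0 (\<lambda>x. M0 x / K n x)" by blast
  have lG: "L2_lim lborel (\<lambda>n. snd (DG n)) F2"
    by (rule NL_lim[OF LZ DG(2) F2(1) limS1 limP bS])
  obtain D2 where D2: "weq 1 T (\<sigma>^2 / 2) s' D2 F2" "ctrace T s' 0 (\<lambda>x. M0 x / k' x)"
    using weq_limit[OF DG(1) T_pos dir_fwd a DG(3) lS1 lG lQ qs' F2(2)] by blast

  \<comment> \<open>Return to the original notions\<close>
  define \<phi> \<psi> where "\<phi> = (\<lambda>t x. p' (t, x))" and "\<psi> = (\<lambda>t x. s' (t, x))"
  have r\<phi>: "isrep (Qc T) (\<lambda>q. \<phi> (fst q) (snd q)) p'" and r\<psi>: "isrep (Qc T) (\<lambda>q. \<psi> (fst q) (snd q)) s'"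
    using m' z' by (simp_all add: \<phi>_def \<psi>_def isrep_self)
  have rk: "isrep Om k' k'" by (rule isrep_self[OF m'(3) zk])
  have Phi: "Phi_sol T \<sigma> f uT \<psi> \<phi>" by (rule Phi_sol_of_weq[OF D1(1) F1(1) r\<phi> r\<psi> H D1(2)])
  have Psi: "Psi_sol T \<sigma> f m0 \<phi> \<psi>"
    by (rule Psi_sol_of_weq[OF D2(1) F2(1) r\<phi> r\<psi> M0 rk trp D2(2)])
  note AEQ = AE_lebesgue_on_iff[OF Qc_sets]

  have i1: "inPe T \<epsilon> (phih n)" for n
  proof -
    have "AE q in lborel. q \<in> Qc T \<longrightarrow> \<epsilon> \<le> phih n (fst q) (snd q)"
      using isrep_AE[OF P[of n]] Plow[of n] by eventually_elim auto
    then show ?thesis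
      using Phi_sol_L2H1[OF phih_rec[rule_format, of n]] unfolding inPe_def AEQ inP_def by blast
  qed
  have i2: "AE q in lebesgue_on (Qc T). phih (Suc n) (fst q) (snd q) \<le> phih n (fst q) (snd q)" for n
    unfolding AEQ using isrep_AE[OF P[of n]] isrep_AE[OF P[of "Suc n"]] Pmono[of n] by eventually_elim auto
  have ii1: "inPe T 0 (psi n)" for n
  proof -
    have "AE q in lborel. q \<in> Qc T \<longrightarrow> 0 \<le> psi n (fst q) (snd q)"
      using isrep_AE[OF S[of n]] Snn[of n] by eventually_elim auto
    moreover have "inP T (psi n)"
    proof (cases n)
      case 0
      then show ?thesis using inPe_const[of T 0, where 'a='a] psi0 by (simp add: inPe_def)
    next
      case (Suc m)
      then show ?thesis using Psi_sol_L2H1[OF psi_rec[rule_format, of m]] unfolding inP_def by blast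
    qed
    ultimately show ?thesis unfolding inPe_def AEQ by blast
  qed
  have ii2: "AE q in lebesgue_on (Qc T). psi n (fst q) (snd q) \<le> psi (Suc n) (fst q) (snd q)" for n
    unfolding AEQ using isrep_AE[OF S[of n]] isrep_AE[OF S[of "Suc n"]] Smono[of n] by eventually_elim auto
  have ii3: "AE q in lebesgue_on (Qc T). psi n (fst q) (snd q) \<le> Y (fst q) (snd q)"
    if Y: "Psi_sol T \<sigma> f m0 (\<lambda>t x. \<epsilon>) Y" for Y n
  proof -
    obtain Y' where rY: "isrep (Qc T) (\<lambda>p. Y (fst p) (snd p)) Y'"
      using Psi_sol_L2H1[OF Y] weak_isrep_exists by metis
    show ?thesis
      unfolding AEQ using isrep_AE[OF S[of n]] isrep_AE[OF rY] SZ[OF Y rY, of n] by eventually_elim auto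
  qed
  have iii1: "AE q in lebesgue_on (Qc T).
      (\<lambda>n. phih n (fst q) (snd q)) \<longlonglongrightarrow> \<phi> (fst q) (snd q) \<and> (\<lambda>n. psi n (fst q) (snd q)) \<longlonglongrightarrow> \<psi> (fst q) (snd q)"
  proof -
    have "AE q in lborel. \<forall>n. q \<in> Qc T \<longrightarrow> P n q = phih n (fst q) (snd q)"
      "AE q in lborel. \<forall>n. q \<in> Qc T \<longrightarrow> S n q = psi n (fst q) (snd q)"
      unfolding AE_all_countable using isrep_AE[OF P] isrep_AE[OF S] by blast+
    then show ?thesis unfolding AEQ using limP limS
    proof eventually_elim
      case (elim q)
      then show ?case by (auto simp: \<phi>_def \<psi>_def)
    qed
  qed
  have iii2: "(\<lambda>n. \<integral>q. (phih n (fst q) (snd q) - \<phi> (fst q) (snd q))^2 \<partial>lebesgue_on (Qc T)) \<longlonglongrightarrow> 0"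
    using lP unfolding L2_lim_def isrep_L2(2)[OF Qc_sets isrep_diff[OF P r\<phi>]] by blast
  have iii3: "(\<lambda>n. \<integral>q. (psi n (fst q) (snd q) - \<psi> (fst q) (snd q))^2 \<partial>lebesgue_on (Qc T)) \<longlonglongrightarrow> 0"
    using lS unfolding L2_lim_def isrep_L2(2)[OF Qc_sets isrep_diff[OF S r\<psi>]] by blast
  have iv1: "inPe T \<epsilon> \<phi>"
  proof -
    have "AE q in lborel. q \<in> Qc T \<longrightarrow> \<epsilon> \<le> \<phi> (fst q) (snd q)"
      using isrep_AE[OF r\<phi>] plow by eventually_elim auto
    then show ?thesis using Phi_sol_L2H1[OF Phi] unfolding inPe_def AEQ inP_def by blast
  qed
  have iv2: "inPe T 0 \<psi>"
  proof -
    have "AE q in lborel. q \<in> Qc T \<longrightarrow> 0 \<le> \<psi> (fst q) (snd q)"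
      using isrep_AE[OF r\<psi>] snn by eventually_elim auto
    then show ?thesis using Psi_sol_L2H1[OF Psi] unfolding inPe_def AEQ inP_def by blast
  qed
  show ?thesis
    unfolding Let_def \<kappa>_def[symmetric] U_def[symmetric] \<epsilon>_def[symmetric]
    using i1 i2 ii1 ii2 ii3 iii1 iii2 iii3 iv1 iv2 Phi Psi by blast
qed

end
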